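(* Let $X$ be a standard Markov process on $E$. Suppose that $X$ has the Inversion Property with continuous characteristics $(I,h,v)$. Let $F\subseteq E$ be such that $I(F)=F$ and suppose that there exists a continuous function $H:F\to\mathbb R_+$ which is excessive for $X$ killed when it exits $F$. Consider $Y=X^H$, the Doob $H$-transform of $X$ (killed when it exits $F$). Then the process $Y$ has the Inversion Property with characteristics $(I,\tilde h,v)$, with $$\tilde h=\frac{\mathcal K H}{H},$$ where $\mathcal K H=h\cdot (H\circ I)$ is the Kelvin transform of $H$.
   Context: State space: $S\subset\mathbb R^n$ is an unbounded locally compact set with $0\in S$, and $E=S\cup\{\infty\}$ is its Alexandroff one-point compactification, with its Borel $\sigma$-field. Write $\mathring S$ for the interior of $S$ and $\mathring E=\mathring S\setminus\{0\}$ ("the interior of $E$"). Process: $X=((X_t)_{t\ge0},(\mathbb P_x)_{x\in E})$ is a standard Markov process on $E$ (in the sense of Blumenthal and Getoor): strong Markov, right-continuous with left limits, quasi-left-continuous on $[0,\zeta)$, where $\zeta=\inf\{s>0: X_s\notin\mathring S\setminus\{0\}\}$ is the lifetime. $X$ is absorbed at $\partial S\cup\{0,\infty\}$: it is sent to $0$ when it leaves $\mathring S\setminus\{0\}$ through $\partial S\cup\{0\}$ and to $\infty$ otherwise. $X$ is irreducible: from any point of $\mathring S\setminus\{0\}$ it reaches any nonempty open subset of $E$ with positive probability. Excessive functions and Doob transform: for a Markov process $Z$, a Borel function $h\ge 0$ is $Z$-excessive if $\mathbb E_xh(Z_t)\le h(x)$ for all $x,t$ and $\lim_{t\to0+}\mathbb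 E_xh(Z_t)=h(x)$ for all $x$. With $E_h=\{0<h<\infty\}$, the Doob $h$-transform $Z^h$ is the (sub-)Markov process with semigroup $\frac{h(y)}{h(x)}Q^h_t(x,dy)$ for $x\in E_h$ and $0$ for $x\notin E_h$, where $Q^h_t$ is the semigroup of $Z$ killed on exiting $E_h$. Inversion Property: a process $Z$ on a state space $G$ (here $Z=X$, $G=E$, or $Z=Y$, $G=F$) has the Inversion Property with characteristics $(I,h,v)$ if $I\neq\mathrm{Id}$ is an involution of $G$, $h\ge0$ is a $Z$-excessive function on $G$ with $0<h<\infty$ in the interior of $G$, $v$ is a positive continuous function and, for every $x\in G$, the process $(I(Z_{\gamma_t}),t\ge0)$ with $Z_0=x$ has the same law as $(Z^h_t,t\ge0)$ with $Z^h_0=I(x)$. Here $\gamma_t$ is the inverse of the additive functional $A_t=\int_0^tv^{-1}(Z_s)\,ds$, and $Z^h$ is killed when it exits the interior of $G$. The characteristics are called continuous if $I$ and $h$ are continuous in the interior of $G$.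
   Formalization: F is taken Borel, H>0 on the interior of F, and I not the identity on F; in the Inversion Property both laws are killed on leaving the interior, and excessivity of h and of KH/H is meant for the process killed at its lifetime (boundary mass not counted). *)

theory Defs
  imports "HOL-Probability.Probability"
begin

section \<open>The state space\<close>

text \<open>Points of the one-point compactification of \<open>S\<close> have type \<^typ>\<open>'a option\<close>:
  \<^term>\<open>None\<close> is the point at infinity.\<close>

definition compactified :: "'a::euclidean_space set \<Rightarrow> 'a option topology" where
  "compactified S = Alexandroff_compactification (top_of_set S)"

abbreviation points :: "'a::euclidean_space set \<Rightarrow> 'a option set" where
  "points S \<equiv> topspace (compactified S)"

definition borel_of :: "'s topology \<Rightarrow> 's measure" where
  "borel_of T = sigma (topspace T) {U. openin T U}"

text \<open>The point \<open>0\<close> is removed by convention, and the point at infinity is never interior; for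
  \<open>G = points S\<close> this is the interior of \<open>S\<close> without \<open>0\<close>.\<close>

definition interior_pts :: "'a::euclidean_space option set \<Rightarrow> 'a option set" where
  "interior_pts G = Some ` (interior {x. Some x \<in> G} - {0})"

lemma points_eq: "points S = insert None (Some ` S)"
  by (auto simp: compactified_def)

lemma interior_pts_points: "interior_pts (points S) = Some ` (interior S - {0})"
proof -
  have "{x. Some x \<in> points S} = S" by (auto simp: points_eq)
  then show ?thesis by (simp add: interior_pts_def)
qed


section \<open>Processes with a cemetery, killing, Doob transforms\<close>

text \<open>A process with state space in \<^typ>\<open>'s\<close> and possibly finite life is a function
  \<open>Z :: real \<Rightarrow> 'w \<Rightarrow> 's option\<close>, considered at nonnegative times; here \<^term>\<open>None\<close> is the isolated
  cemetery (not the point at infinity). A family \<open>P\<close> of probability measures carries the laws,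
  \<open>P x\<close> being the one for the starting point \<open>x\<close>.\<close>

definition exit_time :: "(real \<Rightarrow> 'w \<Rightarrow> 's option) \<Rightarrow> 's set \<Rightarrow> 'w \<Rightarrow> ennreal" where
  "exit_time Z B \<omega> = Inf (ennreal ` {s. 0 \<le> s \<and> Z s \<omega> \<notin> Some ` B})"

text \<open>Semigroups are given by their action on functions with values in \<open>[0, \<infinity>]\<close>. Exit times of
  Borel sets are in general measurable only for the completed measures.\<close>

definition killed_semigroup ::
  "('s \<Rightarrow> 'w measure) \<Rightarrow> (real \<Rightarrow> 'w \<Rightarrow> 's option) \<Rightarrow> 's set \<Rightarrow> real \<Rightarrow> ('s \<Rightarrow> ennreal) \<Rightarrow> 's \<Rightarrow> ennreal"
where
  "killed_semigroup P Z B t f x =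
     (\<integral>\<^sup>+\<omega>. (if ennreal t < exit_time Z B \<omega>
             then (case Z t \<omega> of Some y \<Rightarrow> f y | None \<Rightarrow> 0) else 0) \<partial>completion (P x))"

definition excessive ::
  "'s topology \<Rightarrow> ('s \<Rightarrow> 'w measure) \<Rightarrow> (real \<Rightarrow> 'w \<Rightarrow> 's option) \<Rightarrow> 's set \<Rightarrow> ('s \<Rightarrow> ennreal) \<Rightarrow> bool"
where
  \<comment> \<open>\<open>h\<close> is excessive for \<open>Z\<close> killed when it exits \<open>B\<close>\<close>
  "excessive T P Z B h \<longleftrightarrow>
     h \<in> borel_measurable (restrict_space (borel_of T) B) \<and>
     (\<forall>x\<in>B. (\<forall>t\<ge>0. killed_semigroup P Z B t h x \<le> h x) \<and>
            ((\<lambda>t. killed_semigroup P Z B t h x) \<longlongrightarrow> h x) (at_right 0))"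

text \<open>The semigroup of the Doob \<open>h\<close>-transform of \<open>Z\<close> killed when it exits \<open>B\<close>; killing on exit from
  \<open>B\<close> and then on exit from \<open>{0 < h < \<infinity>}\<close> is killing on exit from the intersection.\<close>

definition doob_semigroup ::
  "('s \<Rightarrow> 'w measure) \<Rightarrow> (real \<Rightarrow> 'w \<Rightarrow> 's option) \<Rightarrow> 's set \<Rightarrow> ('s \<Rightarrow> ennreal) \<Rightarrow>
   real \<Rightarrow> ('s \<Rightarrow> ennreal) \<Rightarrow> 's \<Rightarrow> ennreal"
where
  "doob_semigroup P Z B h t f x =
     (let B' = B \<inter> {y. 0 < h y \<and> h y < \<infinity>} in
      if x \<in> B' then killed_semigroup P Z B' t (\<lambda>y. h y * f y) x / h x else 0)"


section \<open>The law of a Markov process with given semigroup\<close>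

text \<open>In a list \<open>[(s\<^sub>1, B\<^sub>1), \<dots>, (s\<^sub>n, B\<^sub>n)]\<close> the \<open>s\<^sub>i\<close> are time increments: the constraint is that
  the path be alive and in \<open>B\<^sub>i\<close> at time \<open>t + s\<^sub>1 + \<dots> + s\<^sub>i\<close>, for all \<open>i\<close>.\<close>

fun visits :: "(real \<Rightarrow> 's option) \<Rightarrow> real \<Rightarrow> (real \<times> 's set) list \<Rightarrow> bool" where
  "visits z t [] \<longleftrightarrow> True"
| "visits z t ((s, B) # l) \<longleftrightarrow> z (t + s) \<in> Some ` B \<and> visits z (t + s) l"

fun fdd :: "(real \<Rightarrow> ('s \<Rightarrow> ennreal) \<Rightarrow> 's \<Rightarrow> ennreal) \<Rightarrow> (real \<times> 's set) list \<Rightarrow> 's \<Rightarrow> ennreal" where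
  "fdd Q [] x = 1"
| "fdd Q ((s, B) # l) x = Q s (\<lambda>y. indicator B y * fdd Q l y) x"

text \<open>\<open>Z\<close> has, under \<open>M\<close>, the finite-dimensional distributions of the Markov process with
  (sub-Markov) semigroup \<open>Q\<close> started at \<open>x\<close>.\<close>

definition has_markov_law ::
  "'s topology \<Rightarrow> 'w measure \<Rightarrow> (real \<Rightarrow> 'w \<Rightarrow> 's option) \<Rightarrow>
   (real \<Rightarrow> ('s \<Rightarrow> ennreal) \<Rightarrow> 's \<Rightarrow> ennreal) \<Rightarrow> 's \<Rightarrow> bool"
where
  "has_markov_law T M Z Q x \<longleftrightarrow>
     (\<forall>l. (\<forall>(s, B)\<in>set l. 0 \<le> s \<and> B \<in> sets (borel_of T)) \<longrightarrow>
        emeasure (completion M) {\<omega>\<in>space M. visits (\<lambda>t. Z t \<omega>) 0 l} = fdd Q l x)"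

definition right_continuous_killed :: "'s topology \<Rightarrow> (real \<Rightarrow> 's option) \<Rightarrow> bool" where
  "right_continuous_killed T z \<longleftrightarrow>
     (\<forall>t\<ge>0. case z t of
        Some y \<Rightarrow> y \<in> topspace T \<and>
          (\<forall>U. openin T U \<and> y \<in> U \<longrightarrow> eventually (\<lambda>s. z s \<in> Some ` U) (at_right t))
      | None \<Rightarrow> (\<forall>s\<ge>t. z s = None))"

text \<open>\<open>(N, Y)\<close> is a right-continuous realisation, with state space \<open>F\<close>, of the Doob \<open>H\<close>-transform of
  \<open>Z\<close> killed when it exits \<open>F\<close>.\<close>

definition is_doob_transform ::
  "'s topology \<Rightarrow> ('s \<Rightarrow> 'w measure) \<Rightarrow> (real \<Rightarrow> 'w \<Rightarrow> 's option) \<Rightarrow> 's set \<Rightarrow> ('s \<Rightarrow> ennreal) \<Rightarrow>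
   ('s \<Rightarrow> 'u measure) \<Rightarrow> (real \<Rightarrow> 'u \<Rightarrow> 's option) \<Rightarrow> bool"
where
  "is_doob_transform T P Z F H N Y \<longleftrightarrow>
     (\<forall>x\<in>F. prob_space (N x) \<and>
        (\<forall>t\<ge>0. \<forall>B\<in>sets (borel_of T). {\<omega>\<in>space (N x). Y t \<omega> \<in> Some ` B} \<in> sets (N x)) \<and>
        (\<forall>\<omega>\<in>space (N x). right_continuous_killed (subtopology T F) (\<lambda>t. Y t \<omega>)) \<and>
        has_markov_law T (N x) Y (doob_semigroup P Z F H) x)"


section \<open>Standard processes on the compactified space\<close>

definition lifetime :: "'a::euclidean_space set \<Rightarrow> (real \<Rightarrow> 'w \<Rightarrow> 'a option) \<Rightarrow> 'w \<Rightarrow> ennreal" where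
  "lifetime S X \<omega> = Inf (ennreal ` {s. 0 < s \<and> X s \<omega> \<notin> interior_pts (points S)})"

definition strong_markov ::
  "'s topology \<Rightarrow> 'w measure \<Rightarrow> (ennreal \<Rightarrow> 'w measure) \<Rightarrow> ('s \<Rightarrow> 'w measure) \<Rightarrow> (real \<Rightarrow> 'w \<Rightarrow> 's) \<Rightarrow> bool"
where
  "strong_markov T M \<F> P X \<longleftrightarrow>
     (\<forall>x\<in>topspace T. \<forall>\<tau>. stopping_time \<F> \<tau> \<longrightarrow>
        (\<forall>A\<in>sets (filtration.pre_sigma (space M) \<F> \<tau>). \<forall>t\<ge>0. \<forall>B\<in>sets (borel_of T).
           emeasure (P x) {\<omega>\<in>A. \<tau> \<omega> < \<infinity> \<and> X (enn2real (\<tau> \<omega>) + t) \<omega> \<in> B} =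
           (\<integral>\<^sup>+\<omega>. indicator {\<omega>\<in>A. \<tau> \<omega> < \<infinity>} \<omega> *
               emeasure (P (X (enn2real (\<tau> \<omega>)) \<omega>)) {\<omega>'\<in>space M. X t \<omega>' \<in> B} \<partial>P x)))"

definition quasi_left_continuous ::
  "'s topology \<Rightarrow> (ennreal \<Rightarrow> 'w measure) \<Rightarrow> ('s \<Rightarrow> 'w measure) \<Rightarrow> (real \<Rightarrow> 'w \<Rightarrow> 's) \<Rightarrow>
   ('w \<Rightarrow> ennreal) \<Rightarrow> bool"
where
  "quasi_left_continuous T \<F> P X \<zeta> \<longleftrightarrow>
     (\<forall>x\<in>topspace T. \<forall>\<sigma>::nat \<Rightarrow> 'w \<Rightarrow> ennreal.
        (\<forall>n. stopping_time \<F> (\<sigma> n)) \<and> (\<forall>n \<omega>. \<sigma> n \<omega> \<le> \<sigma> (Suc n) \<omega>) \<longrightarrow>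
        (AE \<omega> in P x. (SUP n. \<sigma> n \<omega>) < \<zeta> \<omega> \<longrightarrow>
           limitin T (\<lambda>n. X (enn2real (\<sigma> n \<omega>)) \<omega>) (X (enn2real (SUP n. \<sigma> n \<omega>)) \<omega>) sequentially))"

text \<open>On a jump out of the interior the would-be landing point is not visible, so in that case a path
  may be sent to either of \<open>0\<close> and \<open>\<infinity>\<close>. An exit with left limit on the boundary or at \<open>0\<close> goes to
  \<open>0\<close>, and one with left limit \<open>\<infinity>\<close> to \<open>\<infinity>\<close>.\<close>

definition absorbed_at_boundary ::
  "'a::euclidean_space set \<Rightarrow> ('a option \<Rightarrow> 'w measure) \<Rightarrow> (real \<Rightarrow> 'w \<Rightarrow> 'a option) \<Rightarrow> bool"
where
  "absorbed_at_boundary S P X \<longleftrightarrow>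
     (\<forall>x\<in>points S - interior_pts (points S). AE \<omega> in P x. \<forall>t\<ge>0. X t \<omega> = x) \<and>
     (\<forall>x\<in>points S. AE \<omega> in P x.
        \<forall>t\<ge>0. lifetime S X \<omega> \<le> ennreal t \<longrightarrow> X t \<omega> = X (enn2real (lifetime S X \<omega>)) \<omega>) \<and>
     (\<forall>x\<in>interior_pts (points S). AE \<omega> in P x. lifetime S X \<omega> < \<infinity> \<longrightarrow>
        (let r = enn2real (lifetime S X \<omega>) in
           X r \<omega> \<in> {Some 0, None} \<and>
           (\<forall>y\<in>frontier S \<union> {0}.
              limitin (compactified S) (\<lambda>s. X s \<omega>) (Some y) (at_left r) \<longrightarrow> X r \<omega> = Some 0) \<and>
           (limitin (compactified S) (\<lambda>s. X s \<omega>) None (at_left r) \<longrightarrow> X r \<omega> = None)))"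

definition standard_process ::
  "'a::euclidean_space set \<Rightarrow> 'w measure \<Rightarrow> (ennreal \<Rightarrow> 'w measure) \<Rightarrow>
   ('a option \<Rightarrow> 'w measure) \<Rightarrow> (real \<Rightarrow> 'w \<Rightarrow> 'a option) \<Rightarrow> bool"
where
  "standard_process S M \<F> P X \<longleftrightarrow>
     filtration (space M) \<F> \<and> (\<forall>t. sets (\<F> t) \<subseteq> sets M) \<and>
     (\<forall>t<\<infinity>. sets (\<F> t) = (\<Inter>s\<in>{t<..}. sets (\<F> s))) \<and>
     (\<forall>t\<ge>0. X t \<in> measurable (\<F> (ennreal t)) (borel_of (compactified S))) \<and>
     (\<forall>x\<in>points S. prob_space (P x) \<and> sets (P x) = sets M \<and> (AE \<omega> in P x. X 0 \<omega> = x)) \<and>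
     (\<forall>t\<ge>0. \<forall>B\<in>sets (borel_of (compactified S)).
        (\<lambda>x. emeasure (P x) {\<omega>\<in>space M. X t \<omega> \<in> B}) \<in> borel_measurable (borel_of (compactified S))) \<and>
     (\<forall>\<omega>\<in>space M. \<forall>t\<ge>0. limitin (compactified S) (\<lambda>s. X s \<omega>) (X t \<omega>) (at_right t)) \<and>
     (\<forall>\<omega>\<in>space M. \<forall>t>0. ennreal t < lifetime S X \<omega> \<longrightarrow>
        (\<exists>y. limitin (compactified S) (\<lambda>s. X s \<omega>) y (at_left t))) \<and>
     strong_markov (compactified S) M \<F> P X \<and>
     quasi_left_continuous (compactified S) \<F> P X (lifetime S X) \<and>
     absorbed_at_boundary S P X"

definition irreducible_process ::
  "'a::euclidean_space set \<Rightarrow> ('a option \<Rightarrow> 'w measure) \<Rightarrow> (real \<Rightarrow> 'w \<Rightarrow> 'a option) \<Rightarrow> bool"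
where
  "irreducible_process S P X \<longleftrightarrow>
     (\<forall>x\<in>interior_pts (points S). \<forall>U. openin (compactified S) U \<and> U \<noteq> {} \<longrightarrow>
        0 < emeasure (P x) {\<omega>\<in>space (P x). \<exists>t\<ge>0. X t \<omega> \<in> U})"


section \<open>The Inversion Property\<close>

definition clock ::
  "('s \<Rightarrow> real) \<Rightarrow> (real \<Rightarrow> 'w \<Rightarrow> 's option) \<Rightarrow> real \<Rightarrow> 'w \<Rightarrow> ennreal"
where
  "clock v Z t \<omega> =
     (\<integral>\<^sup>+s. (case Z s \<omega> of Some y \<Rightarrow> ennreal (1 / v y) | None \<Rightarrow> 0) * indicator {0..t} s \<partial>lborel)"

definition inverse_clock ::
  "('s \<Rightarrow> real) \<Rightarrow> (real \<Rightarrow> 'w \<Rightarrow> 's option) \<Rightarrow> real \<Rightarrow> 'w \<Rightarrow> ennreal"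
where
  "inverse_clock v Z t \<omega> = Inf (ennreal ` {s. 0 \<le> s \<and> ennreal t < clock v Z s \<omega>})"

text \<open>The process \<open>I(Z\<^sub>\<gamma>)\<close>, where \<open>Z\<close> is killed when it exits \<open>B\<close>.\<close>

definition inverted_process ::
  "('s \<Rightarrow> 's) \<Rightarrow> ('s \<Rightarrow> real) \<Rightarrow> 's set \<Rightarrow> (real \<Rightarrow> 'w \<Rightarrow> 's option) \<Rightarrow> real \<Rightarrow> 'w \<Rightarrow> 's option"
where
  "inverted_process I v B Z t \<omega> =
     (if inverse_clock v Z t \<omega> < exit_time Z B \<omega>
      then map_option I (Z (enn2real (inverse_clock v Z t \<omega>)) \<omega>) else None)"

text \<open>The states of a process on \<open>G\<close>, as opposed to its cemetery: the points of \<open>\<partial>S \<union> {0, \<infinity>}\<close>, at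
  which the lifetime of the underlying process has expired, and the points from which the process
  starts dead (for a Doob \<open>H\<close>-transform: the zeros of \<open>H\<close>) are left out.\<close>

definition live_states ::
  "'a::euclidean_space set \<Rightarrow> 'a option set \<Rightarrow> ('a option \<Rightarrow> 'w measure) \<Rightarrow>
   (real \<Rightarrow> 'w \<Rightarrow> 'a option option) \<Rightarrow> 'a option set"
where
  "live_states S G P Z = {x \<in> G \<inter> interior_pts (points S). AE \<omega> in P x. Z 0 \<omega> = Some x}"

text \<open>Both sides of the identity in law are killed when \<open>Z\<close>, resp. \<open>Z\<^sup>h\<close>, leaves the interior of \<open>G\<close>:
  for \<open>Z = X\<close> this is the lifetime. Without killing on the left the identity would fail at all
  absorbing points. Accordingly \<open>v\<close> matters only in the interior; it may vanish or blow up outside.\<close>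

definition inversion_property ::
  "'a::euclidean_space set \<Rightarrow> 'a option set \<Rightarrow> ('a option \<Rightarrow> 'w measure) \<Rightarrow>
   (real \<Rightarrow> 'w \<Rightarrow> 'a option option) \<Rightarrow>
   ('a option \<Rightarrow> 'a option) \<Rightarrow> ('a option \<Rightarrow> ennreal) \<Rightarrow> ('a option \<Rightarrow> real) \<Rightarrow> bool"
where
  "inversion_property S G P Z I h v \<longleftrightarrow>
     I \<in> G \<rightarrow> G \<and> (\<forall>x\<in>G. I (I x) = x) \<and> (\<exists>x\<in>G. I x \<noteq> x) \<and>
     excessive (compactified S) P Z (live_states S G P Z) h \<and>
     (\<forall>x\<in>interior_pts G. 0 < h x \<and> h x < \<infinity>) \<and>
     (\<forall>x\<in>interior_pts G. 0 < v x) \<and>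
     continuous_map (subtopology (compactified S) (interior_pts G)) euclideanreal v \<and>
     (\<forall>x\<in>G. has_markov_law (compactified S) (P x) (inverted_process I v (interior_pts G) Z)
              (doob_semigroup P Z (interior_pts G) h) (I x))"

definition continuous_characteristics ::
  "'a::euclidean_space set \<Rightarrow> 'a option set \<Rightarrow> ('a option \<Rightarrow> 'a option) \<Rightarrow> ('a option \<Rightarrow> ennreal) \<Rightarrow> bool"
where
  "continuous_characteristics S G I h \<longleftrightarrow>
     continuous_map (subtopology (compactified S) (interior_pts G)) (compactified S) I \<and>
     continuous_map (subtopology (compactified S) (interior_pts G)) euclidean h"

definition kelvin_transform :: "('s \<Rightarrow> 's) \<Rightarrow> ('s \<Rightarrow> ennreal) \<Rightarrow> ('s \<Rightarrow> ennreal) \<Rightarrow> 's \<Rightarrow> ennreal" where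
  "kelvin_transform I h H x = h x * H (I x)"

end

theory Submission
  imports Defs
begin

text \<open>On path space, the law of \<open>Y\<close> up to a fixed time \<open>q\<close> is dominated by the law of \<open>X\<close> up to \<open>q\<close> weighted
  with \<open>H(X\<^sub>q) / H(x)\<close>, and both agree on the paths that stay in the interior of \<open>F\<close>; the paths on which
  the two notions of leaving the interior could differ are null by quasi-left-continuity.
  The inversion property of \<open>X\<close>, extended from finite-dimensional distributions to path functionals,
  exchanges \<open>I(X\<^sub>\<gamma>)\<close> under the law from \<open>x\<close> with \<open>X\<close> under the law from \<open>I x\<close>, weighted with \<open>h(X\<^sub>t) / h(I x)\<close>.
  Approximating \<open>\<gamma>\<^sub>t\<close> by dyadic times from above, both sides of the identity in law for \<open>Y\<close> become the
  expectation of \<open>H(X\<close> at time \<open>\<gamma>\<^sub>t) / H(x)\<close> over the paths of \<open>X\<close> that stay in the interior of \<open>F\<close> until \<open>\<gamma>\<^sub>t\<close>.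
  That the transformed function is excessive follows from the same exchange and optional stopping of the
  supermartingale \<open>H(X)\<close> at \<open>\<gamma>\<^sub>t\<close>, where \<open>\<gamma>\<^sub>t\<close> is approached from below, again by quasi-left-continuity.
  The event of staying in a Borel set is measurable only after completion, by Choquet's argument.\<close>

section \<open>Comparison of measures, measurability of projections\<close>

text \<open>The process \<open>Y\<close> is given only through its finite-dimensional distributions
  and right-continuity. Left limits, the strong Markov property and quasi-left-continuity are not
  assumed for it, so every regularity statement about \<open>Y\<close> is borrowed from
  \<open>X\<close>. Its semigroup contains exit times from sets that are merely Borel, and iterating
  such kernels yields functions of unknown measurability. Monotonicity of the integral survives
  without measurability, additivity does not; hence the two-sided bounds, an upper one that drops
  the killing and a lower one that keeps only paths confined to a compact subset of the interior. An
  inequality between laws is enough to carry null sets from \<open>X\<close> to \<open>Y\<close>.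
  The compact pieces of an exhaustion play three roles: confinement to one of them is a Borel event,
  \<open>H\<close> and \<open>v\<close> are bounded above and away from zero there, and their images
  under \<open>I\<close> are again compact. Since the weight \<open>H(X_q)\<close> changes with
  \<open>q\<close>, the comparison is tied to a fixed \<open>q\<close>; this forces the random time
  into countably many deterministic slots.\<close>

lemma measure_le_generated:
  assumes "finite_measure \<mu>" "finite_measure \<nu>"
    and G: "G \<subseteq> Pow \<Omega>" and s\<mu>: "sets \<mu> = sigma_sets \<Omega> G" and s\<nu>: "sets \<nu> = sigma_sets \<Omega> G"
    and compl: "\<And>A. A \<in> G \<Longrightarrow> \<Omega> - A \<in> G"
    and le: "\<And>J. finite J \<Longrightarrow> J \<subseteq> G \<Longrightarrow> emeasure \<mu> (\<Omega> \<inter> \<Inter>J) \<le> emeasure \<nu> (\<Omega> \<inter> \<Inter>J)"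
  shows "emeasure \<mu> A \<le> emeasure \<nu> A"
proof -
  interpret m: finite_measure \<mu> by fact
  interpret n: finite_measure \<nu> by fact
  interpret sigma_algebra \<Omega> "sigma_sets \<Omega> G" using G by (rule sigma_algebra_sigma_sets)
  have [simp]: "space \<mu> = \<Omega>" "space \<nu> = \<Omega>"
    using s\<mu> s\<nu> G sets_eq_imp_space_eq[of \<mu> "sigma \<Omega> G"] sets_eq_imp_space_eq[of \<nu> "sigma \<Omega> G"]
    by (simp_all add: space_measure_of_conv)
  define dep where "dep J A \<longleftrightarrow> (\<forall>x\<in>\<Omega>. \<forall>y\<in>\<Omega>. (\<forall>B\<in>J. x \<in> B \<longleftrightarrow> y \<in> B) \<longrightarrow> (x \<in> A \<longleftrightarrow> y \<in> A))" for J A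
  define Alg where "Alg = {A. A \<subseteq> \<Omega> \<and> (\<exists>J. finite J \<and> J \<subseteq> G \<and> dep J A)}"
  define atm where "atm J K = {x\<in>\<Omega>. \<forall>B\<in>J. x \<in> B \<longleftrightarrow> B \<in> K}" for J K :: "'a set set"
  \<comment> \<open>Complements of generators are generators by \<open>compl\<close>, so an atom is
    an intersection of finitely many generators and \<open>le\<close> applies to it.\<close>
  have at_eq: "atm J K = \<Omega> \<inter> \<Inter>(K \<union> (\<lambda>B. \<Omega> - B) ` (J - K))" if "K \<subseteq> J" for J K
    using that by (auto simp: atm_def)
  have at_G: "finite (K \<union> (\<lambda>B. \<Omega> - B) ` (J - K))" "K \<union> (\<lambda>B. \<Omega> - B) ` (J - K) \<subseteq> G"
    if "finite J" "J \<subseteq> G" "K \<subseteq> J" for J K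
    using that compl by (auto intro: finite_subset)
  have at_le: "emeasure \<mu> (atm J K) \<le> emeasure \<nu> (atm J K)" if "finite J" "J \<subseteq> G" "K \<subseteq> J" for J K
    unfolding at_eq[OF that(3)] using at_G[OF that] by (rule le)
  have at_sets: "atm J K \<in> sigma_sets \<Omega> G" if "finite J" "J \<subseteq> G" "K \<subseteq> J" for J K
  proof -
    have "atm J K = (\<Inter>B\<in>insert \<Omega> (K \<union> (\<lambda>B. \<Omega> - B) ` (J - K)). B)"
      using at_eq[OF that(3)] by auto
    also have "\<dots> \<in> sigma_sets \<Omega> G"
      using at_G[OF that] by (intro finite_INT) auto
    finally show ?thesis .
  qed
  have dec: "\<exists>D. finite D \<and> disjoint D \<and> A = \<Union>D \<and> (\<forall>d\<in>D. d \<in> sigma_sets \<Omega> G \<and> emeasure \<mu> d \<le> emeasure \<nu> d)"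
    if "A \<in> Alg" for A
  proof -
    from that obtain J where J: "finite J" "J \<subseteq> G" "dep J A" "A \<subseteq> \<Omega>" by (auto simp: Alg_def)
    let ?D = "atm J ` {K. K \<subseteq> J \<and> atm J K \<subseteq> A}"
    have "finite ?D" using J by auto
    moreover have "disjoint ?D" unfolding disjoint_def by (auto simp: atm_def)
    moreover have "A = \<Union>?D"
    proof (intro set_eqI iffI)
      fix x assume x: "x \<in> A"
      then have "x \<in> atm J {B\<in>J. x \<in> B}" using J by (auto simp: atm_def)
      moreover have "atm J {B\<in>J. x \<in> B} \<subseteq> A"
        using J x by (auto simp: atm_def dep_def)
      ultimately show "x \<in> \<Union>?D"
        by (intro UnionI[of "atm J {B\<in>J. x \<in> B}"] imageI CollectI conjI) auto
    qed auto
    ultimately show ?thesis using at_le[OF J(1,2)] at_sets[OF J(1,2)]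
      by (intro exI[of _ ?D]) auto
  qed
  have Alg_sets: "A \<in> sigma_sets \<Omega> G" if A: "A \<in> Alg" for A
    using dec[OF A] by auto
  have Alg_le: "measure \<mu> A \<le> measure \<nu> A" if "A \<in> Alg" for A
  proof -
    from dec[OF that] obtain D where D: "finite D" "disjoint D" "A = \<Union>D"
      "\<And>d. d \<in> D \<Longrightarrow> d \<in> sigma_sets \<Omega> G" "\<And>d. d \<in> D \<Longrightarrow> emeasure \<mu> d \<le> emeasure \<nu> d" by auto
    have dd: "disjoint_family_on (\<lambda>x. x) D"
      using D(2) by (auto simp: disjoint_def disjoint_family_on_def)
    have "measure \<mu> A = (\<Sum>d\<in>D. measure \<mu> d)"
      using m.finite_measure_finite_Union[OF D(1) _ dd] D(3,4) s\<mu> by auto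
    also have "\<dots> \<le> (\<Sum>d\<in>D. measure \<nu> d)"
      using D by (intro sum_mono) (simp add: m.emeasure_eq_measure n.emeasure_eq_measure)
    also have "\<dots> = measure \<nu> A"
      using n.finite_measure_finite_Union[OF D(1) _ dd] D(3,4) s\<nu> by (simp add: subset_iff)
    finally show ?thesis .
  qed
  have Alg_empty: "{} \<in> Alg" by (auto simp: Alg_def dep_def)
  have Alg_compl: "\<Omega> - A \<in> Alg" if "A \<in> Alg" for A
    using that unfolding Alg_def dep_def by blast
  have Alg_Un: "A \<union> B \<in> Alg" if "A \<in> Alg" "B \<in> Alg" for A B
  proof -
    from that obtain J K where JK: "finite J" "J \<subseteq> G" "dep J A" "A \<subseteq> \<Omega>" "finite K" "K \<subseteq> G" "dep K B" "B \<subseteq> \<Omega>"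
      by (auto simp: Alg_def)
    have "dep (J \<union> K) (A \<union> B)" unfolding dep_def
    proof (intro ballI impI)
      fix x y assume xy: "x \<in> \<Omega>" "y \<in> \<Omega>" "\<forall>B\<in>J \<union> K. (x \<in> B) = (y \<in> B)"
      have "(x \<in> A) = (y \<in> A)"
        using xy(3) by (intro JK(3)[unfolded dep_def, rule_format, OF xy(1,2)]) auto
      moreover have "(x \<in> B) = (y \<in> B)"
        using xy(3) by (intro JK(7)[unfolded dep_def, rule_format, OF xy(1,2)]) auto
      ultimately
      show "(x \<in> A \<union> B) = (y \<in> A \<union> B)" by auto
    qed
    then show ?thesis using JK by (auto simp: Alg_def intro!: exI[of _ "J \<union> K"])
  qed
  \<comment> \<open>The approximating set has to be the same for \<open>\<mu>\<close> and
    \<open>\<nu>\<close>: the inequality known for it is then moved to \<open>A\<close> at the cost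
    of two small symmetric differences.\<close>
  have approx: "\<forall>e>0. \<exists>B\<in>Alg. measure \<mu> (A - B \<union> (B - A)) < e \<and> measure \<nu> (A - B \<union> (B - A)) < e"
    if "A \<in> sigma_sets \<Omega> G" for A
    using that
  proof (induct rule: sigma_sets.induct)
    case (Basic A)
    then have "A \<in> Alg" using G by (auto simp: Alg_def dep_def intro!: exI[of _ "{A}"])
    then show ?case by (auto intro!: bexI[of _ A])
  next
    case Empty
    then show ?case using Alg_empty by (auto intro!: bexI[of _ "{}"])
  next
    case (Compl A)
    have "A \<subseteq> \<Omega>" using Compl(1) space_closed by auto
    show ?case
    proof (intro allI impI)
      fix e :: real assume "e > 0"
      then obtain B where B: "B \<in> Alg" "measure \<mu> (A - B \<union> (B - A)) < e" "measure \<nu> (A - B \<union> (B - A)) < e"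
        using Compl(2) by auto
      have "B \<subseteq> \<Omega>" using B by (auto simp: Alg_def)
      then have "(\<Omega> - A) - (\<Omega> - B) \<union> ((\<Omega> - B) - (\<Omega> - A)) = A - B \<union> (B - A)"
        using \<open>A \<subseteq> \<Omega>\<close> by auto
      then show "\<exists>B\<in>Alg. measure \<mu> (\<Omega> - A - B \<union> (B - (\<Omega> - A))) < e \<and> measure \<nu> (\<Omega> - A - B \<union> (B - (\<Omega> - A))) < e"
        using B Alg_compl by (intro bexI[of _ "\<Omega> - B"]) auto
    qed
  next
    case (Union A)
    show ?case
    proof (intro allI impI)
      fix e :: real assume e: "e > 0"
      let ?U = "\<Union>i. A i" let ?P = "\<lambda>n. \<Union>i<n. A i"
      have Us: "?U \<in> sigma_sets \<Omega> G" using Union by auto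
      have Ps: "?P n \<in> sigma_sets \<Omega> G" for n using Union by (intro finite_UN) auto
      have UP: "(\<Union>n. ?P n) = ?U" by auto
      have inc: "incseq ?P" by (auto simp: incseq_def intro: less_le_trans)
      have "(\<lambda>n. measure \<mu> (?P n)) \<longlonglongrightarrow> measure \<mu> ?U"
        using m.finite_Lim_measure_incseq[OF _ inc] Ps s\<mu> UP by auto
      then have 1: "eventually (\<lambda>n. measure \<mu> ?U - e / 2 < measure \<mu> (?P n)) sequentially"
        using e by (intro order_tendstoD(1)) auto
      have "(\<lambda>n. measure \<nu> (?P n)) \<longlonglongrightarrow> measure \<nu> ?U"
        using n.finite_Lim_measure_incseq[OF _ inc] Ps s\<nu> UP by auto
      then have 2: "eventually (\<lambda>n. measure \<nu> ?U - e / 2 < measure \<nu> (?P n)) sequentially"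
        using e by (intro order_tendstoD(1)) auto
      from eventually_conj[OF 1 2] obtain N where
        N: "measure \<mu> ?U - e / 2 < measure \<mu> (?P N)" "measure \<nu> ?U - e / 2 < measure \<nu> (?P N)"
        by (auto simp: eventually_sequentially)
      have PU: "?P N \<subseteq> ?U" by auto
      have N': "measure \<mu> (?U - ?P N) < e / 2" "measure \<nu> (?U - ?P N) < e / 2"
        using N m.finite_measure_Diff[of ?U "?P N"] n.finite_measure_Diff[of ?U "?P N"] Us Ps s\<mu> s\<nu> PU by auto
      \<comment> \<open>\<open>N\<close> pieces with error \<open>d\<close> cost less than
        \<open>e / 2\<close>; the \<open>+ 1\<close> keeps the denominator positive when
        \<open>N = 0\<close>.\<close>
      define d where "d = e / (2 * (real N + 1))"
      have d: "d > 0" using e by (simp add: d_def)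
      have "\<forall>i. \<exists>B\<in>Alg. measure \<mu> (A i - B \<union> (B - A i)) < d \<and> measure \<nu> (A i - B \<union> (B - A i)) < d"
        using Union(2) d by blast
      then obtain B where B: "\<And>i. B i \<in> Alg" "\<And>i. measure \<mu> (A i - B i \<union> (B i - A i)) < d"
        "\<And>i. measure \<nu> (A i - B i \<union> (B i - A i)) < d" by metis
      let ?B = "\<Union>i<N. B i"
      have BA: "?B \<in> Alg"
        by (induct N) (auto simp: Alg_empty lessThan_Suc Alg_Un B)
      let ?X = "\<Union>i<N. A i - B i \<union> (B i - A i)"
      have Bs: "B i \<in> sigma_sets \<Omega> G" for i using B Alg_sets by auto
      have Di: "A i - B i \<union> (B i - A i) \<in> sigma_sets \<Omega> G" for i using Bs Union by auto
      have Xs: "?X \<in> sigma_sets \<Omega> G" using Di by (intro finite_UN) auto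
      have sub: "?U - ?B \<union> (?B - ?U) \<subseteq> (?U - ?P N) \<union> ?X" by auto
      have Nd: "real N * d < e / 2" using e by (simp add: d_def field_simps)
      have "measure \<mu> (?U - ?B \<union> (?B - ?U)) \<le> measure \<mu> ((?U - ?P N) \<union> ?X)"
        using Us Ps Xs s\<mu> sub by (intro m.finite_measure_mono) auto
      also have "\<dots> \<le> measure \<mu> (?U - ?P N) + measure \<mu> ?X"
        using Us Ps Xs s\<mu> by (intro measure_Un_le) auto
      also have "measure \<mu> ?X \<le> (\<Sum>i<N. measure \<mu> (A i - B i \<union> (B i - A i)))"
        using Di s\<mu> by (intro m.finite_measure_subadditive_finite) auto
      also have "\<dots> \<le> (\<Sum>i<N. d)" using B by (intro sum_mono less_imp_le) auto
      finally have r1: "measure \<mu> (?U - ?B \<union> (?B - ?U)) < e" using N' Nd by simp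
      have "measure \<nu> (?U - ?B \<union> (?B - ?U)) \<le> measure \<nu> ((?U - ?P N) \<union> ?X)"
        using Us Ps Xs s\<nu> sub by (intro n.finite_measure_mono) auto
      also have "\<dots> \<le> measure \<nu> (?U - ?P N) + measure \<nu> ?X"
        using Us Ps Xs s\<nu> by (intro measure_Un_le) auto
      also have "measure \<nu> ?X \<le> (\<Sum>i<N. measure \<nu> (A i - B i \<union> (B i - A i)))"
        using Di s\<nu> by (intro n.finite_measure_subadditive_finite) auto
      also have "\<dots> \<le> (\<Sum>i<N. d)" using B by (intro sum_mono less_imp_le) auto
      finally have r2: "measure \<nu> (?U - ?B \<union> (?B - ?U)) < e" using N' Nd by simp
      show "\<exists>B\<in>Alg. measure \<mu> (?U - B \<union> (B - ?U)) < e \<and> measure \<nu> (?U - B \<union> (B - ?U)) < e"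
        using BA r1 r2 by blast
    qed
  qed
  show ?thesis
  proof (cases "A \<in> sigma_sets \<Omega> G")
    case False
    then show ?thesis using s\<mu> by (simp add: emeasure_notin_sets)
  next
    case A: True
    have "measure \<mu> A \<le> measure \<nu> A + e" if "e > 0" for e
    proof -
      from approx[OF A] that obtain B where B: "B \<in> Alg"
        "measure \<mu> (A - B \<union> (B - A)) < e / 2" "measure \<nu> (A - B \<union> (B - A)) < e / 2"
        by (meson half_gt_zero)
      have Bs: "B \<in> sigma_sets \<Omega> G" using B Alg_sets by auto
      have "measure \<mu> A \<le> measure \<mu> (B \<union> (A - B \<union> (B - A)))"
        using A Bs s\<mu> by (intro m.finite_measure_mono) auto
      also have "\<dots> \<le> measure \<mu> B + measure \<mu> (A - B \<union> (B - A))"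
        using A Bs s\<mu> by (intro measure_Un_le) auto
      also have "measure \<mu> B \<le> measure \<nu> B" using B Alg_le by auto
      also have "measure \<nu> B \<le> measure \<nu> (A \<union> (A - B \<union> (B - A)))"
        using A Bs s\<nu> by (intro n.finite_measure_mono) auto
      also have "\<dots> \<le> measure \<nu> A + measure \<nu> (A - B \<union> (B - A))"
        using A Bs s\<nu> by (intro measure_Un_le) auto
      finally show ?thesis using B by simp
    qed
    then have "measure \<mu> A \<le> measure \<nu> A" by (rule field_le_epsilon)
    then show ?thesis by (simp add: m.emeasure_eq_measure n.emeasure_eq_measure)
  qed
qed

section \<open>Suslin sets and projections along a compact time interval\<close>

inductive_set compact_rects :: "'w measure \<Rightarrow> (real \<times> 'w) set set" for M where
  rect: "compact K \<Longrightarrow> A \<in> sets M \<Longrightarrow> K \<times> A \<in> compact_rects M"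
| Un: "C \<in> compact_rects M \<Longrightarrow> D \<in> compact_rects M \<Longrightarrow> C \<union> D \<in> compact_rects M"

lemma compact_rects_empty: "{} \<in> compact_rects M"
  using compact_rects.rect[of "{}" "{}" M] by auto

lemma compact_rects_Int:
  assumes "C \<in> compact_rects M" "D \<in> compact_rects M"
  shows "C \<inter> D \<in> compact_rects M"
  using assms
proof (induct)
  case (rect K A)
  from rect(3) show ?case
  proof (induct)
    case (rect K' A')
    have "K \<times> A \<inter> K' \<times> A' = (K \<inter> K') \<times> (A \<inter> A')" by auto
    then show ?case using rect \<open>compact K\<close> \<open>A \<in> sets M\<close>
      by (auto intro!: compact_rects.rect compact_Int)
  qed (auto simp: Int_Un_distrib intro: compact_rects.Un)
qed (auto simp: Int_Un_distrib2 intro: compact_rects.Un)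

lemma compact_rects_UN:
  "finite I \<Longrightarrow> (\<And>i. i \<in> I \<Longrightarrow> C i \<in> compact_rects M) \<Longrightarrow> (\<Union>i\<in>I. C i) \<in> compact_rects M"
  by (induct rule: finite_induct) (auto simp: compact_rects_empty intro: compact_rects.Un)

lemma compact_rects_INT:
  "finite I \<Longrightarrow> D \<in> compact_rects M \<Longrightarrow> (\<And>i. i \<in> I \<Longrightarrow> C i \<in> compact_rects M) \<Longrightarrow>
    D \<inter> (\<Inter>i\<in>I. C i) \<in> compact_rects M"
  by (induct rule: finite_induct) (auto simp: Int_left_commute[of D] intro!: compact_rects_Int)

lemma compact_rects_section: "C \<in> compact_rects M \<Longrightarrow> compact {s. (s, w) \<in> C}"
proof (induct rule: compact_rects.induct)
  case (rect K A)
  then show ?case by (cases "w \<in> A") auto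
next
  case (Un C D)
  then show ?case using compact_Un by (auto simp: Collect_disj_eq)
qed

lemma compact_rects_snd: "C \<in> compact_rects M \<Longrightarrow> snd ` C \<in> sets M"
proof (induct rule: compact_rects.induct)
  case (rect K A)
  then show ?case by (cases "K = {}") auto
qed (auto simp: image_Un)

text \<open>Above a fixed \<open>w\<close> the sections form a decreasing sequence of nonempty
  compact sets of times, which has a common point. Compactness enters in the time direction
  only.\<close>

lemma compact_rects_snd_INT:
  assumes "\<And>n. C n \<in> compact_rects M" "decseq C"
  shows "snd ` (\<Inter>n::nat. C n) = (\<Inter>n. snd ` C n)"
proof (intro set_eqI iffI)
  fix w assume w: "w \<in> (\<Inter>n. snd ` C n)"
  define S where "S n = {s. (s, w) \<in> C n}" for n
  have "compact (S n)" for n unfolding S_def by (rule compact_rects_section[OF assms(1)])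
  moreover have "S n \<noteq> {}" for n using w by (force simp: S_def)
  moreover have "S n \<subseteq> S m" if "m \<le> n" for m n
    using \<open>decseq C\<close> that by (auto simp: S_def decseq_def)
  ultimately have "\<Inter>(range S) \<noteq> {}" by (intro compact_nest) auto
  then show "w \<in> snd ` (\<Inter>n. C n)" by (force simp: S_def)
qed auto

text \<open>The sets obtained from finite unions of rectangles by the Suslin operation; the sequence
  \<open>f\<close> enters the \<open>k\<close>-th condition through finitely many of its terms only.\<close>

definition suslin :: "'w measure \<Rightarrow> (real \<times> 'w) set \<Rightarrow> (real \<times> 'w) set \<Rightarrow> bool" where
  "suslin M X C \<longleftrightarrow> C \<subseteq> X \<and> (\<exists>Z :: nat \<Rightarrow> (nat \<Rightarrow> nat) \<Rightarrow> (real \<times> 'w) set.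
     (\<forall>k f. Z k f \<in> compact_rects M) \<and>
     (\<forall>k. \<exists>m. \<forall>f g. (\<forall>i<m. f i = g i) \<longrightarrow> Z k f = Z k g) \<and>
     C = {x. \<exists>f. \<forall>k. x \<in> Z k f})"

lemma suslin_compact_rects: "C \<in> compact_rects M \<Longrightarrow> C \<subseteq> X \<Longrightarrow> suslin M X C"
  unfolding suslin_def by (intro conjI exI[of _ "\<lambda>k f. C"]) auto

lemma suslin_UN:
  assumes X: "X \<in> compact_rects M" and C: "\<And>n::nat. suslin M X (C n)"
  shows "suslin M X (\<Union>n. C n)"
proof -
  have "\<forall>n. \<exists>Z :: nat \<Rightarrow> (nat \<Rightarrow> nat) \<Rightarrow> (real \<times> 'a) set. (\<forall>k f. Z k f \<in> compact_rects M) \<and>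
     (\<forall>k. \<exists>m. \<forall>f g. (\<forall>i<m. f i = g i) \<longrightarrow> Z k f = Z k g) \<and> C n = {x. \<exists>f. \<forall>k. x \<in> Z k f}"
    by (rule allI) (rule C[unfolded suslin_def, THEN conjunct2])
  from choice[OF this] obtain Z :: "nat \<Rightarrow> nat \<Rightarrow> (nat \<Rightarrow> nat) \<Rightarrow> (real \<times> 'a) set" where "\<forall>n. (\<forall>k f. Z n k f \<in> compact_rects M) \<and>
     (\<forall>k. \<exists>m. \<forall>f g. (\<forall>i<m. f i = g i) \<longrightarrow> Z n k f = Z n k g) \<and> C n = {x. \<exists>f. \<forall>k. x \<in> Z n k f}"
    by (elim exE)
  then have Z: "\<And>n k f. Z n k f \<in> compact_rects M"
    "\<And>n k. \<exists>m. \<forall>f g. (\<forall>i<m. f i = g i) \<longrightarrow> Z n k f = Z n k g"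
    "\<And>n. C n = {x. \<exists>f::nat \<Rightarrow> nat. \<forall>k::nat. x \<in> Z n k f}" by simp_all
  \<comment> \<open>The first term of \<open>f\<close> selects the member of the union, the
    remaining terms are the Suslin sequence of that member. Conditions coded for another member hold
    trivially, since \<open>X\<close> stands in for them.\<close>
  define Z' where "Z' j f = (if f 0 = fst (prod_decode j) then Z (f 0) (snd (prod_decode j)) (\<lambda>i. f (Suc i)) else X)"
    for j and f :: "nat \<Rightarrow> nat"
  have CX: "C n \<subseteq> X" for n using C by (auto simp: suslin_def)
  show ?thesis unfolding suslin_def
  proof (intro conjI exI[of _ Z'] allI)
    show "(\<Union>n. C n) \<subseteq> X" using CX by auto
    show "Z' k f \<in> compact_rects M" for k f using X Z(1) by (auto simp: Z'_def)
    show "\<exists>m. \<forall>f g. (\<forall>i<m. f i = g i) \<longrightarrow> Z' k f = Z' k g" for k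
    proof -
      obtain m where m: "\<And>f g. (\<forall>i<m. f i = g i) \<Longrightarrow>
          Z (fst (prod_decode k)) (snd (prod_decode k)) f = Z (fst (prod_decode k)) (snd (prod_decode k)) g"
        using Z(2) by meson
      show ?thesis
      proof (intro exI[of _ "Suc m"] allI impI)
        fix f g :: "nat \<Rightarrow> nat" assume "\<forall>i<Suc m. f i = g i"
        then have "f 0 = g 0" "\<forall>i<m. f (Suc i) = g (Suc i)" by auto
        then show "Z' k f = Z' k g" using m[of "\<lambda>i. f (Suc i)" "\<lambda>i. g (Suc i)"] by (auto simp: Z'_def)
      qed
    qed
    show "(\<Union>n. C n) = {x. \<exists>f. \<forall>k. x \<in> Z' k f}"
    proof (intro set_eqI iffI)
      fix x assume "x \<in> (\<Union>n. C n)"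
      then obtain n where n: "x \<in> C n" by auto
      then obtain f where f: "\<And>k. x \<in> Z n k f" using Z(3) by auto
      have "x \<in> Z' k (case_nat n f)" for k using f n CX by (auto simp: Z'_def)
      then show "x \<in> {x. \<exists>f. \<forall>k. x \<in> Z' k f}" by blast
    next
      fix x assume "x \<in> {x. \<exists>f. \<forall>k. x \<in> Z' k f}"
      then obtain f where f: "\<And>k. x \<in> Z' k f" by auto
      have "x \<in> Z (f 0) k (\<lambda>i. f (Suc i))" for k
        using f[of "prod_encode (f 0, k)"] by (simp add: Z'_def)
      then show "x \<in> (\<Union>n. C n)" using Z(3) by blast
    qed
  qed
qed

lemma suslin_INT:
  assumes C: "\<And>n::nat. suslin M X (C n)"
  shows "suslin M X (\<Inter>n. C n)"
proof -
  have "\<forall>n. \<exists>Z :: nat \<Rightarrow> (nat \<Rightarrow> nat) \<Rightarrow> (real \<times> 'a) set. (\<forall>k f. Z k f \<in> compact_rects M) \<and>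
     (\<forall>k. \<exists>m. \<forall>f g. (\<forall>i<m. f i = g i) \<longrightarrow> Z k f = Z k g) \<and> C n = {x. \<exists>f. \<forall>k. x \<in> Z k f}"
    by (rule allI) (rule C[unfolded suslin_def, THEN conjunct2])
  from choice[OF this] obtain Z :: "nat \<Rightarrow> nat \<Rightarrow> (nat \<Rightarrow> nat) \<Rightarrow> (real \<times> 'a) set" where "\<forall>n. (\<forall>k f. Z n k f \<in> compact_rects M) \<and>
     (\<forall>k. \<exists>m. \<forall>f g. (\<forall>i<m. f i = g i) \<longrightarrow> Z n k f = Z n k g) \<and> C n = {x. \<exists>f. \<forall>k. x \<in> Z n k f}"
    by (elim exE)
  then have Z: "\<And>n k f. Z n k f \<in> compact_rects M"
    "\<And>n k. \<exists>m. \<forall>f g. (\<forall>i<m. f i = g i) \<longrightarrow> Z n k f = Z n k g"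
    "\<And>n. C n = {x. \<exists>f::nat \<Rightarrow> nat. \<forall>k::nat. x \<in> Z n k f}" by simp_all
  \<comment> \<open>One sequence stores a whole family of sequences along the pairing function; the
    index \<open>j\<close> decodes into a member and a condition for that member.\<close>
  define Z' where "Z' j f = Z (fst (prod_decode j)) (snd (prod_decode j)) (\<lambda>i. f (prod_encode (fst (prod_decode j), i)))"
    for j and f :: "nat \<Rightarrow> nat"
  show ?thesis unfolding suslin_def
  proof (intro conjI exI[of _ Z'] allI)
    show "(\<Inter>n. C n) \<subseteq> X" using C[of 0] by (auto simp: suslin_def)
    show "Z' k f \<in> compact_rects M" for k f using Z(1) by (auto simp: Z'_def)
    show "\<exists>m. \<forall>f g. (\<forall>i<m. f i = g i) \<longrightarrow> Z' k f = Z' k g" for k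
    proof -
      obtain m where m: "\<And>f g. (\<forall>i<m. f i = g i) \<Longrightarrow>
          Z (fst (prod_decode k)) (snd (prod_decode k)) f = Z (fst (prod_decode k)) (snd (prod_decode k)) g"
        using Z(2) by meson
      let ?e = "\<lambda>i. prod_encode (fst (prod_decode k), i)"
      show ?thesis
      proof (intro exI[of _ "Suc (Max (?e ` {..m}))"] allI impI)
        fix f g :: "nat \<Rightarrow> nat" assume *: "\<forall>i<Suc (Max (?e ` {..m})). f i = g i"
        have "f (?e i) = g (?e i)" if "i < m" for i
          using that * by (auto simp: less_Suc_eq_le intro!: Max_ge)
        then show "Z' k f = Z' k g" unfolding Z'_def by (intro m) auto
      qed
    qed
    show "(\<Inter>n. C n) = {x. \<exists>f. \<forall>k. x \<in> Z' k f}"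
    proof (intro set_eqI iffI)
      fix x assume "x \<in> (\<Inter>n. C n)"
      then have "\<forall>n. \<exists>f. \<forall>k. x \<in> Z n k f" using Z(3) by auto
      then obtain f where f: "\<And>n k. x \<in> Z n k (f n)" by metis
      have "x \<in> Z' k (\<lambda>j. f (fst (prod_decode j)) (snd (prod_decode j)))" for k
        using f by (auto simp: Z'_def)
      then show "x \<in> {x. \<exists>f. \<forall>k. x \<in> Z' k f}" by blast
    next
      fix x assume "x \<in> {x. \<exists>f. \<forall>k. x \<in> Z' k f}"
      then obtain f where f: "\<And>k. x \<in> Z' k f" by auto
      have "x \<in> Z n k (\<lambda>i. f (prod_encode (n, i)))" for n k
        using f[of "prod_encode (n, k)"] by (simp add: Z'_def)
      then show "x \<in> (\<Inter>n. C n)" using Z(3) by blast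
    qed
  qed
qed

text \<open>Koenig's lemma for a finitely branching tree: the pigeonhole principle fixes the next
  term of \<open>g\<close> while infinitely many indices \<open>k\<close> still agree with all terms
  fixed before. The limit \<open>g\<close> need not be one of the \<open>f k\<close>.\<close>

lemma koenig_bounded:
  fixes f :: "nat \<Rightarrow> nat \<Rightarrow> nat"
  assumes "\<And>k i. f k i \<le> b i"
  shows "\<exists>g. \<forall>n. infinite {k. \<forall>i<n. f k i = g i}"
proof -
  have "\<exists>G. \<forall>n. infinite {k. \<forall>i<n. f k i = G n i} \<and> (\<forall>i<n. G (Suc n) i = G n i)"
  proof (rule dependent_nat_choice)
    show "\<exists>x. infinite {k. \<forall>i<0. f k i = x i}" by simp
    fix g n assume inf: "infinite {k. \<forall>i<n. f k i = g i}"
    have "finite ((\<lambda>k. f k n) ` {k. \<forall>i<n. f k i = g i})"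
      by (rule finite_subset[of _ "{..b n}"]) (use assms in auto)
    from pigeonhole_infinite[OF inf this] obtain k0 where
      "infinite {k \<in> {k. \<forall>i<n. f k i = g i}. f k n = f k0 n}" by auto
    also have "{k \<in> {k. \<forall>i<n. f k i = g i}. f k n = f k0 n} = {k. \<forall>i<Suc n. f k i = (g(n := f k0 n)) i}"
      by (auto simp: less_Suc_eq)
    finally show "\<exists>h. infinite {k. \<forall>i<Suc n. f k i = h i} \<and> (\<forall>i<n. h i = g i)"
      by (intro exI[of _ "g(n := f k0 n)"]) auto
  qed
  then obtain G where G: "\<And>n. infinite {k. \<forall>i<n. f k i = G n i}" "\<And>n i. i < n \<Longrightarrow> G (Suc n) i = G n i"
    by blast
  have eq: "G n i = G (Suc i) i" if "i < n" for n i
    using that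
  proof (induct n)
    case (Suc n)
    then show ?case using G(2)[of i n] by (cases "i = n") auto
  qed simp
  have "infinite {k. \<forall>i<n. f k i = G (Suc i) i}" for n
  proof -
    have "{k. \<forall>i<n. f k i = G (Suc i) i} = {k. \<forall>i<n. f k i = G n i}"
      using eq[of _ n] by auto
    then show ?thesis using G(1)[of n] by simp
  qed
  then show ?thesis by (intro exI[of _ "\<lambda>i. G (Suc i) i"]) auto
qed

text \<open>Choquet's capacitability argument: the outer measure of the projection is continuous along
  increasing sequences of sets, and projections of decreasing sequences of sets in
  \<open>compact_rects\<close> commute with intersections.\<close>

lemma suslin_snd_completion:
  assumes "finite_measure M" and X: "X \<in> compact_rects M" and S: "suslin M X C"
  shows "snd ` C \<in> sets (completion M)"
proof -
  interpret finite_measure M by fact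
  from S[unfolded suslin_def, THEN conjunct2] obtain Z where
    Z': "(\<forall>k f. Z k f \<in> compact_rects M) \<and> (\<forall>k. \<exists>m. \<forall>f g. (\<forall>i<m. f i = g i) \<longrightarrow> Z k f = Z k g) \<and>
      C = {x. \<exists>f::nat \<Rightarrow> nat. \<forall>k::nat. x \<in> Z k f}" by (elim exE)
  then have Z: "\<And>k f. Z k f \<in> compact_rects M" and C: "C = {x. \<exists>f. \<forall>k. x \<in> Z k f}" by simp_all
  have CX: "C \<subseteq> X" using S by (simp add: suslin_def)
  from choice[OF Z'[THEN conjunct2, THEN conjunct1]] obtain m where
    "\<forall>k f g. (\<forall>i<m k. f i = g i) \<longrightarrow> Z k f = Z k g" by (elim exE)
  then have m: "\<And>k f g. (\<forall>i<m k. f i = g i) \<Longrightarrow> Z k f = Z k g" by blast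
  have CM: "snd ` C \<subseteq> space M"
    using CX compact_rects_snd[OF X] sets.sets_into_space by blast
  have inner: "\<exists>B\<in>sets M. B \<subseteq> snd ` C \<and> a \<le> emeasure M B" if a: "a < outer_measure_of M (snd ` C)" for a
  proof -
    \<comment> \<open>Only the first \<open>n\<close> terms of the witness are bounded. As the bound
      on the next term grows, these sets increase to the preceding stage; continuity of the outer
      measure then lets the bounds be fixed one after another while the outer measure stays above
      \<open>a\<close>.\<close>
    define Cb where "Cb b n = {x. \<exists>f. (\<forall>i<n. f i \<le> b i) \<and> (\<forall>k. x \<in> Z k f)}" for b :: "nat \<Rightarrow> nat" and n :: nat
    have "\<exists>B. \<forall>n. a < outer_measure_of M (snd ` Cb (B n) n) \<and> (\<forall>i<n. B (Suc n) i = B n i)"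
    proof (rule dependent_nat_choice)
      show "\<exists>x. a < outer_measure_of M (snd ` Cb x 0)" using a by (simp add: Cb_def C)
      fix b n assume *: "a < outer_measure_of M (snd ` Cb b n)"
      have Un: "Cb b n = (\<Union>j. Cb (b(n := j)) (Suc n))"
        by (auto simp: Cb_def less_Suc_eq all_conj_distrib imp_conjR split: if_splits)
      have inc: "incseq (\<lambda>j. snd ` Cb (b(n := j)) (Suc n))"
        by (intro incseq_SucI image_mono) (auto simp: Cb_def less_Suc_eq split: if_splits intro: le_SucI)
      have "Cb b n \<subseteq> C" for b n by (auto simp: Cb_def C)
      then have "\<And>j. snd ` Cb (b(n := j)) (Suc n) \<subseteq> space M" using CM by (meson image_mono order_trans)
      from SUP_outer_measure_of_incseq[OF this inc]
      have "outer_measure_of M (snd ` Cb b n) = (SUP j. outer_measure_of M (snd ` Cb (b(n := j)) (Suc n)))"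
        by (simp add: Un image_UN)
      with * obtain j where "a < outer_measure_of M (snd ` Cb (b(n := j)) (Suc n))"
        by (auto simp: less_SUP_iff)
      then show "\<exists>y. a < outer_measure_of M (snd ` Cb y (Suc n)) \<and> (\<forall>i<n. y i = b i)"
        by (intro exI[of _ "b(n := j)"]) auto
    qed
    then obtain B where B: "\<And>n. a < outer_measure_of M (snd ` Cb (B n) n)" "\<And>n i. i < n \<Longrightarrow> B (Suc n) i = B n i"
      by blast
    define b where "b i = B (Suc i) i" for i
    have eq: "B n i = b i" if "i < n" for n i
      using that
    proof (induct n)
      case (Suc n)
      then show ?case using B(2)[of i n] by (cases "i = n") (auto simp: b_def)
    qed simp
    have "Cb (B n) n = Cb b n" for n by (auto simp: Cb_def eq)
    with B(1) have ab: "a < outer_measure_of M (snd ` Cb b n)" for n by metis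
    \<comment> \<open>Now all terms are bounded, but only the first \<open>k\<close> conditions are
      imposed. This leaves finitely many relevant witnesses, so \<open>D k\<close> is again in
      \<open>compact_rects\<close> and has a measurable projection.\<close>
    define D where "D k = {x\<in>X. \<exists>f. (\<forall>i. f i \<le> b i) \<and> (\<forall>j<k. x \<in> Z j f)}" for k
    have DR: "D k \<in> compact_rects M" for k
    proof -
      \<comment> \<open>The sum of the lengths \<open>m j\<close> is a crude common bound for the
        number of terms that the first \<open>k\<close> conditions read.\<close>
      define N where "N = (\<Sum>j<k. m j)"
      have mN: "m j \<le> N" if "j < k" for j
        unfolding N_def using that by (intro member_le_sum) auto
      let ?F = "{f. (\<forall>i. (i \<in> {..<N} \<longrightarrow> f i \<in> {..(\<Sum>i<N. b i)}) \<and> (i \<notin> {..<N} \<longrightarrow> f i = (0::nat))) \<and> (\<forall>i. f i \<le> b i)}"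
      have fin: "finite ?F"
        by (rule finite_subset[OF _ finite_set_of_finite_funs[of "{..<N}" "{..(\<Sum>i<N. b i)}" 0]]) auto
      have "D k = (\<Union>f\<in>?F. X \<inter> (\<Inter>j<k. Z j f))"
      proof (intro set_eqI iffI)
        fix x assume "x \<in> D k"
        then obtain f where f: "x \<in> X" "\<And>i. f i \<le> b i" "\<And>j. j < k \<Longrightarrow> x \<in> Z j f" by (auto simp: D_def)
        define g where "g i = (if i < N then f i else 0)" for i
        have "f i \<le> (\<Sum>i<N. b i)" if "i < N" for i
          using f(2)[of i] member_le_sum[of i "{..<N}" b] that by auto
        then have "g \<in> ?F" using f(2) by (auto simp: g_def)
        moreover have "Z j g = Z j f" if "j < k" for j
          using mN[OF that] by (intro m) (auto simp: g_def)
        ultimately show "x \<in> (\<Union>f\<in>?F. X \<inter> (\<Inter>j<k. Z j f))" using f by blast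
      qed (auto simp: D_def)
      also have "\<dots> \<in> compact_rects M"
        using fin Z X by (intro compact_rects_UN compact_rects_INT) auto
      finally show ?thesis .
    qed
    have CbD: "\<exists>n. Cb b n \<subseteq> D k" for k
    proof (intro exI[of _ "\<Sum>j<k. m j"] subsetI)
      fix x assume x: "x \<in> Cb b (\<Sum>j<k. m j)"
      then obtain f where f: "\<And>i. i < (\<Sum>j<k. m j) \<Longrightarrow> f i \<le> b i" "\<And>k. x \<in> Z k f" by (auto simp: Cb_def)
      have mN: "m j \<le> (\<Sum>j<k. m j)" if "j < k" for j
        using that by (intro member_le_sum) auto
      define g where "g i = (if i < (\<Sum>j<k. m j) then f i else 0)" for i
      have "Z j g = Z j f" if "j < k" for j
        using mN[OF that] by (intro m) (auto simp: g_def)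
      moreover have "x \<in> X" using f CX C by auto
      ultimately show "x \<in> D k" using f by (auto simp: D_def g_def intro!: exI[of _ g])
    qed
    have dec: "decseq D" by (auto simp: decseq_def D_def)
    \<comment> \<open>The witnesses for different \<open>k\<close> may differ. A limit witness
      exists because they are bounded term by term, and it satisfies each condition because a
      condition reads finitely many terms.\<close>
    have DC: "(\<Inter>k. D k) \<subseteq> C"
    proof
      fix x assume "x \<in> (\<Inter>k. D k)"
      then have "\<forall>k. \<exists>f. (\<forall>i. f i \<le> b i) \<and> (\<forall>j<k. x \<in> Z j f)" by (auto simp: D_def)
      then obtain f where f: "\<And>k i. f k i \<le> b i" "\<And>k j. j < k \<Longrightarrow> x \<in> Z j (f k)" by metis
      from koenig_bounded[of f b, OF f(1)] obtain g where g: "\<And>n. infinite {k. \<forall>i<n. f k i = g i}" by auto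
      have "x \<in> Z j g" for j
      proof -
        obtain k where k: "k > j" "\<forall>i<m j. f k i = g i"
          using g[of "m j"] by (auto simp: infinite_nat_iff_unbounded)
        show ?thesis using f(2)[OF k(1)] m[of j "f k" g] k(2) by auto
      qed
      then show "x \<in> C" using C by auto
    qed
    have sD: "snd ` D k \<in> sets M" for k using compact_rects_snd[OF DR] .
    have "a \<le> emeasure M (snd ` D k)" for k
    proof -
      obtain n where "Cb b n \<subseteq> D k" using CbD by auto
      then have "outer_measure_of M (snd ` Cb b n) \<le> outer_measure_of M (snd ` D k)"
        by (intro outer_measure_of_mono image_mono)
      with ab[of n] sD[of k] show ?thesis by simp
    qed
    then have "a \<le> (INF k. emeasure M (snd ` D k))" by (intro INF_greatest)
    also have "\<dots> = emeasure M (\<Inter>k. snd ` D k)"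
      using sD dec by (intro INF_emeasure_decseq) (auto simp: decseq_def image_mono)
    also have "(\<Inter>k. snd ` D k) = snd ` (\<Inter>k. D k)"
      using compact_rects_snd_INT[OF DR dec] by simp
    finally have "a \<le> emeasure M (snd ` (\<Inter>k. D k))" .
    moreover have "snd ` (\<Inter>k. D k) \<in> sets M"
      using compact_rects_snd_INT[OF DR dec] sD by auto
    ultimately show ?thesis using DC by (intro bexI[of _ "snd ` (\<Inter>k. D k)"]) auto
  qed
  \<comment> \<open>\<open>E\<close> is a measurable hull. Inner sets whose measure comes within
    \<open>1 / Suc n\<close> of that of \<open>E\<close> fill it up to a null set, so the projection
    differs from a measurable set by a subset of a null set.\<close>
  obtain E where E: "E \<in> sets M" "snd ` C \<subseteq> E" "outer_measure_of M (snd ` C) = emeasure M E"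
    using outer_measure_of_attain[OF CM] by auto
  show ?thesis
  proof (cases "emeasure M E = 0")
    case True
    then have "E \<in> null_sets M" using E by auto
    then have "snd ` C \<in> null_sets (completion M)" using null_sets_completion_subset[OF E(2)] null_sets_completionI by auto
    then show ?thesis by auto
  next
    case False
    define a where "a n = ennreal (measure M E - 1 / Suc n)" for n :: nat
    have "measure M E > 0" using False by (simp add: emeasure_eq_measure zero_less_measure_iff)
    then have "a n < outer_measure_of M (snd ` C)" for n
      unfolding E(3) a_def emeasure_eq_measure by (intro ennreal_lessI) (auto simp del: of_nat_Suc)
    with inner have "\<forall>n. \<exists>B\<in>sets M. B \<subseteq> snd ` C \<and> a n \<le> emeasure M B" by blast
    then obtain B where B: "\<And>n. B n \<in> sets M" "\<And>n. B n \<subseteq> snd ` C" "\<And>n. a n \<le> emeasure M (B n)" by metis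
    let ?B = "\<Union>n. B n"
    have "measure M E \<le> measure M ?B"
    proof (rule field_le_epsilon)
      fix e :: real assume "e > 0"
      then obtain n where n: "1 / Suc n < e" by (metis nat_approx_posE)
      have "measure M E - 1 / Suc n \<le> measure M (B n)"
        using B(3)[of n] unfolding a_def emeasure_eq_measure by (subst (asm) ennreal_le_iff) auto
      also have "\<dots> \<le> measure M ?B" using B(1) by (intro finite_measure_mono) auto
      finally show "measure M E \<le> measure M ?B + e" using n by linarith
    qed
    then have "emeasure M E \<le> emeasure M ?B" by (simp add: emeasure_eq_measure)
    moreover have "?B \<subseteq> E" using B(2) E(2) by blast
    ultimately have "emeasure M (E - ?B) = 0"
      using B(1) E(1) by (subst emeasure_Diff) (auto intro!: diff_eq_0_ennreal simp: less_top[symmetric])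
    then have "E - ?B \<in> null_sets M" using B E by auto
    then have "snd ` C - ?B \<in> null_sets (completion M)"
      using E(2) null_sets_completion_subset[of "snd ` C - ?B" "E - ?B" M] null_sets_completionI by auto
    then have "?B \<union> (snd ` C - ?B) \<in> sets (completion M)" using B(1) by (intro sets.Un) auto
    moreover have "?B \<union> (snd ` C - ?B) = snd ` C" using B(2) by blast
    ultimately show ?thesis by simp
  qed
qed

text \<open>Suslin sets need not be closed under complements. The induction therefore runs over the
  sets that are Suslin together with their complement in the strip; these form a sigma-algebra
  containing the time cylinders and the space cylinders.\<close>

lemma suslin_pair_measure:
  assumes "C \<in> sets (borel \<Otimes>\<^sub>M M)"
  shows "suslin M ({a..b} \<times> space M) (({a..b} \<times> space M) \<inter> C) \<and> suslin M ({a..b} \<times> space M) (({a..b} \<times> space M) - C)"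
proof -
  let ?X = "{a..b} \<times> space M"
  have X: "?X \<in> compact_rects M" by (intro compact_rects.rect) auto
  define Q where "Q C \<longleftrightarrow> suslin M ?X (?X \<inter> C) \<and> suslin M ?X (?X - C)" for C
  \<comment> \<open>\<open>Q\<close> sees only the trace on the strip, so complements may be taken
    in the whole type instead of the product space.\<close>
  have Q_cong: "Q C \<Longrightarrow> ?X \<inter> C = ?X \<inter> C' \<Longrightarrow> Q C'" for C C'
  proof -
    assume "Q C" and eq: "?X \<inter> C = ?X \<inter> C'"
    have "?X - C = ?X - (?X \<inter> C)" "?X - C' = ?X - (?X \<inter> C')" by auto
    with eq have "?X - C = ?X - C'" by simp
    with \<open>Q C\<close> eq show "Q C'" by (simp add: Q_def)
  qed
  have Q_compl: "Q C \<Longrightarrow> Q (- C)" for C unfolding Q_def by (simp add: Diff_eq)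
  have Q_UN: "Q (\<Union>n::nat. C n)" if "\<And>n. Q (C n)" for C
  proof -
    have "?X \<inter> (\<Union>n. C n) = (\<Union>n. ?X \<inter> C n)" "?X - (\<Union>n. C n) = (\<Inter>n. ?X - C n)" by auto
    then show ?thesis unfolding Q_def
      using suslin_UN[OF X, of "\<lambda>n. ?X \<inter> C n"] suslin_INT[of M ?X "\<lambda>n. ?X - C n"] that by (auto simp: Q_def)
  qed
  have Q_Int: "Q (C \<inter> D)" if "Q C" "Q D" for C D
  proof -
    have "Q (- (\<Union>n::nat. if n = 0 then - C else - D))" using that
      by (intro Q_compl Q_UN) (auto intro: Q_compl)
    also have "- (\<Union>n::nat. if n = 0 then - C else - D) = C \<inter> D" by (auto split: if_splits)
    finally show ?thesis .
  qed
  have Q_empty: "Q {}" unfolding Q_def using X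
    by (auto intro!: suslin_compact_rects compact_rects_empty)
  have time: "Q (K \<times> space M)" if K: "K \<in> sets borel" for K :: "real set"
  proof -
    from K have "K \<in> sigma_sets UNIV (range (\<lambda>a. {..a}))"
      by (simp add: borel_eq_atMost)
    then show ?thesis
    proof induct
      case (Basic K)
      then obtain c where c: "K = {..c}" by auto
      have "?X \<inter> (K \<times> space M) = ({a..b} \<inter> {..c}) \<times> space M" using c by auto
      moreover have "({a..b} \<inter> {..c}) \<times> space M \<in> compact_rects M"
        by (intro compact_rects.rect compact_Int_closed) auto
      ultimately have 1: "suslin M ?X (?X \<inter> (K \<times> space M))" by (intro suslin_compact_rects) auto
      \<comment> \<open>The complement of a closed half-line is open, hence not compact inside the
        strip but a countable union of compact intervals.\<close>
      have "?X - (K \<times> space M) = (\<Union>n::nat. ({a..b} \<inter> {c + 1 / Suc n..}) \<times> space M)"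
      proof (intro set_eqI iffI)
        fix x assume x: "x \<in> ?X - (K \<times> space M)"
        then have "fst x - c > 0" using c by auto
        then obtain n where n: "1 / Suc n < fst x - c" by (metis nat_approx_posE)
        then have "c + 1 / Suc n \<le> fst x" by simp
        then show "x \<in> (\<Union>n::nat. ({a..b} \<inter> {c + 1 / Suc n..}) \<times> space M)"
          using x by (auto simp del: of_nat_Suc)
      next
        fix x assume "x \<in> (\<Union>n::nat. ({a..b} \<inter> {c + 1 / Suc n..}) \<times> space M)"
        then obtain n :: nat where n: "x \<in> ({a..b} \<inter> {c + 1 / Suc n..}) \<times> space M" by auto
        have "1 / real (Suc n) > 0" by simp
        moreover have "c + 1 / real (Suc n) \<le> fst x" using n by auto
        ultimately have "fst x > c" by linarith
        then show "x \<in> ?X - (K \<times> space M)" using n c by auto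
      qed
      moreover have "suslin M ?X (\<Union>n::nat. ({a..b} \<inter> {c + 1 / Suc n..}) \<times> space M)"
        by (intro suslin_UN[OF X] suslin_compact_rects compact_rects.rect compact_Int_closed) auto
      ultimately show ?case using 1 by (simp add: Q_def)
    next
      case (Compl K)
      then have "Q (- (K \<times> space M))" by (intro Q_compl)
      then show ?case by (rule Q_cong) auto
    next
      case (Union K)
      then have "Q (\<Union>n. K n \<times> space M)" by (intro Q_UN)
      then show ?case by (rule Q_cong) auto
    qed (simp add: Q_empty)
  qed
  have spc: "Q (UNIV \<times> A)" if "A \<in> sets M" for A
  proof -
    have "?X \<inter> UNIV \<times> A = {a..b} \<times> A" "?X - UNIV \<times> A = {a..b} \<times> (space M - A)"
      using sets.sets_into_space[OF that] by auto
    then show ?thesis unfolding Q_def using that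
      by (auto intro!: suslin_compact_rects compact_rects.rect)
  qed
  have "C \<in> sigma_sets (UNIV \<times> space M) {a \<times> b |a b. a \<in> sets borel \<and> b \<in> sets M}"
    using assms by (simp add: sets_pair_measure)
  then have "Q C"
  proof induct
    case (Basic C)
    then obtain K A where "C = K \<times> A" "K \<in> sets borel" "A \<in> sets M" by auto
    moreover from this have "K \<times> space M \<inter> UNIV \<times> A = C" using sets.sets_into_space[of A M] by auto
    ultimately show ?case using Q_Int[OF time spc, of K A] by simp
  next
    case (Compl C)
    then have "Q (- C)" by (intro Q_compl)
    then show ?case by (rule Q_cong) auto
  next
    case (Union C)
    then show ?case by (intro Q_UN)
  qed (simp add: Q_empty)
  then show ?thesis by (simp add: Q_def)
qed

text \<open>The time interval is compact so that the strip over it is itself a compact rectangle.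
  With \<open>C\<close> the set of pairs of a time and a path that is outside a Borel set at that
  time, this gives measurability of exit events for completed measures.\<close>

theorem measurable_projection:
  fixes a b :: real
  assumes "finite_measure M" "C \<in> sets (borel \<Otimes>\<^sub>M M)"
  shows "{w\<in>space M. \<exists>s\<in>{a..b}. (s, w) \<in> C} \<in> sets (completion M)"
proof -
  have "snd ` (({a..b} \<times> space M) \<inter> C) \<in> sets (completion M)"
    using suslin_pair_measure[OF assms(2)] assms(1)
    by (intro suslin_snd_completion[of _ "{a..b} \<times> space M"] compact_rects.rect) auto
  also have "snd ` (({a..b} \<times> space M) \<inter> C) = {w\<in>space M. \<exists>s\<in>{a..b}. (s, w) \<in> C}" by force
  finally show ?thesis .
qed

section \<open>Right-continuous paths\<close>

lemma space_borel_of [simp]: "space (borel_of T) = topspace T"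
  unfolding borel_of_def by (rule space_measure_of) (auto dest: openin_subset)

lemma sets_borel_of: "sets (borel_of T) = sigma_sets (topspace T) {U. openin T U}"
  unfolding borel_of_def by (rule sets_measure_of) (auto dest: openin_subset)

lemma openin_borel_of: "openin T U \<Longrightarrow> U \<in> sets (borel_of T)"
  by (simp add: sets_borel_of sigma_sets.Basic)

lemma closedin_borel_of: "closedin T C \<Longrightarrow> C \<in> sets (borel_of T)"
proof -
  assume C: "closedin T C"
  then have "topspace T - (topspace T - C) = C" using closedin_subset by blast
  moreover have "topspace T - C \<in> sets (borel_of T)" using C by (intro openin_borel_of) (simp add: closedin_def)
  ultimately show ?thesis using sets.compl_sets[of "topspace T - C" "borel_of T"] by simp
qed

lemma measurable_borel_ofI:
  assumes "\<And>x. x \<in> space M \<Longrightarrow> f x \<in> topspace T"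
    and "\<And>U. openin T U \<Longrightarrow> {x\<in>space M. f x \<in> U} \<in> sets M"
  shows "f \<in> measurable M (borel_of T)"
  unfolding borel_of_def
proof (rule measurable_measure_of)
  show "f -` U \<inter> space M \<in> sets M" if "U \<in> {U. openin T U}" for U
  proof -
    have "f -` U \<inter> space M = {x\<in>space M. f x \<in> U}" by auto
    then show ?thesis using assms(2)[of U] that by simp
  qed
qed (use assms(1) in \<open>auto dest: openin_subset\<close>)

lemma measurable_borel_ofD:
  assumes "f \<in> measurable M (borel_of T)" "B \<in> sets (borel_of T)"
  shows "{x\<in>space M. f x \<in> B} \<in> sets M"
proof -
  have "{x\<in>space M. f x \<in> B} = f -` B \<inter> space M" by auto
  then show ?thesis using measurable_sets[OF assms] by simp
qed

text \<open>Nesting in the interiors gives two things that plain inclusion would not: every compact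
  subset of \<open>U\<close> lies in one of the sets, and a right-continuous path found in
  \<open>K m\<close> remains in \<open>K (Suc m)\<close> for a while.\<close>

definition exhausts :: "'s topology \<Rightarrow> (nat \<Rightarrow> 's set) \<Rightarrow> 's set \<Rightarrow> bool" where
  "exhausts T K U \<longleftrightarrow> (\<forall>m. closedin T (K m) \<and> K m \<subseteq> T interior_of (K (Suc m))) \<and> (\<Union>m. K m) = U"

lemma exhausts_mono: "exhausts T K U \<Longrightarrow> m \<le> n \<Longrightarrow> K m \<subseteq> K n"
proof (rule lift_Suc_mono_le[of K])
  assume "exhausts T K U"
  then show "K n \<subseteq> K (Suc n)" for n
    using interior_of_subset[of T "K (Suc n)"] by (auto simp: exhausts_def)
qed

lemma exhausts_closed: "exhausts T K U \<Longrightarrow> closedin T (K m)"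
  by (auto simp: exhausts_def)

lemma exhausts_subset: "exhausts T K U \<Longrightarrow> K m \<subseteq> U"
  by (auto simp: exhausts_def)

lemma exhausts_interior: "exhausts T K U \<Longrightarrow> K m \<subseteq> T interior_of (K (Suc m))"
  by (auto simp: exhausts_def)

lemma exhausts_compact:
  assumes "exhausts T K U" "compactin T C" "C \<subseteq> U"
  shows "\<exists>m. C \<subseteq> K m"
proof -
  have "\<exists>F. finite F \<and> F \<subseteq> range (\<lambda>m. T interior_of (K m)) \<and> C \<subseteq> \<Union>F"
  proof (rule compactinD[OF assms(2)])
    show "C \<subseteq> \<Union>(range (\<lambda>m. T interior_of (K m)))"
      using assms(1,3) unfolding exhausts_def by blast
  qed auto
  then obtain F where F: "finite F" "F \<subseteq> range (\<lambda>m. T interior_of (K m))" "C \<subseteq> \<Union>F" by auto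
  then obtain J where J: "finite J" "F = (\<lambda>m. T interior_of (K m)) ` J"
    by (auto dest: finite_subset_image)
  have "C \<subseteq> K (Max J)"
  proof
    fix x assume "x \<in> C"
    then have "x \<in> \<Union>F" using F(3) by auto
    then obtain m where m: "m \<in> J" "x \<in> T interior_of K m" unfolding J(2) by auto
    then have "x \<in> K m" using interior_of_subset[of T "K m"] by auto
    then show "x \<in> K (Max J)" using exhausts_mono[OF assms(1), of m "Max J"] J m by auto
  qed
  then show ?thesis ..
qed

text \<open>In a normal space it suffices that the open set is a countable union of closed sets: the
  closed set reached so far, joined with the next \<open>C n\<close>, is enlarged to a closed
  neighbourhood that still lies in \<open>U\<close>.\<close>

lemma exhausts_exists:
  assumes "normal_space T" "openin T U" "\<And>n::nat. closedin T (C n)" "(\<Union>n. C n) = U"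
  shows "\<exists>K. exhausts T K U"
proof -
  have step: "\<exists>K'. closedin T K' \<and> K' \<subseteq> U \<and> A \<subseteq> T interior_of K'" if A: "closedin T A" "A \<subseteq> U" for A
  proof -
    obtain V where "openin T V" "A \<subseteq> V" "T closure_of V \<subseteq> U"
      using assms(1)[unfolded normal_space_alt, rule_format, OF conjI[OF A(1) conjI[OF assms(2) A(2)]]]
      by (elim exE conjE)
    moreover have "V \<subseteq> T interior_of (T closure_of V)"
      using \<open>openin T V\<close> by (intro interior_of_maximal closure_of_subset openin_subset) auto
    ultimately show ?thesis by (intro exI[of _ "T closure_of V"]) auto
  qed
  have "\<exists>K. \<forall>n. (closedin T (K n) \<and> C n \<subseteq> K n \<and> K n \<subseteq> U) \<and> K n \<subseteq> T interior_of (K (Suc n))"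
  proof (rule dependent_nat_choice)
    show "\<exists>x. closedin T x \<and> C 0 \<subseteq> x \<and> x \<subseteq> U" using assms(3,4) by blast
    fix x n assume x: "closedin T x \<and> C n \<subseteq> x \<and> x \<subseteq> U"
    have "closedin T (x \<union> C (Suc n))" "x \<union> C (Suc n) \<subseteq> U" using x assms(3,4) by auto
    from step[OF this] obtain K' where K': "closedin T K'" "K' \<subseteq> U" "x \<union> C (Suc n) \<subseteq> T interior_of K'"
      by (elim exE conjE)
    moreover have "C (Suc n) \<subseteq> K'" "x \<subseteq> T interior_of K'"
      using K'(3) interior_of_subset[of T K'] by (meson order_trans le_supE)+
    ultimately show "\<exists>y. (closedin T y \<and> C (Suc n) \<subseteq> y \<and> y \<subseteq> U) \<and> x \<subseteq> T interior_of y"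
      by (intro exI[of _ K'] conjI)
  qed
  then obtain K where K: "\<forall>n. (closedin T (K n) \<and> C n \<subseteq> K n \<and> K n \<subseteq> U) \<and> K n \<subseteq> T interior_of (K (Suc n))"
    by (elim exE)
  then have "(\<Union>n. C n) \<subseteq> (\<Union>n. K n)" "(\<Union>n. K n) \<subseteq> U" by (simp_all add: UN_mono UN_least)
  then have "(\<Union>n. K n) = U" using assms(4) by simp
  with K show ?thesis by (intro exI[of _ K]) (simp add: exhausts_def)
qed

section \<open>Exhaustions in the one-point compactification\<close>

lemma compact_space_compactified: "compact_space (compactified S)"
  by (simp add: compactified_def)

lemma openin_compactified_Some: "openin (compactified S) (Some ` W) \<longleftrightarrow> openin (top_of_set S) W"
  by (simp add: compactified_def)

lemma compactified_Hausdorff: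
  fixes S :: "'a::euclidean_space set"
  assumes "locally compact S"
  shows "Hausdorff_space (compactified S)"
  unfolding compactified_def Hausdorff_space_Alexandroff_compactification
proof
  show "Hausdorff_space (top_of_set S)" by (simp add: Hausdorff_space_subtopology)
  show "locally_compact_space (top_of_set S)"
    unfolding locally_compact_space_def
  proof
    fix x assume "x \<in> topspace (top_of_set S)"
    then obtain U V where "openin (top_of_set S) U" "compact V" "x \<in> U" "U \<subseteq> V" "V \<subseteq> S"
      using assms[unfolded locally_def, rule_format, of S x] by auto
    then show "\<exists>U K. openin (top_of_set S) U \<and> compactin (top_of_set S) K \<and> x \<in> U \<and> U \<subseteq> K"
      by (intro exI[of _ U] exI[of _ V]) (auto simp: compactin_subtopology)
  qed
qed

text \<open>Every open set is a countable union of closed sets. An open subset of \<open>S\<close>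
  is sigma-compact because \<open>S\<close> is locally closed in Euclidean space; a neighbourhood of
  infinity omits a compact set, which is a countable intersection of metric neighbourhoods.\<close>

lemma compactified_exhausts:
  fixes S :: "'a::euclidean_space set"
  assumes "locally compact S" "openin (compactified S) U"
  shows "\<exists>K. exhausts (compactified S) K U"
proof -
  have haus: "Hausdorff_space (compactified S)" by (rule compactified_Hausdorff[OF assms(1)])
  have norm: "normal_space (compactified S)"
    using haus compact_space_compactified compact_Hausdorff_or_regular_imp_normal_space by blast
  consider (a) W where "openin (top_of_set S) W" "U = Some ` W"
    | (b) C where "compactin (top_of_set S) C" "U = insert None (Some ` (S - C))"
    using assms(2) by (auto simp: compactified_def openin_Alexandroff_compactification)
  then have "\<exists>C :: nat \<Rightarrow> 'a option set. (\<forall>n. closedin (compactified S) (C n)) \<and> (\<Union>n. C n) = U"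
  proof cases
    case a
    obtain A V where AV: "closed A" "open V" "S = A \<inter> V"
      using assms(1)[unfolded locally_compact_closed_Int_open] by (elim exE conjE)
    obtain O' where O': "open O'" "W = S \<inter> O'" using a(1) by (auto simp: openin_open)
    obtain C :: "nat \<Rightarrow> 'a set" where C: "\<And>n. compact (C n)" "\<And>n. C n \<subseteq> V \<inter> O'" "\<Union>(range C) = V \<inter> O'"
      by (rule open_Union_compact_subsets[of "V \<inter> O'"]) (use AV O' in auto)
    have "compact (A \<inter> C n)" "A \<inter> C n \<subseteq> S" for n using C AV by (auto intro: closed_Int_compact)
    then have "closedin (compactified S) (Some ` (A \<inter> C n))" for n
      by (auto simp: compactified_def compactin_subtopology compact_imp_closed closed_subset)
    moreover have "(\<Union>n. Some ` (A \<inter> C n)) = U"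
      unfolding image_UN[symmetric] using a(2) O' AV C(3) by auto
    ultimately show ?thesis by (intro exI[of _ "\<lambda>n. Some ` (A \<inter> C n)"]) auto
  next
    case b
    show ?thesis
    \<comment> \<open>The distance to the empty set is \<open>0\<close> by convention, so the
      neighbourhoods \<open>V n\<close> of the other case would be all of \<open>S\<close> and their
      complements would reduce to the point at infinity.\<close>
    proof (cases "C = {}")
      case True
      have "closedin (compactified S) (topspace (compactified S))" by simp
      then show ?thesis using True b by (intro exI[of _ "\<lambda>n. U"]) (auto simp: points_eq)
    next
      case False
      have C: "compact C" "C \<subseteq> S" using b by (auto simp: compactin_subtopology)
      define V where "V n = {x\<in>S. infdist x C < 1 / real (Suc n)}" for n
      have "open {x. infdist x C < 1 / real (Suc n)}" for n
        by (intro open_Collect_less continuous_intros)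
      then have "openin (top_of_set S) (S \<inter> {x. infdist x C < 1 / real (Suc n)})" for n
        by (rule openin_open_Int)
      then have "openin (top_of_set S) (V n)" for n by (simp add: V_def Int_def)
      then have "closedin (compactified S) (topspace (compactified S) - Some ` V n)" for n
        by (intro closedin_diff) (auto simp: openin_compactified_Some)
      moreover have "(\<Union>n. topspace (compactified S) - Some ` V n) = U"
      proof (intro set_eqI iffI)
        fix x assume "x \<in> (\<Union>n. topspace (compactified S) - Some ` V n)"
        then obtain n where n: "x \<in> points S" "x \<notin> Some ` V n" by auto
        have "C \<subseteq> V n" using C by (auto simp: V_def)
        then show "x \<in> U" using n b by (auto simp: points_eq)
      next
        fix x assume x: "x \<in> U"
        show "x \<in> (\<Union>n. topspace (compactified S) - Some ` V n)"
        proof (cases x)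
          case None
          then show ?thesis by (auto simp: points_eq)
        next
          case (Some y)
          then have y: "y \<in> S" "y \<notin> C" using x b by auto
          then have "infdist y C > 0"
            using C False by (intro infdist_pos_not_in_closed compact_imp_closed)
          then obtain n where "1 / real (Suc n) < infdist y C" by (metis nat_approx_posE)
          then have "y \<notin> V n" by (auto simp: V_def)
          then show ?thesis using Some y by (auto simp: points_eq)
        qed
      qed
      ultimately show ?thesis by (intro exI[of _ "\<lambda>n. topspace (compactified S) - Some ` V n"]) auto
    qed
  qed
  then show ?thesis using exhausts_exists[OF norm assms(2)] by blast
qed

section \<open>The space of right-continuous paths\<close>

definition rc_paths :: "'s topology \<Rightarrow> (real \<Rightarrow> 's) set" where
  "rc_paths T = {w. \<forall>t\<ge>0. limitin T w (w t) (at_right t)}"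

text \<open>The trace of the product sigma-algebra over nonnegative times. Values at negative times
  are neither constrained nor observed, which is why evaluation at a variable time is written with
  \<open>max 0 s\<close>.\<close>

definition path_algebra :: "'s topology \<Rightarrow> (real \<Rightarrow> 's) measure" where
  "path_algebra T = sigma (rc_paths T) {{w\<in>rc_paths T. w t \<in> B} | t B. 0 \<le> t \<and> B \<in> sets (borel_of T)}"

lemma space_path_algebra [simp]: "space (path_algebra T) = rc_paths T"
  unfolding path_algebra_def by (rule space_measure_of) auto

lemma sets_path_algebra:
  "sets (path_algebra T) = sigma_sets (rc_paths T) {{w\<in>rc_paths T. w t \<in> B} | t B. 0 \<le> t \<and> B \<in> sets (borel_of T)}"
  unfolding path_algebra_def by (rule sets_measure_of) auto

lemma rc_paths_topspace: "w \<in> rc_paths T \<Longrightarrow> 0 \<le> t \<Longrightarrow> w t \<in> topspace T"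
  by (auto simp: rc_paths_def limitin_def)

lemma rc_pathsD:
  "w \<in> rc_paths T \<Longrightarrow> 0 \<le> t \<Longrightarrow> openin T U \<Longrightarrow> w t \<in> U \<Longrightarrow> eventually (\<lambda>s. w s \<in> U) (at_right t)"
  by (auto simp: rc_paths_def limitin_def)

lemma path_eval: "0 \<le> t \<Longrightarrow> (\<lambda>w. w t) \<in> measurable (path_algebra T) (borel_of T)"
proof (rule measurableI)
  fix B assume "0 \<le> t" "B \<in> sets (borel_of T)"
  then have "{w\<in>rc_paths T. w t \<in> B} \<in> sets (path_algebra T)"
    unfolding sets_path_algebra by blast
  moreover have "(\<lambda>w. w t) -` B \<inter> space (path_algebra T) = {w\<in>rc_paths T. w t \<in> B}" by auto
  ultimately show "(\<lambda>w. w t) -` B \<inter> space (path_algebra T) \<in> sets (path_algebra T)" by simp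
qed (simp add: rc_paths_topspace)

lemma path_measurableI:
  assumes "\<And>x. x \<in> space M \<Longrightarrow> f x \<in> rc_paths T"
    and "\<And>t. 0 \<le> t \<Longrightarrow> (\<lambda>x. f x t) \<in> measurable M (borel_of T)"
  shows "f \<in> measurable M (path_algebra T)"
  unfolding path_algebra_def
proof (rule measurable_measure_of)
  fix A assume "A \<in> {{w\<in>rc_paths T. w t \<in> B} | t B. 0 \<le> t \<and> B \<in> sets (borel_of T)}"
  then obtain t B where A: "A = {w\<in>rc_paths T. w t \<in> B}" "0 \<le> t" "B \<in> sets (borel_of T)" by auto
  have "f -` A \<inter> space M = {x\<in>space M. f x t \<in> B}" using A assms(1) by auto
  also have "\<dots> \<in> sets M" using measurable_borel_ofD[OF assms(2)] A by auto
  finally show "f -` A \<inter> space M \<in> sets M" .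
qed (use assms(1) in auto)

text \<open>The right end point of the half-open dyadic interval of level \<open>n\<close> around
  \<open>s\<close>. Adding \<open>1\<close> to the floor keeps it strictly above \<open>s\<close>
  even for dyadic \<open>s\<close>, so convergence is from the right, and each level has only
  countably many values.\<close>

definition dyadic_above :: "nat \<Rightarrow> real \<Rightarrow> real" where
  "dyadic_above n s = (real_of_int \<lfloor>s * 2 ^ n\<rfloor> + 1) / 2 ^ n"

lemma dyadic_above_gt: "s < dyadic_above n s"
proof -
  have "s * 2 ^ n < real_of_int \<lfloor>s * 2 ^ n\<rfloor> + 1" by linarith
  then show ?thesis unfolding dyadic_above_def by (subst pos_less_divide_eq) auto
qed

lemma dyadic_above_le: "dyadic_above n s \<le> s + 1 / 2 ^ n"
proof -
  have "real_of_int \<lfloor>s * 2 ^ n\<rfloor> + 1 \<le> s * 2 ^ n + 1" by simp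
  then have "dyadic_above n s \<le> (s * 2 ^ n + 1) / 2 ^ n"
    unfolding dyadic_above_def by (rule divide_right_mono) simp
  also have "\<dots> = s + 1 / 2 ^ n" by (simp add: add_divide_distrib)
  finally show ?thesis .
qed

lemma filterlim_dyadic_above: "filterlim (\<lambda>n. dyadic_above n s) (at_right s) sequentially"
proof (rule filterlim_at_withinI)
  have "(\<lambda>n. s + (1 / 2) ^ n) \<longlonglongrightarrow> s + 0"
    by (intro tendsto_intros LIMSEQ_power_zero) auto
  then have "(\<lambda>n. s + 1 / 2 ^ n) \<longlonglongrightarrow> s" by (simp add: power_one_over)
  then show "(\<lambda>n. dyadic_above n s) \<longlonglongrightarrow> s"
    by (rule tendsto_sandwich[OF _ _ tendsto_const, rotated 2])
      (auto intro!: always_eventually dyadic_above_le less_imp_le[OF dyadic_above_gt])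
  show "eventually (\<lambda>n. dyadic_above n s \<in> {s<..} - {s}) sequentially"
    using dyadic_above_gt by (auto intro!: always_eventually simp: less_le)
qed

text \<open>A substitute for metrizability: membership of a limit in an open set is decided by
  countably many closed sets.\<close>

locale exhaustible =
  fixes T :: "'s topology"
  assumes exh: "openin T U \<Longrightarrow> \<exists>K. exhausts T K U"
begin

lemma joint_eval:
  "(\<lambda>(s, w). w (max 0 s)) \<in> measurable (borel \<Otimes>\<^sub>M path_algebra T) (borel_of T)"
proof (rule measurable_borel_ofI)
  fix U assume U: "openin T U"
  then obtain K where K: "exhausts T K U" using exh by auto
  let ?M = "(borel :: real measure) \<Otimes>\<^sub>M path_algebra T"
  define d where "d n s = dyadic_above n (max 0 s)" for n s
  have d0: "0 \<le> d n s" for n s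
    unfolding d_def using dyadic_above_gt[of "max 0 s" n] by linarith
  have md: "(\<lambda>(s, w). w (d n s)) \<in> measurable ?M (borel_of T)" for n
  proof -
    \<comment> \<open>The floor takes countably many values, and on each of them the path is read at
      one fixed time.\<close>
    have "(\<lambda>x. snd x (max 0 ((real_of_int \<lfloor>max 0 (fst x :: real) * 2 ^ n\<rfloor> + 1) / 2 ^ n))) \<in> measurable ?M (borel_of T)"
    proof (rule measurable_compose_countable[where f="\<lambda>k x. snd x (max 0 ((real_of_int k + 1) / 2 ^ n))"
        and g="\<lambda>x. \<lfloor>max 0 (fst x :: real) * 2 ^ n\<rfloor>"])
      show "(\<lambda>x. snd x (max 0 ((real_of_int k + 1) / 2 ^ n))) \<in> measurable ?M (borel_of T)" for k :: int
        by (rule measurable_compose[OF measurable_snd path_eval]) auto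
    qed measurable
    then show ?thesis
      using d0 by (simp add: d_def dyadic_above_def split_beta' max_absorb2)
  qed
  \<comment> \<open>A limit from the right lies in \<open>U\<close> iff the approximations are
    eventually in one \<open>K m\<close>: forward through the interior of the next member of the
    exhaustion, backward because \<open>K m\<close> is closed.\<close>
  have "{x\<in>space ?M. (case x of (s, w) \<Rightarrow> w (max 0 s)) \<in> U} =
      {x\<in>space ?M. \<exists>m. \<forall>\<^sub>F n in sequentially. (case x of (s, w) \<Rightarrow> w (d n s)) \<in> K m}"
  proof (intro Collect_cong conj_cong refl)
    fix x assume "x \<in> space ?M"
    then obtain s w where x: "x = (s, w)" "w \<in> rc_paths T" by (auto simp: space_pair_measure)
    have lim: "filterlim (\<lambda>n. d n s) (at_right (max 0 s)) sequentially"
      unfolding d_def by (rule filterlim_dyadic_above)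
    show "((case x of (s, w) \<Rightarrow> w (max 0 s)) \<in> U) = (\<exists>m. \<forall>\<^sub>F n in sequentially. (case x of (s, w) \<Rightarrow> w (d n s)) \<in> K m)"
    proof
      assume "(case x of (s, w) \<Rightarrow> w (max 0 s)) \<in> U"
      then obtain m where "w (max 0 s) \<in> K m" using K x by (auto simp: exhausts_def)
      then have "w (max 0 s) \<in> T interior_of K (Suc m)" using exhausts_interior[OF K] by auto
      from rc_pathsD[OF x(2) _ openin_interior_of this]
      have "eventually (\<lambda>r. w r \<in> T interior_of K (Suc m)) (at_right (max 0 s))" by simp
      from eventually_compose_filterlim[OF this lim]
      show "\<exists>m. \<forall>\<^sub>F n in sequentially. (case x of (s, w) \<Rightarrow> w (d n s)) \<in> K m"
        using interior_of_subset[of T "K (Suc m)"]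
        by (intro exI[of _ "Suc m"]) (auto simp: x(1) elim!: eventually_mono)
    next
      assume "\<exists>m. \<forall>\<^sub>F n in sequentially. (case x of (s, w) \<Rightarrow> w (d n s)) \<in> K m"
      then obtain m where m: "\<forall>\<^sub>F n in sequentially. w (d n s) \<in> K m" by (auto simp: x)
      show "(case x of (s, w) \<Rightarrow> w (max 0 s)) \<in> U"
      proof (rule ccontr)
        assume "(case x of (s, w) \<Rightarrow> w (max 0 s)) \<notin> U"
        then have "w (max 0 s) \<in> topspace T - K m"
          using exhausts_subset[OF K] rc_paths_topspace[OF x(2)] by (auto simp: x)
        moreover have "openin T (topspace T - K m)" using exhausts_closed[OF K] by blast
        ultimately have "eventually (\<lambda>r. w r \<in> topspace T - K m) (at_right (max 0 s))"
          by (intro rc_pathsD[OF x(2)]) auto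
        from eventually_compose_filterlim[OF this lim] m
        have "eventually (\<lambda>n. False) sequentially" by eventually_elim auto
        then show False by simp
      qed
    qed
  qed
  also have "\<dots> \<in> sets ?M"
    using measurable_borel_ofD[OF md closedin_borel_of[OF exhausts_closed[OF K]]] by measurable
  finally show "{x\<in>space ?M. (case x of (s, w) \<Rightarrow> w (max 0 s)) \<in> U} \<in> sets ?M" .
qed (auto simp: space_pair_measure rc_paths_topspace)

lemma eval_measurable:
  assumes "f \<in> borel_measurable M" "g \<in> measurable M (path_algebra T)" "\<And>x. x \<in> space M \<Longrightarrow> 0 \<le> f x"
  shows "(\<lambda>x. g x (f x)) \<in> measurable M (borel_of T)"
proof -
  have "(\<lambda>x. (\<lambda>(s, w). w (max 0 s)) (f x, g x)) \<in> measurable M (borel_of T)"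
    by (intro measurable_compose[OF _ joint_eval] measurable_Pair assms)
  moreover have "(\<lambda>(s, w). w (max 0 s)) (f x, g x) = g x (f x)" if "x \<in> space M" for x
    using assms(3)[OF that] by (simp add: max_absorb2)
  ultimately show ?thesis
    using measurable_cong[of M "\<lambda>x. (\<lambda>(s, w). w (max 0 s)) (f x, g x)" "\<lambda>x. g x (f x)" "borel_of T"]
    by blast
qed

definition stays :: "'s set \<Rightarrow> real \<Rightarrow> (real \<Rightarrow> 's) set" where
  "stays B q = {w\<in>rc_paths T. \<forall>s\<in>{0..q}. w s \<in> B}"

text \<open>The complement is the projection of a set of pairs of a time and a path, which is
  measurable because evaluation is jointly measurable.\<close>

theorem stays_completion:
  assumes "finite_measure \<nu>" "sets \<nu> = sets (path_algebra T)" "B \<in> sets (borel_of T)"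
  shows "stays B q \<in> sets (completion \<nu>)"
proof -
  have sp: "space \<nu> = rc_paths T" using sets_eq_imp_space_eq[OF assms(2)] by simp
  have "{x\<in>space (borel \<Otimes>\<^sub>M path_algebra T). (\<lambda>(s, w). w (max 0 s)) x \<in> topspace T - B} \<in> sets (borel \<Otimes>\<^sub>M path_algebra T)"
    using sets.compl_sets[OF assms(3)] by (intro measurable_borel_ofD[OF joint_eval]) auto
  also have "sets (borel \<Otimes>\<^sub>M path_algebra T) = sets (borel \<Otimes>\<^sub>M \<nu>)"
    using assms(2) by (intro sets_pair_measure_cong) auto
  finally have "{w\<in>space \<nu>. \<exists>s\<in>{0..q}. (s, w) \<in> {x\<in>space (borel \<Otimes>\<^sub>M path_algebra T). (\<lambda>(s, w). w (max 0 s)) x \<in> topspace T - B}} \<in> sets (completion \<nu>)"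
    by (rule measurable_projection[OF assms(1)])
  then have "space (completion \<nu>) - {w\<in>space \<nu>. \<exists>s\<in>{0..q}. (s, w) \<in> {x\<in>space (borel \<Otimes>\<^sub>M path_algebra T). (\<lambda>(s, w). w (max 0 s)) x \<in> topspace T - B}} \<in> sets (completion \<nu>)"
    by (rule sets.compl_sets)
  also have "space (completion \<nu>) - {w\<in>space \<nu>. \<exists>s\<in>{0..q}. (s, w) \<in> {x\<in>space (borel \<Otimes>\<^sub>M path_algebra T). (\<lambda>(s, w). w (max 0 s)) x \<in> topspace T - B}} = stays B q"
    by (auto simp: stays_def space_pair_measure sp rc_paths_topspace)
  finally show ?thesis .
qed

lemma closed_rationals:
  assumes w: "w \<in> rc_paths T" and C: "closedin T C" and r: "\<And>r. r \<in> \<rat> \<Longrightarrow> 0 \<le> r \<Longrightarrow> r < q \<Longrightarrow> w r \<in> C"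
    and s: "0 \<le> s" "s < q"
  shows "w s \<in> C"
proof (rule ccontr)
  assume "w s \<notin> C"
  then have "w s \<in> topspace T - C" using rc_paths_topspace[OF w] s by auto
  moreover have "openin T (topspace T - C)" using C by blast
  ultimately have "eventually (\<lambda>r. w r \<in> topspace T - C) (at_right s)"
    by (intro rc_pathsD[OF w s(1)]) auto
  then obtain b where b: "b > s" "\<And>y. y > s \<Longrightarrow> y < b \<Longrightarrow> w y \<notin> C"
    by (auto simp: eventually_at_right_field)
  obtain r where "r \<in> \<rat>" "s < r" "r < min b q" using Rats_dense_in_real[of s "min b q"] b s by auto
  then show False using b(2)[of r] r[of r] s by auto
qed

lemma stays_closed:
  assumes C: "closedin T C"
  shows "stays C q \<in> sets (path_algebra T)"
proof (cases "0 \<le> q")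
  case False
  then have "stays C q = space (path_algebra T)" by (auto simp: stays_def)
  then show ?thesis by (metis sets.top)
next
  case True
  \<comment> \<open>Rational times before \<open>q\<close> control all times before \<open>q\<close>
    by right-continuity. No admissible time lies to the right of \<open>q\<close>, so
    \<open>q\<close> itself is listed separately.\<close>
  have "stays C q = {w\<in>space (path_algebra T). (\<forall>r\<in>{r\<in>\<rat>. 0 \<le> r \<and> r < q}. w r \<in> C) \<and> w q \<in> C}"
    (is "_ = ?R")
  proof (intro set_eqI iffI)
    fix w assume "w \<in> ?R"
    then have "w \<in> rc_paths T" "\<And>r. r \<in> \<rat> \<Longrightarrow> 0 \<le> r \<Longrightarrow> r < q \<Longrightarrow> w r \<in> C" "w q \<in> C" by auto
    moreover have "w s \<in> C" if "s \<in> {0..q}" for s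
      using that closed_rationals[OF \<open>w \<in> rc_paths T\<close> C \<open>\<And>r. r \<in> \<rat> \<Longrightarrow> 0 \<le> r \<Longrightarrow> r < q \<Longrightarrow> w r \<in> C\<close>, of q s] \<open>w q \<in> C\<close>
      by (cases "s = q") auto
    ultimately show "w \<in> stays C q" by (simp add: stays_def)
  qed (use True in \<open>auto simp: stays_def\<close>)
  also have "\<dots> \<in> sets (path_algebra T)"
  proof -
    have *: "{w\<in>space (path_algebra T). w r \<in> C} \<in> sets (path_algebra T)" if "0 \<le> r" for r
      using that by (intro measurable_borel_ofD[OF path_eval] closedin_borel_of C)
    have "{w\<in>space (path_algebra T). \<forall>r\<in>{r\<in>\<rat>. 0 \<le> r \<and> r < q}. w r \<in> C} \<in> sets (path_algebra T)"
    proof -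
      have "{w\<in>space (path_algebra T). 0 \<le> real_of_rat r \<and> real_of_rat r < q \<longrightarrow> w (real_of_rat r) \<in> C} \<in> sets (path_algebra T)" for r
        using *[of "real_of_rat r"] by (cases "0 \<le> real_of_rat r \<and> real_of_rat r < q") (simp_all del: space_path_algebra)
      then have "{w\<in>space (path_algebra T). \<forall>r. 0 \<le> real_of_rat r \<and> real_of_rat r < q \<longrightarrow> w (real_of_rat r) \<in> C} \<in> sets (path_algebra T)"
        by (rule sets.sets_Collect_countable_All)
      also have "{w\<in>space (path_algebra T). \<forall>r. 0 \<le> real_of_rat r \<and> real_of_rat r < q \<longrightarrow> w (real_of_rat r) \<in> C} =
          {w\<in>space (path_algebra T). \<forall>r\<in>{r\<in>\<rat>. 0 \<le> r \<and> r < q}. w r \<in> C}"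
        by (auto simp: Rats_def)
      finally show ?thesis .
    qed
    from sets.Int[OF this *[OF True]] show ?thesis
      by (rule back_subst[where P="\<lambda>A. A \<in> sets (path_algebra T)"]) blast
  qed
  finally show ?thesis .
qed

lemma stop_rc_paths:
  assumes "w \<in> rc_paths T" "0 \<le> q"
  shows "(\<lambda>s. w (min s q)) \<in> rc_paths T"
  unfolding rc_paths_def
proof (intro CollectI allI impI)
  fix t :: real assume t: "0 \<le> t"
  show "limitin T (\<lambda>s. w (min s q)) (w (min t q)) (at_right t)"
  proof (cases "t < q")
    case True
    have "eventually (\<lambda>s. w s = w (min s q)) (at_right t)"
      using eventually_at_right_real[OF True] by eventually_elim (auto simp: min_def)
    moreover have "limitin T w (w t) (at_right t)" using assms t by (auto simp: rc_paths_def)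
    ultimately show ?thesis using True by (simp add: min_def limitin_transform_eventually)
  next
    case False
    have "eventually (\<lambda>s. w q = w (min s q)) (at_right t)"
      using False by (auto simp: eventually_at_right_field min_def intro!: exI[of _ "t + 1"])
    then show ?thesis using False rc_paths_topspace[OF assms]
      by (auto simp: limitin_def min_def elim!: eventually_mono)
  qed
qed

lemma shift_rc_paths:
  assumes "w \<in> rc_paths T" "0 \<le> q"
  shows "(\<lambda>s. w (q + s)) \<in> rc_paths T"
  unfolding rc_paths_def limitin_def
proof (intro CollectI allI impI conjI)
  fix t :: real assume t: "0 \<le> t"
  show "w (q + t) \<in> topspace T" using assms t by (intro rc_paths_topspace) auto
  fix U assume "openin T U \<and> w (q + t) \<in> U"
  then have "eventually (\<lambda>s. w s \<in> U) (at_right (q + t))" using rc_pathsD[OF assms(1)] t assms(2) by auto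
  then show "eventually (\<lambda>s. w (q + s) \<in> U) (at_right t)"
    by (simp add: eventually_at_right_to_0[of _ "q + t"] eventually_at_right_to_0[of _ t] add_ac)
qed

end

section \<open>Functionals of the Markov process\<close>

text \<open>The iterated kernels of \<open>fdd\<close> with a terminal weight in place of
  \<open>1\<close>. In a Doob transform the intermediate densities cancel and one factor remains at
  the last time, so its \<open>fdd\<close> becomes a \<open>nest\<close> of untransformed
  kernels.\<close>

fun nest :: "(real \<Rightarrow> ('s \<Rightarrow> ennreal) \<Rightarrow> 's \<Rightarrow> ennreal) \<Rightarrow> (real \<times> 's set) list \<Rightarrow> ('s \<Rightarrow> ennreal) \<Rightarrow> 's \<Rightarrow> ennreal" where
  "nest Q [] g x = g x"
| "nest Q ((s, B) # l) g x = Q s (\<lambda>y. indicator B y * nest Q l g y) x"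

definition valid_list :: "'s topology \<Rightarrow> (real \<times> 's set) list \<Rightarrow> bool" where
  "valid_list T l \<longleftrightarrow> (\<forall>(s, B)\<in>set l. 0 \<le> s \<and> B \<in> sets (borel_of T))"

lemma valid_list_simps [simp]:
  "valid_list T []"
  "valid_list T ((s, B) # l) \<longleftrightarrow> 0 \<le> s \<and> B \<in> sets (borel_of T) \<and> valid_list T l"
  by (auto simp: valid_list_def)

definition total :: "(real \<times> 's set) list \<Rightarrow> real" where
  "total l = (\<Sum>(s, B)\<leftarrow>l. s)"

lemma total_simps [simp]: "total [] = 0" "total ((s, B) # l) = s + total l"
  by (auto simp: total_def)

lemma total_nonneg: "valid_list T l \<Longrightarrow> 0 \<le> total l"
  by (induct l) auto

text \<open>Lists carry time increments, so a constraint at a given time has to split the increment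
  into which it falls; beyond the end it is appended. Constraints collected in any order thus become
  one list.\<close>

fun insert_visit :: "real \<Rightarrow> 's set \<Rightarrow> (real \<times> 's set) list \<Rightarrow> (real \<times> 's set) list" where
  "insert_visit t B [] = [(t, B)]"
| "insert_visit t B ((s, C) # l) =
     (if t \<le> s then (t, B) # (s - t, C) # l else (s, C) # insert_visit (t - s) B l)"

lemma visits_insert: "visits z r (insert_visit t B l) \<longleftrightarrow> z (r + t) \<in> Some ` B \<and> visits z r l"
  by (induct t B l arbitrary: r rule: insert_visit.induct) (auto simp: algebra_simps)

lemma valid_insert: "valid_list T l \<Longrightarrow> 0 \<le> t \<Longrightarrow> B \<in> sets (borel_of T) \<Longrightarrow> valid_list T (insert_visit t B l)"
  by (induct t B l rule: insert_visit.induct) auto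

lemma total_insert: "0 \<le> t \<Longrightarrow> t \<le> total l \<Longrightarrow> total (insert_visit t B l) = total l"
  by (induct t B l rule: insert_visit.induct) auto

lemma visits_cong:
  "valid_list T l \<Longrightarrow> (\<And>s. r \<le> s \<Longrightarrow> s \<le> r + total l \<Longrightarrow> z s = z' s) \<Longrightarrow> visits z r l = visits z' r l"
proof (induct l arbitrary: r)
  case (Cons a l)
  obtain s B where a: "a = (s, B)" by (cases a)
  have v: "valid_list T l" "0 \<le> s" using Cons.prems(1) a by auto
  have "z (r + s) = z' (r + s)"
    using Cons.prems(2)[of "r + s"] total_nonneg[OF v(1)] v a by auto
  moreover have "visits z (r + s) l = visits z' (r + s) l"
    using Cons.prems(2) v a by (intro Cons.hyps) auto
  ultimately show ?case by (simp add: a)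
qed simp

lemma visits_shift: "visits z (r + t) l = visits (\<lambda>s. z (t + s)) r l"
proof (induct l arbitrary: r)
  case (Cons a l)
  obtain s B where a: "a = (s, B)" by (cases a)
  have "visits z (r + t + s) l = visits (\<lambda>s. z (t + s)) (r + s) l"
    using Cons[of "r + s"] by (simp add: ac_simps)
  then show ?case by (simp add: a ac_simps)
qed simp

text \<open>The two cases of \<open>Q\<close> are arbitrary paths, and paths that are constant after time \<open>q\<close>; for the
  latter, constraints ending at time \<open>q\<close> suffice.\<close>

lemma path_law_le:
  assumes fin: "finite_measure m" "finite_measure n"
    and f: "f \<in> measurable m (path_algebra T)" and g: "g \<in> measurable n (path_algebra T)"
    and Q: "Q = UNIV \<and> c = (\<lambda>t. t) \<or> Q = {q} \<and> c = (\<lambda>t. min t q) \<and> 0 \<le> q"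
    and fc: "\<And>x t. 0 \<le> t \<Longrightarrow> f x t = f x (c t)" and gc: "\<And>x t. 0 \<le> t \<Longrightarrow> g x t = g x (c t)"
    and le: "\<And>l. valid_list T l \<Longrightarrow> total l \<in> Q \<Longrightarrow>
      emeasure m {x\<in>space m. visits (\<lambda>t. Some (f x t)) 0 l} \<le> emeasure n {x\<in>space n. visits (\<lambda>t. Some (g x t)) 0 l}"
    and V: "V \<in> sets (path_algebra T)"
  shows "emeasure m {x\<in>space m. f x \<in> V} \<le> emeasure n {x\<in>space n. g x \<in> V}"
proof -
  let ?PA = "path_algebra T" let ?RC = "rc_paths T"
  let ?G = "{{w\<in>?RC. w t \<in> B} | t B. 0 \<le> t \<and> B \<in> sets (borel_of T)}"
  have fr: "f x \<in> ?RC" if "x \<in> space m" for x using measurable_space[OF f that] by simp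
  have gr: "g x \<in> ?RC" if "x \<in> space n" for x using measurable_space[OF g that] by simp
  have c0: "0 \<le> t \<Longrightarrow> 0 \<le> c t" for t using Q by auto
  have ex: "\<exists>l. valid_list T l \<and> total l \<in> Q \<and>
      (\<forall>w. (\<forall>t\<ge>0. w t = w (c t)) \<longrightarrow> w \<in> ?RC \<longrightarrow> (w \<in> \<Inter>J \<longleftrightarrow> visits (\<lambda>t. Some (w t)) 0 l))"
    if "finite J" "J \<subseteq> ?G" for J
    using that
  proof (induct J rule: finite_induct)
    case empty
    have E: "topspace T \<in> sets (borel_of T)" using sets.top[of "borel_of T"] by simp
    from Q show ?case
    proof (elim disjE conjE)
      assume "Q = UNIV"
      then show ?thesis by (intro exI[of _ "[]"]) simp
    next
      \<comment> \<open>The empty list has total \<open>0\<close> instead of \<open>q\<close>; a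
        void constraint at time \<open>q\<close> repairs this.\<close>
      assume "Q = {q}" "0 \<le> q"
      show ?thesis
      proof (intro exI[of _ "[(q, topspace T)]"] conjI allI impI)
        show "valid_list T [(q, topspace T)]" using E \<open>0 \<le> q\<close> by simp
        show "total [(q, topspace T)] \<in> Q" using \<open>Q = {q}\<close> by simp
        fix w assume "w \<in> ?RC"
        then show "w \<in> \<Inter>{} \<longleftrightarrow> visits (\<lambda>t. Some (w t)) 0 [(q, topspace T)]"
          using rc_paths_topspace[OF \<open>w \<in> ?RC\<close> \<open>0 \<le> q\<close>] by simp
      qed
    qed
  next
    case (insert A J)
    then obtain l where l: "valid_list T l" "total l \<in> Q"
      "\<And>w. (\<forall>t\<ge>0. w t = w (c t)) \<Longrightarrow> w \<in> ?RC \<Longrightarrow> w \<in> \<Inter>J \<longleftrightarrow> visits (\<lambda>t. Some (w t)) 0 l" by auto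
    from insert obtain t B where A: "A = {w\<in>?RC. w t \<in> B}" "0 \<le> t" "B \<in> sets (borel_of T)" by auto
    \<comment> \<open>For a path that is constant after \<open>q\<close>, a constraint after
      \<open>q\<close> is one at \<open>q\<close>; it is inserted at \<open>c t\<close>, so the
      total of the list does not grow.\<close>
    have "total (insert_visit (c t) B l) \<in> Q"
      using Q l(2) total_insert[of "c t" l B] c0[OF A(2)] by auto
    moreover have "valid_list T (insert_visit (c t) B l)" using l A c0 by (intro valid_insert) auto
    moreover have "w \<in> \<Inter>(insert A J) \<longleftrightarrow> visits (\<lambda>t. Some (w t)) 0 (insert_visit (c t) B l)"
      if "\<forall>t\<ge>0. w t = w (c t)" "w \<in> ?RC" for w
    proof -
      have "w t = w (c t)" using that A by auto
      then show ?thesis using l(3)[OF that] A that by (auto simp: visits_insert)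
    qed
    ultimately show ?case by blast
  qed
  have "emeasure (distr m ?PA f) V \<le> emeasure (distr n ?PA g) V"
  proof (rule measure_le_generated[where \<Omega>="?RC" and G="?G"])
    show "finite_measure (distr m ?PA f)" by (rule finite_measure.finite_measure_distr[OF fin(1) f])
    show "finite_measure (distr n ?PA g)" by (rule finite_measure.finite_measure_distr[OF fin(2) g])
    show "?RC - A \<in> ?G" if "A \<in> ?G" for A
    proof -
      from that obtain t B where A: "A = {w\<in>?RC. w t \<in> B}" "0 \<le> t" "B \<in> sets (borel_of T)" by auto
      have "?RC - A = {w\<in>?RC. w t \<in> topspace T - B}" using A rc_paths_topspace by auto
      moreover have "topspace T - B \<in> sets (borel_of T)" using sets.compl_sets[OF A(3)] by simp
      ultimately show ?thesis using A(2) by blast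
    qed
    fix J assume J: "finite J" "J \<subseteq> ?G"
    from ex[OF J] obtain l where l: "valid_list T l" "total l \<in> Q"
      "\<And>w. (\<forall>t\<ge>0. w t = w (c t)) \<Longrightarrow> w \<in> ?RC \<Longrightarrow> w \<in> \<Inter>J \<longleftrightarrow> visits (\<lambda>t. Some (w t)) 0 l" by auto
    have sJ: "?RC \<inter> \<Inter>J \<in> sets ?PA"
    proof (cases "J = {}")
      case True
      then show ?thesis using sets.top[of ?PA] by simp
    next
      case False
      have "J \<subseteq> sets ?PA" using J by (auto simp: sets_path_algebra)
      then have "\<Inter>J \<in> sets ?PA" using J(1) False sets.finite_INT[of J "\<lambda>x. x" ?PA] by auto
      moreover have "?RC \<inter> \<Inter>J = \<Inter>J" using False J by auto
      ultimately show ?thesis by simp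
    qed
    have "f -` (?RC \<inter> \<Inter>J) \<inter> space m = {x\<in>space m. visits (\<lambda>t. Some (f x t)) 0 l}"
      using l(3) fc fr by blast
    moreover have "g -` (?RC \<inter> \<Inter>J) \<inter> space n = {x\<in>space n. visits (\<lambda>t. Some (g x t)) 0 l}"
      using l(3) gc gr by blast
    ultimately show "emeasure (distr m ?PA f) (?RC \<inter> \<Inter>J) \<le> emeasure (distr n ?PA g) (?RC \<inter> \<Inter>J)"
      using le[OF l(1,2)] by (simp add: emeasure_distr[OF f sJ] emeasure_distr[OF g sJ])
  qed (auto simp: sets_path_algebra)
  moreover have "f -` V \<inter> space m = {x\<in>space m. f x \<in> V}" "g -` V \<inter> space n = {x\<in>space n. g x \<in> V}"
    by auto
  ultimately show ?thesis using emeasure_distr[OF f V] emeasure_distr[OF g V] by simp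
qed

lemma path_law_eq:
  assumes fin: "finite_measure m" "finite_measure n"
    and f: "f \<in> measurable m (path_algebra T)" and g: "g \<in> measurable n (path_algebra T)"
    and Q: "Q = UNIV \<and> c = (\<lambda>t. t) \<or> Q = {q} \<and> c = (\<lambda>t. min t q) \<and> 0 \<le> q"
    and fc: "\<And>x t. 0 \<le> t \<Longrightarrow> f x t = f x (c t)" and gc: "\<And>x t. 0 \<le> t \<Longrightarrow> g x t = g x (c t)"
    and eq: "\<And>l. valid_list T l \<Longrightarrow> total l \<in> Q \<Longrightarrow>
      emeasure m {x\<in>space m. visits (\<lambda>t. Some (f x t)) 0 l} = emeasure n {x\<in>space n. visits (\<lambda>t. Some (g x t)) 0 l}"
  shows "distr m (path_algebra T) f = distr n (path_algebra T) g"
proof (rule measure_eqI)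
  fix V assume "V \<in> sets (distr m (path_algebra T) f)"
  then have V: "V \<in> sets (path_algebra T)" by simp
  have "emeasure m {x\<in>space m. f x \<in> V} = emeasure n {x\<in>space n. g x \<in> V}"
    using path_law_le[OF fin f g Q fc gc _ V] path_law_le[OF fin(2,1) g f Q gc fc _ V] eq by (intro antisym) auto
  moreover have "f -` V \<inter> space m = {x\<in>space m. f x \<in> V}" "g -` V \<inter> space n = {x\<in>space n. g x \<in> V}" by auto
  ultimately show "emeasure (distr m (path_algebra T) f) V = emeasure (distr n (path_algebra T) g) V"
    using f g V by (simp add: emeasure_distr)
qed simp

lemma visits_path_sets:
  assumes "valid_list T l" "0 \<le> r"
  shows "{w\<in>rc_paths T. visits (\<lambda>t. Some (w t)) r l} \<in> sets (path_algebra T)"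
  using assms
proof (induct l arbitrary: r)
  case Nil
  then show ?case using sets.top[of "path_algebra T"] by simp
next
  case (Cons a l)
  obtain s B where a: "a = (s, B)" by (cases a)
  have "{w\<in>rc_paths T. visits (\<lambda>t. Some (w t)) r (a # l)} =
    {w\<in>space (path_algebra T). w (r + s) \<in> B} \<inter> {w\<in>rc_paths T. visits (\<lambda>t. Some (w t)) (r + s) l}"
    by (auto simp: a)
  also have "\<dots> \<in> sets (path_algebra T)"
    using Cons a by (intro sets.Int measurable_borel_ofD[OF path_eval]) auto
  finally show ?case .
qed

section \<open>The Markov property of \<open>X\<close> for path functionals\<close>

locale std_process =
  fixes S :: "'a::euclidean_space set" and M :: "'w measure" and \<F> :: "ennreal \<Rightarrow> 'w measure"
    and P :: "'a option \<Rightarrow> 'w measure" and X :: "real \<Rightarrow> 'w \<Rightarrow> 'a option"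
  assumes lc: "locally compact S" and std: "standard_process S M \<F> P X"
begin

abbreviation "T \<equiv> compactified S"
abbreviation "PA \<equiv> path_algebra T"
abbreviation "BE \<equiv> borel_of T"
abbreviation "U0 \<equiv> interior_pts (points S)"
abbreviation (input) path :: "'w \<Rightarrow> real \<Rightarrow> 'a option" where "path om \<equiv> (\<lambda>s. X s om)"

sublocale exhaustible T
  by unfold_locales (rule compactified_exhausts[OF lc])

lemma filt: "filtration (space M) \<F>"
  using std unfolding standard_process_def by (elim conjE)

lemma space_F [simp]: "space (\<F> t) = space M"
  using filt by (simp add: filtration.space_F)

lemma F_mono: "s \<le> t \<Longrightarrow> A \<in> sets (\<F> s) \<Longrightarrow> A \<in> sets (\<F> t)"
  using filtration.sets_F_mono[OF filt] by auto

lemma F_sets: "A \<in> sets (\<F> t) \<Longrightarrow> A \<in> sets M"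
proof -
  have "\<forall>t. sets (\<F> t) \<subseteq> sets M" using std unfolding standard_process_def by (elim conjE)
  then show "A \<in> sets (\<F> t) \<Longrightarrow> A \<in> sets M" by auto
qed

lemma F_right: "t < \<infinity> \<Longrightarrow> sets (\<F> t) = (\<Inter>s\<in>{t<..}. sets (\<F> s))"
proof -
  have "\<forall>t<\<infinity>. sets (\<F> t) = (\<Inter>s\<in>{t<..}. sets (\<F> s))" using std unfolding standard_process_def by (elim conjE)
  then show "t < \<infinity> \<Longrightarrow> sets (\<F> t) = (\<Inter>s\<in>{t<..}. sets (\<F> s))" by auto
qed

lemma X_F: "0 \<le> t \<Longrightarrow> X t \<in> measurable (\<F> (ennreal t)) BE"
proof -
  have "\<forall>t\<ge>0. X t \<in> measurable (\<F> (ennreal t)) BE" using std unfolding standard_process_def by (elim conjE)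
  then show "0 \<le> t \<Longrightarrow> X t \<in> measurable (\<F> (ennreal t)) BE" by auto
qed

lemma P_facts: assumes "x \<in> points S"
  shows P_prob: "prob_space (P x)" and P_sets [simp]: "sets (P x) = sets M" and P_start: "AE om in P x. X 0 om = x"
    and P_space [simp]: "space (P x) = space M"
proof -
  have "\<forall>x\<in>points S. prob_space (P x) \<and> sets (P x) = sets M \<and> (AE om in P x. X 0 om = x)"
    using std unfolding standard_process_def by (elim conjE)
  then show "prob_space (P x)" "sets (P x) = sets M" "AE om in P x. X 0 om = x" using assms by auto
  then show "space (P x) = space M" using sets_eq_imp_space_eq by blast
qed

lemma P_kernel: "0 \<le> t \<Longrightarrow> B \<in> sets BE \<Longrightarrow> (\<lambda>x. emeasure (P x) {om\<in>space M. X t om \<in> B}) \<in> borel_measurable BE"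
proof -
  have "\<forall>t\<ge>0. \<forall>B\<in>sets BE. (\<lambda>x. emeasure (P x) {om\<in>space M. X t om \<in> B}) \<in> borel_measurable BE"
    using std unfolding standard_process_def by (elim conjE)
  then show "0 \<le> t \<Longrightarrow> B \<in> sets BE \<Longrightarrow> (\<lambda>x. emeasure (P x) {om\<in>space M. X t om \<in> B}) \<in> borel_measurable BE" by auto
qed

lemma path_rc: "om \<in> space M \<Longrightarrow> path om \<in> rc_paths T"
proof -
  have "\<forall>om\<in>space M. \<forall>t\<ge>0. limitin T (\<lambda>s. X s om) (X t om) (at_right t)"
    using std unfolding standard_process_def by (elim conjE)
  then show "om \<in> space M \<Longrightarrow> path om \<in> rc_paths T" by (auto simp: rc_paths_def)
qed

lemma smk: "strong_markov T M \<F> P X"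
  using std unfolding standard_process_def by (elim conjE)

lemma qlc: "quasi_left_continuous T \<F> P X (lifetime S X)"
  using std unfolding standard_process_def by (elim conjE)

lemma absorbed: "absorbed_at_boundary S P X"
  using std unfolding standard_process_def by (elim conjE)

lemma X_M: "0 \<le> t \<Longrightarrow> X t \<in> measurable M BE"
proof -
  assume t: "0 \<le> t"
  show ?thesis
  proof (rule measurableI)
    show "X t -` A \<inter> space M \<in> sets M" if "A \<in> sets BE" for A
      using F_sets[OF measurable_sets[OF X_F[OF t] that]] by (simp only: space_F)
    show "X t om \<in> space BE" if "om \<in> space M" for om
      using that by (intro measurable_space[OF X_F[OF t]]) (simp only: space_F)
  qed
qed

lemma X_space: "0 \<le> t \<Longrightarrow> om \<in> space M \<Longrightarrow> X t om \<in> points S"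
  using measurable_space[OF X_M] by simp

lemma X_P: "x \<in> points S \<Longrightarrow> 0 \<le> t \<Longrightarrow> X t \<in> measurable (P x) BE"
  using X_M by (simp add: measurable_def)

lemma path_M: "path \<in> measurable M PA"
  by (rule path_measurableI) (auto simp: path_rc X_M)

lemma path_P: "x \<in> points S \<Longrightarrow> path \<in> measurable (P x) PA"
  using path_M by (simp add: measurable_def)

lemma spath_F:
  assumes "0 \<le> u"
  shows "(\<lambda>om s. X (min s u) om) \<in> measurable (\<F> (ennreal u)) PA"
proof (rule path_measurableI)
  show "(\<lambda>s. X (min s u) om) \<in> rc_paths T" if "om \<in> space (\<F> (ennreal u))" for om
    using stop_rc_paths[OF path_rc assms] that by simp
  show "(\<lambda>om. X (min t u) om) \<in> measurable (\<F> (ennreal u)) BE" if "0 \<le> t" for t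
  proof (rule measurableI)
    have F: "X (min t u) \<in> measurable (\<F> (ennreal (min t u))) BE" using that assms by (intro X_F) auto
    show "X (min t u) -` A \<inter> space (\<F> (ennreal u)) \<in> sets (\<F> (ennreal u))" if "A \<in> sets BE" for A
      using F_mono[OF _ measurable_sets[OF F that], of "ennreal u"] by (simp add: ennreal_leI)
    show "X (min t u) om \<in> space BE" if "om \<in> space (\<F> (ennreal u))" for om
      using that by (intro measurable_space[OF F]) (simp only: space_F)
  qed
qed

lemma spath_M:
  assumes "0 \<le> u"
  shows "(\<lambda>om s. X (min s u) om) \<in> measurable M PA"
  using stop_rc_paths[OF path_rc assms] assms by (intro path_measurableI X_M) auto

lemma spath_P: "x \<in> points S \<Longrightarrow> 0 \<le> u \<Longrightarrow> (\<lambda>om s. X (min s u) om) \<in> measurable (P x) PA"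
  using spath_M by (simp add: measurable_def)

definition Kx :: "real \<Rightarrow> ('a option \<Rightarrow> ennreal) \<Rightarrow> 'a option \<Rightarrow> ennreal" where
  "Kx t f x = (\<integral>\<^sup>+om. f (X t om) \<partial>P x)"

lemma Kx_measurable:
  assumes t: "0 \<le> t" and f: "f \<in> borel_measurable BE"
  shows "Kx t f \<in> borel_measurable BE"
  using f
proof induct
  case (cong f g)
  have "Kx t f x = Kx t g x" if "x \<in> space BE" for x
    unfolding Kx_def using cong(3) X_space t that by (intro nn_integral_cong) auto
  then show ?case using cong(4) measurable_cong[of BE "Kx t f" "Kx t g" borel] by simp
next
  case (set A)
  have "Kx t (indicator A) x = emeasure (P x) {om\<in>space M. X t om \<in> A}" if "x \<in> space BE" for x
  proof -
    have "Kx t (indicator A) x = (\<integral>\<^sup>+om. indicator {om\<in>space M. X t om \<in> A} om \<partial>P x)"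
      unfolding Kx_def using that by (intro nn_integral_cong) (auto simp: indicator_def)
    then show ?thesis using measurable_borel_ofD[OF X_P[of x t] set] that t by simp
  qed
  then show ?case using P_kernel[OF t set]
      measurable_cong[of BE "Kx t (indicator A)" "\<lambda>x. emeasure (P x) {om\<in>space M. X t om \<in> A}" borel] by simp
next
  case (mult u c)
  have "Kx t (\<lambda>x. c * u x) x = c * Kx t u x" if "x \<in> space BE" for x
    unfolding Kx_def using mult(2) measurable_compose[OF X_P[of x t]] that t by (intro nn_integral_cmult) auto
  then show ?case using mult(4) measurable_cong[of BE "Kx t (\<lambda>x. c * u x)" "\<lambda>x. c * Kx t u x" borel] by simp
next
  case (add u v)
  have "Kx t (\<lambda>x. v x + u x) x = Kx t v x + Kx t u x" if "x \<in> space BE" for x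
    unfolding Kx_def using add measurable_compose[OF X_P[of x t]] that t by (intro nn_integral_add) auto
  then show ?case using add(3,7) measurable_cong[of BE "Kx t (\<lambda>x. v x + u x)" "\<lambda>x. Kx t v x + Kx t u x" borel] by simp
next
  case (seq U)
  have "Kx t (Sup (range U)) x = (SUP i. Kx t (U i) x)" if "x \<in> space BE" for x
    unfolding Kx_def SUP_apply
  proof (rule nn_integral_monotone_convergence_SUP)
    show "incseq (\<lambda>i om. U i (X t om))" using seq(4) by (simp add: incseq_def le_fun_def)
    show "(\<lambda>om. U i (X t om)) \<in> borel_measurable (P x)" for i
      using that by (intro measurable_compose[OF X_P[OF _ t] seq(1)]) simp
  qed
  moreover have "(\<lambda>x. SUP i. Kx t (U i) x) \<in> borel_measurable BE" using seq(3) by measurable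
  ultimately show ?case using measurable_cong[of BE "Kx t (Sup (range U))" "\<lambda>x. SUP i. Kx t (U i) x" borel]
    by (simp del: Sup_apply SUP_apply)
qed

text \<open>The strong Markov property at the constant time \<open>t\<close>, extended from
  indicators to nonnegative Borel functions by measurable induction.\<close>

lemma markov_single:
  assumes x: "x \<in> points S" and t: "0 \<le> t" and s: "0 \<le> s" and A: "A \<in> sets (\<F> (ennreal t))"
    and g: "g \<in> borel_measurable BE"
  shows "(\<integral>\<^sup>+om. indicator A om * g (X (t + s) om) \<partial>P x) = (\<integral>\<^sup>+om. indicator A om * Kx s g (X t om) \<partial>P x)"
proof -
  have AM: "A \<in> sets (P x)" using F_sets[OF A] x by simp
  have A0: "A \<subseteq> space M" using sets.sets_into_space[OF F_sets[OF A]] .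
  have Xts: "X (t + s) \<in> measurable (P x) BE" using X_P[OF x] s t by auto
  have KX: "(\<lambda>om. Kx s g (X t om)) \<in> borel_measurable (P x)" if "g \<in> borel_measurable BE" for g
    using measurable_compose[OF X_P[OF x t] Kx_measurable[OF s that]] .
  have gX: "(\<lambda>om. g (X (t + s) om)) \<in> borel_measurable (P x)" if "g \<in> borel_measurable BE" for g
    using measurable_compose[OF Xts that] .
  show ?thesis using g
  proof induct
    case (cong f g)
    have "(\<integral>\<^sup>+om. indicator A om * f (X (t + s) om) \<partial>P x) = (\<integral>\<^sup>+om. indicator A om * g (X (t + s) om) \<partial>P x)"
      using cong(3) X_space s t x by (intro nn_integral_cong) auto
    moreover have "Kx s f y = Kx s g y" if "y \<in> points S" for y
      unfolding Kx_def using cong(3) X_space s that by (intro nn_integral_cong) auto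
    then have "(\<integral>\<^sup>+om. indicator A om * Kx s f (X t om) \<partial>P x) = (\<integral>\<^sup>+om. indicator A om * Kx s g (X t om) \<partial>P x)"
      using X_space t x by (intro nn_integral_cong) auto
    ultimately show ?case using cong(4) by simp
  next
    case (set B)
    \<comment> \<open>For a constant stopping time, the events prior to it include those of the
      filtration at that constant.\<close>
    have pre: "A \<in> sets (filtration.pre_sigma (space M) \<F> (\<lambda>_. ennreal t))"
      unfolding filtration.pre_sigma_def[OF filt]
    proof (rule in_measure_of)
      show "{A. \<forall>ta. {om \<in> A. ennreal t \<le> ta} \<in> sets (\<F> ta)} \<subseteq> Pow (space M)"
      proof
        fix B assume "B \<in> {A. \<forall>ta. {om \<in> A. ennreal t \<le> ta} \<in> sets (\<F> ta)}"
        then have "{om\<in>B. ennreal t \<le> ennreal t} \<in> sets (\<F> (ennreal t))" by blast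
        then show "B \<in> Pow (space M)" using sets.sets_into_space by fastforce
      qed
      show "A \<in> {A. \<forall>ta. {om \<in> A. ennreal t \<le> ta} \<in> sets (\<F> ta)}"
      proof (intro CollectI allI)
        fix ta show "{om \<in> A. ennreal t \<le> ta} \<in> sets (\<F> ta)"
          using F_mono[OF _ A, of ta] by (cases "ennreal t \<le> ta") auto
      qed
    qed
    have "emeasure (P x) {om\<in>A. ennreal t < \<infinity> \<and> X (enn2real (ennreal t) + s) om \<in> B} =
       (\<integral>\<^sup>+om. indicator {om\<in>A. ennreal t < \<infinity>} om *
           emeasure (P (X (enn2real (ennreal t)) om)) {om'\<in>space M. X s om' \<in> B} \<partial>P x)"
      using smk[unfolded strong_markov_def, rule_format, OF x stopping_time_const pre s set] .
    then have eq: "emeasure (P x) {om\<in>A. X (t + s) om \<in> B} =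
       (\<integral>\<^sup>+om. indicator A om * emeasure (P (X t om)) {om'\<in>space M. X s om' \<in> B} \<partial>P x)"
      using t by simp
    have K: "Kx s (indicator B) y = emeasure (P y) {om\<in>space M. X s om \<in> B}" if "y \<in> points S" for y
    proof -
      have "Kx s (indicator B) y = (\<integral>\<^sup>+om. indicator {om\<in>space M. X s om \<in> B} om \<partial>P y)"
        unfolding Kx_def using that by (intro nn_integral_cong) (auto simp: indicator_def)
      then show ?thesis using measurable_borel_ofD[OF X_P[of y s] set] that s by simp
    qed
    have "{om\<in>A. X (t + s) om \<in> B} = A \<inter> {om\<in>space (P x). X (t + s) om \<in> B}" using A0 x by auto
    then have ms: "{om\<in>A. X (t + s) om \<in> B} \<in> sets (P x)"
      using measurable_borel_ofD[OF Xts set] AM by auto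
    have "(\<integral>\<^sup>+om. indicator A om * indicator B (X (t + s) om) \<partial>P x) = (\<integral>\<^sup>+om. indicator {om\<in>A. X (t + s) om \<in> B} om \<partial>P x)"
      by (intro nn_integral_cong) (auto simp: indicator_def)
    also have "\<dots> = emeasure (P x) {om\<in>A. X (t + s) om \<in> B}" using ms by simp
    also have "\<dots> = (\<integral>\<^sup>+om. indicator A om * Kx s (indicator B) (X t om) \<partial>P x)"
      unfolding eq using K X_space t x by (intro nn_integral_cong) auto
    finally show ?case .
  next
    case (mult u c)
    have "Kx s (\<lambda>x. c * u x) y = c * Kx s u y" if "y \<in> points S" for y
      unfolding Kx_def using mult(2) measurable_compose[OF X_P[OF that s]] by (intro nn_integral_cmult) auto
    then have "(\<integral>\<^sup>+om. indicator A om * Kx s (\<lambda>x. c * u x) (X t om) \<partial>P x) = (\<integral>\<^sup>+om. c * (indicator A om * Kx s u (X t om)) \<partial>P x)"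
      using X_space t x by (intro nn_integral_cong) (auto simp: algebra_simps)
    also have "\<dots> = c * (\<integral>\<^sup>+om. indicator A om * Kx s u (X t om) \<partial>P x)"
      using AM KX[OF mult(2)] by (intro nn_integral_cmult) auto
    also have "\<dots> = c * (\<integral>\<^sup>+om. indicator A om * u (X (t + s) om) \<partial>P x)" using mult(4) by simp
    also have "\<dots> = (\<integral>\<^sup>+om. c * (indicator A om * u (X (t + s) om)) \<partial>P x)"
      using AM gX[OF mult(2)] by (intro nn_integral_cmult[symmetric]) auto
    finally show ?case by (simp add: mult.left_commute)
  next
    case (add u v)
    have "Kx s (\<lambda>x. v x + u x) y = Kx s v y + Kx s u y" if "y \<in> points S" for y
      unfolding Kx_def using add(1,4) measurable_compose[OF X_P[OF that s]] by (intro nn_integral_add) auto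
    then have "(\<integral>\<^sup>+om. indicator A om * Kx s (\<lambda>x. v x + u x) (X t om) \<partial>P x) =
        (\<integral>\<^sup>+om. indicator A om * Kx s v (X t om) + indicator A om * Kx s u (X t om) \<partial>P x)"
      using X_space t x by (intro nn_integral_cong) (auto simp: algebra_simps)
    also have "\<dots> = (\<integral>\<^sup>+om. indicator A om * Kx s v (X t om) \<partial>P x) + (\<integral>\<^sup>+om. indicator A om * Kx s u (X t om) \<partial>P x)"
      using AM KX[OF add(1)] KX[OF add(4)] by (intro nn_integral_add) auto
    also have "\<dots> = (\<integral>\<^sup>+om. indicator A om * v (X (t + s) om) \<partial>P x) + (\<integral>\<^sup>+om. indicator A om * u (X (t + s) om) \<partial>P x)"
      using add(3,7) by simp
    also have "\<dots> = (\<integral>\<^sup>+om. indicator A om * v (X (t + s) om) + indicator A om * u (X (t + s) om) \<partial>P x)"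
      using AM gX[OF add(1)] gX[OF add(4)] by (intro nn_integral_add[symmetric]) auto
    finally show ?case unfolding distrib_left by (rule sym)
  next
    case (seq U)
    have "Kx s (Sup (range U)) y = (SUP i. Kx s (U i) y)" if "y \<in> points S" for y
      unfolding Kx_def SUP_apply
    proof (rule nn_integral_monotone_convergence_SUP)
      show "incseq (\<lambda>i om. U i (X s om))" using seq(4) by (simp add: incseq_def le_fun_def)
      show "(\<lambda>om. U i (X s om)) \<in> borel_measurable (P y)" for i
        by (rule measurable_compose[OF X_P[OF that s] seq(1)])
    qed
    then have "(\<integral>\<^sup>+om. indicator A om * Kx s (Sup (range U)) (X t om) \<partial>P x) = (\<integral>\<^sup>+om. (SUP i. indicator A om * Kx s (U i) (X t om)) \<partial>P x)"
      using X_space t x by (intro nn_integral_cong) (auto simp: SUP_mult_left_ennreal)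
    also have "\<dots> = (SUP i. \<integral>\<^sup>+om. indicator A om * Kx s (U i) (X t om) \<partial>P x)"
    proof (rule nn_integral_monotone_convergence_SUP)
      show "incseq (\<lambda>i om. indicator A om * Kx s (U i) (X t om))"
        using seq(4) unfolding Kx_def by (auto simp: incseq_def le_fun_def intro!: mult_left_mono nn_integral_mono)
      show "(\<lambda>om. indicator A om * Kx s (U i) (X t om)) \<in> borel_measurable (P x)" for i
        using AM KX[OF seq(1)] by auto
    qed
    also have "\<dots> = (SUP i. \<integral>\<^sup>+om. indicator A om * U i (X (t + s) om) \<partial>P x)" using seq(3) by simp
    also have "\<dots> = (\<integral>\<^sup>+om. (SUP i. indicator A om * U i (X (t + s) om)) \<partial>P x)"
    proof (rule nn_integral_monotone_convergence_SUP[symmetric])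
      show "incseq (\<lambda>i om. indicator A om * U i (X (t + s) om))"
        using seq(4) by (auto simp: incseq_def le_fun_def intro!: mult_left_mono)
      show "(\<lambda>om. indicator A om * U i (X (t + s) om)) \<in> borel_measurable (P x)" for i
        using AM gX[OF seq(1)] by auto
    qed
    also have "\<dots> = (\<integral>\<^sup>+om. indicator A om * (Sup (range U)) (X (t + s) om) \<partial>P x)"
      unfolding SUP_apply by (simp add: SUP_mult_left_ennreal)
    finally show ?case by (rule sym)
  qed
qed

lemma nest_Kx_measurable:
  "valid_list T l \<Longrightarrow> g \<in> borel_measurable BE \<Longrightarrow> nest Kx l g \<in> borel_measurable BE"
proof (induct l)
  case (Cons a l)
  obtain s B where a: "a = (s, B)" by (cases a)
  have "(\<lambda>y. indicator B y * nest Kx l g y) \<in> borel_measurable BE"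
    using Cons a by (intro borel_measurable_times_ennreal borel_measurable_indicator) auto
  then have "Kx s (\<lambda>y. indicator B y * nest Kx l g y) \<in> borel_measurable BE"
    using Cons a by (intro Kx_measurable) auto
  moreover have "nest Kx (a # l) g = Kx s (\<lambda>y. indicator B y * nest Kx l g y)" by (auto simp: a)
  ultimately show ?case by simp
next
  case Nil
  moreover have "nest Kx [] g = g" by auto
  ultimately show ?case by simp
qed

text \<open>By induction on the list: the first visit is merged into the conditioning event, which
  then belongs to the filtration at the later time \<open>t + s\<close>.\<close>

lemma markov_nest:
  assumes x: "x \<in> points S" and g: "g \<in> borel_measurable BE" and l: "valid_list T l"
    and t: "0 \<le> t" and A: "A \<in> sets (\<F> (ennreal t))"
  shows "(\<integral>\<^sup>+om. indicator A om * (indicator {om. visits (\<lambda>s. Some (X s om)) t l} om * g (X (t + total l) om)) \<partial>P x)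
      = (\<integral>\<^sup>+om. indicator A om * nest Kx l g (X t om) \<partial>P x)"
  using l t A
proof (induct l arbitrary: t A)
  case (Cons a l)
  obtain s B where a: "a = (s, B)" by (cases a)
  have v: "0 \<le> s" "B \<in> sets BE" "valid_list T l" using Cons.prems a by auto
  let ?A = "A \<inter> {om\<in>space (\<F> (ennreal (t + s))). X (t + s) om \<in> B}"
  have A': "?A \<in> sets (\<F> (ennreal (t + s)))"
    using v Cons.prems measurable_borel_ofD[OF X_F v(2), of "t + s"] F_mono[of "ennreal t" "ennreal (t + s)" A]
    by (intro sets.Int) (auto intro: ennreal_leI)
  have A0: "A \<subseteq> space M" using sets.sets_into_space[OF F_sets[OF Cons.prems(3)]] .
  have "(\<integral>\<^sup>+om. indicator A om * (indicator {om. visits (\<lambda>s. Some (X s om)) t (a # l)} om * g (X (t + total (a # l)) om)) \<partial>P x)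
      = (\<integral>\<^sup>+om. indicator ?A om * (indicator {om. visits (\<lambda>s. Some (X s om)) (t + s) l} om * g (X ((t + s) + total l) om)) \<partial>P x)"
    using A0 by (intro nn_integral_cong) (auto simp: a indicator_def add.assoc)
  also have "\<dots> = (\<integral>\<^sup>+om. indicator ?A om * nest Kx l g (X (t + s) om) \<partial>P x)"
    using v Cons.prems A' by (intro Cons.hyps) auto
  also have "\<dots> = (\<integral>\<^sup>+om. indicator A om * (\<lambda>y. indicator B y * nest Kx l g y) (X (t + s) om) \<partial>P x)"
    using A0 by (intro nn_integral_cong) (auto simp: indicator_def)
  also have "\<dots> = (\<integral>\<^sup>+om. indicator A om * Kx s (\<lambda>y. indicator B y * nest Kx l g y) (X t om) \<partial>P x)"
    using v Cons.prems nest_Kx_measurable[OF v(3) g] by (intro markov_single[OF x]) auto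
  finally show ?case by (simp add: a)
qed simp

lemma visits_X_sets:
  assumes l: "valid_list T l" and t: "0 \<le> t"
  shows "{om\<in>space M. visits (\<lambda>s. Some (X s om)) t l} \<in> sets M"
proof -
  have "{om\<in>space M. visits (\<lambda>s. Some (X s om)) t l} = path -` {w\<in>rc_paths T. visits (\<lambda>t. Some (w t)) t l} \<inter> space M"
    using path_rc by auto
  then show ?thesis using measurable_sets[OF path_M visits_path_sets[OF l t]] by simp
qed

lemma nest_Kx_eq:
  assumes x: "x \<in> points S" and g: "g \<in> borel_measurable BE" and l: "valid_list T l"
  shows "nest Kx l g x = (\<integral>\<^sup>+om. indicator {om. visits (\<lambda>s. Some (X s om)) 0 l} om * g (X (total l) om) \<partial>P x)"
proof -
  interpret prob_space "P x" using x by (rule P_prob)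
  have "space M \<in> sets (\<F> (ennreal 0))" using sets.top[of "\<F> (ennreal 0)"] by simp
  from markov_nest[OF x g l order_refl this]
  have "(\<integral>\<^sup>+om. indicator (space M) om * (indicator {om. visits (\<lambda>s. Some (X s om)) 0 l} om * g (X (total l) om)) \<partial>P x)
      = (\<integral>\<^sup>+om. indicator (space M) om * nest Kx l g (X 0 om) \<partial>P x)" by simp
  moreover have "(\<integral>\<^sup>+om. indicator (space M) om * (indicator {om. visits (\<lambda>s. Some (X s om)) 0 l} om * g (X (total l) om)) \<partial>P x)
      = (\<integral>\<^sup>+om. indicator {om. visits (\<lambda>s. Some (X s om)) 0 l} om * g (X (total l) om) \<partial>P x)"
    using x by (intro nn_integral_cong) auto
  moreover have "(\<integral>\<^sup>+om. indicator (space M) om * nest Kx l g (X 0 om) \<partial>P x) = (\<integral>\<^sup>+om. nest Kx l g x \<partial>P x)"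
    using P_start[OF x] x by (intro nn_integral_cong_AE) (auto elim!: AE_mp)
  ultimately show ?thesis by (simp add: emeasure_space_1)
qed

definition Lx :: "'a option \<Rightarrow> (real \<Rightarrow> 'a option) measure" where
  "Lx y = distr (P y) PA path"

lemma Lx_prob: "y \<in> points S \<Longrightarrow> prob_space (Lx y)"
  unfolding Lx_def by (rule prob_space.prob_space_distr[OF P_prob path_P])

lemma sets_Lx [simp]: "sets (Lx y) = sets PA" and space_Lx [simp]: "space (Lx y) = rc_paths T"
  by (simp_all add: Lx_def)


text \<open>Finite-dimensional events generate the path sigma-algebra and are stable under
  intersection, and their probabilities are iterated kernels, measurable in the starting point. This
  makes mixtures of the laws \<open>Lx\<close> over \<open>X t\<close> available.\<close>

lemma Lx_measurable: "Lx \<in> measurable BE (prob_algebra PA)"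
proof (rule measurable_prob_algebra_generated)
  let ?G = "{{w\<in>rc_paths T. \<forall>t\<in>J. w t \<in> B t} | J B. finite J \<and> J \<subseteq> {0..} \<and> (\<forall>t. B t \<in> sets BE)}"
  have gen1: "{w\<in>rc_paths T. \<forall>t\<in>J. w t \<in> B t} \<in> sets PA" if "finite J" "J \<subseteq> {0..}" "\<forall>t. B t \<in> sets BE" for J B
  proof -
    have "{w\<in>space PA. \<forall>t\<in>J. w t \<in> B t} \<in> sets PA"
      using that by (intro sets.sets_Collect_finite_All measurable_borel_ofD[OF path_eval]) auto
    then show ?thesis by simp
  qed
  show "sets PA = sigma_sets (rc_paths T) ?G"
  proof
    show "sigma_sets (rc_paths T) ?G \<subseteq> sets PA"
      using gen1 sets.sigma_sets_subset[of ?G PA] by auto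
    show "sets PA \<subseteq> sigma_sets (rc_paths T) ?G"
      unfolding sets_path_algebra
    proof (rule sigma_sets_mono')
      show "{{w\<in>rc_paths T. w t \<in> B} | t B. 0 \<le> t \<and> B \<in> sets BE} \<subseteq> ?G"
      proof
        fix A assume "A \<in> {{w\<in>rc_paths T. w t \<in> B} | t B. 0 \<le> t \<and> B \<in> sets BE}"
        then obtain t B where "A = {w\<in>rc_paths T. w t \<in> B}" "0 \<le> t" "B \<in> sets BE" by auto
        then show "A \<in> ?G" by (intro CollectI exI[of _ "{t}"] exI[of _ "\<lambda>_. B"]) auto
      qed
    qed
  qed
  show "Int_stable ?G"
  proof (rule Int_stableI)
    fix A A' assume "A \<in> ?G" "A' \<in> ?G"
    then obtain J B J' B' where *: "A = {w\<in>rc_paths T. \<forall>t\<in>J. w t \<in> B t}" "finite J" "J \<subseteq> {0..}" "\<forall>t. B t \<in> sets BE"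
      "A' = {w\<in>rc_paths T. \<forall>t\<in>J'. w t \<in> B' t}" "finite J'" "J' \<subseteq> {0..}" "\<forall>t. B' t \<in> sets BE" by auto
    have "A \<inter> A' = {w\<in>rc_paths T. \<forall>t\<in>J \<union> J'. w t \<in> (if t \<in> J then if t \<in> J' then B t \<inter> B' t else B t else B' t)}"
      using * by (auto split: if_splits)
    then show "A \<inter> A' \<in> ?G" using *
      by (intro CollectI exI[of _ "J \<union> J'"] exI[of _ "\<lambda>t. if t \<in> J then if t \<in> J' then B t \<inter> B' t else B t else B' t"]) auto
  qed
  show "?G \<subseteq> Pow (rc_paths T)" by auto
  show "prob_space (Lx a)" if "a \<in> space BE" for a using that by (intro Lx_prob) simp
  show "sets (Lx a) = sets PA" for a by simp
  fix A assume "A \<in> ?G"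
  then obtain J B where A: "A = {w\<in>rc_paths T. \<forall>t\<in>J. w t \<in> B t}" "finite J" "J \<subseteq> {0..}" "\<forall>t. B t \<in> sets BE" by auto
  \<comment> \<open>Finitely many simultaneous constraints become one list of increments by repeated
    insertion.\<close>
  have "\<exists>l. valid_list T l \<and> (\<forall>z. (\<forall>t\<in>J. z t \<in> Some ` B t) \<longleftrightarrow> visits z 0 l)"
    using A(2,3)
  proof (induct J rule: finite_induct)
    case empty
    show ?case by (intro exI[of _ "[]"]) simp
  next
    case (insert t J)
    then obtain l where l: "valid_list T l" "\<forall>z. (\<forall>t\<in>J. z t \<in> Some ` B t) \<longleftrightarrow> visits z 0 l" by auto
    then show ?case using insert A(4)
      by (intro exI[of _ "insert_visit t (B t) l"]) (auto simp: visits_insert intro!: valid_insert)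
  qed
  then obtain l where l: "valid_list T l" "\<And>z. (\<forall>t\<in>J. z t \<in> Some ` B t) \<longleftrightarrow> visits z 0 l" by auto
  have Al: "A = {w\<in>rc_paths T. visits (\<lambda>t. Some (w t)) 0 l}"
    unfolding A(1) l(2)[symmetric] by auto
  have "emeasure (Lx y) A = nest Kx l (\<lambda>_. 1) y" if "y \<in> points S" for y
  proof -
    have AP: "A \<in> sets PA" unfolding Al by (rule visits_path_sets[OF l(1)]) simp
    have "path -` A \<inter> space (P y) = {om\<in>space M. visits (\<lambda>s. Some (X s om)) 0 l}"
      using that path_rc by (auto simp: Al)
    then have "emeasure (Lx y) A = emeasure (P y) {om\<in>space M. visits (\<lambda>s. Some (X s om)) 0 l}"
      unfolding Lx_def using emeasure_distr[OF path_P[OF that] AP] by simp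
    also have "\<dots> = (\<integral>\<^sup>+om. indicator {om\<in>space M. visits (\<lambda>s. Some (X s om)) 0 l} om \<partial>P y)"
      using visits_X_sets[OF l(1)] that by simp
    also have "\<dots> = (\<integral>\<^sup>+om. indicator {om. visits (\<lambda>s. Some (X s om)) 0 l} om * 1 \<partial>P y)"
      using that by (intro nn_integral_cong) (auto simp: indicator_def)
    also have "\<dots> = nest Kx l (\<lambda>_. 1) y"
      using nest_Kx_eq[OF that, of "\<lambda>_. 1" l] l(1) by simp
    finally show ?thesis .
  qed
  then show "(\<lambda>a. emeasure (Lx a) A) \<in> borel_measurable BE"
    using nest_Kx_measurable[OF l(1), of "\<lambda>_. 1"] measurable_cong[of BE "\<lambda>a. emeasure (Lx a) A" "nest Kx l (\<lambda>_. 1)" borel]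
    by simp
qed

lemma nn_integral_Lx: "y \<in> points S \<Longrightarrow> g \<in> borel_measurable PA \<Longrightarrow> (\<integral>\<^sup>+w. g w \<partial>Lx y) = (\<integral>\<^sup>+om. g (path om) \<partial>P y)"
  unfolding Lx_def by (subst nn_integral_distr[OF path_P]) simp_all

lemma Lx_integral_measurable:
  "g \<in> borel_measurable PA \<Longrightarrow> (\<lambda>y. \<integral>\<^sup>+w. g w \<partial>Lx y) \<in> borel_measurable BE"
  using measurable_prob_algebraD[OF Lx_measurable] by (rule nn_integral_measurable_subprob_algebra2[rotated]) simp

text \<open>For fixed \<open>A\<close> both sides integrate \<open>g\<close> against finite measures
  on path space: the law of the shifted path weighted with the indicator of \<open>A\<close>, and a
  mixture of the laws \<open>Lx\<close>. These agree on finite-dimensional events by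
  \<open>markov_nest\<close>.\<close>

theorem markov_path:
  assumes x: "x \<in> points S" and t: "0 \<le> t" and A: "A \<in> sets (\<F> (ennreal t))"
    and g: "g \<in> borel_measurable PA"
  shows "(\<integral>\<^sup>+om. indicator A om * g (\<lambda>s. X (t + s) om) \<partial>P x) = (\<integral>\<^sup>+om. indicator A om * (\<integral>\<^sup>+w. g w \<partial>Lx (X t om)) \<partial>P x)"
proof -
  interpret prob_space "P x" using x by (rule P_prob)
  have AM: "A \<in> sets (P x)" using F_sets[OF A] x by simp
  let ?D = "density (P x) (indicator A)"
  have shift: "(\<lambda>om s. X (t + s) om) \<in> measurable (P x) PA"
    using shift_rc_paths[OF path_rc t] x t by (intro path_measurableI X_P) auto
  have shiftD: "(\<lambda>om s. X (t + s) om) \<in> measurable ?D PA" using shift by simp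
  have XD: "X t \<in> measurable ?D BE" using X_P[OF x t] by simp
  have fD: "finite_measure ?D"
    using AM emeasure_finite[of A] by (intro finite_measureI) (simp add: emeasure_density)
  \<comment> \<open>The mixture of the laws started at \<open>X t\<close>; its mass is that of
    \<open>A\<close>, so it is only a subprobability in general.\<close>
  define N where "N = ?D \<bind> (\<lambda>om. Lx (X t om))"
  have k: "(\<lambda>om. Lx (X t om)) \<in> measurable ?D (subprob_algebra PA)"
    by (rule measurable_compose[OF XD measurable_prob_algebraD[OF Lx_measurable]])
  have ne: "space ?D \<noteq> {}" using not_empty by simp
  have sN: "sets N = sets PA" unfolding N_def by (rule sets_bind) (use ne in auto)
  have emN: "emeasure N V = (\<integral>\<^sup>+om. emeasure (Lx (X t om)) V \<partial>?D)" if "V \<in> sets PA" for V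
    unfolding N_def by (rule emeasure_bind[OF ne k that])
  have "emeasure N (space N) \<le> (\<integral>\<^sup>+om. 1 \<partial>?D)"
  proof -
    have "space N \<in> sets PA" using sN sets.top by blast
    then have "emeasure N (space N) = (\<integral>\<^sup>+om. emeasure (Lx (X t om)) (space N) \<partial>?D)" by (rule emN)
    also have "\<dots> \<le> (\<integral>\<^sup>+om. 1 \<partial>?D)"
      using x X_space[OF t] by (intro nn_integral_mono prob_space.measure_le_1[OF Lx_prob]) simp
    finally show ?thesis .
  qed
  also have "\<dots> < \<infinity>" using finite_measure.emeasure_finite[OF fD] by (simp add: less_top)
  finally have fN: "finite_measure N" by (intro finite_measureI) auto
  have eqv: "emeasure ?D {om\<in>space ?D. visits (\<lambda>s. Some (X (t + s) om)) 0 l} = emeasure N {w\<in>space N. visits (\<lambda>s. Some (w s)) 0 l}"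
    if l: "valid_list T l" for l
  proof -
    let ?V = "{w\<in>rc_paths T. visits (\<lambda>s. Some (w s)) 0 l}"
    have V: "?V \<in> sets PA" by (rule visits_path_sets[OF l]) simp
    have spN: "space N = rc_paths T" using sets_eq_imp_space_eq[OF sN] by simp
    have ml: "{om\<in>space (P x). visits (\<lambda>s. Some (X (t + s) om)) 0 l} \<in> sets (P x)"
      using visits_X_sets[OF l t] visits_shift[of _ 0 t l] x by simp
    have emL: "emeasure (Lx y) ?V = nest Kx l (\<lambda>_. 1) y" if y: "y \<in> points S" for y
    proof -
      have "emeasure (Lx y) ?V = (\<integral>\<^sup>+w. indicator ?V w \<partial>Lx y)" using V by simp
      also have "\<dots> = (\<integral>\<^sup>+om. indicator ?V (path om) \<partial>P y)" using V by (intro nn_integral_Lx[OF y]) simp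
      also have "\<dots> = nest Kx l (\<lambda>_. 1) y"
        unfolding nest_Kx_eq[OF y borel_measurable_const l] using y path_rc
        by (intro nn_integral_cong) (auto simp: indicator_def)
      finally show ?thesis .
    qed
    have "emeasure ?D {om\<in>space ?D. visits (\<lambda>s. Some (X (t + s) om)) 0 l} =
       (\<integral>\<^sup>+om. indicator A om * indicator {om\<in>space (P x). visits (\<lambda>s. Some (X (t + s) om)) 0 l} om \<partial>P x)"
      using AM ml by (simp add: emeasure_density)
    also have "\<dots> = (\<integral>\<^sup>+om. indicator A om * (indicator {om. visits (\<lambda>s. Some (X s om)) t l} om * 1) \<partial>P x)"
      using visits_shift[of _ 0 t l] by (intro nn_integral_cong) (auto simp: indicator_def)
    also have "\<dots> = (\<integral>\<^sup>+om. indicator A om * nest Kx l (\<lambda>_. 1) (X t om) \<partial>P x)"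
      by (rule markov_nest[OF x borel_measurable_const l t A])
    also have "\<dots> = (\<integral>\<^sup>+om. indicator A om * emeasure (Lx (X t om)) ?V \<partial>P x)"
      using emL X_space[OF t] x by (intro nn_integral_cong) simp
    also have "\<dots> = (\<integral>\<^sup>+om. emeasure (Lx (X t om)) ?V \<partial>?D)"
    proof (rule nn_integral_density[symmetric])
      show "(\<lambda>om. emeasure (Lx (X t om)) ?V) \<in> borel_measurable (P x)"
        using measurable_compose[OF k measurable_emeasure_subprob_algebra[OF V]] by simp
    qed (use AM in simp)
    also have "\<dots> = emeasure N ?V" using emN[OF V] by simp
    finally show ?thesis by (simp add: spN)
  qed
  have idN: "(\<lambda>w. w) \<in> measurable N PA" by (rule measurable_ident_sets[OF sN])
  have "distr ?D PA (\<lambda>om s. X (t + s) om) = distr N PA (\<lambda>w. w)"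
    by (rule path_law_eq[OF fD fN shiftD idN, where Q=UNIV and c="\<lambda>t. t"]) (use eqv in auto)
  also have "\<dots> = N" by (rule distr_id2[OF sN[symmetric]])
  finally have "distr ?D PA (\<lambda>om s. X (t + s) om) = N" .
  then have "(\<integral>\<^sup>+om. g (\<lambda>s. X (t + s) om) \<partial>?D) = (\<integral>\<^sup>+w. g w \<partial>N)"
  proof -
    assume eq: "distr ?D PA (\<lambda>om s. X (t + s) om) = N"
    have "(\<integral>\<^sup>+w. g w \<partial>distr ?D PA (\<lambda>om s. X (t + s) om)) = (\<integral>\<^sup>+om. g (\<lambda>s. X (t + s) om) \<partial>?D)"
      by (subst nn_integral_distr[OF shiftD]) (simp_all add: g)
    then show ?thesis unfolding eq by (rule sym)
  qed
  also have "\<dots> = (\<integral>\<^sup>+om. (\<integral>\<^sup>+w. g w \<partial>Lx (X t om)) \<partial>?D)"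
    unfolding N_def by (rule nn_integral_bind[OF g k])
  finally have *: "(\<integral>\<^sup>+om. g (\<lambda>s. X (t + s) om) \<partial>?D) = (\<integral>\<^sup>+om. (\<integral>\<^sup>+w. g w \<partial>Lx (X t om)) \<partial>?D)" .
  have "(\<integral>\<^sup>+om. g (\<lambda>s. X (t + s) om) \<partial>?D) = (\<integral>\<^sup>+om. indicator A om * g (\<lambda>s. X (t + s) om) \<partial>P x)"
    using AM measurable_compose[OF shift g] by (intro nn_integral_density) auto
  moreover have "(\<integral>\<^sup>+om. (\<integral>\<^sup>+w. g w \<partial>Lx (X t om)) \<partial>?D) = (\<integral>\<^sup>+om. indicator A om * (\<integral>\<^sup>+w. g w \<partial>Lx (X t om)) \<partial>P x)"
    using AM measurable_compose[OF X_P[OF x t] Lx_integral_measurable[OF g]] by (intro nn_integral_density) auto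
  ultimately show ?thesis using * by simp
qed

end

section \<open>Stopping times and exits\<close>

lemma ennreal_Inf_less_iff:
  fixes A :: "real set"
  shows "Inf (ennreal ` A) < a \<longleftrightarrow> (\<exists>s\<in>A. ennreal s < a)"
  by (simp add: Inf_less_iff)

lemma interior_pts_subset: "interior_pts G \<subseteq> G"
  using interior_subset by (auto simp: interior_pts_def)

lemma interior_pts_mono: "G \<subseteq> G' \<Longrightarrow> interior_pts G \<subseteq> interior_pts G'"
proof -
  assume "G \<subseteq> G'"
  then have "interior {x. Some x \<in> G} \<subseteq> interior {x. Some x \<in> G'}" by (intro interior_mono) auto
  then show ?thesis by (auto simp: interior_pts_def)
qed

lemma openin_interior_pts:
  assumes "G \<subseteq> points S"
  shows "openin (compactified S) (interior_pts G)"
proof -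
  have "interior {x. Some x \<in> G} \<subseteq> {x. Some x \<in> G}" by (rule interior_subset)
  moreover have "{x. Some x \<in> G} \<subseteq> S" using assms by (auto simp: points_eq)
  ultimately have "interior {x. Some x \<in> G} - {0} \<subseteq> S" by auto
  moreover have "open (interior {x. Some x \<in> G} - {0})" by (simp add: open_delete)
  ultimately have "openin (top_of_set S) (interior {x. Some x \<in> G} - {0})"
    by (metis open_openin_trans inf.absorb_iff2 openin_open_Int)
  then show ?thesis unfolding interior_pts_def openin_compactified_Some .
qed

text \<open>Away from \<open>0\<close>, infinity and the boundary, open sets of the compactification
  are open in Euclidean space. This is how \<open>I\<close> is later seen to preserve the interior
  of \<open>F\<close>.\<close>

lemma interior_pts_greatest:
  assumes "openin (compactified S) W" "W \<subseteq> G" "W \<subseteq> interior_pts (points S)"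
  shows "W \<subseteq> interior_pts G"
proof -
  have W: "W = Some ` {x. Some x \<in> W}" using assms(3) by (auto simp: interior_pts_def)
  have "openin (top_of_set S) {x. Some x \<in> W}"
    using assms(1) W openin_compactified_Some by metis
  then obtain O' where O': "open O'" "{x. Some x \<in> W} = S \<inter> O'" by (auto simp: openin_open)
  have "{x. Some x \<in> W} = interior S \<inter> O'"
  proof
    show "{x. Some x \<in> W} \<subseteq> interior S \<inter> O'" using O' assms(3) by (auto simp: interior_pts_points)
    show "interior S \<inter> O' \<subseteq> {x. Some x \<in> W}" using O'(2) interior_subset by auto
  qed
  then have "open {x. Some x \<in> W}" using O' by auto
  then have "{x. Some x \<in> W} \<subseteq> interior {x. Some x \<in> G}" using assms(2) by (intro interior_maximal) auto
  moreover have "Some 0 \<notin> W" using assms(3) by (auto simp: interior_pts_def)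
  ultimately have "{x. Some x \<in> W} \<subseteq> interior {x. Some x \<in> G} - {0}" by auto
  then have "Some ` {x. Some x \<in> W} \<subseteq> interior_pts G" unfolding interior_pts_def by (rule image_mono)
  then show ?thesis using W by simp
qed

section \<open>Lifetime, stopping times and exits of \<open>X\<close>\<close>

context std_process
begin

lemma openin_U0: "openin T U0"
  by (rule openin_interior_pts) simp

lemma U0_sub: "U0 \<subseteq> points S"
  by (rule interior_pts_subset)

text \<open>After its lifetime a path rests at the position taken at the lifetime. If that position
  were interior, right-continuity would keep the path inside for a while longer, against the choice
  of the lifetime as an infimum.\<close>

lemma absorb_AE:
  assumes x: "x \<in> points S"
  shows "AE om in P x. \<forall>t\<ge>0. X t om \<in> U0 \<longrightarrow> ennreal t < lifetime S X om \<and> (\<forall>s\<in>{0..t}. X s om \<in> U0)"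
proof (cases "x \<in> U0")
  case False
  have "\<forall>x\<in>points S - U0. AE om in P x. \<forall>t\<ge>0. X t om = x"
    using absorbed unfolding absorbed_at_boundary_def by (elim conjE)
  then have "AE om in P x. \<forall>t\<ge>0. X t om = x" using x False by auto
  then show ?thesis by eventually_elim (use False in auto)
next
  case True
  have "\<forall>x\<in>points S. AE om in P x. \<forall>t\<ge>0. lifetime S X om \<le> ennreal t \<longrightarrow> X t om = X (enn2real (lifetime S X om)) om"
    using absorbed unfolding absorbed_at_boundary_def by (elim conjE)
  then have "AE om in P x. \<forall>t\<ge>0. lifetime S X om \<le> ennreal t \<longrightarrow> X t om = X (enn2real (lifetime S X om)) om"
    using x by auto
  moreover have "AE om in P x. X 0 om = x" by (rule P_start[OF x])
  moreover have "AE om in P x. om \<in> space M" using AE_space[of "P x"] x by simp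
  ultimately show ?thesis
  proof eventually_elim
    case (elim om)
    show ?case
    proof (intro allI impI)
      fix t :: real assume t: "0 \<le> t" "X t om \<in> U0"
      have lt: "ennreal t < lifetime S X om"
      proof (rule ccontr)
        assume "\<not> ennreal t < lifetime S X om"
        then have le: "lifetime S X om \<le> ennreal t" by simp
        define r where "r = enn2real (lifetime S X om)"
        have r: "lifetime S X om = ennreal r" "0 \<le> r"
          using le unfolding r_def by (auto simp: ennreal_enn2real_if top_unique)
        have "X r om \<in> U0" using elim(1) t le by (auto simp: r_def)
        then have "eventually (\<lambda>s. X s om \<in> U0) (at_right r)"
          using rc_pathsD[OF path_rc[OF elim(3)] r(2) openin_U0] by simp
        then obtain b where b: "b > r" "\<And>s. r < s \<Longrightarrow> s < b \<Longrightarrow> X s om \<in> U0"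
          by (auto simp: eventually_at_right_field)
        have "lifetime S X om < ennreal b" using r b by (simp add: ennreal_lessI)
        then obtain s where s: "0 < s" "X s om \<notin> U0" "ennreal s < ennreal b"
          unfolding lifetime_def ennreal_Inf_less_iff by auto
        have "r \<le> s"
        proof -
          have "lifetime S X om \<le> ennreal s" unfolding lifetime_def using s by (intro Inf_lower) auto
          then show ?thesis using r s by simp
        qed
        moreover have "s < b" using s by (simp add: ennreal_less_iff)
        ultimately have "s = r" using b(2)[of s] s by (cases "s = r") auto
        then show False using s \<open>X r om \<in> U0\<close> by simp
      qed
      \<comment> \<open>The lifetime looks at positive times only; time \<open>0\<close> is settled
        by the starting point.\<close>
      moreover have "X s om \<in> U0" if "s \<in> {0..t}" for s
      proof (cases "s = 0")
        case True
        then show ?thesis using elim(2) \<open>x \<in> U0\<close> by simp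
      next
        case False
        show ?thesis
        proof (rule ccontr)
          assume "X s om \<notin> U0"
          then have "lifetime S X om \<le> ennreal s"
            unfolding lifetime_def using that False by (intro Inf_lower) auto
          also have "\<dots> \<le> ennreal t" using that by (intro ennreal_leI) auto
          finally show False using lt by simp
        qed
      qed
      ultimately show "ennreal t < lifetime S X om \<and> (\<forall>s\<in>{0..t}. X s om \<in> U0)" by blast
    qed
  qed
qed

text \<open>Right-continuity of the filtration: an event known at every time after \<open>a\<close>
  is known at \<open>a\<close>. Strict inequalities suit infima over path conditions, which need not
  be attained.\<close>

lemma stopping_time_less:
  assumes "\<And>b. 0 < b \<Longrightarrow> {om\<in>space M. \<tau> om < ennreal b} \<in> sets (\<F> (ennreal b))"
  shows "stopping_time \<F> \<tau>"
proof (rule stopping_timeI)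
  fix a :: ennreal
  have "{om\<in>space M. \<tau> om \<le> a} \<in> sets (\<F> a)"
  proof (cases a)
    case top
    then show ?thesis using sets.top[of "\<F> a"] by simp
  next
    case (real r)
    have "{om\<in>space M. \<tau> om \<le> a} \<in> sets (\<F> s)" if s: "a < s" for s
    proof -
      obtain d where d: "0 < d" "ennreal (r + d) \<le> s"
      proof (cases s)
        case (real q)
        then show ?thesis using s \<open>a = ennreal r\<close> \<open>0 \<le> r\<close> that[of "q - r"] by (simp add: ennreal_less_iff)
      qed (use that[of 1] in auto)
      have "{om\<in>space M. \<tau> om \<le> a} = (\<Inter>n::nat. {om\<in>space M. \<tau> om < ennreal (r + d / Suc n)})"
      proof (intro set_eqI iffI)
        fix om assume "om \<in> {om\<in>space M. \<tau> om \<le> a}"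
        moreover have "a < ennreal (r + d / Suc n)" for n
          using real d by (simp add: ennreal_lessI del: of_nat_Suc)
        ultimately show "om \<in> (\<Inter>n::nat. {om\<in>space M. \<tau> om < ennreal (r + d / Suc n)})"
          by (auto intro: le_less_trans)
      next
        fix om assume *: "om \<in> (\<Inter>n::nat. {om\<in>space M. \<tau> om < ennreal (r + d / Suc n)})"
        have "\<tau> om \<le> a"
        proof (rule ccontr)
          assume "\<not> \<tau> om \<le> a"
          then have "a < \<tau> om" by simp
          then obtain q where q: "a < ennreal q" "ennreal q < \<tau> om" "0 \<le> q"
            by (metis dense ennreal_cases less_le_not_le top_greatest)
          then have "0 < (q - r) / d" using real d by (simp add: ennreal_less_iff)
          then obtain n where n: "1 / Suc n < (q - r) / d" by (metis nat_approx_posE)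
          then have "d / Suc n < q - r" using d by (simp add: field_simps del: of_nat_Suc)
          then have "ennreal (r + d / Suc n) \<le> ennreal q" by (intro ennreal_leI) simp
          moreover have "\<tau> om < ennreal (r + d / Suc n)" using * by auto
          ultimately show False using q by (meson less_le_trans less_asym)
        qed
        then show "om \<in> {om\<in>space M. \<tau> om \<le> a}" using * by auto
      qed
      also have "\<dots> \<in> sets (\<F> s)"
      proof (intro sets.countable_INT image_subsetI)
        fix n :: nat
        have "ennreal (r + d / Suc n) \<le> ennreal (r + d)"
          using d real by (intro ennreal_leI) (simp add: divide_le_eq)
        also have "\<dots> \<le> s" by (rule d(2))
        finally have "ennreal (r + d / Suc n) \<le> s" .
        moreover have "0 < r + d / Suc n" using d real by (intro add_nonneg_pos) auto
        ultimately show "{om\<in>space M. \<tau> om < ennreal (r + d / Suc n)} \<in> sets (\<F> s)"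
          by (intro F_mono[OF _ assms])
      qed simp
      finally show ?thesis .
    qed
    moreover have "a < \<infinity>" using real by simp
    ultimately show ?thesis using F_right[of a] by auto
  qed
  then show "Measurable.pred (\<F> a) (\<lambda>x. \<tau> x \<le> a)" by (simp add: Measurable.pred_def)
qed

text \<open>Leaving a closed set means entering an open one; by right-continuity this happens before
  \<open>b\<close> iff it happens at a rational time before \<open>b\<close>.\<close>

lemma hitting_stopping_time:
  assumes C: "closedin T C"
  shows "stopping_time \<F> (\<lambda>om. Inf (ennreal ` {s. 0 \<le> s \<and> X s om \<notin> C}))"
proof (rule stopping_time_less)
  fix b :: real assume b: "0 < b"
  have "{om\<in>space M. Inf (ennreal ` {s. 0 \<le> s \<and> X s om \<notin> C}) < ennreal b} =
    (\<Union>q\<in>{q. 0 \<le> real_of_rat q \<and> real_of_rat q < b}. {om\<in>space M. X (real_of_rat q) om \<in> topspace T - C})"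
  proof (intro set_eqI iffI)
    fix om assume "om \<in> {om\<in>space M. Inf (ennreal ` {s. 0 \<le> s \<and> X s om \<notin> C}) < ennreal b}"
    then obtain s where s: "om \<in> space M" "0 \<le> s" "X s om \<notin> C" "s < b"
      unfolding ennreal_Inf_less_iff by (auto simp: ennreal_less_iff)
    have "\<exists>r\<in>\<rat>. 0 \<le> r \<and> r < b \<and> X r om \<notin> C"
    proof (rule ccontr)
      assume "\<not> (\<exists>r\<in>\<rat>. 0 \<le> r \<and> r < b \<and> X r om \<notin> C)"
      then have "\<And>r. r \<in> \<rat> \<Longrightarrow> 0 \<le> r \<Longrightarrow> r < b \<Longrightarrow> X r om \<in> C" by auto
      from closed_rationals[OF path_rc[OF s(1)] C this s(2,4)] s(3) show False by simp
    qed
    then obtain q where "0 \<le> real_of_rat q" "real_of_rat q < b" "X (real_of_rat q) om \<notin> C"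
      by (auto simp: Rats_def)
    then show "om \<in> (\<Union>q\<in>{q. 0 \<le> real_of_rat q \<and> real_of_rat q < b}. {om\<in>space M. X (real_of_rat q) om \<in> topspace T - C})"
      using s X_space by auto
  next
    fix om assume "om \<in> (\<Union>q\<in>{q. 0 \<le> real_of_rat q \<and> real_of_rat q < b}. {om\<in>space M. X (real_of_rat q) om \<in> topspace T - C})"
    then obtain q where q: "0 \<le> real_of_rat q" "real_of_rat q < b" "om \<in> space M" "X (real_of_rat q) om \<notin> C" by auto
    then have "Inf (ennreal ` {s. 0 \<le> s \<and> X s om \<notin> C}) < ennreal b"
      unfolding ennreal_Inf_less_iff by (intro bexI[of _ "real_of_rat q"]) (auto simp: ennreal_less_iff)
    then show "om \<in> {om\<in>space M. Inf (ennreal ` {s. 0 \<le> s \<and> X s om \<notin> C}) < ennreal b}" using q by simp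
  qed
  also have "\<dots> \<in> sets (\<F> (ennreal b))"
  proof (rule sets.countable_UN')
    show "countable {q. 0 \<le> real_of_rat q \<and> real_of_rat q < b}" by simp
    show "(\<lambda>q. {om\<in>space M. X (real_of_rat q) om \<in> topspace T - C}) ` {q. 0 \<le> real_of_rat q \<and> real_of_rat q < b} \<subseteq> sets (\<F> (ennreal b))"
    proof clarify
      fix q assume q: "0 \<le> real_of_rat q" "real_of_rat q < b"
      have "topspace T - C \<in> sets BE" using sets.compl_sets[OF closedin_borel_of[OF C]] by simp
      from F_mono[OF ennreal_leI[OF less_imp_le[OF q(2)]] measurable_borel_ofD[OF X_F[OF q(1)] this]]
      show "{om\<in>space M. X (real_of_rat q) om \<in> topspace T - C} \<in> sets (\<F> (ennreal b))"
        by (simp only: space_F)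
    qed
  qed
  finally show "{om\<in>space M. Inf (ennreal ` {s. 0 \<le> s \<and> X s om \<notin> C}) < ennreal b} \<in> sets (\<F> (ennreal b))" .
qed

lemma qlc_AE:
  assumes "x \<in> points S" "\<And>n. stopping_time \<F> (\<sigma> n)" "\<And>n om. \<sigma> n om \<le> \<sigma> (Suc n) om"
  shows "AE om in P x. (SUP n. \<sigma> n om) < lifetime S X om \<longrightarrow>
           limitin T (\<lambda>n. X (enn2real (\<sigma> n om)) om) (X (enn2real (SUP n. \<sigma> n om)) om) sequentially"
  using qlc unfolding quasi_left_continuous_def using assms by auto

text \<open>Quasi-left-continuity excludes that a path leaves an open set of the interior by approaching
  its boundary and then jumps back into the set at the time of the approach.\<close>

lemma exhaust_AE:
  assumes x: "x \<in> points S" and K: "exhausts T K D" and D: "D \<subseteq> U0"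
  shows "AE om in P x. \<forall>u\<ge>0. (\<forall>m. \<exists>s\<in>{0..u}. X s om \<notin> K m) \<longrightarrow> X u om \<in> U0 \<longrightarrow>
    (\<exists>s\<in>{0..u}. X s om \<notin> D \<and> (\<forall>m. Inf (ennreal ` {s. 0 \<le> s \<and> X s om \<notin> K m}) \<le> ennreal s) \<and>
       ennreal s = (SUP m. Inf (ennreal ` {s. 0 \<le> s \<and> X s om \<notin> K m})))"
proof -
  define \<sigma> where "\<sigma> m om = Inf (ennreal ` {s. 0 \<le> s \<and> X s om \<notin> K m})" for m om
  have st: "stopping_time \<F> (\<sigma> m)" for m
    unfolding \<sigma>_def by (rule hitting_stopping_time[OF exhausts_closed[OF K]])
  have mono: "\<sigma> m om \<le> \<sigma> (Suc m) om" for m om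
    unfolding \<sigma>_def using exhausts_mono[OF K, of m "Suc m"] by (intro Inf_superset_mono image_mono) auto
  have "AE om in P x. om \<in> space M" using AE_space[of "P x"] x by simp
  with absorb_AE[OF x] qlc_AE[where \<sigma>=\<sigma>, OF x st mono] show ?thesis
    unfolding \<sigma>_def[symmetric]
  proof eventually_elim
    case (elim om)
    show ?case
    proof (intro allI impI)
      fix u :: real assume u: "0 \<le> u" "\<forall>m. \<exists>s\<in>{0..u}. X s om \<notin> K m" "X u om \<in> U0"
      have le: "\<sigma> m om \<le> ennreal u" for m
      proof -
        obtain s where "s \<in> {0..u}" "X s om \<notin> K m" using u(2)[rule_format, of m] by (elim bexE)
        then have "\<sigma> m om \<le> ennreal s" unfolding \<sigma>_def by (intro Inf_lower) auto
        also have "\<dots> \<le> ennreal u" using \<open>s \<in> {0..u}\<close> by (intro ennreal_leI) auto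
        finally show ?thesis .
      qed
      then have SUPle: "(SUP m. \<sigma> m om) \<le> ennreal u" by (rule SUP_least)
      \<comment> \<open>Being in \<open>U0\<close> at time \<open>u\<close> puts \<open>u\<close>
        before the lifetime, where quasi-left-continuity is available for the increasing exit
        times.\<close>
      also have "\<dots> < lifetime S X om" using elim(1) u by auto
      finally have lim: "limitin T (\<lambda>n. X (enn2real (\<sigma> n om)) om) (X (enn2real (SUP n. \<sigma> n om)) om) sequentially"
        using elim(2) by simp
      define r where "r = enn2real (SUP n. \<sigma> n om)"
      have "(SUP n. \<sigma> n om) < top" using SUPle ennreal_less_top by (rule le_less_trans)
      then have r: "(SUP n. \<sigma> n om) = ennreal r" "0 \<le> r"
        unfolding r_def by (simp_all only: ennreal_enn2real enn2real_nonneg)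
      have ru: "r \<le> u" using SUPle r u by simp
      \<comment> \<open>If the limit position were in \<open>D\<close>, the positions at the exit
        times would eventually be in the interior of a fixed member of the exhaustion and remain
        there for a while. Yet at or right after exit time number \<open>n\<close> the path has
        points outside \<open>K n\<close>.\<close>
      have nD: "X r om \<notin> D"
      proof
        assume "X r om \<in> D"
        then obtain p where "X r om \<in> K p" using K by (auto simp: exhausts_def)
        then have rp: "X r om \<in> T interior_of K (Suc p)" using exhausts_interior[OF K] by auto
        have "eventually (\<lambda>n. X (enn2real (\<sigma> n om)) om \<in> T interior_of K (Suc p)) sequentially"
          using lim rp unfolding limitin_def r_def[symmetric] by (metis openin_interior_of)
        from eventually_conj[OF this eventually_ge_at_top[of "Suc p"]]
        obtain n where n: "X (enn2real (\<sigma> n om)) om \<in> T interior_of K (Suc p)" "n \<ge> Suc p"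
          by (auto simp: eventually_sequentially)
        define a where "a = enn2real (\<sigma> n om)"
        have "\<sigma> n om < top" using le[of n] ennreal_less_top by (rule le_less_trans)
        then have a: "\<sigma> n om = ennreal a" "0 \<le> a" unfolding a_def by (auto simp: ennreal_enn2real)
        have sub: "T interior_of K (Suc p) \<subseteq> K n"
          using interior_of_subset[of T "K (Suc p)"] exhausts_mono[OF K n(2)] by auto
        have "eventually (\<lambda>s. X s om \<in> T interior_of K (Suc p)) (at_right a)"
          using rc_pathsD[OF path_rc[OF elim(3)] a(2) openin_interior_of] n(1) by (simp add: a_def)
        then obtain b where b: "b > a" "\<And>s. a < s \<Longrightarrow> s < b \<Longrightarrow> X s om \<in> T interior_of K (Suc p)"
          by (auto simp: eventually_at_right_field)
        have "\<sigma> n om < ennreal b" using a b by (simp add: ennreal_lessI)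
        then obtain s where s: "0 \<le> s" "X s om \<notin> K n" "ennreal s < ennreal b"
          unfolding \<sigma>_def ennreal_Inf_less_iff by auto
        have "ennreal a \<le> ennreal s" unfolding a(1)[symmetric] \<sigma>_def using s by (intro Inf_lower) auto
        then have "a \<le> s" using s by simp
        moreover have "s < b" using s by (simp add: ennreal_less_iff)
        ultimately have "X s om \<in> T interior_of K (Suc p)"
          using b(2)[of s] n(1) by (cases "s = a") (auto simp: a_def)
        then show False using s sub by auto
      qed
      have "\<sigma> m om \<le> ennreal r" for m unfolding r(1)[symmetric] by (rule SUP_upper) simp
      then show "\<exists>s\<in>{0..u}. X s om \<notin> D \<and> (\<forall>m. \<sigma> m om \<le> ennreal s) \<and> ennreal s = (SUP m. \<sigma> m om)"
        using nD r ru by (intro bexI[of _ r]) auto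
    qed
  qed
qed

text \<open>A path staying in \<open>D\<close> up to \<open>u\<close> could still have a left limit
  on the boundary of \<open>D\<close>; quasi-left-continuity excludes this. So staying in
  \<open>D\<close> agrees almost surely with the Borel event of staying in some
  \<open>K m\<close>.\<close>

lemma good_AE:
  assumes x: "x \<in> points S" and K: "exhausts T K D" and D: "D \<subseteq> U0"
  shows "AE om in P x. \<forall>u\<ge>0. (\<forall>s\<in>{0..u}. X s om \<in> D) \<longrightarrow> (\<exists>m. \<forall>s\<in>{0..u}. X s om \<in> K m)"
  using exhaust_AE[OF assms]
proof eventually_elim
  case (elim om)
  show ?case
  proof (intro allI impI)
    fix u :: real assume u: "0 \<le> u" "\<forall>s\<in>{0..u}. X s om \<in> D"
    have "X u om \<in> U0" using u D by auto
    show "\<exists>m. \<forall>s\<in>{0..u}. X s om \<in> K m"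
    proof (rule ccontr)
      assume "\<not> (\<exists>m. \<forall>s\<in>{0..u}. X s om \<in> K m)"
      then have "\<forall>m. \<exists>s\<in>{0..u}. X s om \<notin> K m" by simp
      with elim u \<open>X u om \<in> U0\<close> obtain s where "s \<in> {0..u}" "X s om \<notin> D" by blast
      then show False using u by auto
    qed
  qed
qed

end

section \<open>The time change\<close>

lemma limitin_compose_on:
  assumes "continuous_map (subtopology T A) Y f" "limitin T g l Fl" "l \<in> A" "eventually (\<lambda>x. g x \<in> A) Fl"
  shows "limitin Y (\<lambda>x. f (g x)) (f l) Fl"
proof -
  have "limitin (subtopology T A) g l Fl" using assms by (simp add: limitin_subtopology)
  from continuous_map_limit[OF assms(1) this] show ?thesis by (simp add: o_def)
qed

lemma continuous_map_bounds:
  fixes f :: "'s \<Rightarrow> real"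
  assumes "compact_space T" "continuous_map (subtopology T A) euclideanreal f" "closedin T C" "C \<subseteq> A"
    "\<And>y. y \<in> C \<Longrightarrow> 0 < f y"
  shows "\<exists>a b. 0 < a \<and> 0 < b \<and> (\<forall>y\<in>C. a \<le> f y \<and> f y \<le> b)"
proof (cases "C = {}")
  case True
  then show ?thesis by (intro exI[of _ 1]) auto
next
  case False
  have "compactin (subtopology T A) C"
    using assms by (simp add: compactin_subtopology closedin_compact_space)
  from image_compactin[OF this assms(2)] have cpt: "compact (f ` C)" by simp
  obtain a where a: "a \<in> f ` C" "\<And>y. y \<in> f ` C \<Longrightarrow> a \<le> y"
    using compact_attains_inf[OF cpt] False by auto
  obtain b where b: "b \<in> f ` C" "\<And>y. y \<in> f ` C \<Longrightarrow> y \<le> b"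
    using compact_attains_sup[OF cpt] False by auto
  show ?thesis using a b assms(5) by (intro exI[of _ a] exI[of _ b]) auto
qed

lemma borel_of_euclidean: "borel_of euclidean = borel"
  by (simp add: borel_of_def borel_def)

lemma continuous_map_measurable_restrict:
  assumes "continuous_map (subtopology T A) Y f" "A \<subseteq> topspace T"
  shows "f \<in> measurable (restrict_space (borel_of T) A) (borel_of Y)"
proof (rule measurable_borel_ofI)
  fix x assume "x \<in> space (restrict_space (borel_of T) A)"
  then show "f x \<in> topspace Y"
    using assms continuous_map_image_subset_topspace[OF assms(1)] by (auto simp: space_restrict_space)
next
  fix U assume "openin Y U"
  then have "openin (subtopology T A) {x \<in> topspace (subtopology T A). f x \<in> U}"
    using assms(1) by (rule openin_continuous_map_preimage[rotated])
  then obtain V where "openin T V" "{x \<in> topspace (subtopology T A). f x \<in> U} = V \<inter> A"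
    by (auto simp: openin_subtopology)
  then have "{x \<in> space (restrict_space (borel_of T) A). f x \<in> U} = A \<inter> V"
    using assms(2) by (auto simp: space_restrict_space)
  then show "{x \<in> space (restrict_space (borel_of T) A). f x \<in> U} \<in> sets (restrict_space (borel_of T) A)"
    using openin_borel_of[OF \<open>openin T V\<close>] by (auto simp: sets_restrict_space)
qed

lemma measurable_restrict_preimage:
  assumes "f \<in> measurable (restrict_space M A) N" "A \<in> sets M" "B \<in> sets N"
  shows "{y\<in>A. f y \<in> B} \<in> sets M"
proof -
  have "f -` B \<inter> space (restrict_space M A) \<in> sets (restrict_space M A)" by (rule measurable_sets[OF assms(1,3)])
  then have "f -` B \<inter> space (restrict_space M A) \<in> sets M"
    using assms(2) by (auto simp: sets_restrict_space intro: sets.Int)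
  moreover have "f -` B \<inter> space (restrict_space M A) = {y\<in>A. f y \<in> B}"
    using sets.sets_into_space[OF assms(2)] by (auto simp: space_restrict_space)
  ultimately show ?thesis by simp
qed

text \<open>An infimum below \<open>u\<close> is decided by the members up to \<open>u\<close>. For
  the inverse clock this means that it depends on the path before \<open>u\<close> only.\<close>

lemma Inf_ennreal_agree:
  fixes A B :: "real set"
  assumes "\<And>s. s \<le> u \<Longrightarrow> s \<in> A \<longleftrightarrow> s \<in> B" "\<And>s. s \<in> A \<Longrightarrow> 0 \<le> s" "Inf (ennreal ` A) < ennreal u"
  shows "Inf (ennreal ` B) = Inf (ennreal ` A)"
proof -
  have *: "Inf (ennreal ` B) \<le> Inf (ennreal ` A)"
    if AB: "\<And>s. s \<le> u \<Longrightarrow> s \<in> A \<longleftrightarrow> s \<in> B" and lt: "Inf (ennreal ` A) < ennreal u" for A B :: "real set"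
  proof (rule ccontr)
    assume "\<not> Inf (ennreal ` B) \<le> Inf (ennreal ` A)"
    then have "Inf (ennreal ` A) < min (Inf (ennreal ` B)) (ennreal u)" using lt by simp
    then obtain s where s: "s \<in> A" "ennreal s < Inf (ennreal ` B)" "ennreal s < ennreal u"
      unfolding ennreal_Inf_less_iff by auto
    have "s \<le> u" using s(3) by (meson ennreal_leI leD less_imp_le not_le)
    then have "s \<in> B" using AB s by auto
    then have "Inf (ennreal ` B) \<le> ennreal s" by (intro Inf_lower) auto
    then show False using s by simp
  qed
  have "Inf (ennreal ` B) \<le> Inf (ennreal ` A)" using assms by (intro *) auto
  moreover from this have "Inf (ennreal ` B) < ennreal u" using assms(3) by simp
  then have "Inf (ennreal ` A) \<le> Inf (ennreal ` B)" using assms(1) by (intro *) auto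
  ultimately show ?thesis by simp
qed

lemma clock_mono: "s \<le> t \<Longrightarrow> clock v Z s om \<le> clock v Z t om"
  unfolding clock_def by (intro nn_integral_mono mult_left_mono) (auto simp: indicator_def)

lemma clock_cong:
  assumes "\<And>s. 0 \<le> s \<Longrightarrow> s \<le> t \<Longrightarrow> (case Z s om of Some y \<Rightarrow> ennreal (1 / v y) | None \<Rightarrow> 0) = (case Z' s om' of Some y \<Rightarrow> ennreal (1 / v' y) | None \<Rightarrow> 0)"
  shows "clock v Z t om = clock v' Z' t om'"
  unfolding clock_def using assms by (intro nn_integral_cong) (auto simp: indicator_def)

text \<open>Two processes and two functions \<open>v\<close> in one statement serve three later
  switches: between \<open>v\<close> and its truncation \<open>v0\<close>, between \<open>Y\<close>
  and a path without cemetery, and between a path and its stopped version.\<close>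

lemma inverse_clock_cong:
  assumes "\<And>s. 0 \<le> s \<Longrightarrow> s \<le> u \<Longrightarrow> (case Z s om of Some y \<Rightarrow> ennreal (1 / v y) | None \<Rightarrow> 0) = (case Z' s om' of Some y \<Rightarrow> ennreal (1 / v' y) | None \<Rightarrow> 0)"
    and "inverse_clock v Z t om < ennreal u"
  shows "inverse_clock v' Z' t om' = inverse_clock v Z t om"
  unfolding inverse_clock_def
proof (rule Inf_ennreal_agree)
  show "s \<in> {s. 0 \<le> s \<and> ennreal t < clock v Z s om} \<longleftrightarrow> s \<in> {s. 0 \<le> s \<and> ennreal t < clock v' Z' s om'}" if "s \<le> u" for s
    using clock_cong[where t=s and Z=Z and om=om and v=v and Z'=Z' and om'=om' and v'=v'] assms(1) that by auto
qed (use assms(2) in \<open>auto simp: inverse_clock_def\<close>)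

lemma inverse_clock_mono: "s \<le> t \<Longrightarrow> inverse_clock v Z s om \<le> inverse_clock v Z t om"
  unfolding inverse_clock_def
  by (intro Inf_superset_mono image_mono) (auto intro: le_less_trans[OF ennreal_leI])

text \<open>The strict inequality in the definition makes the inverse clock right-continuous: the
  clock reading at the witness exceeds \<open>t\<close>, hence also some \<open>t'\<close> after
  \<open>t\<close>.\<close>

lemma inverse_clock_right:
  assumes "0 \<le> t" "inverse_clock v Z t om < ennreal r"
  shows "\<exists>t'>t. inverse_clock v Z t' om < ennreal r"
proof -
  obtain s where s: "0 \<le> s" "ennreal t < clock v Z s om" "ennreal s < ennreal r"
    using assms(2) unfolding inverse_clock_def ennreal_Inf_less_iff by auto
  obtain t' where t': "ennreal t < ennreal t'" "ennreal t' < clock v Z s om"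
    using s(2) by (metis dense ennreal_cases less_le_not_le top_greatest)
  have "inverse_clock v Z t' om \<le> ennreal s"
    unfolding inverse_clock_def using s t' by (intro Inf_lower) auto
  moreover have "t < t'" using t'(1) assms(1) by (simp add: ennreal_less_iff)
  ultimately show ?thesis using s(3) by (intro exI[of _ t']) auto
qed

lemma time_changed_rc:
  assumes w: "w \<in> rc_paths T" and q: "0 \<le> q" "inverse_clock v Z q om < \<infinity>"
  shows "(\<lambda>s. w (enn2real (inverse_clock v Z (min s q) om))) \<in> rc_paths T"
  unfolding rc_paths_def
proof (intro CollectI allI impI)
  define g where "g s = enn2real (inverse_clock v Z (min s q) om)" for s
  have fin: "inverse_clock v Z (min s q) om = ennreal (g s)" for s
    using le_less_trans[OF inverse_clock_mono[of "min s q" q] q(2)] by (simp add: g_def)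
  have g0: "0 \<le> g s" for s by (simp add: g_def)
  have gmono: "g s \<le> g t" if "s \<le> t" for s t
    using inverse_clock_mono[of "min s q" "min t q" v Z om] that by (simp add: fin g0)
  fix t :: real assume t: "0 \<le> t"
  show "limitin T (\<lambda>s. w (g s)) (w (g t)) (at_right t)"
    unfolding limitin_def
  proof (intro conjI allI impI)
    show "w (g t) \<in> topspace T" by (rule rc_paths_topspace[OF w g0])
    fix U assume U: "openin T U \<and> w (g t) \<in> U"
    then have "eventually (\<lambda>s. w s \<in> U) (at_right (g t))" using rc_pathsD[OF w g0] by auto
    then obtain b where b: "b > g t" "\<And>s. g t < s \<Longrightarrow> s < b \<Longrightarrow> w s \<in> U"
      by (auto simp: eventually_at_right_field)
    \<comment> \<open>The inverse clock is only known to be nondecreasing and might be flat to the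
      right of \<open>t\<close>, so the time \<open>g t\<close> itself is included.\<close>
    have wU: "w r \<in> U" if "g t \<le> r" "r < b" for r using that U b(2)[of r] by (cases "r = g t") auto
    have "inverse_clock v Z (min t q) om < ennreal b" using b g0[of t] by (simp add: fin ennreal_less_iff)
    from inverse_clock_right[OF _ this] t q obtain t' where t': "t' > min t q" "inverse_clock v Z t' om < ennreal b" by auto
    have "eventually (\<lambda>s. g s < b) (at_right t)"
    proof (cases "t < q")
      case True
      then have tt: "t < t'" using t' by (simp add: min_def)
      show ?thesis
        using eventually_at_right_real[OF tt]
      proof eventually_elim
        case (elim s)
        have "inverse_clock v Z (min s q) om \<le> inverse_clock v Z t' om" using elim by (intro inverse_clock_mono) auto
        then have "ennreal (g s) < ennreal b" using t'(2) by (simp add: fin)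
        then show ?case using g0[of s] by (simp add: ennreal_less_iff)
      qed
    next
      case False
      then have "g s = g t" if "s > t" for s using that by (simp add: g_def min_def)
      then show ?thesis using b by (auto simp: eventually_at_right_field intro!: exI[of _ "t + 1"])
    qed
    moreover have "eventually (\<lambda>s. t < s) (at_right t)" by (simp add: eventually_at_right_less)
    ultimately show "eventually (\<lambda>s. w (g s) \<in> U) (at_right t)"
    proof eventually_elim
      case (elim s)
      then show ?case using gmono[of t s] by (intro wU) auto
    qed
  qed
qed

section \<open>The clock and its inverse along a path\<close>

locale time_change = std_process +
  fixes v :: "'a option \<Rightarrow> real"
  assumes vpos: "\<And>y. y \<in> U0 \<Longrightarrow> 0 < v y"
    and vcont: "continuous_map (subtopology T U0) euclideanreal v"
begin

text \<open>Outside of \<open>U0\<close> the values of \<open>v\<close> are irrelevant and need not even be measurable; with the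
  value \<open>0\<close> the clock stops there, as \<open>1 / 0 = 0\<close>.\<close>

definition v0 :: "'a option \<Rightarrow> real" where
  "v0 y = (if y \<in> U0 then v y else 0)"

text \<open>A functional of the path alone, so that it can be evaluated under the laws of
  \<open>X\<close>, of \<open>Y\<close> and of stopped paths alike.\<close>

definition gam :: "real \<Rightarrow> (real \<Rightarrow> 'a option) \<Rightarrow> ennreal" where
  "gam t w = inverse_clock v0 (\<lambda>s w. Some (w s)) t w"

abbreviation clk :: "real \<Rightarrow> (real \<Rightarrow> 'a option) \<Rightarrow> ennreal" where
  "clk t w \<equiv> clock v0 (\<lambda>s w. Some (w s)) t w"

abbreviation gamr :: "real \<Rightarrow> (real \<Rightarrow> 'a option) \<Rightarrow> real" where
  "gamr t w \<equiv> enn2real (gam t w)"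

lemma inv_v0_measurable: "(\<lambda>y. ennreal (1 / v0 y)) \<in> borel_measurable BE"
proof -
  have U: "U0 \<in> sets BE" by (rule openin_borel_of[OF openin_U0])
  have "v \<in> measurable (restrict_space BE U0) borel"
    using continuous_map_measurable_restrict[OF vcont U0_sub] by (simp add: borel_of_euclidean)
  then have "(\<lambda>y. if y \<in> U0 then v y else 0) \<in> borel_measurable BE"
    using sets.Int[OF U sets.top[of BE]] by (subst measurable_restrict_space_iff[symmetric]) auto
  then have "v0 \<in> borel_measurable BE" by (simp add: v0_def[abs_def])
  then show ?thesis by measurable
qed

lemma clk_measurable: "clk t \<in> borel_measurable PA"
proof -
  have J: "(\<lambda>(w, s). w (max 0 s)) \<in> measurable (PA \<Otimes>\<^sub>M (borel :: real measure)) BE"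
    using measurable_compose[OF measurable_pair_swap' joint_eval] by (simp add: split_beta')
  have "(\<lambda>(w, s). ennreal (1 / v0 (w (max 0 s))) * indicator {0..t} s) \<in> borel_measurable (PA \<Otimes>\<^sub>M lborel)"
  proof -
    have "(\<lambda>x. ennreal (1 / v0 ((\<lambda>(w, s). w (max 0 s)) x))) \<in> borel_measurable (PA \<Otimes>\<^sub>M borel)"
      by (rule measurable_compose[OF J inv_v0_measurable])
    then show ?thesis by (simp add: split_beta') measurable
  qed
  then have "(\<lambda>w. \<integral>\<^sup>+s. ennreal (1 / v0 (w (max 0 s))) * indicator {0..t} s \<partial>lborel) \<in> borel_measurable PA"
    by (rule lborel.borel_measurable_nn_integral)
  also have "(\<lambda>w. \<integral>\<^sup>+s. ennreal (1 / v0 (w (max 0 s))) * indicator {0..t} s \<partial>lborel) = clk t"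
    unfolding clock_def by (intro ext nn_integral_cong) (auto simp: indicator_def max_absorb2)
  finally show ?thesis .
qed

lemma gam_less_iff:
  assumes "0 \<le> b"
  shows "gam t w < ennreal b \<longleftrightarrow> (\<exists>q. 0 \<le> real_of_rat q \<and> real_of_rat q < b \<and> ennreal t < clk (real_of_rat q) w)"
proof
  assume "gam t w < ennreal b"
  then obtain s where s: "0 \<le> s" "ennreal t < clk s w" "ennreal s < ennreal b"
    unfolding gam_def inverse_clock_def ennreal_Inf_less_iff by auto
  then have "s < b" by (simp add: ennreal_less_iff)
  then obtain q where q: "s < real_of_rat q" "real_of_rat q < b" using of_rat_dense by blast
  then have "clk s w \<le> clk (real_of_rat q) w" by (intro clock_mono) auto
  moreover have "0 \<le> real_of_rat q" using q s by linarith
  ultimately show "\<exists>q. 0 \<le> real_of_rat q \<and> real_of_rat q < b \<and> ennreal t < clk (real_of_rat q) w"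
    using q s by (intro exI[of _ q]) auto
next
  assume "\<exists>q. 0 \<le> real_of_rat q \<and> real_of_rat q < b \<and> ennreal t < clk (real_of_rat q) w"
  then obtain q where "0 \<le> real_of_rat q" "real_of_rat q < b" "ennreal t < clk (real_of_rat q) w" by auto
  then show "gam t w < ennreal b"
    unfolding gam_def inverse_clock_def ennreal_Inf_less_iff
    by (intro bexI[of _ "real_of_rat q"]) (auto simp: ennreal_less_iff)
qed

lemma gam_measurable: "gam t \<in> borel_measurable PA"
proof (rule borel_measurableI_less)
  fix y :: ennreal
  have *: "{w\<in>space PA. gam t w < ennreal b} \<in> sets PA" if "0 \<le> b" for b
  proof -
    have "{w\<in>space PA. gam t w < ennreal b} =
      {w\<in>space PA. \<exists>q. 0 \<le> real_of_rat q \<and> real_of_rat q < b \<and> ennreal t < clk (real_of_rat q) w}"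
      by (simp only: gam_less_iff[OF that])
    also have "\<dots> \<in> sets PA" using clk_measurable by measurable
    finally show ?thesis .
  qed
  show "{w\<in>space PA. gam t w < y} \<in> sets PA"
  proof (cases y)
    case (real b)
    then show ?thesis using * by simp
  next
    case top
    have "{w\<in>space PA. gam t w < y} = (\<Union>n::nat. {w\<in>space PA. gam t w < ennreal (real n)})"
    proof (intro set_eqI iffI)
      fix w assume w: "w \<in> {w\<in>space PA. gam t w < y}"
      then obtain r where "gam t w = ennreal r" "0 \<le> r" using top by (cases "gam t w") auto
      moreover obtain n :: nat where "r < real n" using reals_Archimedean2 by auto
      ultimately show "w \<in> (\<Union>n::nat. {w\<in>space PA. gam t w < ennreal (real n)})"
        using w by (auto simp: ennreal_less_iff)
    qed (auto simp: top intro: less_trans)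
    then show ?thesis using * by (auto intro!: sets.countable_UN)
  qed
qed

lemma gam_mono: "s \<le> t \<Longrightarrow> gam s w \<le> gam t w"
  unfolding gam_def by (rule inverse_clock_mono)

lemma gamr_mono: "s \<le> t \<Longrightarrow> gam t w < \<infinity> \<Longrightarrow> gamr s w \<le> gamr t w"
  by (intro enn2real_mono gam_mono) auto

text \<open>On the compact set \<open>C\<close> the function \<open>v\<close> is bounded and bounded
  away from \<open>0\<close>, so the clock is bi-Lipschitz as long as the path stays there.
  Finiteness, continuity and strict growth of the clock all come from this.\<close>

lemma clk_step:
  assumes w: "w \<in> stays C u" and C: "closedin T C" "C \<subseteq> U0"
  shows "\<exists>a b. 0 < a \<and> 0 < b \<and> (\<forall>r s. 0 \<le> r \<longrightarrow> r \<le> s \<longrightarrow> s \<le> u \<longrightarrow>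
    clk r w + ennreal (a * (s - r)) \<le> clk s w \<and> clk s w \<le> clk r w + ennreal (b * (s - r)))"
proof -
  obtain a b where ab: "0 < a" "0 < b" "\<And>y. y \<in> C \<Longrightarrow> a \<le> v y" "\<And>y. y \<in> C \<Longrightarrow> v y \<le> b"
    using continuous_map_bounds[OF compact_space_compactified vcont C] vpos C(2) by (metis subsetD)
  have bnd: "1 / b \<le> 1 / v0 (w s) \<and> 1 / v0 (w s) \<le> 1 / a" if "0 \<le> s" "s \<le> u" for s
  proof -
    have "w s \<in> C" using w that by (auto simp: stays_def)
    then have "a \<le> v0 (w s)" "v0 (w s) \<le> b" using ab C by (auto simp: v0_def)
    then show ?thesis using ab by (auto intro!: divide_left_mono mult_pos_pos)
  qed
  have wrc: "w \<in> rc_paths T" using w by (simp add: stays_def)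
  have W: "(\<lambda>s. ennreal (1 / v0 (w (max 0 s)))) \<in> borel_measurable lborel"
  proof -
    have "(\<lambda>s. (\<lambda>(s, w). w (max 0 s)) (s, w)) \<in> measurable (borel :: real measure) BE"
      using wrc by (intro measurable_compose[OF _ joint_eval] measurable_Pair) auto
    then have "(\<lambda>s. w (max 0 s)) \<in> measurable lborel BE" by simp
    from measurable_compose[OF this inv_v0_measurable] show ?thesis by simp
  qed
  show ?thesis
  \<comment> \<open>The bounds change sides under the reciprocal: the lower slope is the inverse of
    the upper bound of \<open>v\<close>.\<close>
  proof (rule exI[of _ "1 / b"], rule exI[of _ "1 / a"], intro conjI allI impI)
    fix r s :: real assume rs: "0 \<le> r" "r \<le> s" "s \<le> u"
    have c: "clk t w = (\<integral>\<^sup>+s. ennreal (1 / v0 (w (max 0 s))) * indicator {0..t} s \<partial>lborel)" for t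
      unfolding clock_def by (intro nn_integral_cong) (auto simp: indicator_def max_absorb2)
    have "clk s w = (\<integral>\<^sup>+x. ennreal (1 / v0 (w (max 0 x))) * indicator {0..r} x + ennreal (1 / v0 (w (max 0 x))) * indicator {r<..s} x \<partial>lborel)"
      unfolding c using rs by (intro nn_integral_cong) (auto simp: indicator_def)
    also have "\<dots> = clk r w + (\<integral>\<^sup>+x. ennreal (1 / v0 (w (max 0 x))) * indicator {r<..s} x \<partial>lborel)"
      unfolding c using W by (intro nn_integral_add) auto
    finally have eq: "clk s w = clk r w + (\<integral>\<^sup>+x. ennreal (1 / v0 (w (max 0 x))) * indicator {r<..s} x \<partial>lborel)" .
    have "(\<integral>\<^sup>+x. ennreal (1 / b) * indicator {r<..s} x \<partial>lborel) \<le> (\<integral>\<^sup>+x. ennreal (1 / v0 (w (max 0 x))) * indicator {r<..s} x \<partial>lborel)"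
      using bnd rs by (intro nn_integral_mono) (auto simp: indicator_def intro!: ennreal_leI)
    moreover have "(\<integral>\<^sup>+x. ennreal (1 / v0 (w (max 0 x))) * indicator {r<..s} x \<partial>lborel) \<le> (\<integral>\<^sup>+x. ennreal (1 / a) * indicator {r<..s} x \<partial>lborel)"
      using bnd rs by (intro nn_integral_mono) (auto simp: indicator_def intro!: ennreal_leI)
    moreover have "(\<integral>\<^sup>+x. ennreal k * indicator {r<..s} x \<partial>lborel) = ennreal (k * (s - r))" if "0 < k" for k
      using that rs by (simp add: nn_integral_cmult_indicator ennreal_mult)
    ultimately show "clk r w + ennreal (1 / b * (s - r)) \<le> clk s w" "clk s w \<le> clk r w + ennreal (1 / a * (s - r))"
      unfolding eq using ab by (auto intro: add_left_mono)
  qed (use ab in auto)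
qed

lemma clk_0: "clk 0 w = 0"
proof -
  have "clk 0 w \<le> (\<integral>\<^sup>+s. top * indicator {0 :: real} s \<partial>lborel)"
    unfolding clock_def by (intro nn_integral_mono) (auto simp: indicator_def)
  also have "\<dots> = 0" by (simp add: nn_integral_cmult_indicator)
  finally show ?thesis by simp
qed

context
  fixes w C u
  assumes w: "w \<in> stays C u" and C: "closedin T C" "C \<subseteq> U0"
begin

lemma clk_finite: assumes "0 \<le> s" "s \<le> u" shows "clk s w < \<infinity>"
proof -
  obtain a b where "clk s w \<le> clk 0 w + ennreal (b * (s - 0))"
    using clk_step[OF w C] assms by blast
  then show ?thesis by (simp add: clk_0 le_less_trans)
qed

lemma clk_strict: assumes "0 \<le> r" "r < s" "s \<le> u" shows "clk r w < clk s w"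
proof -
  obtain a b where a: "0 < a" "clk r w + ennreal (a * (s - r)) \<le> clk s w"
    using clk_step[OF w C] assms by (meson less_imp_le)
  have "0 < a * (s - r)" using a assms by simp
  moreover obtain x where "clk r w = ennreal x" "0 \<le> x" using clk_finite[of r] assms by (cases "clk r w") auto
  ultimately have "clk r w < clk r w + ennreal (a * (s - r))"
    by (simp add: ennreal_plus[symmetric] ennreal_less_iff del: ennreal_plus)
  from this a(2) show ?thesis by (rule less_le_trans)
qed

text \<open>The clock grows strictly just after \<open>s\<close>, so the infimum in the inverse
  clock cannot exceed \<open>s\<close>; \<open>s < u\<close> leaves the room to the right that this
  needs.\<close>

lemma gam_clk:
  assumes s: "0 \<le> s" "s < u" and t: "0 \<le> t" "clk s w = ennreal t"
  shows "gam t w = ennreal s"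
proof (rule antisym)
  show "ennreal s \<le> gam t w"
    unfolding gam_def inverse_clock_def
  proof (rule Inf_greatest)
    fix x assume "x \<in> ennreal ` {r. 0 \<le> r \<and> ennreal t < clk r w}"
    then obtain r where r: "x = ennreal r" "0 \<le> r" "clk s w < clk r w" using t by auto
    have "s \<le> r" using r(3) clock_mono[of r s v0 "\<lambda>s w. Some (w s)" w] by (cases "s \<le> r") auto
    then show "ennreal s \<le> x" using r by (simp add: ennreal_leI)
  qed
  show "gam t w \<le> ennreal s"
  proof (rule ccontr)
    assume "\<not> gam t w \<le> ennreal s"
    then have "ennreal s < min (gam t w) (ennreal u)" using s by (simp add: ennreal_lessI)
    then obtain q where q: "ennreal s < q" "q < min (gam t w) (ennreal u)" using dense by blast
    then obtain r where r: "q = ennreal r" "0 \<le> r" by (cases q) (auto simp: top_unique)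
    have rs: "s < r" "r < u" using q r s by (auto simp: ennreal_less_iff)
    then have "ennreal t < clk r w" using clk_strict[of s r] s t by auto
    then have "gam t w \<le> ennreal r" unfolding gam_def inverse_clock_def using r by (intro Inf_lower) auto
    then have "\<not> ennreal r < gam t w" by (rule leD)
    then show False using q r by auto
  qed
qed

text \<open>The Lipschitz bound makes the clock continuous, so at the inverse time the reading can
  neither lag behind \<open>t\<close> nor have passed it.\<close>

lemma clk_gam:
  assumes t: "0 \<le> t" "gam t w < ennreal u"
  shows "clk (gamr t w) w = ennreal t"
proof -
  define g where "g = gamr t w"
  have "gam t w < top" using t(2) by (rule less_trans) simp
  then have g: "gam t w = ennreal g" "0 \<le> g" by (auto simp: g_def)
  have gu: "g < u" using g t by (simp add: ennreal_less_iff)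
  from clk_step[OF w C] obtain a b where "0 < a \<and> 0 < b \<and> (\<forall>r s. 0 \<le> r \<longrightarrow> r \<le> s \<longrightarrow> s \<le> u \<longrightarrow>
    clk r w + ennreal (a * (s - r)) \<le> clk s w \<and> clk s w \<le> clk r w + ennreal (b * (s - r)))"
    by (elim exE)
  then have ab: "0 < a" "0 < b" "\<And>r s. 0 \<le> r \<Longrightarrow> r \<le> s \<Longrightarrow> s \<le> u \<Longrightarrow>
    clk r w + ennreal (a * (s - r)) \<le> clk s w \<and> clk s w \<le> clk r w + ennreal (b * (s - r))"
    by auto
  define A where "A s = enn2real (clk s w)" for s
  have A: "clk s w = ennreal (A s)" "0 \<le> A s" if "0 \<le> s" "s \<le> u" for s
    using clk_finite[OF that] by (auto simp: A_def)
  have lip: "A s \<le> A r + b * (s - r)" if "0 \<le> r" "r \<le> s" "s \<le> u" for r s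
  proof -
    have "ennreal (A s) \<le> ennreal (A r) + ennreal (b * (s - r))"
      using ab(3)[of r s] that A[of r] A[of s] by auto
    also have "\<dots> = ennreal (A r + b * (s - r))" using that ab A[of r] by (simp add: ennreal_plus)
    finally show ?thesis using that ab A[of r] by (subst (asm) ennreal_le_iff) auto
  qed
  have up: "t \<le> A s" if "g < s" "s \<le> u" for s
  proof -
    have "gam t w < ennreal s" using g that by (simp add: ennreal_lessI)
    then obtain r where r: "0 \<le> r" "ennreal t < clk r w" "ennreal r < ennreal s"
      unfolding gam_def inverse_clock_def ennreal_Inf_less_iff by auto
    have "r < s" using r by (simp add: ennreal_less_iff)
    then have "clk r w \<le> clk s w" by (intro clock_mono) auto
    with r(2) have "ennreal t < clk s w" by (rule less_le_trans)
    then have "ennreal t < ennreal (A s)" using A[of s] that g by simp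
    then show ?thesis using t by (simp add: ennreal_less_iff)
  qed
  have "t \<le> A g"
  proof (rule field_le_epsilon)
    fix e :: real assume e: "0 < e"
    \<comment> \<open>Over a step of length \<open>e / b\<close> the clock gains at most
      \<open>e\<close>; the minimum keeps the time in the range where the bounds hold.\<close>
    define s where "s = min u (g + e / b)"
    have s: "g < s" "s \<le> u" "b * (s - g) \<le> e" using gu e ab by (auto simp: s_def min_def field_simps)
    have "t \<le> A s" by (rule up[OF s(1,2)])
    also have "\<dots> \<le> A g + b * (s - g)" using s g by (intro lip) auto
    finally show "t \<le> A g + e" using s(3) by simp
  qed
  moreover have "A g \<le> t"
  proof (rule ccontr)
    assume "\<not> A g \<le> t"
    then have *: "t < A g" by simp
    have "0 < g"
      using * t g A[of 0] gu clk_0[of w] by (cases "g = 0") (auto simp: A_def)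
    \<comment> \<open>Going back this far loses at most half of the excess \<open>A g - t\<close>,
      so the clock already exceeds \<open>t\<close> before \<open>g\<close>; the maximum keeps the
      time nonnegative.\<close>
    define r where "r = max 0 (g - (A g - t) / (2 * b))"
    have r: "0 \<le> r" "r < g" using \<open>0 < g\<close> * ab by (auto simp: r_def)
    have "b * (g - r) \<le> (A g - t) / 2" using ab by (auto simp: r_def max_def field_simps)
    then have "t < A r" using lip[of r g] r gu * by simp
    then have "ennreal t < clk r w" using A[of r] r gu t by (simp add: ennreal_less_iff)
    then have "gam t w \<le> ennreal r" unfolding gam_def inverse_clock_def using r by (intro Inf_lower) auto
    then show False using g r by simp
  qed
  ultimately have "A g = t" by simp
  moreover have "clk g w = ennreal (A g)" using g(2) gu by (intro A(1)) auto
  ultimately show ?thesis unfolding g_def by simp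
qed

text \<open>The preimage of \<open>r\<close> is its clock reading. The time change skips no part of
  the path, so a property of the time-changed path up to \<open>t\<close> is one of the original
  path up to the inverse clock.\<close>

lemma gam_surj:
  assumes t: "0 \<le> t" "gam t w < ennreal u" and r: "0 \<le> r" "r \<le> gamr t w"
  shows "\<exists>s. 0 \<le> s \<and> s \<le> t \<and> gam s w = ennreal r \<and> (r < gamr t w \<longrightarrow> s < t)"
proof -
  have "gam t w < top" using t(2) by (rule less_trans) simp
  then have gu: "gamr t w < u" using t(2) by (cases "gam t w") (auto simp: ennreal_less_iff)
  define s where "s = enn2real (clk r w)"
  have s: "clk r w = ennreal s" "0 \<le> s" using clk_finite[of r] r gu by (auto simp: s_def)
  have "gam s w = ennreal r" using gam_clk[of r s] r gu s by auto
  moreover have "ennreal s \<le> ennreal t"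
    using clock_mono[OF r(2), of v0 "\<lambda>s w. Some (w s)" w] clk_gam[OF t] s by simp
  moreover have "ennreal s < ennreal t" if "r < gamr t w"
    using clk_strict[OF r(1) that] gu clk_gam[OF t] s by simp
  ultimately show ?thesis using s t by (intro exI[of _ s]) (auto simp: ennreal_less_iff)
qed

lemma gam_strict:
  assumes t: "0 \<le> t'" "t' < t" "gam t w < ennreal u"
  shows "gamr t' w < gamr t w"
proof (rule ccontr)
  assume *: "\<not> gamr t' w < gamr t w"
  have "gam t' w \<le> gam t w" using t by (intro gam_mono) auto
  then have lt: "gam t' w < ennreal u" using t(3) by simp
  have "gam t w < top" using t(3) by (rule less_trans) simp
  then have "gamr t' w = gamr t w" using * gamr_mono[of t' t w] t by auto
  then have "ennreal t' = ennreal t" using clk_gam[of t'] clk_gam[of t] t lt by auto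
  then show False using t by simp
qed

end

end

section \<open>The inversion property for paths\<close>

text \<open>Laws of processes are stated for completed measures, since killing on exit involves
  uncountably many times. Such an event is handled through a measurable set with which it agrees
  almost surely.\<close>

lemma emeasure_completion_AE:
  assumes A: "A \<in> sets M" and B: "B \<subseteq> space M" and ae: "AE x in M. x \<in> A \<longleftrightarrow> x \<in> B"
  shows "emeasure (completion M) B = emeasure M A" "B \<in> sets (completion M)"
proof -
  from AE_E[OF ae] obtain N where N: "{x\<in>space M. \<not> (x \<in> A \<longleftrightarrow> x \<in> B)} \<subseteq> N" "emeasure M N = 0" "N \<in> sets M" by auto
  have "A \<subseteq> space M" using sets.sets_into_space[OF A] .
  then have "B = (A - N) \<union> (B \<inter> N)" using N(1) B by auto
  then show s: "B \<in> sets (completion M)"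
    by (rule sets_completionI[where N'=N]) (use N A in auto)
  have "emeasure (completion M) B = emeasure (completion M) A"
    using ae A s by (intro emeasure_eq_AE) (auto dest: AE_completion simp: eq_commute)
  then show "emeasure (completion M) B = emeasure M A" using A by simp
qed

lemma ennreal_div_self: "0 < (a::ennreal) \<Longrightarrow> a < \<infinity> \<Longrightarrow> a / a = 1"
  by (simp add: ennreal_divide_self less_top)

lemma ennreal_mult_div_cancel: "0 < (a::ennreal) \<Longrightarrow> a < \<infinity> \<Longrightarrow> a * (b / a) = b"
  by (metis ennreal_times_divide ennreal_div_self mult.commute mult.right_neutral infinity_ennreal_def)

lemma visits_append: "visits z r (l @ [(0, B)]) \<longleftrightarrow> visits z r l \<and> z (r + total l) \<in> Some ` B"
proof (induct l arbitrary: r)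
  case (Cons a l)
  then show ?case by (cases a) (simp add: add.assoc)
qed simp

lemma total_append: "total (l @ [(0, B)]) = total l"
  by (simp add: total_def)

lemma valid_append: "valid_list T (l @ [(0, B)]) \<longleftrightarrow> valid_list T l \<and> B \<in> sets (borel_of T)"
  by (induct l) (auto simp: valid_list_def)

text \<open>A path that is still inside at \<open>t\<close> may have exit time equal to
  \<open>t\<close>, because the infimum need not be attained; the behaviour just after
  \<open>t\<close> decides.\<close>

lemma exit_time_gt:
  assumes "0 \<le> t" "\<And>s. 0 \<le> s \<Longrightarrow> s \<le> t \<Longrightarrow> Z s om \<in> Some ` B" "eventually (\<lambda>s. Z s om \<in> Some ` B) (at_right t)"
  shows "ennreal t < exit_time Z B om"
proof -
  from assms(3) obtain b where b: "b > t" "\<And>s. t < s \<Longrightarrow> s < b \<Longrightarrow> Z s om \<in> Some ` B"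
    by (auto simp: eventually_at_right_field)
  have "ennreal b \<le> exit_time Z B om"
    unfolding exit_time_def
  proof (rule Inf_greatest)
    fix x assume "x \<in> ennreal ` {s. 0 \<le> s \<and> Z s om \<notin> Some ` B}"
    then obtain s where s: "x = ennreal s" "0 \<le> s" "Z s om \<notin> Some ` B" by auto
    have "\<not> s < b" using assms(2)[of s] b(2)[of s] s by (cases "s \<le> t") auto
    then show "ennreal b \<le> x" using s by (simp add: ennreal_leI)
  qed
  moreover have "ennreal t < ennreal b" using b assms(1) by (simp add: ennreal_lessI)
  ultimately show ?thesis by (simp add: less_le_trans)
qed

lemma exit_time_less_in:
  assumes "ennreal t < exit_time Z B om" "0 \<le> s" "s \<le> t"
  shows "Z s om \<in> Some ` B"
proof (rule ccontr)
  assume "Z s om \<notin> Some ` B"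
  then have "exit_time Z B om \<le> ennreal s" unfolding exit_time_def using assms by (intro Inf_lower) auto
  also have "\<dots> \<le> ennreal t" using assms by (intro ennreal_leI)
  finally show False using assms(1) by simp
qed

lemma exit_time_ge:
  assumes "\<And>s. 0 \<le> s \<Longrightarrow> s \<le> u \<Longrightarrow> Z s om \<in> Some ` B"
  shows "ennreal u \<le> exit_time Z B om"
  unfolding exit_time_def
proof (rule Inf_greatest)
  fix x assume "x \<in> ennreal ` {s. 0 \<le> s \<and> Z s om \<notin> Some ` B}"
  then obtain s where s: "x = ennreal s" "0 \<le> s" "Z s om \<notin> Some ` B" by auto
  then have "\<not> s \<le> u" using assms by auto
  then show "ennreal u \<le> x" using s by (simp add: ennreal_leI)
qed

text \<open>Gains a strict margin after \<open>u\<close>, at the price of the next member of the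
  exhaustion. Events such as \<open>alive\<close> ask for confinement beyond the inverse clock and
  not only up to it.\<close>

lemma (in exhaustible) stays_extend:
  assumes "exhausts T K D" "w \<in> stays (K m) u" "0 \<le> u"
  shows "\<exists>u'>u. w \<in> stays (K (Suc m)) u'"
proof -
  have w: "w \<in> rc_paths T" "\<And>s. 0 \<le> s \<Longrightarrow> s \<le> u \<Longrightarrow> w s \<in> K m" using assms(2) by (auto simp: stays_def)
  have sub: "K m \<subseteq> T interior_of K (Suc m)" by (rule exhausts_interior[OF assms(1)])
  have "w u \<in> T interior_of K (Suc m)" using w(2)[of u] assms(3) sub by auto
  then have "eventually (\<lambda>s. w s \<in> T interior_of K (Suc m)) (at_right u)"
    using rc_pathsD[OF w(1) assms(3) openin_interior_of] by simp
  then obtain b where b: "b > u" "\<And>s. u < s \<Longrightarrow> s < b \<Longrightarrow> w s \<in> T interior_of K (Suc m)"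
    by (auto simp: eventually_at_right_field)
  have "w s \<in> K (Suc m)" if "0 \<le> s" "s \<le> (u + b) / 2" for s
  proof (cases "s \<le> u")
    case True
    then show ?thesis using w(2)[of s] that exhausts_mono[OF assms(1), of m "Suc m"] by auto
  next
    case False
    then have "w s \<in> T interior_of K (Suc m)" using that b(1) by (intro b(2)) auto
    then show ?thesis using interior_of_subset[of T "K (Suc m)"] by auto
  qed
  then show ?thesis using b(1) w(1) by (intro exI[of _ "(u + b) / 2"]) (auto simp: stays_def)
qed

section \<open>The time change and inversion of \<open>X\<close>\<close>

locale inv_process = std_process +
  fixes I :: "'a option \<Rightarrow> 'a option" and h :: "'a option \<Rightarrow> ennreal" and v :: "'a option \<Rightarrow> real"
  assumes invp: "inversion_property S (points S) P (\<lambda>t om. Some (X t om)) I h v"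
    and cc: "continuous_characteristics S (points S) I h"
begin

abbreviation "Xo \<equiv> (\<lambda>t om. Some (X t om))"

sublocale time_change S M \<F> P X v
proof unfold_locales
  have "\<forall>y\<in>U0. 0 < v y" using invp unfolding inversion_property_def by (elim conjE)
  then show "y \<in> U0 \<Longrightarrow> 0 < v y" for y by auto
  show "continuous_map (subtopology T U0) euclideanreal v"
    using invp unfolding inversion_property_def by (elim conjE)
qed

lemma I_E: "x \<in> points S \<Longrightarrow> I x \<in> points S"
proof -
  have "I \<in> points S \<rightarrow> points S" using invp unfolding inversion_property_def by (elim conjE)
  then show "x \<in> points S \<Longrightarrow> I x \<in> points S" by auto
qed

lemma I_I: "x \<in> points S \<Longrightarrow> I (I x) = x"
proof -
  have "\<forall>x\<in>points S. I (I x) = x" using invp unfolding inversion_property_def by (elim conjE)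
  then show "x \<in> points S \<Longrightarrow> I (I x) = x" by auto
qed

lemma h_pos: "x \<in> U0 \<Longrightarrow> 0 < h x" "x \<in> U0 \<Longrightarrow> h x < \<infinity>"
proof -
  have "\<forall>x\<in>U0. 0 < h x \<and> h x < \<infinity>" using invp unfolding inversion_property_def by (elim conjE)
  then show "x \<in> U0 \<Longrightarrow> 0 < h x" "x \<in> U0 \<Longrightarrow> h x < \<infinity>" by auto
qed

lemma X_law: "x \<in> points S \<Longrightarrow> has_markov_law T (P x) (inverted_process I v U0 Xo) (doob_semigroup P Xo U0 h) (I x)"
proof -
  have "\<forall>x\<in>points S. has_markov_law T (P x) (inverted_process I v U0 Xo) (doob_semigroup P Xo U0 h) (I x)"
    using invp unfolding inversion_property_def by (elim conjE)
  then show "x \<in> points S \<Longrightarrow> has_markov_law T (P x) (inverted_process I v U0 Xo) (doob_semigroup P Xo U0 h) (I x)" by auto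
qed

lemma I_cont: "continuous_map (subtopology T U0) T I" and h_cont: "continuous_map (subtopology T U0) euclidean h"
  using cc unfolding continuous_characteristics_def by auto

lemma U0_BE: "U0 \<in> sets BE"
  by (rule openin_borel_of[OF openin_U0])

lemma I_measurable: "I \<in> measurable (restrict_space BE U0) BE"
  by (rule continuous_map_measurable_restrict[OF I_cont U0_sub])

text \<open>The value \<open>0\<close> outside \<open>U0\<close> encodes killing: almost surely a
  path of \<open>X\<close> that has left \<open>U0\<close> does not return, so a weight at the last
  time already discards every path that died earlier.\<close>

definition h0 :: "'a option \<Rightarrow> ennreal" where
  "h0 y = (if y \<in> U0 then h y else 0)"

lemma h0_measurable: "h0 \<in> borel_measurable BE"
proof -
  have "h \<in> measurable (restrict_space BE U0) borel"
    using continuous_map_measurable_restrict[OF h_cont U0_sub] by (simp add: borel_of_euclidean)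
  then have "(\<lambda>y. if y \<in> U0 then h y else 0) \<in> borel_measurable BE"
    using sets.Int[OF U0_BE sets.top[of BE]] by (subst measurable_restrict_space_iff[symmetric]) auto
  then show ?thesis by (simp add: h0_def[abs_def])
qed

lemma Kx_outside:
  assumes "z \<in> points S" "z \<notin> U0" "0 \<le> s"
  shows "Kx s g z = g z"
proof -
  interpret prob_space "P z" using assms(1) by (rule P_prob)
  have "\<forall>x\<in>points S - U0. AE om in P x. \<forall>t\<ge>0. X t om = x"
    using absorbed unfolding absorbed_at_boundary_def by (elim conjE)
  then have "AE om in P z. \<forall>t\<ge>0. X t om = z" using assms by auto
  then have "Kx s g z = (\<integral>\<^sup>+om. g z \<partial>P z)"
    unfolding Kx_def using assms(3) by (intro nn_integral_cong_AE) (auto elim!: eventually_mono)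
  then show ?thesis by (simp add: emeasure_space_1)
qed

text \<open>By absorption, being in \<open>U0\<close> at time \<open>t\<close> means almost surely
  not having left it before. The exit time thus disappears from the semigroup.\<close>

lemma killed_semigroup_X:
  assumes y: "y \<in> points S" and t: "0 \<le> t"
  shows "killed_semigroup P Xo U0 t f y = Kx t (\<lambda>z. indicator U0 z * f z) y"
  unfolding killed_semigroup_def nn_integral_completion Kx_def
proof (rule nn_integral_cong_AE)
  have "AE om in P y. om \<in> space M" using AE_space[of "P y"] y by simp
  with absorb_AE[OF y]
  show "AE om in P y. (if ennreal t < exit_time Xo U0 om then case Some (X t om) of None \<Rightarrow> 0 | Some y \<Rightarrow> f y else 0) =
      indicator U0 (X t om) * f (X t om)"
  proof eventually_elim
    case (elim om)
    have "ennreal t < exit_time Xo U0 om \<longleftrightarrow> X t om \<in> U0"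
    proof
      assume "ennreal t < exit_time Xo U0 om"
      from exit_time_less_in[OF this t order_refl] show "X t om \<in> U0" by auto
    next
      assume Xt: "X t om \<in> U0"
      show "ennreal t < exit_time Xo U0 om"
      proof (rule exit_time_gt[OF t])
        show "Some (X s om) \<in> Some ` U0" if "0 \<le> s" "s \<le> t" for s
          using elim(1)[rule_format, OF t Xt] that by (intro imageI) auto
        have "eventually (\<lambda>s. X s om \<in> U0) (at_right t)"
          using rc_pathsD[OF path_rc[OF elim(2)] t openin_U0] Xt by simp
        then show "eventually (\<lambda>s. Some (X s om) \<in> Some ` U0) (at_right t)"
          by eventually_elim auto
      qed
    qed
    then show ?case by simp
  qed
qed

lemma nest_h0_outside:
  "valid_list T l \<Longrightarrow> z \<in> points S \<Longrightarrow> z \<notin> U0 \<Longrightarrow> nest Kx l h0 z = 0"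
proof (induct l)
  case (Cons a l)
  obtain s B where "a = (s, B)" by (cases a)
  then show ?case using Cons by (simp add: Kx_outside)
qed (simp add: h0_def)

lemma fdd_X:
  assumes "valid_list T l" "y \<in> U0"
  shows "fdd (doob_semigroup P Xo U0 h) l y = nest Kx l h0 y / h y"
  using assms
proof (induct l arbitrary: y)
  case Nil
  then show ?case using h_pos[of y] by (simp add: h0_def ennreal_div_self)
next
  case (Cons a l)
  obtain s B where a: "a = (s, B)" by (cases a)
  have v: "0 \<le> s" "valid_list T l" using Cons.prems a by auto
  have yE: "y \<in> points S" using U0_sub Cons.prems by auto
  have B': "U0 \<inter> {y. 0 < h y \<and> h y < \<infinity>} = U0" using h_pos by auto
  have "fdd (doob_semigroup P Xo U0 h) (a # l) y =
      Kx s (\<lambda>z. indicator U0 z * (h z * (indicator B z * fdd (doob_semigroup P Xo U0 h) l z))) y / h y"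
    unfolding a fdd.simps doob_semigroup_def Let_def B' using Cons.prems(2) killed_semigroup_X[OF yE v(1)] by simp
  also have "Kx s (\<lambda>z. indicator U0 z * (h z * (indicator B z * fdd (doob_semigroup P Xo U0 h) l z))) y =
     Kx s (\<lambda>z. indicator B z * nest Kx l h0 z) y"
  proof -
    have "indicator U0 (X s om) * (h (X s om) * (indicator B (X s om) * fdd (doob_semigroup P Xo U0 h) l (X s om)))
      = indicator B (X s om) * nest Kx l h0 (X s om)" if "om \<in> space (P y)" for om
    proof (cases "X s om \<in> U0")
      case True
      then have "nest Kx l h0 (X s om) = h (X s om) * fdd (doob_semigroup P Xo U0 h) l (X s om)"
        using Cons.hyps[OF v(2) True] h_pos by (simp add: ennreal_mult_div_cancel)
      then show ?thesis using True by (simp add: mult.left_commute)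
    next
      case False
      moreover have "X s om \<in> points S" using X_space[OF v(1)] yE that by simp
      ultimately show ?thesis using nest_h0_outside[OF v(2)] by simp
    qed
    then show ?thesis unfolding Kx_def by (intro nn_integral_cong)
  qed
  finally show ?case by (simp add: a)
qed

lemma fdd_X_outside:
  "y \<notin> U0 \<Longrightarrow> fdd (doob_semigroup P Xo U0 h) ((s, B) # l) y = 0"
  by (simp add: doob_semigroup_def Let_def)

lemma inverted_process_eq:
  assumes D: "D \<subseteq> U0" and Z: "\<And>s. 0 \<le> s \<Longrightarrow> s \<le> u \<Longrightarrow> Z s om = Some (w s)" "\<And>s. 0 \<le> s \<Longrightarrow> s \<le> u \<Longrightarrow> w s \<in> D"
    and g: "gam t w < ennreal u"
  shows "inverted_process I v D Z t om = Some (I (w (gamr t w)))"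
proof -
  have eq: "inverse_clock v Z t om = gam t w"
    unfolding gam_def
  proof (rule inverse_clock_cong)
    show "(case Some (w s) of None \<Rightarrow> 0 | Some y \<Rightarrow> ennreal (1 / v0 y)) = (case Z s om of None \<Rightarrow> 0 | Some y \<Rightarrow> ennreal (1 / v y))"
      if "0 \<le> s" "s \<le> u" for s
      using Z[OF that] D by (auto simp: v0_def)
  qed (use g in \<open>simp add: gam_def\<close>)
  have "ennreal u \<le> exit_time Z D om" using Z by (intro exit_time_ge) auto
  then have "inverse_clock v Z t om < exit_time Z D om" using g eq by simp
  moreover have "gamr t w \<le> u" using g by (cases "gam t w") (auto simp: ennreal_less_iff)
  ultimately show ?thesis unfolding inverted_process_def eq using Z(1)[of "gamr t w"] by simp
qed

text \<open>Survival is a strict inequality between the inverse clock and the exit time, so density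
  provides a \<open>u\<close> between them.\<close>

lemma inverted_process_alive:
  assumes "inverted_process I v D Z t om \<noteq> None"
  shows "\<exists>u\<ge>0. inverse_clock v Z t om < ennreal u \<and> (\<forall>s\<in>{0..u}. Z s om \<in> Some ` D)"
proof -
  have lt: "inverse_clock v Z t om < exit_time Z D om" using assms by (auto simp: inverted_process_def split: if_splits)
  then obtain q where q: "inverse_clock v Z t om < q" "q < exit_time Z D om" using dense by blast
  then obtain u where u: "q = ennreal u" "0 \<le> u" by (cases q) (auto simp: top_unique)
  then show ?thesis using q exit_time_less_in[of u Z D om] by (intro exI[of _ u]) auto
qed

definition K0 :: "nat \<Rightarrow> 'a option set" where
  "K0 = (SOME K. exhausts T K U0)"

lemma K0: "exhausts T K0 U0"
  unfolding K0_def using exh[OF openin_U0] by (rule someI_ex)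

text \<open>A Borel version of the event that the inverse clock at \<open>t\<close> is smaller than
  the lifetime: confinement to one \<open>K0 m\<close> until some \<open>u\<close> strictly beyond
  the inverse clock. The strict gap allows \<open>u\<close> to be taken rational.\<close>

definition alive :: "real \<Rightarrow> (real \<Rightarrow> 'a option) set" where
  "alive t = {w\<in>rc_paths T. \<exists>m u. w \<in> stays (K0 m) u \<and> gam t w < ennreal u}"

lemma alive_sets: "alive t \<in> sets PA"
proof -
  have "alive t = (\<Union>m. \<Union>q::rat. stays (K0 m) (real_of_rat q) \<inter> {w\<in>space PA. gam t w < ennreal (real_of_rat q)})"
  proof (intro set_eqI iffI)
    fix w assume "w \<in> alive t"
    then obtain m u where w: "w \<in> rc_paths T" "w \<in> stays (K0 m) u" "gam t w < ennreal u" by (auto simp: alive_def)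
    obtain g where g: "gam t w = ennreal g" "0 \<le> g" using w(3) by (cases "gam t w") auto
    then have "g < u" using w(3) by (simp add: ennreal_less_iff)
    then obtain q where q: "g < real_of_rat q" "real_of_rat q < u" using of_rat_dense by blast
    have "w \<in> stays (K0 m) (real_of_rat q)" using w(2) q by (auto simp: stays_def)
    moreover have "gam t w < ennreal (real_of_rat q)" using g q by (simp add: ennreal_less_iff)
    ultimately show "w \<in> (\<Union>m. \<Union>q::rat. stays (K0 m) (real_of_rat q) \<inter> {w\<in>space PA. gam t w < ennreal (real_of_rat q)})"
      using w(1) by auto
  next
    fix w assume "w \<in> (\<Union>m. \<Union>q::rat. stays (K0 m) (real_of_rat q) \<inter> {w\<in>space PA. gam t w < ennreal (real_of_rat q)})"
    then show "w \<in> alive t" by (auto simp: alive_def)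
  qed
  also have "\<dots> \<in> sets PA"
  proof -
    have "{w\<in>space PA. gam t w < c} \<in> sets PA" for c using gam_measurable by measurable
    then show ?thesis
      by (intro sets.countable_UN'' sets.Int stays_closed exhausts_closed[OF K0]) (auto simp del: space_path_algebra)
  qed
  finally show ?thesis .
qed

lemma alive_gam: "w \<in> alive t \<Longrightarrow> gam t w < \<infinity>"
  by (auto simp: alive_def intro: less_trans)

lemma alive_mono: "w \<in> alive t \<Longrightarrow> s \<le> t \<Longrightarrow> w \<in> alive s"
  unfolding alive_def using gam_mono[of s t w] by (auto intro: le_less_trans)

lemma alive_U0: assumes "w \<in> alive t" "0 \<le> s" "s \<le> gamr t w" shows "w s \<in> U0"
proof -
  obtain m u where w: "w \<in> stays (K0 m) u" "gam t w < ennreal u" using assms(1) by (auto simp: alive_def)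
  have "gamr t w \<le> u" using w(2) by (cases "gam t w") (auto simp: ennreal_less_iff)
  then have "w s \<in> K0 m" using w(1) assms by (auto simp: stays_def)
  then show ?thesis using exhausts_subset[OF K0] by auto
qed

text \<open>On the almost sure set of \<open>good_AE\<close>, staying in \<open>U0\<close> up to
  \<open>u\<close> is confinement to some \<open>K0 m\<close>; this translates survival of the
  inverted process into \<open>alive\<close> for all \<open>t\<close> simultaneously.\<close>

lemma inverted_alive_AE:
  assumes x: "x \<in> points S"
  shows "AE om in P x. \<forall>t. inverted_process I v U0 Xo t om =
    (if path om \<in> alive t then Some (I (X (gamr t (path om)) om)) else None)"
proof -
  have "AE om in P x. om \<in> space M" using AE_space[of "P x"] x by simp
  with good_AE[OF x K0 order_refl] show ?thesis
  proof eventually_elim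
    case (elim om)
    show ?case
    proof
      fix t
      show "inverted_process I v U0 Xo t om =
        (if path om \<in> alive t then Some (I (X (gamr t (path om)) om)) else None)"
      proof (cases "path om \<in> alive t")
        case True
        then obtain m u where w: "path om \<in> stays (K0 m) u" "gam t (path om) < ennreal u" by (auto simp: alive_def)
        have "X s om \<in> U0" if "0 \<le> s" "s \<le> u" for s
          using w(1) that exhausts_subset[OF K0, of m] by (auto simp: stays_def)
        then show ?thesis using True inverted_process_eq[OF order_refl, of u Xo om "path om" t] w(2) by simp
      next
        case False
        have "inverted_process I v U0 Xo t om = None"
        proof (rule ccontr)
          assume "inverted_process I v U0 Xo t om \<noteq> None"
          from inverted_process_alive[OF this] obtain u where
            u: "0 \<le> u" "inverse_clock v Xo t om < ennreal u" "\<forall>s\<in>{0..u}. Some (X s om) \<in> Some ` U0"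
            by (elim exE conjE)
          have u3: "X s om \<in> U0" if "s \<in> {0..u}" for s using u(3)[rule_format, OF that] by auto
          then obtain m where m: "\<forall>s\<in>{0..u}. X s om \<in> K0 m" using elim(1) u(1) by blast
          have "gam t (path om) = inverse_clock v Xo t om"
            unfolding gam_def
          proof (rule inverse_clock_cong[OF _ u(2)])
            show "(case Some (X s om) of None \<Rightarrow> 0 | Some y \<Rightarrow> ennreal (1 / v y)) = (case Some (X s om) of None \<Rightarrow> 0 | Some y \<Rightarrow> ennreal (1 / v0 y))"
              if "0 \<le> s" "s \<le> u" for s
              using u3[of s] that by (simp add: v0_def)
          qed
          then have "path om \<in> alive t"
            using u(2) m path_rc[OF elim(2)] by (auto simp: alive_def stays_def intro!: exI[of _ m] exI[of _ u])
          then show False using False by simp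
        qed
        then show ?thesis using False by simp
      qed
    qed
  qed
qed

text \<open>Frozen at \<open>t\<close>, since beyond \<open>t\<close> the inverse clock may be
  infinite; on \<open>alive t\<close> the result is a genuine right-continuous path.\<close>

definition tc :: "real \<Rightarrow> (real \<Rightarrow> 'a option) \<Rightarrow> real \<Rightarrow> 'a option" where
  "tc t w = (\<lambda>s. I (w (gamr (min s t) w)))"

lemma tc_rc: assumes "w \<in> alive t" "0 \<le> t" shows "tc t w \<in> rc_paths T"
proof -
  have w: "w \<in> rc_paths T" using assms by (simp add: alive_def)
  have g: "(\<lambda>s. w (gamr (min s t) w)) \<in> rc_paths T"
    unfolding gam_def using alive_gam[OF assms(1)] by (intro time_changed_rc[OF w assms(2)]) (simp add: gam_def)
  have U: "w (gamr (min s t) w) \<in> U0" for s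
    using alive_gam[OF assms(1)] by (intro alive_U0[OF assms(1)] gamr_mono) auto
  show ?thesis unfolding rc_paths_def tc_def
  proof (intro CollectI allI impI)
    fix r :: real assume "0 \<le> r"
    then have "limitin T (\<lambda>s. w (gamr (min s t) w)) (w (gamr (min r t) w)) (at_right r)"
      using g by (simp add: rc_paths_def)
    from limitin_compose_on[OF I_cont this U] show "limitin T (\<lambda>s. I (w (gamr (min s t) w))) (I (w (gamr (min r t) w))) (at_right r)"
      using U by simp
  qed
qed

lemma gamr_measurable: "gamr s \<in> borel_measurable PA"
  using gam_measurable by measurable

lemma eval_gam_measurable: "(\<lambda>w. w (gamr s w)) \<in> measurable PA BE"
  by (rule eval_measurable[OF gamr_measurable]) auto

lemma tc_measurable:
  assumes "0 \<le> t"
  shows "tc t \<in> measurable (restrict_space PA (alive t)) PA"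
proof (rule path_measurableI)
  show "tc t w \<in> rc_paths T" if "w \<in> space (restrict_space PA (alive t))" for w
    using that tc_rc assms by (simp add: space_restrict_space)
  fix s :: real assume "0 \<le> s"
  have "(\<lambda>w. w (gamr (min s t) w)) \<in> measurable (restrict_space PA (alive t)) (restrict_space BE U0)"
  proof (rule measurable_restrict_space2)
    show "(\<lambda>w. w (gamr (min s t) w)) \<in> measurable (restrict_space PA (alive t)) BE"
      by (rule measurable_restrict_space1[OF eval_gam_measurable])
    show "(\<lambda>w. w (gamr (min s t) w)) \<in> space (restrict_space PA (alive t)) \<rightarrow> U0"
      using alive_gam by (auto simp: space_restrict_space intro!: alive_U0 gamr_mono)
  qed
  from measurable_compose[OF this I_measurable]
  show "(\<lambda>w. tc t w s) \<in> measurable (restrict_space PA (alive t)) BE" by (simp add: tc_def)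
qed

lemma alive_M:
  "{om\<in>space M. path om \<in> alive t} \<in> sets M"
proof -
  have "path -` alive t \<inter> space M = {om\<in>space M. path om \<in> alive t}" by auto
  then show ?thesis using measurable_sets[OF path_M alive_sets[of t]] by simp
qed

text \<open>By right-continuity the path stays in one compact piece for a positive time, and there
  the clock starts to run at once.\<close>

lemma alive_0:
  assumes w: "w \<in> rc_paths T" "w 0 \<in> U0"
  shows "w \<in> alive 0" "gam 0 w = 0"
proof -
  have "w 0 \<in> (\<Union>m. K0 m)" using w(2) K0 by (simp add: exhausts_def)
  then obtain m where "w 0 \<in> K0 m" by auto
  then have "w \<in> stays (K0 m) 0" using w by (simp add: stays_def)
  from stays_extend[OF K0 this order_refl] obtain u where u: "u > 0" "w \<in> stays (K0 (Suc m)) u" by auto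
  show "gam 0 w = 0"
    using gam_clk[OF u(2) exhausts_closed[OF K0] exhausts_subset[OF K0], of 0 0] u(1) by (simp add: clk_0)
  then show "w \<in> alive 0" using u w(1) by (auto simp: alive_def)
qed

text \<open>Not part of the assumptions but forced by the law: from an interior point the inverted
  process is alive at time \<open>0\<close>, whereas the Doob transform started outside
  \<open>U0\<close> carries no mass, so the identity would read \<open>1 = 0\<close>.\<close>

lemma I_U0:
  assumes x: "x \<in> U0"
  shows "I x \<in> U0"
proof (rule ccontr)
  assume n: "I x \<notin> U0"
  have xE: "x \<in> points S" using x U0_sub by auto
  interpret prob_space "P x" using xE by (rule P_prob)
  let ?A = "{om\<in>space (P x). visits (\<lambda>t. inverted_process I v U0 Xo t om) 0 [(0, points S)]}"
  have "emeasure (completion (P x)) ?A = fdd (doob_semigroup P Xo U0 h) [(0, points S)] (I x)"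
    using X_law[OF xE, unfolded has_markov_law_def, rule_format, of "[(0, points S)]"] sets.top[of BE] by simp
  also have "\<dots> = 0" by (rule fdd_X_outside[OF n])
  finally have 0: "emeasure (completion (P x)) ?A = 0" .
  have "AE om in P x. om \<in> space M" using AE_space[of "P x"] xE by simp
  with inverted_alive_AE[OF xE] P_start[OF xE] have "AE om in P x. om \<in> space (P x) \<longleftrightarrow> om \<in> ?A"
  proof eventually_elim
    case (elim om)
    have "path om \<in> alive 0" using alive_0[OF path_rc[OF elim(3)]] elim(2) x by simp
    then have "inverted_process I v U0 Xo 0 om = Some (I (X (gamr 0 (path om)) om))" using elim(1) by simp
    moreover have "I (X (gamr 0 (path om)) om) \<in> points S" using X_space elim(3) by (intro I_E) simp
    ultimately show ?case using elim(3) xE by simp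
  qed
  from emeasure_completion_AE(1)[OF sets.top _ this] have "emeasure (completion (P x)) ?A = 1"
    by (simp add: emeasure_space_1)
  then show False using 0 by simp
qed

lemma tc_preimage_sets:
  assumes t: "0 \<le> t" and V: "V \<in> sets PA"
  shows "{w\<in>alive t. tc t w \<in> V} \<in> sets PA"
proof -
  have sp: "space (restrict_space PA (alive t)) = alive t"
    using sets.sets_into_space[OF alive_sets[of t]] by (auto simp: space_restrict_space)
  have "tc t -` V \<inter> space (restrict_space PA (alive t)) \<in> sets (restrict_space PA (alive t))"
    by (rule measurable_sets[OF tc_measurable[OF t] V])
  also have "tc t -` V \<inter> space (restrict_space PA (alive t)) = {w\<in>alive t. tc t w \<in> V}" unfolding sp by auto
  finally have 4: "{w\<in>alive t. tc t w \<in> V} \<in> sets (restrict_space PA (alive t))" .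
  have 5: "alive t \<inter> space PA \<in> sets PA" by (rule sets.Int[OF alive_sets sets.top])
  show ?thesis using sets_restrict_space_iff[OF 5] 4 by (rule iffD1[THEN conjunct2])
qed

lemma tc_path_measurable:
  assumes x: "x \<in> points S" and t: "0 \<le> t"
  shows "(\<lambda>om. tc t (path om)) \<in> measurable (restrict_space (P x) {om\<in>space M. path om \<in> alive t}) PA"
proof (rule measurable_compose[OF _ tc_measurable[OF t]])
  show "path \<in> measurable (restrict_space (P x) {om\<in>space M. path om \<in> alive t}) (restrict_space PA (alive t))"
    by (rule measurable_restrict_space2)
      (use x measurable_restrict_space1[OF path_P[OF x]] in \<open>auto simp: space_restrict_space\<close>)
qed

text \<open>The density \<open>h0 (X t)\<close> sits at time \<open>t\<close>, so the
  finite-dimensional identity is used for lists that end exactly at \<open>t\<close>. Freezing both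
  paths at \<open>t\<close> lets these lists determine the law on path space.\<close>

theorem inversion_integral:
  assumes x: "x \<in> U0" and t: "0 \<le> t" and \<Phi>: "\<Phi> \<in> borel_measurable PA"
  shows "(\<integral>\<^sup>+om. indicator (alive t) (path om) * \<Phi> (tc t (path om)) \<partial>P x) =
    (\<integral>\<^sup>+om. h0 (X t om) * \<Phi> (\<lambda>s. X (min s t) om) \<partial>P (I x)) / h (I x)"
proof -
  have xE: "x \<in> points S" using x U0_sub by auto
  have y: "I x \<in> U0" by (rule I_U0[OF x])
  have yE: "I x \<in> points S" using y U0_sub by auto
  interpret X: prob_space "P x" using xE by (rule P_prob)
  interpret Y: prob_space "P (I x)" using yE by (rule P_prob)
  let ?A = "{om\<in>space M. path om \<in> alive t}"
  define m where "m = restrict_space (P x) ?A"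
  define n where "n = density (P (I x)) (\<lambda>om. h0 (X t om) / h (I x))"
  have AP: "?A \<in> sets (P x)" using alive_M[of t] xE by simp
  have spm: "space m = ?A" using xE by (auto simp: m_def space_restrict_space)
  have em: "emeasure m C = emeasure (P x) C" if "C \<subseteq> ?A" for C
    unfolding m_def using AP that by (intro emeasure_restrict_space) auto
  have h0X: "(\<lambda>om. h0 (X t om)) \<in> borel_measurable (P (I x))"
    by (rule measurable_compose[OF X_P[OF yE t] h0_measurable])
  have fac: "(\<integral>\<^sup>+om. h0 (X t om) / h (I x) * k om \<partial>P (I x)) = (\<integral>\<^sup>+om. h0 (X t om) * k om \<partial>P (I x)) / h (I x)"
    if "k \<in> borel_measurable (P (I x))" for k
  proof -
    have "(\<integral>\<^sup>+om. h0 (X t om) / h (I x) * k om \<partial>P (I x)) = (\<integral>\<^sup>+om. h0 (X t om) * k om / h (I x) \<partial>P (I x))"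
      by (intro nn_integral_cong) (simp add: divide_ennreal_def mult_ac)
    also have "\<dots> = (\<integral>\<^sup>+om. h0 (X t om) * k om \<partial>P (I x)) / h (I x)"
      using h0X that by (intro nn_integral_divide borel_measurable_times_ennreal)
    finally show ?thesis .
  qed
  have en: "emeasure n C = (\<integral>\<^sup>+om. h0 (X t om) * indicator C om \<partial>P (I x)) / h (I x)" if "C \<in> sets M" for C
  proof -
    have "emeasure n C = (\<integral>\<^sup>+om. h0 (X t om) / h (I x) * indicator C om \<partial>P (I x))"
      unfolding n_def using that h0X yE by (intro emeasure_density) auto
    moreover have "indicator C \<in> borel_measurable (P (I x))" using that yE by (intro borel_measurable_indicator) simp
    ultimately show ?thesis using fac[of "indicator C"] by simp
  qed
  have f: "(\<lambda>om. tc t (path om)) \<in> measurable m PA"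
    unfolding m_def by (rule tc_path_measurable[OF xE t])
  have g: "(\<lambda>om s. X (min s t) om) \<in> measurable n PA"
    using spath_P[OF yE t] by (simp add: n_def)
  have main: "emeasure m {om\<in>space m. visits (\<lambda>s. Some (tc t (path om) s)) 0 l} =
      emeasure n {om\<in>space n. visits (\<lambda>s. Some (X (min s t) om)) 0 l}"
    if l: "valid_list T l" "total l = t" for l
  proof -
    \<comment> \<open>The extra visit with increment \<open>0\<close> makes survival up to
      \<open>t\<close> part of the event, also when \<open>l\<close> is empty.\<close>
    let ?l = "l @ [(0, points S)]"
    have l': "valid_list T ?l" using l sets.top[of BE] by (simp add: valid_append)
    let ?B = "{om\<in>space (P x). visits (\<lambda>t. inverted_process I v U0 Xo t om) 0 ?l}"
    let ?C = "{om\<in>space m. visits (\<lambda>s. Some (tc t (path om) s)) 0 l}"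
    have "?C = {om\<in>space m. tc t (path om) \<in> {w\<in>rc_paths T. visits (\<lambda>s. Some (w s)) 0 l}}"
      using measurable_space[OF f] by auto
    also have "\<dots> = (\<lambda>om. tc t (path om)) -` {w\<in>rc_paths T. visits (\<lambda>s. Some (w s)) 0 l} \<inter> space m" by auto
    also have "\<dots> \<in> sets m" by (rule measurable_sets[OF f visits_path_sets[OF l(1) order_refl]])
    finally have Cm: "?C \<in> sets m" .
    then have CP: "?C \<in> sets (P x)" using AP unfolding m_def by (subst (asm) sets_restrict_space_iff) auto
    have CA: "?C \<subseteq> ?A" by (auto simp: spm)
    have "emeasure m ?C = emeasure (P x) ?C" by (rule em[OF CA])
    also have "\<dots> = emeasure (completion (P x)) ?B"
    proof (rule emeasure_completion_AE(1)[OF CP, symmetric])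
      have "AE om in P x. om \<in> space M" using AE_space[of "P x"] xE by simp
      with inverted_alive_AE[OF xE] show "AE om in P x. om \<in> ?C \<longleftrightarrow> om \<in> ?B"
      proof eventually_elim
        case (elim om)
        let ?Z = "\<lambda>t. inverted_process I v U0 Xo t om"
        show ?case
        proof (cases "path om \<in> alive t")
          case True
          have Zs: "?Z s = Some (tc t (path om) s)" if "0 \<le> s" "s \<le> t" for s
            using elim(1) alive_mono[OF True that(2)] that by (simp add: tc_def min_absorb1)
          have "visits ?Z 0 l = visits (\<lambda>s. Some (tc t (path om) s)) 0 l"
            using l Zs by (intro visits_cong) auto
          moreover have "?Z t \<in> Some ` points S"
            using Zs[of t] t rc_paths_topspace[OF tc_rc[OF True t] t] by simp
          ultimately show ?thesis using True elim(2) xE l by (simp add: visits_append spm)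
        next
          case False
          then have "?Z t = None" using elim(1) by simp
          then show ?thesis using False l by (auto simp: visits_append spm)
        qed
      qed
    qed auto
    also have "\<dots> = fdd (doob_semigroup P Xo U0 h) ?l (I x)"
      using X_law[OF xE] l' unfolding has_markov_law_def valid_list_def by auto
    also have "\<dots> = nest Kx ?l h0 (I x) / h (I x)" by (rule fdd_X[OF l' y])
    also have "nest Kx ?l h0 (I x) = (\<integral>\<^sup>+om. indicator {om. visits (\<lambda>s. Some (X s om)) 0 ?l} om * h0 (X (total ?l) om) \<partial>P (I x))"
      by (rule nest_Kx_eq[OF yE h0_measurable l'])
    also have "\<dots> = (\<integral>\<^sup>+om. h0 (X t om) * indicator {om\<in>space n. visits (\<lambda>s. Some (X (min s t) om)) 0 l} om \<partial>P (I x))"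
    proof (rule nn_integral_cong)
      fix om assume om: "om \<in> space (P (I x))"
      have "visits (\<lambda>s. Some (X s om)) 0 l = visits (\<lambda>s. Some (X (min s t) om)) 0 l"
        using l by (intro visits_cong) auto
      moreover have "X t om \<in> points S" using om yE X_space[OF t] by simp
      ultimately show "indicator {om. visits (\<lambda>s. Some (X s om)) 0 ?l} om * h0 (X (total ?l) om) =
        h0 (X t om) * indicator {om\<in>space n. visits (\<lambda>s. Some (X (min s t) om)) 0 l} om"
        using l om by (simp add: visits_append total_append n_def indicator_def)
    qed
    also have "\<dots> / h (I x) = emeasure n {om\<in>space n. visits (\<lambda>s. Some (X (min s t) om)) 0 l}"
    proof (rule en[symmetric])
      have "{om\<in>space n. visits (\<lambda>s. Some (X (min s t) om)) 0 l} = {om\<in>space M. visits (\<lambda>s. Some (X s om)) 0 l}"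
      proof (intro Collect_cong conj_cong)
        show "visits (\<lambda>s. Some (X (min s t) om)) 0 l = visits (\<lambda>s. Some (X s om)) 0 l" for om
          using l by (intro visits_cong) auto
      qed (simp add: n_def yE)
      then show "{om\<in>space n. visits (\<lambda>s. Some (X (min s t) om)) 0 l} \<in> sets M"
        using visits_X_sets[OF l(1) order_refl] by simp
    qed
    finally show ?thesis .
  qed
  have fm: "finite_measure m"
    using em[of ?A] by (intro finite_measureI) (simp add: spm)
  \<comment> \<open>The mass of \<open>n\<close> is read off from the identity itself, applied to a
    void constraint at time \<open>t\<close>.\<close>
  have "emeasure n (space n) = emeasure m (space m)"
  proof -
    have "valid_list T [(t, points S)]" using t sets.top[of BE] by simp
    from main[OF this] have "emeasure m {om\<in>space m. visits (\<lambda>s. Some (tc t (path om) s)) 0 [(t, points S)]} =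
      emeasure n {om\<in>space n. visits (\<lambda>s. Some (X (min s t) om)) 0 [(t, points S)]}" by simp
    moreover have "{om\<in>space m. visits (\<lambda>s. Some (tc t (path om) s)) 0 [(t, points S)]} = space m"
      using rc_paths_topspace[OF tc_rc[OF _ t] t] by (auto simp: spm)
    moreover have "{om\<in>space n. visits (\<lambda>s. Some (X (min s t) om)) 0 [(t, points S)]} = space n"
      using X_space[OF t] by (auto simp: n_def yE)
    ultimately show ?thesis by simp
  qed
  then have fn: "finite_measure n" using finite_measure.emeasure_finite[OF fm] by (intro finite_measureI) simp
  have eq: "distr m PA (\<lambda>om. tc t (path om)) = distr n PA (\<lambda>om s. X (min s t) om)"
    by (rule path_law_eq[OF fm fn f g, where Q="{t}" and c="\<lambda>s. min s t" and q=t]) (use t main in \<open>auto simp: tc_def\<close>)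
  have \<Phi>X: "(\<lambda>om. \<Phi> (\<lambda>s. X (min s t) om)) \<in> borel_measurable (P (I x))"
    by (rule measurable_compose[OF spath_P[OF yE t] \<Phi>])
  have "(\<integral>\<^sup>+om. indicator (alive t) (path om) * \<Phi> (tc t (path om)) \<partial>P x) = (\<integral>\<^sup>+om. \<Phi> (tc t (path om)) * indicator ?A om \<partial>P x)"
    using xE by (intro nn_integral_cong) (auto simp: indicator_def)
  also have "\<dots> = (\<integral>\<^sup>+om. \<Phi> (tc t (path om)) \<partial>m)"
    unfolding m_def using AP by (intro nn_integral_restrict_space[symmetric]) auto
  also have "\<dots> = (\<integral>\<^sup>+w. \<Phi> w \<partial>distr m PA (\<lambda>om. tc t (path om)))"
    by (subst nn_integral_distr[OF f]) (use \<Phi> in simp_all)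
  also have "\<dots> = (\<integral>\<^sup>+om. \<Phi> (\<lambda>s. X (min s t) om) \<partial>n)"
    unfolding eq by (subst nn_integral_distr[OF g]) (use \<Phi> in simp_all)
  also have "\<dots> = (\<integral>\<^sup>+om. h0 (X t om) / h (I x) * \<Phi> (\<lambda>s. X (min s t) om) \<partial>P (I x))"
    unfolding n_def using h0X \<Phi>X by (intro nn_integral_density) auto
  also have "\<dots> = (\<integral>\<^sup>+om. h0 (X t om) * \<Phi> (\<lambda>s. X (min s t) om) \<partial>P (I x)) / h (I x)"
    by (rule fac[OF \<Phi>X])
  finally show ?thesis .
qed

end

section \<open>The Doob transform on path space\<close>

text \<open>A variant for stopped paths, which agree with the original up to and including
  \<open>q\<close>; a member at \<open>q\<close> itself is allowed here.\<close>

lemma Inf_ennreal_agree':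
  fixes A B :: "real set"
  assumes "\<And>s. s \<le> q \<Longrightarrow> s \<in> A \<longleftrightarrow> s \<in> B" "\<exists>s\<in>A. s \<le> q"
  shows "Inf (ennreal ` A) = Inf (ennreal ` B)"
proof -
  have *: "Inf (ennreal ` A) \<le> Inf (ennreal ` B)"
    if AB: "\<And>s. s \<le> q \<Longrightarrow> s \<in> A \<longleftrightarrow> s \<in> B" and ex: "\<exists>s\<in>A. s \<le> q" for A B :: "real set"
  proof (rule Inf_greatest)
    fix x assume "x \<in> ennreal ` B"
    then obtain b where b: "x = ennreal b" "b \<in> B" by auto
    from ex obtain a where a: "a \<in> A" "a \<le> q" by auto
    show "Inf (ennreal ` A) \<le> x"
    proof (cases "b \<le> q")
      case True
      then have "b \<in> A" using AB b by auto
      then show ?thesis using b by (intro Inf_lower) auto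
    next
      case False
      have "Inf (ennreal ` A) \<le> ennreal a" using a by (intro Inf_lower) auto
      also have "\<dots> \<le> x" using a False b by (simp add: ennreal_leI)
      finally show ?thesis .
    qed
  qed
  have "\<exists>s\<in>B. s \<le> q" using assms by auto
  then show ?thesis using assms by (intro antisym *) auto
qed

lemma (in exhaustible) first_exit_measurable:
  assumes C: "closedin T C"
  shows "(\<lambda>w. Inf (ennreal ` {s. 0 \<le> s \<and> w s \<notin> C})) \<in> borel_measurable (path_algebra T)"
proof (rule borel_measurableI_less)
  fix y :: ennreal
  have Cc: "topspace T - C \<in> sets (borel_of T)" using sets.compl_sets[OF closedin_borel_of[OF C]] by simp
  have "{w\<in>space (path_algebra T). Inf (ennreal ` {s. 0 \<le> s \<and> w s \<notin> C}) < y} =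
    (\<Union>q\<in>{q. 0 \<le> real_of_rat q \<and> ennreal (real_of_rat q) < y}. {w\<in>space (path_algebra T). w (real_of_rat q) \<in> topspace T - C})"
  proof (intro set_eqI iffI)
    fix w assume "w \<in> {w\<in>space (path_algebra T). Inf (ennreal ` {s. 0 \<le> s \<and> w s \<notin> C}) < y}"
    then obtain s where s: "w \<in> rc_paths T" "0 \<le> s" "w s \<notin> C" "ennreal s < y"
      unfolding ennreal_Inf_less_iff by auto
    obtain b where b: "s < b" "ennreal b \<le> y"
    proof (cases y)
      case (real r)
      then show ?thesis using s(2,4) that[of r] by (simp add: ennreal_less_iff)
    next
      case top
      then show ?thesis using that[of "s + 1"] by simp
    qed
    have "\<exists>r\<in>\<rat>. 0 \<le> r \<and> r < b \<and> w r \<notin> C"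
    proof (rule ccontr)
      assume "\<not> (\<exists>r\<in>\<rat>. 0 \<le> r \<and> r < b \<and> w r \<notin> C)"
      then have "\<And>r. r \<in> \<rat> \<Longrightarrow> 0 \<le> r \<Longrightarrow> r < b \<Longrightarrow> w r \<in> C" by auto
      from closed_rationals[OF s(1) C this s(2) b(1)] s(3) show False by simp
    qed
    then obtain q where q: "0 \<le> real_of_rat q" "real_of_rat q < b" "w (real_of_rat q) \<notin> C"
      by (auto simp: Rats_def)
    then have "ennreal (real_of_rat q) < ennreal b" by (simp add: ennreal_less_iff)
    then have "ennreal (real_of_rat q) < y" using b(2) by (rule less_le_trans)
    then show "w \<in> (\<Union>q\<in>{q. 0 \<le> real_of_rat q \<and> ennreal (real_of_rat q) < y}. {w\<in>space (path_algebra T). w (real_of_rat q) \<in> topspace T - C})"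
      using q s(1) rc_paths_topspace[OF s(1) q(1)] by auto
  next
    fix w assume "w \<in> (\<Union>q\<in>{q. 0 \<le> real_of_rat q \<and> ennreal (real_of_rat q) < y}. {w\<in>space (path_algebra T). w (real_of_rat q) \<in> topspace T - C})"
    then obtain q where q: "0 \<le> real_of_rat q" "ennreal (real_of_rat q) < y" "w \<in> rc_paths T" "w (real_of_rat q) \<notin> C" by auto
    then have "Inf (ennreal ` {s. 0 \<le> s \<and> w s \<notin> C}) < y"
      unfolding ennreal_Inf_less_iff by (intro bexI[of _ "real_of_rat q"]) auto
    then show "w \<in> {w\<in>space (path_algebra T). Inf (ennreal ` {s. 0 \<le> s \<and> w s \<notin> C}) < y}" using q by simp
  qed
  also have "\<dots> \<in> sets (path_algebra T)"
    using Cc by (intro sets.countable_UN'' measurable_borel_ofD[OF path_eval]) auto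
  finally show "{w\<in>space (path_algebra T). Inf (ennreal ` {s. 0 \<le> s \<and> w s \<notin> C}) < y} \<in> sets (path_algebra T)" .
qed

section \<open>Comparison of the laws of \<open>Y\<close> and \<open>X\<close> up to a fixed
  time\<close>

locale prop4 = inv_process S M \<F> P X I h v
  for S :: "'a::euclidean_space set" and M :: "'w measure" and \<F> P X I h v +
  fixes F :: "'a option set" and H :: "'a option \<Rightarrow> real"
    and N :: "'a option \<Rightarrow> 'u measure" and Y :: "real \<Rightarrow> 'u \<Rightarrow> 'a option option"
  assumes F_BE: "F \<in> sets BE" and IF: "I ` F = F"
    and H_cont: "continuous_map (subtopology T F) euclideanreal H"
    and H_nonneg: "\<And>x. x \<in> F \<Longrightarrow> 0 \<le> H x" and H_int: "\<And>x. x \<in> interior_pts F \<Longrightarrow> 0 < H x"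
    and H_exc: "excessive T P (\<lambda>t om. Some (X t om)) F (\<lambda>x. ennreal (H x))"
    and Y_doob: "is_doob_transform T P (\<lambda>t om. Some (X t om)) F (\<lambda>x. ennreal (H x)) N Y"
begin

abbreviation "D \<equiv> interior_pts F"
abbreviation "QY \<equiv> doob_semigroup P Xo F (\<lambda>x. ennreal (H x))"

definition Hm :: "'a option \<Rightarrow> ennreal" where
  "Hm y = (if y \<in> F then ennreal (H y) else 0)"

text \<open>The states where the Doob transform carries mass. This set is only known to be Borel
  while the interior \<open>D\<close> is open, so the comparison of \<open>Y\<close> with
  \<open>X\<close> is exact for paths confined to \<open>D\<close> and one-sided on
  \<open>FH\<close>.\<close>

definition FH :: "'a option set" where
  "FH = {y\<in>F. 0 < H y}"

definition KD :: "nat \<Rightarrow> 'a option set" where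
  "KD = (SOME K. exhausts T K D)"

lemma F_E: "F \<subseteq> points S"
  using sets.sets_into_space[OF F_BE] by simp

lemma D_sub: "D \<subseteq> F" "D \<subseteq> U0" "D \<subseteq> FH"
proof -
  show "D \<subseteq> F" by (rule interior_pts_subset)
  then show "D \<subseteq> FH" using H_int by (auto simp: FH_def)
  show "D \<subseteq> U0" by (rule interior_pts_mono[OF F_E])
qed

lemma openin_D: "openin T D"
  by (rule openin_interior_pts[OF F_E])

lemma KD: "exhausts T KD D"
  unfolding KD_def using exh[OF openin_D] by (rule someI_ex)

lemma H_restrict: "H \<in> borel_measurable (restrict_space BE F)"
  using continuous_map_measurable_restrict[OF H_cont F_E] by (simp add: borel_of_euclidean)

lemma Hm_measurable: "Hm \<in> borel_measurable BE"
proof -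
  have "(\<lambda>y. ennreal (H y)) \<in> borel_measurable (restrict_space BE F)" using H_restrict by measurable
  then have "(\<lambda>y. if y \<in> F then ennreal (H y) else 0) \<in> borel_measurable BE"
    using sets.Int[OF F_BE sets.top[of BE]] by (subst measurable_restrict_space_iff[symmetric]) auto
  then show ?thesis by (simp add: Hm_def[abs_def])
qed

lemma H_preimage: "B \<in> sets borel \<Longrightarrow> {y\<in>F. H y \<in> B} \<in> sets BE"
  by (rule measurable_restrict_preimage[OF H_restrict F_BE])

lemma FH_BE: "FH \<in> sets BE"
  using H_preimage[of "{0<..}"] by (simp add: FH_def)

lemma FH_pos: "y \<in> FH \<Longrightarrow> 0 < ennreal (H y) \<and> ennreal (H y) < \<infinity>"
  by (simp add: FH_def)

lemma FH_eq: "F \<inter> {y. 0 < ennreal (H y) \<and> ennreal (H y) < \<infinity>} = FH"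
  by (auto simp: FH_def)

lemma Y_facts: assumes "x \<in> F"
  shows N_prob: "prob_space (N x)"
    and Y_sets: "\<And>t B. 0 \<le> t \<Longrightarrow> B \<in> sets BE \<Longrightarrow> {om\<in>space (N x). Y t om \<in> Some ` B} \<in> sets (N x)"
    and Y_rc: "\<And>om. om \<in> space (N x) \<Longrightarrow> right_continuous_killed (subtopology T F) (\<lambda>t. Y t om)"
    and Y_law: "has_markov_law T (N x) Y QY x"
  using Y_doob assms unfolding is_doob_transform_def by auto

lemma QY_FH: "y \<in> FH \<Longrightarrow> QY t f y = killed_semigroup P Xo FH t (\<lambda>z. ennreal (H z) * f z) y / ennreal (H y)"
  unfolding doob_semigroup_def Let_def FH_eq by simp

lemma QY_out: "y \<notin> FH \<Longrightarrow> QY t f y = 0"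
  unfolding doob_semigroup_def Let_def FH_eq by simp

text \<open>Omitting the condition on the exit time only enlarges each integrand, and the factors
  \<open>H\<close> then cancel from kernel to kernel. The integral is monotone even if the inner
  function is not measurable.\<close>

lemma fdd_upper:
  assumes "valid_list T l" "y \<in> FH"
  shows "fdd QY l y \<le> nest Kx l Hm y / ennreal (H y)"
  using assms
proof (induct l arbitrary: y)
  case Nil
  then show ?case using FH_pos[of y] by (simp add: Hm_def FH_def ennreal_div_self)
next
  case (Cons a l)
  obtain s B where a: "a = (s, B)" by (cases a)
  have v: "0 \<le> s" "valid_list T l" using Cons.prems a by auto
  have "killed_semigroup P Xo FH s (\<lambda>z. ennreal (H z) * (indicator B z * fdd QY l z)) y \<le> Kx s (\<lambda>z. indicator B z * nest Kx l Hm z) y"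
  proof -
    have "(if ennreal s < exit_time Xo FH om then case Some (X s om) of None \<Rightarrow> 0 | Some z \<Rightarrow> ennreal (H z) * (indicator B z * fdd QY l z) else 0)
      \<le> indicator B (X s om) * nest Kx l Hm (X s om)" for om
    proof (cases "ennreal s < exit_time Xo FH om")
      case True
      from exit_time_less_in[OF True v(1) order_refl] have XF: "X s om \<in> FH" by auto
      have "ennreal (H (X s om)) * fdd QY l (X s om) \<le> ennreal (H (X s om)) * (nest Kx l Hm (X s om) / ennreal (H (X s om)))"
        using Cons.hyps[OF v(2) XF] by (intro mult_left_mono) auto
      also have "\<dots> = nest Kx l Hm (X s om)"
        using FH_pos[OF XF] by (intro ennreal_mult_div_cancel) auto
      finally have "indicator B (X s om) * (ennreal (H (X s om)) * fdd QY l (X s om)) \<le> indicator B (X s om) * nest Kx l Hm (X s om)"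
        by (intro mult_left_mono) auto
      then show ?thesis using True by (simp add: mult.left_commute)
    qed simp
    then show ?thesis unfolding killed_semigroup_def nn_integral_completion Kx_def by (intro nn_integral_mono)
  qed
  then show ?case unfolding a fdd.simps nest.simps QY_FH[OF Cons.prems(2)]
    by (rule divide_right_mono_ennreal)
qed

text \<open>The Borel form of staying in \<open>D\<close> on a closed time interval; for
  \<open>X\<close> the two events differ by a null set.\<close>

definition SD :: "real \<Rightarrow> (real \<Rightarrow> 'a option) set" where
  "SD t = (\<Union>m. stays (KD m) t)"

lemma SD_sets: "SD t \<in> sets PA"
  unfolding SD_def using stays_closed[OF exhausts_closed[OF KD]] by auto

lemma SD_in: "w \<in> SD t \<Longrightarrow> 0 \<le> s \<Longrightarrow> s \<le> t \<Longrightarrow> w s \<in> D"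
proof -
  assume "w \<in> SD t" "0 \<le> s" "s \<le> t"
  then obtain m where "\<forall>r\<in>{0..t}. w r \<in> KD m" by (auto simp: SD_def stays_def)
  then have "w s \<in> KD m" using \<open>0 \<le> s\<close> \<open>s \<le> t\<close> by auto
  then show ?thesis using exhausts_subset[OF KD] by auto
qed

lemma SD_mono: "w \<in> SD t \<Longrightarrow> s \<le> t \<Longrightarrow> w \<in> SD s"
proof -
  assume "w \<in> SD t" "s \<le> t"
  then obtain m where "w \<in> stays (KD m) t" by (auto simp: SD_def)
  then have "w \<in> stays (KD m) s" using \<open>s \<le> t\<close> by (simp add: stays_def)
  then show ?thesis by (auto simp: SD_def)
qed

text \<open>Confinement to \<open>KD m\<close> before time \<open>t\<close> and to
  \<open>KD n\<close> after it combine to \<open>KD (max m n)\<close>. This multiplicativity is what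
  makes killing outside \<open>SD\<close> compatible with the Markov property.\<close>

lemma SD_split:
  assumes w: "w \<in> rc_paths T" and "0 \<le> t" "0 \<le> s"
  shows "w \<in> SD (t + s) \<longleftrightarrow> w \<in> SD t \<and> (\<lambda>r. w (t + r)) \<in> SD s"
proof
  assume *: "w \<in> SD (t + s)"
  then obtain m where m: "w \<in> stays (KD m) (t + s)" by (auto simp: SD_def)
  have "(\<lambda>r. w (t + r)) \<in> stays (KD m) s"
    using m assms shift_rc_paths[OF w] by (auto simp: stays_def)
  then show "w \<in> SD t \<and> (\<lambda>r. w (t + r)) \<in> SD s"
    using SD_mono[OF *, of t] assms by (auto simp: SD_def)
next
  assume "w \<in> SD t \<and> (\<lambda>r. w (t + r)) \<in> SD s"
  then obtain m n where m: "w \<in> stays (KD m) t" and n: "(\<lambda>r. w (t + r)) \<in> stays (KD n) s" by (auto simp: SD_def)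
  have "w r \<in> KD (max m n)" if "0 \<le> r" "r \<le> t + s" for r
  proof (cases "r \<le> t")
    case True
    then have "w r \<in> KD m" using m that by (auto simp: stays_def)
    then show ?thesis using exhausts_mono[OF KD, of m "max m n"] by auto
  next
    case False
    then have "r - t \<in> {0..s}" using that by auto
    moreover have "\<forall>x\<in>{0..s}. w (t + x) \<in> KD n" using n by (simp add: stays_def)
    ultimately have "w (t + (r - t)) \<in> KD n" by blast
    then show ?thesis using exhausts_mono[OF KD, of n "max m n"] by auto
  qed
  then have "w \<in> stays (KD (max m n)) (t + s)" using w by (simp add: stays_def)
  then show "w \<in> SD (t + s)" by (auto simp: SD_def)
qed

lemma SD_stop: "w \<in> rc_paths T \<Longrightarrow> 0 \<le> t \<Longrightarrow> (\<lambda>s. w (min s t)) \<in> SD t \<longleftrightarrow> w \<in> SD t"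
  using stop_rc_paths[of w t] by (auto simp: SD_def stays_def min_def)

lemma SD_F:
  assumes "0 \<le> t"
  shows "{om\<in>space M. path om \<in> SD t} \<in> sets (\<F> (ennreal t))"
proof -
  have "{om\<in>space M. path om \<in> SD t} = (\<lambda>om s. X (min s t) om) -` SD t \<inter> space (\<F> (ennreal t))"
    using SD_stop[OF path_rc assms] by auto
  then show ?thesis using measurable_sets[OF spath_F[OF assms] SD_sets] by simp
qed

definition Rx :: "real \<Rightarrow> ('a option \<Rightarrow> ennreal) \<Rightarrow> 'a option \<Rightarrow> ennreal" where
  "Rx t g y = (\<integral>\<^sup>+om. indicator (SD t) (path om) * g (X t om) \<partial>P y)"

lemma Rx_functional:
  fixes g :: "'a option \<Rightarrow> ennreal"
  assumes "0 \<le> t" "g \<in> borel_measurable BE"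
  shows "(\<lambda>w. indicator (SD t) w * g (w t)) \<in> borel_measurable PA"
proof -
  from assms have "(\<lambda>w. g (w t)) \<in> borel_measurable PA" by (intro measurable_compose[OF path_eval])
  then show ?thesis
    by (rule borel_measurable_times_ennreal[OF borel_measurable_indicator[OF SD_sets]])
qed

lemma Rx_Lx:
  "y \<in> points S \<Longrightarrow> 0 \<le> t \<Longrightarrow> g \<in> borel_measurable BE \<Longrightarrow> Rx t g y = (\<integral>\<^sup>+w. indicator (SD t) w * g (w t) \<partial>Lx y)"
  unfolding Rx_def by (rule nn_integral_Lx[OF _ Rx_functional, symmetric])

lemma Rx_measurable:
  assumes "0 \<le> t" "g \<in> borel_measurable BE"
  shows "Rx t g \<in> borel_measurable BE"
  using Lx_integral_measurable[OF Rx_functional[OF assms]]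
    measurable_cong[of BE "Rx t g" "\<lambda>y. \<integral>\<^sup>+w. indicator (SD t) w * g (w t) \<partial>Lx y" borel] Rx_Lx[OF _ assms]
  by simp

lemma nest_Rx_measurable:
  "valid_list T l \<Longrightarrow> g \<in> borel_measurable BE \<Longrightarrow> nest Rx l g \<in> borel_measurable BE"
proof (induct l)
  case Nil
  moreover have "nest Rx [] g = g" by auto
  ultimately show ?case by simp
next
  case (Cons a l)
  obtain s B where a: "a = (s, B)" by (cases a)
  have "(\<lambda>y. indicator B y * nest Rx l g y) \<in> borel_measurable BE"
    using Cons a by (intro borel_measurable_times_ennreal borel_measurable_indicator) auto
  then have "Rx s (\<lambda>y. indicator B y * nest Rx l g y) \<in> borel_measurable BE"
    using Cons a by (intro Rx_measurable) auto
  moreover have "nest Rx (a # l) g = Rx s (\<lambda>y. indicator B y * nest Rx l g y)" by (auto simp: a)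
  ultimately show ?case by simp
qed

text \<open>As for \<open>markov_nest\<close>, except that the confinement up to
  \<open>t + s\<close> is split at \<open>t\<close>: its past part belongs to the filtration at
  \<open>t\<close>, its future part is a functional of the shifted path.\<close>

lemma markov_nest_Rx:
  assumes x: "x \<in> points S" and g: "g \<in> borel_measurable BE" and l: "valid_list T l"
    and t: "0 \<le> t" and A: "A \<in> sets (\<F> (ennreal t))"
  shows "(\<integral>\<^sup>+om. indicator A om * (indicator {om. visits (\<lambda>s. Some (X s om)) t l} om * (indicator (SD (t + total l)) (path om) * g (X (t + total l) om))) \<partial>P x)
      = (\<integral>\<^sup>+om. indicator A om * (indicator (SD t) (path om) * nest Rx l g (X t om)) \<partial>P x)"
  using l t A
proof (induct l arbitrary: t A)
  case (Cons a l)
  obtain s B where a: "a = (s, B)" by (cases a)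
  have v: "0 \<le> s" "B \<in> sets BE" "valid_list T l" using Cons.prems a by auto
  let ?A = "A \<inter> {om\<in>space (\<F> (ennreal (t + s))). X (t + s) om \<in> B}"
  have A': "?A \<in> sets (\<F> (ennreal (t + s)))"
    using F_mono[OF _ Cons.prems(3), of "ennreal (t + s)"] measurable_borel_ofD[OF X_F v(2), of "t + s"] v(1) Cons.prems(2)
    by (intro sets.Int) (auto intro: ennreal_leI)
  have A0: "A \<subseteq> space M" using sets.sets_into_space[OF F_sets[OF Cons.prems(3)]] .
  let ?AS = "A \<inter> {om\<in>space M. path om \<in> SD t}"
  have AS: "?AS \<in> sets (\<F> (ennreal t))" using Cons.prems SD_F by auto
  have gl: "(\<lambda>y. indicator B y * nest Rx l g y) \<in> borel_measurable BE"
    using v nest_Rx_measurable[OF v(3) g] by (intro borel_measurable_times_ennreal borel_measurable_indicator) auto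
  have "(\<integral>\<^sup>+om. indicator A om * (indicator {om. visits (\<lambda>s. Some (X s om)) t (a # l)} om * (indicator (SD (t + total (a # l))) (path om) * g (X (t + total (a # l)) om))) \<partial>P x)
      = (\<integral>\<^sup>+om. indicator ?A om * (indicator {om. visits (\<lambda>s. Some (X s om)) (t + s) l} om * (indicator (SD ((t + s) + total l)) (path om) * g (X ((t + s) + total l) om))) \<partial>P x)"
    using A0 by (intro nn_integral_cong) (auto simp: a indicator_def add.assoc)
  also have "\<dots> = (\<integral>\<^sup>+om. indicator ?A om * (indicator (SD (t + s)) (path om) * nest Rx l g (X (t + s) om)) \<partial>P x)"
    using v Cons.prems A' by (intro Cons.hyps) auto
  also have "\<dots> = (\<integral>\<^sup>+om. indicator ?AS om * (\<lambda>w. indicator (SD s) w * (\<lambda>y. indicator B y * nest Rx l g y) (w s)) (\<lambda>s. X (t + s) om) \<partial>P x)"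
  proof (rule nn_integral_cong)
    fix om assume "om \<in> space (P x)"
    then have "om \<in> space M" using x by simp
    from SD_split[OF path_rc[OF this] Cons.prems(2) v(1)] this
    show "indicator ?A om * (indicator (SD (t + s)) (path om) * nest Rx l g (X (t + s) om)) =
      indicator ?AS om * (\<lambda>w. indicator (SD s) w * (\<lambda>y. indicator B y * nest Rx l g y) (w s)) (\<lambda>s. X (t + s) om)"
      by (auto simp: indicator_def)
  qed
  also have "\<dots> = (\<integral>\<^sup>+om. indicator ?AS om * (\<integral>\<^sup>+w. indicator (SD s) w * (\<lambda>y. indicator B y * nest Rx l g y) (w s) \<partial>Lx (X t om)) \<partial>P x)"
    by (rule markov_path[OF x Cons.prems(2) AS Rx_functional[OF v(1) gl]])
  also have "\<dots> = (\<integral>\<^sup>+om. indicator A om * (indicator (SD t) (path om) * nest Rx (a # l) g (X t om)) \<partial>P x)"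
  proof (rule nn_integral_cong)
    fix om assume "om \<in> space (P x)"
    then have w: "om \<in> space M" using x by simp
    have "nest Rx (a # l) g (X t om) = (\<integral>\<^sup>+w. indicator (SD s) w * (\<lambda>y. indicator B y * nest Rx l g y) (w s) \<partial>Lx (X t om))"
      unfolding a nest.simps by (rule Rx_Lx[OF X_space[OF Cons.prems(2) w] v(1) gl])
    then show "indicator ?AS om * (\<integral>\<^sup>+w. indicator (SD s) w * (\<lambda>y. indicator B y * nest Rx l g y) (w s) \<partial>Lx (X t om)) =
      indicator A om * (indicator (SD t) (path om) * nest Rx (a # l) g (X t om))"
      using w by (simp add: indicator_def)
  qed
  finally show ?case .
qed simp

lemma nest_Rx_eq:
  assumes x: "x \<in> D" and g: "g \<in> borel_measurable BE" and l: "valid_list T l"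
  shows "nest Rx l g x = (\<integral>\<^sup>+om. indicator {om. visits (\<lambda>s. Some (X s om)) 0 l} om * (indicator (SD (total l)) (path om) * g (X (total l) om)) \<partial>P x)"
proof -
  have xE: "x \<in> points S" using x D_sub U0_sub by auto
  interpret prob_space "P x" using xE by (rule P_prob)
  have "space M \<in> sets (\<F> (ennreal 0))" using sets.top[of "\<F> (ennreal 0)"] by simp
  from markov_nest_Rx[OF xE g l order_refl this]
  have "(\<integral>\<^sup>+om. indicator (space M) om * (indicator {om. visits (\<lambda>s. Some (X s om)) 0 l} om * (indicator (SD (total l)) (path om) * g (X (total l) om))) \<partial>P x)
      = (\<integral>\<^sup>+om. indicator (space M) om * (indicator (SD 0) (path om) * nest Rx l g (X 0 om)) \<partial>P x)" by simp
  moreover have "(\<integral>\<^sup>+om. indicator (space M) om * (indicator {om. visits (\<lambda>s. Some (X s om)) 0 l} om * (indicator (SD (total l)) (path om) * g (X (total l) om))) \<partial>P x)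
      = (\<integral>\<^sup>+om. indicator {om. visits (\<lambda>s. Some (X s om)) 0 l} om * (indicator (SD (total l)) (path om) * g (X (total l) om)) \<partial>P x)"
    using xE by (intro nn_integral_cong) auto
  moreover have "(\<integral>\<^sup>+om. indicator (space M) om * (indicator (SD 0) (path om) * nest Rx l g (X 0 om)) \<partial>P x) = (\<integral>\<^sup>+om. nest Rx l g x \<partial>P x)"
  proof (rule nn_integral_cong_AE)
    have "AE om in P x. om \<in> space M" using AE_space[of "P x"] xE by simp
    with P_start[OF xE] show "AE om in P x. indicator (space M) om * (indicator (SD 0) (path om) * nest Rx l g (X 0 om)) = nest Rx l g x"
    proof eventually_elim
      case (elim om)
      have "x \<in> (\<Union>m. KD m)" using x KD by (simp add: exhausts_def)
      then have "path om \<in> SD 0" using elim path_rc[OF elim(2)] by (auto simp: SD_def stays_def)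
      then show ?case using elim by simp
    qed
  qed
  ultimately show ?thesis by (simp add: emeasure_space_1)
qed

text \<open>The counterpart of the upper bound: only paths confined to some \<open>KD m\<close> are
  kept. Right-continuity holds them in the open set \<open>D\<close> slightly beyond
  \<open>s\<close>, so their exit time from \<open>FH\<close> is larger than
  \<open>s\<close>.\<close>

lemma fdd_lower:
  assumes "valid_list T l" "y \<in> D"
  shows "nest Rx l Hm y / ennreal (H y) \<le> fdd QY l y"
  using assms
proof (induct l arbitrary: y)
  case Nil
  then have "y \<in> FH" using D_sub by auto
  then show ?case using FH_pos[of y] by (simp add: Hm_def FH_def ennreal_div_self)
next
  case (Cons a l)
  obtain s B where a: "a = (s, B)" by (cases a)
  have v: "0 \<le> s" "valid_list T l" using Cons.prems a by auto
  have yFH: "y \<in> FH" using Cons.prems D_sub by auto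
  have yE: "y \<in> points S" using Cons.prems D_sub F_E by auto
  have "Rx s (\<lambda>z. indicator B z * nest Rx l Hm z) y \<le> killed_semigroup P Xo FH s (\<lambda>z. ennreal (H z) * (indicator B z * fdd QY l z)) y"
  proof -
    have "indicator (SD s) (path om) * (indicator B (X s om) * nest Rx l Hm (X s om)) \<le>
      (if ennreal s < exit_time Xo FH om then case Some (X s om) of None \<Rightarrow> 0 | Some z \<Rightarrow> ennreal (H z) * (indicator B z * fdd QY l z) else 0)" if "om \<in> space (P y)" for om
    proof (cases "path om \<in> SD s")
      case True
      have w: "om \<in> space M" using yE that by simp
      have XD: "X r om \<in> D" if "0 \<le> r" "r \<le> s" for r using SD_in[OF True that] .
      have lt: "ennreal s < exit_time Xo FH om"
      proof (rule exit_time_gt[OF v(1)])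
        show "Some (X r om) \<in> Some ` FH" if "0 \<le> r" "r \<le> s" for r using XD[OF that] D_sub by auto
        have "eventually (\<lambda>r. X r om \<in> D) (at_right s)"
          using rc_pathsD[OF path_rc[OF w] v(1) openin_D] XD[OF v(1)] by simp
        then show "eventually (\<lambda>r. Some (X r om) \<in> Some ` FH) (at_right s)"
          by eventually_elim (use D_sub in auto)
      qed
      have XF: "X s om \<in> FH" using XD[OF v(1)] D_sub by auto
      have "nest Rx l Hm (X s om) = ennreal (H (X s om)) * (nest Rx l Hm (X s om) / ennreal (H (X s om)))"
        using FH_pos[OF XF] by (intro ennreal_mult_div_cancel[symmetric]) auto
      also have "\<dots> \<le> ennreal (H (X s om)) * fdd QY l (X s om)"
        using Cons.hyps[OF v(2) XD[OF v(1)]] by (intro mult_left_mono) auto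
      finally have "indicator B (X s om) * nest Rx l Hm (X s om) \<le> indicator B (X s om) * (ennreal (H (X s om)) * fdd QY l (X s om))"
        by (intro mult_left_mono) auto
      then show ?thesis using lt True by (simp add: mult.left_commute)
    qed simp
    then show ?thesis unfolding killed_semigroup_def nn_integral_completion Rx_def by (intro nn_integral_mono)
  qed
  then show ?case unfolding a fdd.simps nest.simps QY_FH[OF yFH]
    by (rule divide_right_mono_ennreal)
qed

lemma Y_value: assumes "x \<in> F" "om \<in> space (N x)" "0 \<le> t" "Y t om = Some y"
  shows "y \<in> F" "openin T U \<Longrightarrow> y \<in> U \<Longrightarrow> eventually (\<lambda>s. Y s om \<in> Some ` (F \<inter> U)) (at_right t)"
proof -
  have *: "y \<in> topspace (subtopology T F) \<and> (\<forall>U. openin (subtopology T F) U \<and> y \<in> U \<longrightarrow> eventually (\<lambda>s. Y s om \<in> Some ` U) (at_right t))"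
    using Y_rc[OF assms(1,2), unfolded right_continuous_killed_def, rule_format, OF assms(3)] assms(4) by simp
  then show yF: "y \<in> F" by simp
  assume U: "openin T U" "y \<in> U"
  then have "openin (subtopology T F) (F \<inter> U)" by (auto simp: openin_subtopology)
  then show "eventually (\<lambda>s. Y s om \<in> Some ` (F \<inter> U)) (at_right t)" using * U(2) yF by auto
qed

lemma Y_alive: assumes "x \<in> F" "om \<in> space (N x)" "0 \<le> s" "s \<le> t" "Y t om \<noteq> None"
  shows "\<exists>y\<in>F. Y s om = Some y"
proof (cases "Y s om")
  case None
  then have "\<forall>r\<ge>s. Y r om = None"
    using Y_rc[OF assms(1,2), unfolded right_continuous_killed_def, rule_format, OF assms(3)] by simp
  then show ?thesis using assms by auto
next
  case (Some y)
  then show ?thesis using Y_value(1)[OF assms(1-3)] by auto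
qed

text \<open>The unspecified value of \<open>the\<close> is met only by paths that are dead at
  \<open>q\<close>; these are removed by the restriction to \<open>Al\<close>.\<close>

abbreviation (input) Yst :: "real \<Rightarrow> 'u \<Rightarrow> real \<Rightarrow> 'a option" where
  "Yst q om \<equiv> (\<lambda>s. the (Y (min s q) om))"

lemma Yst_rc: assumes x: "x \<in> F" "om \<in> space (N x)" and q: "0 \<le> q" "Y q om \<noteq> None"
  shows "Yst q om \<in> rc_paths T"
  unfolding rc_paths_def limitin_def
proof (intro CollectI allI impI conjI)
  fix t :: real assume t: "0 \<le> t"
  obtain y where y: "y \<in> F" "Y (min t q) om = Some y" using Y_alive[OF x _ _ q(2), of "min t q"] t q by auto
  then show "the (Y (min t q) om) \<in> topspace T" using F_E by auto
  fix U assume U: "openin T U \<and> the (Y (min t q) om) \<in> U"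
  show "eventually (\<lambda>s. the (Y (min s q) om) \<in> U) (at_right t)"
  proof (cases "t < q")
    case True
    have "eventually (\<lambda>s. Y s om \<in> Some ` (F \<inter> U)) (at_right t)"
      using Y_value(2)[OF x t, of y U] y U True by simp
    then show ?thesis using eventually_at_right_real[OF True]
      by eventually_elim (auto simp: min_def)
  next
    case False
    then have "the (Y (min s q) om) \<in> U" if "s > t" for s using False U that by (simp add: min_absorb2)
    then show ?thesis by (auto simp: eventually_at_right_field intro!: exI[of _ "t + 1"])
  qed
qed

definition Al :: "real \<Rightarrow> 'a option \<Rightarrow> 'u set" where
  "Al q x = {om\<in>space (N x). Y q om \<in> Some ` F}"

lemma Al_sets: "x \<in> F \<Longrightarrow> 0 \<le> q \<Longrightarrow> Al q x \<in> sets (N x)"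
  unfolding Al_def by (rule Y_sets[OF _ _ F_BE])

lemma Yst_measurable:
  assumes x: "x \<in> F" and q: "0 \<le> q"
  shows "Yst q \<in> measurable (restrict_space (N x) (Al q x)) PA"
proof (rule path_measurableI)
  have sp: "space (restrict_space (N x) (Al q x)) = Al q x" by (auto simp: space_restrict_space Al_def)
  show rc: "Yst q om \<in> rc_paths T" if "om \<in> space (restrict_space (N x) (Al q x))" for om
    using that unfolding sp by (intro Yst_rc[OF x _ q]) (auto simp: Al_def)
  fix t :: real assume t: "0 \<le> t"
  show "(\<lambda>om. the (Y (min t q) om)) \<in> measurable (restrict_space (N x) (Al q x)) BE"
  proof (rule measurableI)
    show "the (Y (min t q) om) \<in> space BE" if "om \<in> space (restrict_space (N x) (Al q x))" for om
      using rc_paths_topspace[OF rc[OF that] t] by simp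
    fix B assume B: "B \<in> sets BE"
    have "(\<lambda>om. the (Y (min t q) om)) -` B \<inter> space (restrict_space (N x) (Al q x)) =
      Al q x \<inter> {om\<in>space (N x). Y (min t q) om \<in> Some ` B}"
    proof (intro set_eqI iffI)
      fix om assume "om \<in> (\<lambda>om. the (Y (min t q) om)) -` B \<inter> space (restrict_space (N x) (Al q x))"
      then have w: "om \<in> Al q x" "the (Y (min t q) om) \<in> B" by (auto simp: sp)
      then have "om \<in> space (N x)" "Y q om \<noteq> None" by (auto simp: Al_def)
      from Y_alive[OF x this(1) _ _ this(2), of "min t q"] t q obtain y where "Y (min t q) om = Some y" by auto
      then show "om \<in> Al q x \<inter> {om\<in>space (N x). Y (min t q) om \<in> Some ` B}"
        using w \<open>om \<in> space (N x)\<close> by auto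
    qed (auto simp: sp)
    also have "\<dots> \<in> sets (restrict_space (N x) (Al q x))"
      using Y_sets[OF x _ B, of "min t q"] t q Al_sets[OF x q] by (auto simp: sets_restrict_space)
    finally show "(\<lambda>om. the (Y (min t q) om)) -` B \<inter> space (restrict_space (N x) (Al q x)) \<in> sets (restrict_space (N x) (Al q x))" .
  qed
qed

text \<open>The law of \<open>Y\<close> frozen at \<open>q\<close>, on survival up to
  \<open>q\<close>; paths of this law have no cemetery, at the price of mass below
  \<open>1\<close>.\<close>

definition YL :: "real \<Rightarrow> 'a option \<Rightarrow> (real \<Rightarrow> 'a option) measure" where
  "YL q x = distr (restrict_space (N x) (Al q x)) PA (Yst q)"

text \<open>The weighted process is not killed on exit from \<open>F\<close>, so this measure may
  have infinite mass; finiteness is recovered by bounding \<open>H\<close> at time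
  \<open>q\<close>.\<close>

definition XL :: "real \<Rightarrow> 'a option \<Rightarrow> (real \<Rightarrow> 'a option) measure" where
  "XL q x = distr (density (P x) (\<lambda>om. Hm (X q om) / ennreal (H x))) PA (\<lambda>om s. X (min s q) om)"

lemma sets_YL [simp]: "sets (YL q x) = sets PA" and sets_XL [simp]: "sets (XL q x) = sets PA"
  by (simp_all add: YL_def XL_def)

lemma emeasure_YL:
  assumes x: "x \<in> F" and q: "0 \<le> q" and V: "V \<in> sets PA"
  shows "emeasure (YL q x) V = emeasure (N x) {om\<in>Al q x. Yst q om \<in> V}" "{om\<in>Al q x. Yst q om \<in> V} \<in> sets (N x)"
proof -
  have sp: "space (restrict_space (N x) (Al q x)) = Al q x" by (auto simp: space_restrict_space Al_def)
  have AN: "Al q x \<inter> space (N x) \<in> sets (N x)" using Al_sets[OF x q] by auto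
  have eq: "Yst q -` V \<inter> space (restrict_space (N x) (Al q x)) = {om\<in>Al q x. Yst q om \<in> V}" by (auto simp: sp)
  have "{om\<in>Al q x. Yst q om \<in> V} \<in> sets (restrict_space (N x) (Al q x))"
    using measurable_sets[OF Yst_measurable[OF x q] V] unfolding eq .
  then show "{om\<in>Al q x. Yst q om \<in> V} \<in> sets (N x)" using AN by (simp add: sets_restrict_space_iff)
  show "emeasure (YL q x) V = emeasure (N x) {om\<in>Al q x. Yst q om \<in> V}"
    unfolding YL_def emeasure_distr[OF Yst_measurable[OF x q] V] eq
    using AN by (intro emeasure_restrict_space) auto
qed

lemma nn_integral_YL:
  assumes x: "x \<in> F" and q: "0 \<le> q" and g: "g \<in> borel_measurable PA"
  shows "(\<integral>\<^sup>+w. g w \<partial>YL q x) = (\<integral>\<^sup>+om. indicator (Al q x) om * g (Yst q om) \<partial>N x)"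
proof -
  have AN: "Al q x \<inter> space (N x) \<in> sets (N x)" using Al_sets[OF x q] by auto
  have "(\<integral>\<^sup>+w. g w \<partial>YL q x) = (\<integral>\<^sup>+om. g (Yst q om) \<partial>restrict_space (N x) (Al q x))"
    unfolding YL_def by (subst nn_integral_distr[OF Yst_measurable[OF x q]]) (use g in simp_all)
  also have "\<dots> = (\<integral>\<^sup>+om. g (Yst q om) * indicator (Al q x) om \<partial>N x)"
    using AN by (rule nn_integral_restrict_space)
  finally show ?thesis by (simp add: mult.commute)
qed

lemma nn_integral_XL:
  assumes x: "x \<in> points S" and q: "0 \<le> q" and g: "g \<in> borel_measurable PA"
  shows "(\<integral>\<^sup>+w. g w \<partial>XL q x) = (\<integral>\<^sup>+om. Hm (X q om) * g (\<lambda>s. X (min s q) om) \<partial>P x) / ennreal (H x)"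
proof -
  have HX: "(\<lambda>om. Hm (X q om)) \<in> borel_measurable (P x)"
    by (rule measurable_compose[OF X_P[OF x q] Hm_measurable])
  have gX: "(\<lambda>om. g (\<lambda>s. X (min s q) om)) \<in> borel_measurable (P x)"
    by (rule measurable_compose[OF spath_P[OF x q] g])
  have ms: "(\<lambda>om s. X (min s q) om) \<in> measurable (density (P x) (\<lambda>om. Hm (X q om) / ennreal (H x))) PA"
    using spath_P[OF x q] by simp
  have "(\<integral>\<^sup>+w. g w \<partial>XL q x) = (\<integral>\<^sup>+om. g (\<lambda>s. X (min s q) om) \<partial>density (P x) (\<lambda>om. Hm (X q om) / ennreal (H x)))"
    unfolding XL_def by (subst nn_integral_distr[OF ms]) (use g in simp_all)
  also have "\<dots> = (\<integral>\<^sup>+om. Hm (X q om) / ennreal (H x) * g (\<lambda>s. X (min s q) om) \<partial>P x)"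
    using HX gX by (intro nn_integral_density) auto
  also have "\<dots> = (\<integral>\<^sup>+om. Hm (X q om) * g (\<lambda>s. X (min s q) om) / ennreal (H x) \<partial>P x)"
    by (intro nn_integral_cong) (simp add: divide_ennreal_def mult_ac)
  also have "\<dots> = (\<integral>\<^sup>+om. Hm (X q om) * g (\<lambda>s. X (min s q) om) \<partial>P x) / ennreal (H x)"
    using HX gX by (intro nn_integral_divide borel_measurable_times_ennreal)
  finally show ?thesis .
qed

end

lemma ennreal_divide_finite:
  fixes a x :: ennreal
  assumes "0 < a" "x < \<infinity>"
  shows "x / a < \<infinity>"
proof (cases a)
  case (real r)
  moreover obtain y where "x = ennreal y" "0 \<le> y" using assms(2) by (cases x) auto
  ultimately show ?thesis using assms(1) by (simp add: divide_ennreal)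
next
  case top
  then show ?thesis using assms(2) by (simp add: divide_ennreal_def)
qed

context prop4
begin

lemma visits_Y_sets:
  assumes x: "x \<in> F" and l: "valid_list T l" and t: "0 \<le> t"
  shows "{om\<in>space (N x). visits (\<lambda>s. Y s om) t l} \<in> sets (N x)"
  using l t
proof (induct l arbitrary: t)
  case (Cons a l)
  obtain s B where a: "a = (s, B)" by (cases a)
  have "{om\<in>space (N x). visits (\<lambda>s. Y s om) t (a # l)} =
    {om\<in>space (N x). Y (t + s) om \<in> Some ` B} \<inter> {om\<in>space (N x). visits (\<lambda>s. Y s om) (t + s) l}"
    by (auto simp: a)
  also have "\<dots> \<in> sets (N x)" using Cons a by (intro sets.Int Y_sets[OF x]) auto
  finally show ?case .
qed simp

lemma Y_fdd:
  assumes x: "x \<in> F" and l: "valid_list T l"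
  shows "emeasure (N x) {om\<in>space (N x). visits (\<lambda>s. Y s om) 0 l} = fdd QY l x"
proof -
  have "emeasure (completion (N x)) {om\<in>space (N x). visits (\<lambda>s. Y s om) 0 l} = fdd QY l x"
    using Y_law[OF x, unfolded has_markov_law_def, rule_format, of l] l by (simp add: valid_list_def)
  then show ?thesis using visits_Y_sets[OF x l order_refl] by simp
qed

lemma FH_F: "FH \<subseteq> F"
  by (auto simp: FH_def)

lemma Hm_eq: "y \<in> F \<Longrightarrow> Hm y = ennreal (H y)"
  by (simp add: Hm_def)

lemma nn_integral_div_Hm:
  assumes "x \<in> points S" "0 \<le> q" "C \<in> sets BE" "A \<in> sets M"
  shows "(\<integral>\<^sup>+om. (Hm (X q om) * indicator C (X q om) / c) * indicator A om \<partial>P x) =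
     (\<integral>\<^sup>+om. Hm (X q om) * indicator C (X q om) * indicator A om \<partial>P x) / c"
proof -
  have HX: "(\<lambda>om. Hm (X q om)) \<in> borel_measurable (P x)"
    by (rule measurable_compose[OF X_P[OF assms(1,2)] Hm_measurable])
  have CX: "(\<lambda>om. indicator C (X q om) :: ennreal) \<in> borel_measurable (P x)"
    by (rule measurable_compose[OF X_P[OF assms(1,2)] borel_measurable_indicator[OF assms(3)]])
  have "(\<integral>\<^sup>+om. (Hm (X q om) * indicator C (X q om) / c) * indicator A om \<partial>P x) =
     (\<integral>\<^sup>+om. Hm (X q om) * indicator C (X q om) * indicator A om / c \<partial>P x)"
    by (intro nn_integral_cong) (simp add: divide_ennreal_def mult_ac)
  also have "\<dots> = (\<integral>\<^sup>+om. Hm (X q om) * indicator C (X q om) * indicator A om \<partial>P x) / c"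
    using assms by (intro nn_integral_divide borel_measurable_times_ennreal HX CX borel_measurable_indicator) simp
  finally show ?thesis .
qed

text \<open>Dropping the killing in the semigroup of \<open>Y\<close> bounds its law by that of \<open>X\<close>, weighted with
  \<open>H\<close>; this needs no measurability of exit times.\<close>

lemma YL_le_bounded:
  assumes x: "x \<in> FH" and q: "0 \<le> q" and V: "V \<in> sets PA"
  shows "emeasure (N x) {om\<in>Al q x. Y q om \<in> Some ` {y\<in>F. H y \<le> c} \<and> Yst q om \<in> V} \<le> emeasure (XL q x) V"
proof -
  have xF: "x \<in> F" and xE: "x \<in> points S" using x FH_F F_E by auto
  interpret NN: prob_space "N x" using xF by (rule N_prob)
  interpret PP: prob_space "P x" using xE by (rule P_prob)
  \<comment> \<open>Truncating \<open>H\<close> at level \<open>c\<close> makes the weighted law of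
    \<open>X\<close> finite, as the comparison on a generator requires.\<close>
  define C where "C = {y\<in>F. H y \<le> c}"
  have C: "C \<in> sets BE" using H_preimage[of "{..c}"] by (simp add: C_def)
  let ?A = "{om\<in>space (N x). Y q om \<in> Some ` C}"
  have AC: "?A \<subseteq> Al q x" by (auto simp: Al_def C_def)
  have AN: "?A \<in> sets (N x)" by (rule Y_sets[OF xF q C])
  define m where "m = restrict_space (N x) ?A"
  define n where "n = density (P x) (\<lambda>om. Hm (X q om) * indicator C (X q om) / ennreal (H x))"
  have spm: "space m = ?A" by (auto simp: m_def space_restrict_space)
  have em: "emeasure m E = emeasure (N x) E" if "E \<subseteq> ?A" for E
    unfolding m_def using AN that by (intro emeasure_restrict_space) auto
  have HX: "(\<lambda>om. Hm (X q om)) \<in> borel_measurable (P x)"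
    by (rule measurable_compose[OF X_P[OF xE q] Hm_measurable])
  have CX: "(\<lambda>om. indicator C (X q om) :: ennreal) \<in> borel_measurable (P x)"
    by (rule measurable_compose[OF X_P[OF xE q] borel_measurable_indicator[OF C]])
  have en: "emeasure n E = (\<integral>\<^sup>+om. Hm (X q om) * indicator C (X q om) * indicator E om \<partial>P x) / ennreal (H x)" if "E \<in> sets M" for E
  proof -
    have "emeasure n E = (\<integral>\<^sup>+om. (Hm (X q om) * indicator C (X q om) / ennreal (H x)) * indicator E om \<partial>P x)"
      unfolding n_def using that HX CX xE by (intro emeasure_density) auto
    also have "\<dots> = (\<integral>\<^sup>+om. Hm (X q om) * indicator C (X q om) * indicator E om \<partial>P x) / ennreal (H x)"
      by (rule nn_integral_div_Hm[OF xE q C that])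
    finally show ?thesis .
  qed
  have g: "(\<lambda>om s. X (min s q) om) \<in> measurable n PA" using spath_P[OF xE q] by (simp add: n_def)
  have f: "Yst q \<in> measurable m PA"
  proof -
    have "m = restrict_space (restrict_space (N x) (Al q x)) ?A"
      unfolding m_def using AC Al_sets[OF xF q] AN
      by (subst restrict_restrict_space) (auto simp: Int_absorb1)
    then show ?thesis using measurable_restrict_space1[OF Yst_measurable[OF xF q]] by simp
  qed
  have fm: "finite_measure m" using em[of ?A] by (intro finite_measureI) (simp add: spm)
  have "emeasure n (space n) \<le> (\<integral>\<^sup>+om. ennreal c \<partial>P x) / ennreal (H x)"
  proof -
    have "space n = space M" using xE by (simp add: n_def)
    then have "emeasure n (space n) = (\<integral>\<^sup>+om. Hm (X q om) * indicator C (X q om) * indicator (space M) om \<partial>P x) / ennreal (H x)"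
      using en[of "space M"] by simp
    also have "\<dots> \<le> (\<integral>\<^sup>+om. ennreal c \<partial>P x) / ennreal (H x)"
      by (intro divide_right_mono_ennreal nn_integral_mono) (auto simp: indicator_def C_def Hm_def intro: ennreal_leI)
    finally show ?thesis .
  qed
  also have "\<dots> < \<infinity>" using FH_pos[OF x] by (intro ennreal_divide_finite) (auto simp: PP.emeasure_space_1)
  finally have fn: "finite_measure n" by (intro finite_measureI) auto
  have "emeasure m {om\<in>space m. Yst q om \<in> V} \<le> emeasure n {om\<in>space n. (\<lambda>s. X (min s q) om) \<in> V}"
  proof (rule path_law_le[OF fm fn f g, where Q="{q}" and c="\<lambda>t. min t q" and q=q])
    fix l assume l: "valid_list T l" "total l \<in> {q}"
    let ?l = "l @ [(0, C)]"
    have l': "valid_list T ?l" using l C by (simp add: valid_append)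
    have vis: "visits (\<lambda>t. Some (Yst q om t)) 0 l = visits (\<lambda>s. Y s om) 0 l" if w: "om \<in> ?A" for om
    proof (rule visits_cong[OF l(1)])
      fix s assume "0 \<le> s" "s \<le> 0 + total l"
      then show "Some (Yst q om s) = Y s om" using Y_alive[OF xF, of om s q] w l(2) by (auto simp: min_absorb1)
    qed
    have "{om\<in>space m. visits (\<lambda>t. Some (Yst q om t)) 0 l} = {om\<in>space (N x). visits (\<lambda>s. Y s om) 0 ?l}"
      using l vis by (auto simp: spm visits_append)
    then have "emeasure m {om\<in>space m. visits (\<lambda>t. Some (Yst q om t)) 0 l} = emeasure (N x) {om\<in>space (N x). visits (\<lambda>s. Y s om) 0 ?l}"
      using em[of "{om\<in>space m. visits (\<lambda>t. Some (Yst q om t)) 0 l}"] by (auto simp: spm)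
    also have "\<dots> = fdd QY ?l x" by (rule Y_fdd[OF xF l'])
    also have "\<dots> \<le> nest Kx ?l Hm x / ennreal (H x)" by (rule fdd_upper[OF l' x])
    also have "nest Kx ?l Hm x = (\<integral>\<^sup>+om. indicator {om. visits (\<lambda>s. Some (X s om)) 0 ?l} om * Hm (X (total ?l) om) \<partial>P x)"
      by (rule nest_Kx_eq[OF xE Hm_measurable l'])
    also have "\<dots> = (\<integral>\<^sup>+om. Hm (X q om) * indicator C (X q om) * indicator {om\<in>space n. visits (\<lambda>s. Some (X (min s q) om)) 0 l} om \<partial>P x)"
    proof (rule nn_integral_cong)
      fix om assume om: "om \<in> space (P x)"
      have "visits (\<lambda>s. Some (X s om)) 0 l = visits (\<lambda>s. Some (X (min s q) om)) 0 l"
        using l by (intro visits_cong) (auto simp: min_absorb1)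
      then show "indicator {om. visits (\<lambda>s. Some (X s om)) 0 ?l} om * Hm (X (total ?l) om) =
        Hm (X q om) * indicator C (X q om) * indicator {om\<in>space n. visits (\<lambda>s. Some (X (min s q) om)) 0 l} om"
        using l om by (auto simp: visits_append total_append n_def indicator_def)
    qed
    also have "\<dots> / ennreal (H x) = emeasure n {om\<in>space n. visits (\<lambda>s. Some (X (min s q) om)) 0 l}"
    proof (rule en[symmetric])
      have "{om\<in>space n. visits (\<lambda>s. Some (X (min s q) om)) 0 l} = {om\<in>space M. visits (\<lambda>s. Some (X s om)) 0 l}"
      proof (intro Collect_cong conj_cong)
        show "visits (\<lambda>s. Some (X (min s q) om)) 0 l = visits (\<lambda>s. Some (X s om)) 0 l" for om
          using l by (intro visits_cong) (auto simp: min_absorb1)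
      qed (simp add: n_def xE)
      then show "{om\<in>space n. visits (\<lambda>s. Some (X (min s q) om)) 0 l} \<in> sets M"
        using visits_X_sets[OF l(1) order_refl] by simp
    qed
    finally show "emeasure m {om\<in>space m. visits (\<lambda>t. Some (Yst q om t)) 0 l} \<le> emeasure n {om\<in>space n. visits (\<lambda>s. Some (X (min s q) om)) 0 l}" .
  qed (use q V in auto)
  also have "{om\<in>space m. Yst q om \<in> V} = {om\<in>Al q x. Y q om \<in> Some ` C \<and> Yst q om \<in> V}"
    using AC by (auto simp: spm Al_def)
  also have "emeasure m \<dots> = emeasure (N x) \<dots>" by (rule em) (auto simp: Al_def)
  also have "emeasure n {om\<in>space n. (\<lambda>s. X (min s q) om) \<in> V} =
     (\<integral>\<^sup>+om. Hm (X q om) * indicator C (X q om) * indicator {om\<in>space n. (\<lambda>s. X (min s q) om) \<in> V} om \<partial>P x) / ennreal (H x)"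
  proof (rule en)
    have "{om\<in>space n. (\<lambda>s. X (min s q) om) \<in> V} = (\<lambda>om s. X (min s q) om) -` V \<inter> space M" by (auto simp: n_def xE)
    then show "{om\<in>space n. (\<lambda>s. X (min s q) om) \<in> V} \<in> sets M" using measurable_sets[OF spath_M[OF q] V] by simp
  qed
  also have "\<dots> \<le> (\<integral>\<^sup>+om. Hm (X q om) * indicator V (\<lambda>s. X (min s q) om) \<partial>P x) / ennreal (H x)"
    by (intro divide_right_mono_ennreal nn_integral_mono) (auto simp: indicator_def)
  also have "\<dots> = emeasure (XL q x) V"
    using nn_integral_XL[OF xE q, of "indicator V"] V by simp
  finally show ?thesis by (simp add: C_def)
qed

text \<open>\<open>H\<close> is finite at the position of \<open>Y\<close> at time \<open>q\<close>,
  so the truncation levels exhaust the paths that are alive then.\<close>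

theorem YL_le:
  assumes x: "x \<in> FH" and q: "0 \<le> q"
  shows "YL q x \<le> XL q x"
proof -
  have xF: "x \<in> F" using x FH_F by auto
  have "emeasure (YL q x) V \<le> emeasure (XL q x) V" if V: "V \<in> sets PA" for V
  proof -
    let ?B = "\<lambda>n::nat. {om\<in>Al q x. Y q om \<in> Some ` {y\<in>F. H y \<le> real n} \<and> Yst q om \<in> V}"
    have un: "{om\<in>Al q x. Yst q om \<in> V} = (\<Union>n. ?B n)"
    proof (intro set_eqI iffI)
      fix om assume w: "om \<in> {om\<in>Al q x. Yst q om \<in> V}"
      then obtain y where y: "Y q om = Some y" "y \<in> F" by (auto simp: Al_def)
      obtain n :: nat where "H y \<le> real n" using real_arch_simple by auto
      then show "om \<in> (\<Union>n. ?B n)" using w y by auto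
    qed auto
    have Bs: "?B n \<in> sets (N x)" for n
    proof -
      have "{y\<in>F. H y \<le> real n} \<in> sets BE" using H_preimage[of "{..real n}"] by simp
      from sets.Int[OF emeasure_YL(2)[OF xF q V] Y_sets[OF xF q this]]
      show ?thesis by (rule back_subst[where P="\<lambda>A. A \<in> sets (N x)"]) (auto simp: Al_def)
    qed
    have inc: "incseq ?B" by (auto simp: incseq_def)
    have "emeasure (YL q x) V = emeasure (N x) (\<Union>n. ?B n)"
      using emeasure_YL(1)[OF xF q V] un by simp
    also have "\<dots> = (SUP n. emeasure (N x) (?B n))"
      using Bs inc by (intro SUP_emeasure_incseq[symmetric]) auto
    also have "\<dots> \<le> emeasure (XL q x) V"
      by (intro SUP_least YL_le_bounded[OF x q V])
    finally show ?thesis .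
  qed
  then show ?thesis by (subst le_measure) auto
qed

text \<open>In view of \<open>YL_le\<close>, equality of the finite masses of one event forces
  equality on all its measurable parts; so only the mass of the whole confinement event is
  compared.\<close>

lemma YL_eq_stays:
  assumes x: "x \<in> D" and u: "0 \<le> u" and V: "V \<in> sets PA"
  shows "emeasure (YL u x) (V \<inter> stays (KD m) u) = emeasure (XL u x) (V \<inter> stays (KD m) u)"
proof -
  have xFH: "x \<in> FH" and xF: "x \<in> F" and xE: "x \<in> points S" using x D_sub FH_F F_E by auto
  interpret NN: prob_space "N x" using xF by (rule N_prob)
  interpret PP: prob_space "P x" using xE by (rule P_prob)
  let ?K = "stays (KD m) u"
  have Kc: "closedin T (KD m)" by (rule exhausts_closed[OF KD])
  have Ks: "?K \<in> sets PA" by (rule stays_closed[OF Kc])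
  have KB: "KD m \<in> sets BE" by (rule closedin_borel_of[OF Kc])
  have KF: "KD m \<subseteq> F" using exhausts_subset[OF KD, of m] D_sub by auto
  have le: "emeasure (YL u x) W \<le> emeasure (XL u x) W" for W
    using YL_le[OF xFH u] by (subst (asm) le_measure) (auto simp: emeasure_notin_sets)
  \<comment> \<open>\<open>H\<close> is bounded on the compact set \<open>KD m\<close>. This makes
    the mass of the confinement event finite, which the cancellation at the end relies on.\<close>
  have "\<exists>a b. 0 < a \<and> 0 < b \<and> (\<forall>y\<in>KD m. a \<le> H y \<and> H y \<le> b)"
    using H_int exhausts_subset[OF KD, of m] by (intro continuous_map_bounds[OF compact_space_compactified H_cont Kc KF]) auto
  then obtain b where b: "\<forall>y\<in>KD m. H y \<le> b" by blast
  have "emeasure (XL u x) ?K \<le> (\<integral>\<^sup>+om. ennreal b \<partial>P x) / ennreal (H x)"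
  proof -
    have "emeasure (XL u x) ?K = (\<integral>\<^sup>+om. Hm (X u om) * indicator ?K (\<lambda>s. X (min s u) om) \<partial>P x) / ennreal (H x)"
      using nn_integral_XL[OF xE u, of "indicator ?K"] Ks by simp
    also have "\<dots> \<le> (\<integral>\<^sup>+om. ennreal b \<partial>P x) / ennreal (H x)"
    proof (intro divide_right_mono_ennreal nn_integral_mono)
      fix om
      show "Hm (X u om) * indicator ?K (\<lambda>s. X (min s u) om) \<le> ennreal b"
      proof (cases "(\<lambda>s. X (min s u) om) \<in> ?K")
        case True
        then have "X u om \<in> KD m" using u by (auto simp: stays_def dest: bspec[of _ _ u])
        then show ?thesis using b True by (auto simp: Hm_def intro: ennreal_leI)
      qed simp
    qed
    finally show ?thesis .
  qed
  also have "\<dots> < \<infinity>" using FH_pos[OF xFH] by (intro ennreal_divide_finite) (auto simp: PP.emeasure_space_1)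
  finally have finX: "emeasure (XL u x) ?K < \<infinity>" .
  have tot: "emeasure (XL u x) ?K \<le> emeasure (YL u x) ?K"
  proof -
    \<comment> \<open>An enumeration of the rationals, clamped to \<open>[0, u]\<close>. The list
      number \<open>k\<close> prescribes visits to \<open>KD m\<close> at \<open>u\<close> and at
      the first \<open>k\<close> of these times; by right-continuity the events decrease to
      confinement on the whole interval.\<close>
    define r where "r j = min (max 0 (real_of_rat (from_nat j))) u" for j :: nat
    define l where "l = rec_nat [(u, KD m)] (\<lambda>k l. insert_visit (r k) (KD m) l)"
    have l0: "l 0 = [(u, KD m)]" and lS: "l (Suc k) = insert_visit (r k) (KD m) (l k)" for k
      by (simp_all add: l_def)
    have r: "0 \<le> r k" "r k \<le> u" for k using u by (auto simp: r_def)
    have lt: "total (l k) = u \<and> valid_list T (l k)" for k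
      by (induct k) (use u KB r in \<open>auto simp: l0 lS total_insert intro!: valid_insert\<close>)
    have lv: "visits z 0 (l k) \<longleftrightarrow> z u \<in> Some ` KD m \<and> (\<forall>j<k. z (r j) \<in> Some ` KD m)" for z k
      by (induct k) (auto simp: l0 lS visits_insert less_Suc_eq)
    let ?B = "\<lambda>k. {om\<in>space (N x). visits (\<lambda>s. Y s om) 0 (l k)}"
    have Bs: "?B k \<in> sets (N x)" for k using lt by (intro visits_Y_sets[OF xF]) auto
    have dec: "decseq ?B" by (auto simp: decseq_def lv)
    have lim: "(\<Inter>k. ?B k) = {om\<in>Al u x. Yst u om \<in> ?K}"
    proof (intro set_eqI iffI)
      fix om assume "om \<in> (\<Inter>k. ?B k)"
      then have w: "om \<in> space (N x)" "Y u om \<in> Some ` KD m" "\<And>j. Y (r j) om \<in> Some ` KD m"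
        by (auto simp: lv)
      have wA: "om \<in> Al u x" using w KF by (auto simp: Al_def)
      have rc: "Yst u om \<in> rc_paths T" using w by (intro Yst_rc[OF xF _ u]) auto
      have "Yst u om s \<in> KD m" if s: "0 \<le> s" "s \<le> u" for s
      proof (cases "s = u")
        case True
        then show ?thesis using w(2) by auto
      next
        case False
        show ?thesis
        proof (rule closed_rationals[OF rc Kc])
          fix q :: real assume q: "q \<in> \<rat>" "0 \<le> q" "q < u"
          then obtain q' where "q = real_of_rat q'" by (auto simp: Rats_def)
          then have "r (to_nat q') = q" using q by (simp add: r_def)
          then show "Yst u om q \<in> KD m" using w(3)[of "to_nat q'"] q by (auto simp: min_absorb1)
        qed (use s False in auto)
      qed
      then show "om \<in> {om\<in>Al u x. Yst u om \<in> ?K}" using rc wA by (simp add: stays_def)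
    next
      fix om assume w: "om \<in> {om\<in>Al u x. Yst u om \<in> ?K}"
      then have wN: "om \<in> space (N x)" "Y u om \<noteq> None" by (auto simp: Al_def)
      have "Y s om \<in> Some ` KD m" if s: "0 \<le> s" "s \<le> u" for s
      proof -
        obtain y where "Y s om = Some y" using Y_alive[OF xF wN(1) s wN(2)] by auto
        moreover have "Yst u om s \<in> KD m" using w s by (simp add: stays_def)
        ultimately show ?thesis using s by (simp add: min_absorb1)
      qed
      then show "om \<in> (\<Inter>k. ?B k)" using wN u r by (auto simp: lv)
    qed
    have "emeasure (XL u x) ?K \<le> emeasure (N x) (?B k)" for k
    proof -
      have "emeasure (XL u x) ?K = (\<integral>\<^sup>+om. Hm (X u om) * indicator ?K (\<lambda>s. X (min s u) om) \<partial>P x) / ennreal (H x)"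
        using nn_integral_XL[OF xE u, of "indicator ?K"] Ks by simp
      also have "\<dots> \<le> (\<integral>\<^sup>+om. indicator {om. visits (\<lambda>s. Some (X s om)) 0 (l k)} om * (indicator (SD (total (l k))) (path om) * Hm (X (total (l k)) om)) \<partial>P x) / ennreal (H x)"
      proof (intro divide_right_mono_ennreal nn_integral_mono)
        fix om assume "om \<in> space (P x)"
        then have wM: "om \<in> space M" using xE by simp
        show "Hm (X u om) * indicator ?K (\<lambda>s. X (min s u) om) \<le> indicator {om. visits (\<lambda>s. Some (X s om)) 0 (l k)} om * (indicator (SD (total (l k))) (path om) * Hm (X (total (l k)) om))"
        proof (cases "(\<lambda>s. X (min s u) om) \<in> ?K")
          case True
          then have "(\<lambda>s. X (min s u) om) \<in> SD u" by (auto simp: SD_def)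
          then have "path om \<in> SD u" using SD_stop[OF path_rc[OF wM] u] by simp
          moreover have "X s om \<in> KD m" if "0 \<le> s" "s \<le> u" for s
            using True that by (auto simp: stays_def min_absorb1 dest: bspec[of _ _ s])
          then have "visits (\<lambda>s. Some (X s om)) 0 (l k)" using u r by (simp add: lv)
          ultimately show ?thesis using lt True by simp
        qed simp
      qed
      also have "\<dots> = nest Rx (l k) Hm x / ennreal (H x)"
        using nest_Rx_eq[OF x Hm_measurable, of "l k"] lt by simp
      also have "\<dots> \<le> fdd QY (l k) x" using lt by (intro fdd_lower x) auto
      also have "\<dots> = emeasure (N x) (?B k)" using lt by (intro Y_fdd[OF xF, symmetric]) auto
      finally show ?thesis .
    qed
    then have "emeasure (XL u x) ?K \<le> (INF k. emeasure (N x) (?B k))" by (rule INF_greatest)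
    also have "\<dots> = emeasure (N x) (\<Inter>k. ?B k)"
      using Bs dec by (intro INF_emeasure_decseq) auto
    finally show ?thesis unfolding lim using emeasure_YL(1)[OF xF u Ks] by simp
  qed
  \<comment> \<open>The part of the event outside \<open>V\<close> is estimated by
    \<open>YL_le\<close> and, being of finite mass, subtracted from both sides.\<close>
  show ?thesis
  proof (rule antisym[OF le])
    have d: "?K = (V \<inter> ?K) \<union> (?K - V)" "(V \<inter> ?K) \<inter> (?K - V) = {}" by auto
    have s: "V \<inter> ?K \<in> sets PA" "?K - V \<in> sets PA" using V Ks by auto
    have "emeasure (XL u x) (V \<inter> ?K) + emeasure (XL u x) (?K - V) = emeasure (XL u x) ?K"
      using s d by (subst plus_emeasure) auto
    also have "\<dots> \<le> emeasure (YL u x) ?K" by (rule tot)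
    also have "\<dots> = emeasure (YL u x) (V \<inter> ?K) + emeasure (YL u x) (?K - V)"
      using s d by (subst plus_emeasure) auto
    also have "\<dots> \<le> emeasure (YL u x) (V \<inter> ?K) + emeasure (XL u x) (?K - V)"
      by (intro add_left_mono le)
    finally have "emeasure (XL u x) (V \<inter> ?K) + emeasure (XL u x) (?K - V) \<le> emeasure (YL u x) (V \<inter> ?K) + emeasure (XL u x) (?K - V)" .
    then have "emeasure (XL u x) (?K - V) + emeasure (XL u x) (V \<inter> ?K) \<le> emeasure (XL u x) (?K - V) + emeasure (YL u x) (V \<inter> ?K)"
      by (simp only: add.commute)
    moreover have "emeasure (XL u x) (?K - V) \<le> emeasure (XL u x) ?K"
      using Ks by (intro emeasure_mono) auto
    then have "emeasure (XL u x) (?K - V) < top" using finX by (simp only: infinity_ennreal_def le_less_trans)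
    ultimately show "emeasure (XL u x) (V \<inter> ?K) \<le> emeasure (YL u x) (V \<inter> ?K)"
      by (simp only: ennreal_add_left_cancel_le) auto
  qed
qed

end

section \<open>Regularity of \<open>Y\<close> inherited from \<open>X\<close>\<close>

context prop4
begin

definition sig :: "(real \<Rightarrow> 'a option) \<Rightarrow> ennreal" where
  "sig w = (SUP m. Inf (ennreal ` {s. 0 \<le> s \<and> w s \<notin> KD m}))"

text \<open>Paths that leave \<open>D\<close> through all the sets \<open>KD m\<close> and are back in \<open>D\<close> at the very time of leaving.
  They are the only obstruction to comparing exits in continuous time with exits along the exhaustion.\<close>

definition rebound :: "real \<Rightarrow> (real \<Rightarrow> 'a option) set" where
  "rebound q = {w\<in>rc_paths T. w q \<in> D \<and> (\<forall>m. w \<notin> stays (KD m) q) \<and> w (enn2real (sig w)) \<in> D}"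

lemma sig_measurable: "sig \<in> borel_measurable PA"
  unfolding sig_def[abs_def]
  by (intro borel_measurable_SUP first_exit_measurable exhausts_closed[OF KD]) auto

lemma rebound_sets:
  assumes "0 \<le> q"
  shows "rebound q \<in> sets PA"
proof -
  have D: "D \<in> sets BE" by (rule openin_borel_of[OF openin_D])
  have "(\<lambda>w. enn2real (sig w)) \<in> borel_measurable PA" using sig_measurable by measurable
  from eval_measurable[OF this, of "\<lambda>w. w"] have "(\<lambda>w. w (enn2real (sig w))) \<in> measurable PA BE" by simp
  from measurable_borel_ofD[OF this D] have 1: "{w\<in>space PA. w (enn2real (sig w)) \<in> D} \<in> sets PA" .
  have 2: "{w\<in>space PA. w q \<in> D} \<in> sets PA" by (rule measurable_borel_ofD[OF path_eval[OF assms] D])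
  have 3: "space PA - SD q \<in> sets PA" by (rule sets.compl_sets[OF SD_sets])
  have "rebound q = {w\<in>space PA. w (enn2real (sig w)) \<in> D} \<inter> {w\<in>space PA. w q \<in> D} \<inter> (space PA - SD q)"
    by (auto simp: rebound_def SD_def)
  then show ?thesis using 1 2 3 by auto
qed

text \<open>Quasi-left-continuity places the path outside \<open>D\<close> at the limit of its exit
  times from the sets \<open>KD m\<close>. None of these exits is later than \<open>q\<close>, so
  freezing at \<open>q\<close> does not affect them.\<close>

lemma XL_rebound:
  assumes x: "x \<in> D" and q: "0 \<le> q"
  shows "emeasure (XL q x) (rebound q) = 0"
proof -
  have xE: "x \<in> points S" using x D_sub F_E by auto
  have "AE om in P x. Hm (X q om) * indicator (rebound q) (\<lambda>s. X (min s q) om) = 0"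
    using exhaust_AE[OF xE KD D_sub(2)]
  proof eventually_elim
    case (elim om)
    show ?case
    proof (rule ccontr)
      assume "Hm (X q om) * indicator (rebound q) (\<lambda>s. X (min s q) om) \<noteq> 0"
      then have rb: "(\<lambda>s. X (min s q) om) \<in> rebound q" by (auto simp: indicator_def split: if_splits)
      then have Xq: "X q om \<in> D" by (simp add: rebound_def)
      have out: "\<exists>s\<in>{0..q}. X s om \<notin> KD m" for m
        using rb by (auto simp: rebound_def stays_def min_absorb1)
      from elim[rule_format, OF q _ ] out Xq D_sub(2) obtain s where
        s: "s \<in> {0..q}" "X s om \<notin> D" "ennreal s = (SUP m. Inf (ennreal ` {s. 0 \<le> s \<and> X s om \<notin> KD m}))"
        by blast
      have "Inf (ennreal ` {s. 0 \<le> s \<and> X (min s q) om \<notin> KD m}) = Inf (ennreal ` {s. 0 \<le> s \<and> X s om \<notin> KD m})" for m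
      proof (rule Inf_ennreal_agree'[where q=q])
        show "s \<in> {s. 0 \<le> s \<and> X (min s q) om \<notin> KD m} \<longleftrightarrow> s \<in> {s. 0 \<le> s \<and> X s om \<notin> KD m}" if "s \<le> q" for s
          using that by (simp add: min_absorb1)
        from out[of m] obtain s where "s \<in> {0..q}" "X s om \<notin> KD m" by auto
        then show "\<exists>s\<in>{s. 0 \<le> s \<and> X (min s q) om \<notin> KD m}. s \<le> q" by (intro bexI[of _ s]) (auto simp: min_absorb1)
      qed
      then have "sig (\<lambda>s. X (min s q) om) = ennreal s" by (simp add: sig_def s(3))
      then have "X (min s q) om \<in> D" using rb s(1) by (simp add: rebound_def)
      then show False using s by (simp add: min_absorb1)
    qed
  qed
  then have "(\<integral>\<^sup>+om. Hm (X q om) * indicator (rebound q) (\<lambda>s. X (min s q) om) \<partial>P x) = (\<integral>\<^sup>+om. 0 \<partial>P x)"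
    by (rule nn_integral_cong_AE)
  then show ?thesis
    using nn_integral_XL[OF xE q, of "indicator (rebound q)"] rebound_sets[OF q] by simp
qed

text \<open>The analogue of \<open>good_AE\<close>, obtained without quasi-left-continuity of
  \<open>Y\<close>: the Borel set \<open>rebound q\<close> is null for the dominating law of
  \<open>X\<close>, hence for \<open>Y\<close>, and rational \<open>q\<close> suffice.\<close>

lemma Y_good_AE:
  assumes x: "x \<in> D"
  shows "AE om in N x. \<forall>u\<ge>0. (\<forall>s\<in>{0..u}. Y s om \<in> Some ` D) \<longrightarrow> (\<exists>m. \<forall>s\<in>{0..u}. Y s om \<in> Some ` KD m)"
proof -
  have xFH: "x \<in> FH" and xF: "x \<in> F" using x D_sub by auto
  have "AE om in N x. 0 \<le> real_of_rat q \<longrightarrow> \<not> (om \<in> Al (real_of_rat q) x \<and> Yst (real_of_rat q) om \<in> rebound (real_of_rat q))" for q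
  proof (cases "0 \<le> real_of_rat q")
    case True
    let ?A = "{om\<in>Al (real_of_rat q) x. Yst (real_of_rat q) om \<in> rebound (real_of_rat q)}"
    have "emeasure (YL (real_of_rat q) x) (rebound (real_of_rat q)) \<le> emeasure (XL (real_of_rat q) x) (rebound (real_of_rat q))"
      using YL_le[OF xFH True] by (subst (asm) le_measure) (use rebound_sets[OF True] in auto)
    then have "emeasure (YL (real_of_rat q) x) (rebound (real_of_rat q)) = 0" using XL_rebound[OF x True] by simp
    then have "?A \<in> null_sets (N x)"
      using emeasure_YL[OF xF True rebound_sets[OF True]] by (auto simp: null_sets_def)
    then have "AE om in N x. om \<notin> ?A" by (rule AE_not_in)
    then show ?thesis by eventually_elim auto
  qed simp
  then have "AE om in N x. \<forall>q. 0 \<le> real_of_rat q \<longrightarrow> \<not> (om \<in> Al (real_of_rat q) x \<and> Yst (real_of_rat q) om \<in> rebound (real_of_rat q))"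
    by (simp only: AE_all_countable) blast
  moreover have "AE om in N x. om \<in> space (N x)" by (rule AE_space)
  ultimately show ?thesis
  proof eventually_elim
    case (elim om)
    show ?case
    proof (intro allI impI, rule ccontr)
      fix u :: real assume u: "0 \<le> u" "\<forall>s\<in>{0..u}. Y s om \<in> Some ` D" "\<not> (\<exists>m. \<forall>s\<in>{0..u}. Y s om \<in> Some ` KD m)"
      obtain y where y: "Y u om = Some y" "y \<in> D" using u(1,2) by (auto dest: bspec[of _ _ u])
      have "eventually (\<lambda>s. Y s om \<in> Some ` (F \<inter> D)) (at_right u)"
        by (rule Y_value(2)[OF xF elim(2) u(1) y(1) openin_D y(2)])
      then obtain b where b: "b > u" "\<And>s. u < s \<Longrightarrow> s < b \<Longrightarrow> Y s om \<in> Some ` (F \<inter> D)"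
        by (auto simp: eventually_at_right_field)
      \<comment> \<open>A rational time shortly after \<open>u\<close> at which \<open>Y\<close> is
        still in \<open>D\<close>; the exceptional sets have been removed for rational times
        only.\<close>
      obtain q' where q': "u < real_of_rat q'" "real_of_rat q' < b" using of_rat_dense[OF b(1)] by auto
      define q where "q = real_of_rat q'"
      have "u < q" "q < b" using q' by (auto simp: q_def)
      moreover from this have "0 \<le> q" using u(1) by linarith
      ultimately have q: "u < q" "q < b" "0 \<le> q" by auto
      have YD: "Y s om \<in> Some ` D" if "0 \<le> s" "s \<le> q" for s
      proof (cases "s \<le> u")
        case True
        then show ?thesis using u(2) that by auto
      next
        case False
        then have "Y s om \<in> Some ` (F \<inter> D)" using that q by (intro b(2)) auto
        then show ?thesis by auto
      qed
      define w where "w = Yst q om"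
      have wY: "Y s om = Some (w s)" if "0 \<le> s" "s \<le> q" for s
        using YD[OF that] that by (auto simp: w_def min_absorb1)
      have wD: "w s \<in> D" if "0 \<le> s" "s \<le> q" for s using YD[OF that] wY[OF that] by auto
      have rc: "w \<in> rc_paths T" unfolding w_def using wY[of q] q by (intro Yst_rc[OF xF elim(2)]) auto
      have out: "\<exists>s. 0 \<le> s \<and> s \<le> u \<and> w s \<notin> KD m" for m
      proof -
        from u(3) obtain s where s: "s \<in> {0..u}" "Y s om \<notin> Some ` KD m" by blast
        then show ?thesis using wY[of s] q by (intro exI[of _ s]) auto
      qed
      have "Inf (ennreal ` {s. 0 \<le> s \<and> w s \<notin> KD m}) \<le> ennreal u" for m
      proof -
        obtain s where "0 \<le> s" "s \<le> u" "w s \<notin> KD m" using out by auto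
        then have "Inf (ennreal ` {s. 0 \<le> s \<and> w s \<notin> KD m}) \<le> ennreal s" by (intro Inf_lower) auto
        also have "\<dots> \<le> ennreal u" using \<open>s \<le> u\<close> by (rule ennreal_leI)
        finally show ?thesis .
      qed
      then have "sig w \<le> ennreal u" unfolding sig_def by (rule SUP_least)
      then have "enn2real (sig w) \<le> u" using u(1) by (rule enn2real_leI[rotated])
      then have "w (enn2real (sig w)) \<in> D" using q by (intro wD) auto
      moreover have "w \<notin> stays (KD m) q" for m
        using out[of m] q by (force simp: stays_def)
      moreover have "w q \<in> D" using q by (intro wD) auto
      ultimately have "w \<in> rebound q" using rc by (simp add: rebound_def)
      moreover have "om \<in> Al q x"
        using elim(2) wY[of q] wD[of q] q D_sub(1) by (auto simp: Al_def)
      moreover have "\<not> (om \<in> Al q x \<and> w \<in> rebound q)"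
        using elim(1)[rule_format, of q'] q(3) unfolding q_def[symmetric] w_def by simp
      ultimately show False by blast
    qed
  qed
qed

lemma YL_eq_SD:
  assumes x: "x \<in> D" and u: "0 \<le> u" and V: "V \<in> sets PA"
  shows "emeasure (YL u x) (V \<inter> SD u) = emeasure (XL u x) (V \<inter> SD u)"
proof -
  have eq: "V \<inter> SD u = (\<Union>m. V \<inter> stays (KD m) u)" by (auto simp: SD_def)
  have inc: "incseq (\<lambda>m. V \<inter> stays (KD m) u)"
  proof (rule incseq_SucI)
    fix m
    have "KD m \<subseteq> KD (Suc m)" using exhausts_mono[OF KD, of m "Suc m"] by simp
    then show "V \<inter> stays (KD m) u \<subseteq> V \<inter> stays (KD (Suc m)) u" by (auto simp: stays_def)
  qed
  have s: "V \<inter> stays (KD m) u \<in> sets PA" for m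
    using V stays_closed[OF exhausts_closed[OF KD]] by auto
  have "emeasure (YL u x) (V \<inter> SD u) = (SUP m. emeasure (YL u x) (V \<inter> stays (KD m) u))"
    unfolding eq using s inc by (intro SUP_emeasure_incseq[symmetric]) auto
  also have "\<dots> = (SUP m. emeasure (XL u x) (V \<inter> stays (KD m) u))"
    by (simp add: YL_eq_stays[OF x u V])
  also have "\<dots> = emeasure (XL u x) (V \<inter> SD u)"
    unfolding eq using s inc by (intro SUP_emeasure_incseq) auto
  finally show ?thesis .
qed

lemma nn_integral_YL_SD:
  assumes x: "x \<in> D" and u: "0 \<le> u" and g: "g \<in> borel_measurable PA"
  shows "(\<integral>\<^sup>+w. indicator (SD u) w * g w \<partial>YL u x) = (\<integral>\<^sup>+w. indicator (SD u) w * g w \<partial>XL u x)"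
proof -
  have gY: "g \<in> borel_measurable (YL u x)" and gX: "g \<in> borel_measurable (XL u x)" using g by (simp_all cong: measurable_cong_sets)
  have iY: "(indicator (SD u) :: _ \<Rightarrow> ennreal) \<in> borel_measurable (YL u x)"
    and iX: "(indicator (SD u) :: _ \<Rightarrow> ennreal) \<in> borel_measurable (XL u x)"
    using SD_sets by (auto intro!: borel_measurable_indicator)
  have "density (YL u x) (indicator (SD u)) = density (XL u x) (indicator (SD u))"
  proof (rule measure_eqI)
    fix V assume "V \<in> sets (density (YL u x) (indicator (SD u)))"
    then have V: "V \<in> sets PA" by simp
    have "emeasure (density (YL u x) (indicator (SD u))) V = (\<integral>\<^sup>+w. indicator (SD u) w * indicator V w \<partial>YL u x)"
      using V iY by (intro emeasure_density) auto
    also have "\<dots> = (\<integral>\<^sup>+w. indicator (V \<inter> SD u) w \<partial>YL u x)" by (intro nn_integral_cong) (auto simp: indicator_def)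
    also have "\<dots> = (\<integral>\<^sup>+w. indicator (V \<inter> SD u) w \<partial>XL u x)" using YL_eq_SD[OF x u V] V SD_sets by simp
    also have "\<dots> = (\<integral>\<^sup>+w. indicator (SD u) w * indicator V w \<partial>XL u x)" by (intro nn_integral_cong) (auto simp: indicator_def)
    also have "\<dots> = emeasure (density (XL u x) (indicator (SD u))) V"
      using V iX by (intro emeasure_density[symmetric]) auto
    finally show "emeasure (density (YL u x) (indicator (SD u))) V = emeasure (density (XL u x) (indicator (SD u))) V" .
  qed simp
  then have "(\<integral>\<^sup>+w. g w \<partial>density (YL u x) (indicator (SD u))) = (\<integral>\<^sup>+w. g w \<partial>density (XL u x) (indicator (SD u)))"
    by simp
  then show ?thesis using nn_integral_density[OF iY gY] nn_integral_density[OF iX gX] by simp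
qed

lemma Y_exit_iff:
  assumes x: "x \<in> F" and w: "om \<in> space (N x)" and t: "0 \<le> t"
    and good: "\<forall>u\<ge>0. (\<forall>s\<in>{0..u}. Y s om \<in> Some ` D) \<longrightarrow> (\<exists>m. \<forall>s\<in>{0..u}. Y s om \<in> Some ` KD m)"
  shows "ennreal t < exit_time Y D om \<longleftrightarrow> om \<in> Al t x \<and> Yst t om \<in> SD t"
proof
  assume lt: "ennreal t < exit_time Y D om"
  have YD: "Y s om \<in> Some ` D" if "0 \<le> s" "s \<le> t" for s by (rule exit_time_less_in[OF lt that])
  then obtain m where m: "\<forall>s\<in>{0..t}. Y s om \<in> Some ` KD m" using good t by auto
  have "Y t om \<in> Some ` D" using YD[of t] t by simp
  then have A: "om \<in> Al t x" using w D_sub(1) by (auto simp: Al_def)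
  have "Yst t om \<in> rc_paths T" using A by (intro Yst_rc[OF x w t]) (auto simp: Al_def)
  moreover have "Yst t om s \<in> KD m" if "0 \<le> s" "s \<le> t" for s
    using m that by (auto simp: min_absorb1 dest!: bspec[of _ _ s])
  ultimately have "Yst t om \<in> stays (KD m) t" by (simp add: stays_def)
  then show "om \<in> Al t x \<and> Yst t om \<in> SD t" using A by (auto simp: SD_def)
next
  assume *: "om \<in> Al t x \<and> Yst t om \<in> SD t"
  have YD: "Y s om \<in> Some ` D" if "0 \<le> s" "s \<le> t" for s
  proof -
    have "Y t om \<noteq> None" using * by (auto simp: Al_def)
    from Y_alive[OF x w that this] obtain y where "Y s om = Some y" by auto
    moreover have "Yst t om s \<in> D" by (rule SD_in[OF _ that]) (use * in simp)
    ultimately show ?thesis using that by (simp add: min_absorb1)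
  qed
  show "ennreal t < exit_time Y D om"
  proof (rule exit_time_gt[where Z=Y and B=D and om=om, OF t YD])
    obtain y where y: "Y t om = Some y" "y \<in> D" using YD[of t] t by auto
    from Y_value(2)[OF x w t y(1) openin_D y(2)]
    show "eventually (\<lambda>s. Y s om \<in> Some ` D) (at_right t)" by eventually_elim auto
  qed
qed

text \<open>Killing at the exit from \<open>D\<close> can be computed exactly, because the laws of
  \<open>Y\<close> and of the weighted \<open>X\<close> coincide on \<open>SD\<close>. The killed
  \<open>Y\<close> is the \<open>H\<close>-transform of \<open>X\<close> restricted to confined
  paths.\<close>

lemma killed_semigroup_Y:
  assumes x: "x \<in> D" and t: "0 \<le> t" and g: "g \<in> borel_measurable BE"
  shows "killed_semigroup N Y D t g x = Rx t (\<lambda>z. Hm z * g z) x / ennreal (H x)"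
proof -
  have xF: "x \<in> F" and xE: "x \<in> points S" using x D_sub F_E by auto
  have gt: "(\<lambda>w. g (w t)) \<in> borel_measurable PA" by (rule measurable_compose[OF path_eval[OF t] g])
  have gS: "(\<lambda>w. indicator (SD t) w * g (w t)) \<in> borel_measurable PA" by (rule Rx_functional[OF t g])
  have "killed_semigroup N Y D t g x = (\<integral>\<^sup>+om. indicator (Al t x) om * (\<lambda>w. indicator (SD t) w * g (w t)) (Yst t om) \<partial>N x)"
    unfolding killed_semigroup_def nn_integral_completion
  proof (rule nn_integral_cong_AE)
    have "AE om in N x. om \<in> space (N x)" by (rule AE_space)
    with Y_good_AE[OF x]
    show "AE om in N x. (if ennreal t < exit_time Y D om then case Y t om of None \<Rightarrow> 0 | Some y \<Rightarrow> g y else 0) =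
      indicator (Al t x) om * (\<lambda>w. indicator (SD t) w * g (w t)) (Yst t om)"
    proof eventually_elim
      case (elim om)
      from Y_exit_iff[OF xF elim(2) t elim(1)] show ?case
        by (auto simp: indicator_def Al_def split: option.splits)
    qed
  qed
  also have "\<dots> = (\<integral>\<^sup>+w. indicator (SD t) w * g (w t) \<partial>YL t x)"
    by (rule nn_integral_YL[OF xF t gS, symmetric])
  also have "\<dots> = (\<integral>\<^sup>+w. indicator (SD t) w * g (w t) \<partial>XL t x)"
    by (rule nn_integral_YL_SD[OF x t gt])
  also have "\<dots> = (\<integral>\<^sup>+om. Hm (X t om) * (\<lambda>w. indicator (SD t) w * g (w t)) (\<lambda>s. X (min s t) om) \<partial>P x) / ennreal (H x)"
    by (rule nn_integral_XL[OF xE t gS])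
  also have "(\<integral>\<^sup>+om. Hm (X t om) * (\<lambda>w. indicator (SD t) w * g (w t)) (\<lambda>s. X (min s t) om) \<partial>P x) = Rx t (\<lambda>z. Hm z * g z) x"
    unfolding Rx_def
  proof (rule nn_integral_cong)
    fix om assume "om \<in> space (P x)"
    then have "om \<in> space M" using xE by simp
    from SD_stop[OF path_rc[OF this] t]
    show "Hm (X t om) * (\<lambda>w. indicator (SD t) w * g (w t)) (\<lambda>s. X (min s t) om) = indicator (SD t) (path om) * (Hm (X t om) * g (X t om))"
      by (auto simp: indicator_def)
  qed
  finally show ?thesis .
qed

end

section \<open>The law of the inverted Doob transform\<close>

lemma visits_last: "visits z r l \<Longrightarrow> l \<noteq> [] \<Longrightarrow> z (r + total l) \<noteq> None"
proof (induct l arbitrary: r)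
  case (Cons a l)
  obtain s B where a: "a = (s, B)" by (cases a)
  show ?case
  proof (cases "l = []")
    case True
    then show ?thesis using Cons(2) a by auto
  next
    case False
    then show ?thesis using Cons(1)[of "r + s"] Cons(2) a by (simp add: add.assoc)
  qed
qed simp

text \<open>Refining the grid never moves the approximation to the right, so confinement known up to
  the old approximation still covers the new one.\<close>

lemma dyadic_above_Suc_le: "dyadic_above (Suc n) s \<le> dyadic_above n s"
proof -
  have "s * 2 ^ n < real_of_int \<lfloor>s * 2 ^ n\<rfloor> + 1" by linarith
  then have "s * 2 ^ Suc n < 2 * (real_of_int \<lfloor>s * 2 ^ n\<rfloor> + 1)" by (simp add: algebra_simps)
  then have "s * 2 ^ Suc n < real_of_int (2 * (\<lfloor>s * 2 ^ n\<rfloor> + 1))" by simp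
  then have "\<lfloor>s * 2 ^ Suc n\<rfloor> < 2 * (\<lfloor>s * 2 ^ n\<rfloor> + 1)" by (simp only: floor_less_iff)
  then have "\<lfloor>s * 2 ^ Suc n\<rfloor> + 1 \<le> 2 * (\<lfloor>s * 2 ^ n\<rfloor> + 1)" by simp
  then have "real_of_int (\<lfloor>s * 2 ^ Suc n\<rfloor> + 1) \<le> real_of_int (2 * (\<lfloor>s * 2 ^ n\<rfloor> + 1))"
    by (simp only: of_int_le_iff)
  then have "(real_of_int \<lfloor>s * 2 ^ Suc n\<rfloor> + 1) / 2 ^ Suc n \<le> (2 * (real_of_int \<lfloor>s * 2 ^ n\<rfloor> + 1)) / 2 ^ Suc n"
    by (intro divide_right_mono) auto
  moreover have "2 * b / 2 ^ Suc n = b / 2 ^ n" for b :: real by simp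
  ultimately show ?thesis unfolding dyadic_above_def by metis
qed

lemma dyadic_above_interval:
  fixes j :: nat
  assumes "real j / 2 ^ n \<le> s" "s < (real j + 1) / 2 ^ n"
  shows "dyadic_above n s = (real j + 1) / 2 ^ n"
proof -
  have "real j \<le> s * 2 ^ n" "s * 2 ^ n < real j + 1"
    using assms by (simp_all add: pos_divide_le_eq pos_less_divide_eq)
  then have "\<lfloor>s * 2 ^ n\<rfloor> = int j" by (intro floor_unique) auto
  then show ?thesis by (simp add: dyadic_above_def)
qed

lemma dyadic_above_index:
  assumes "0 \<le> s"
  shows "\<exists>j::nat. real j / 2 ^ n \<le> s \<and> s < (real j + 1) / 2 ^ n"
proof -
  have f: "real_of_int \<lfloor>s * 2 ^ n\<rfloor> \<le> s * 2 ^ n" "s * 2 ^ n < real_of_int \<lfloor>s * 2 ^ n\<rfloor> + 1" by linarith+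
  have "0 \<le> \<lfloor>s * 2 ^ n\<rfloor>" using assms by simp
  then have "real (nat \<lfloor>s * 2 ^ n\<rfloor>) = real_of_int \<lfloor>s * 2 ^ n\<rfloor>" by simp
  with f show ?thesis
    by (intro exI[of _ "nat \<lfloor>s * 2 ^ n\<rfloor>"]) (simp add: pos_divide_le_eq pos_less_divide_eq)
qed

context inv_process
begin

lemma I_measurable_U0: "g \<in> borel_measurable BE \<Longrightarrow> (\<lambda>y. if y \<in> U0 then g (I y) else (0::ennreal)) \<in> borel_measurable BE"
proof -
  assume "g \<in> borel_measurable BE"
  from measurable_compose[OF I_measurable this] show ?thesis
    using sets.Int[OF U0_BE sets.top[of BE]] by (subst measurable_restrict_space_iff[symmetric]) auto
qed

end

section \<open>Composition of the two Doob transforms and confinement under inversion\<close>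

context prop4
begin

lemma I_F: "y \<in> F \<Longrightarrow> I y \<in> F"
  using IF by auto

text \<open>As \<open>I\<close> is an involution, the image of \<open>D\<close> is also its
  preimage, hence open by continuity. It lies in \<open>F\<close> and in \<open>U0\<close>, so it is
  contained in the interior of \<open>F\<close>.\<close>

lemma I_D: assumes "y \<in> D" shows "I y \<in> D"
proof -
  have eq: "I ` D = {y \<in> topspace (subtopology T U0). I y \<in> D}"
  proof (intro set_eqI iffI)
    fix z assume "z \<in> I ` D"
    then obtain y where y: "y \<in> D" "z = I y" by auto
    then show "z \<in> {y \<in> topspace (subtopology T U0). I y \<in> D}"
      using I_U0[of y] I_I[of y] D_sub U0_sub F_E by auto
  next
    fix z assume "z \<in> {y \<in> topspace (subtopology T U0). I y \<in> D}"
    then have "I (I z) = z" "I z \<in> D" using I_I[of z] by auto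
    then show "z \<in> I ` D" by (metis imageI)
  qed
  have "openin (subtopology T U0) (I ` D)"
    unfolding eq by (rule openin_continuous_map_preimage[OF I_cont openin_D])
  then have "openin T (I ` D)" using openin_U0 by (rule openin_trans_full)
  moreover have "I ` D \<subseteq> F" using I_F D_sub by auto
  moreover have "I ` D \<subseteq> U0" using I_U0 D_sub by auto
  ultimately have "I ` D \<subseteq> D" by (rule interior_pts_greatest)
  then show ?thesis using assms by auto
qed

definition ht :: "'a option \<Rightarrow> ennreal" where
  "ht x = kelvin_transform I h (\<lambda>y. ennreal (H y)) x / ennreal (H x)"

definition HI :: "'a option \<Rightarrow> ennreal" where
  "HI y = (if y \<in> U0 then Hm (I y) else 0)"

text \<open>The Kelvin transform of \<open>H\<close>, extended by zero. On the live states it is the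
  product of the densities of the two successive transforms, so it is the terminal weight left in
  their finite-dimensional distributions.\<close>

definition kap :: "'a option \<Rightarrow> ennreal" where
  "kap y = h0 y * HI y"

lemma HI_measurable: "HI \<in> borel_measurable BE"
  unfolding HI_def[abs_def] by (rule I_measurable_U0[OF Hm_measurable])

lemma kap_measurable: "kap \<in> borel_measurable BE"
  unfolding kap_def[abs_def] using h0_measurable HI_measurable by (rule borel_measurable_times_ennreal)

lemma kap_ht:
  assumes "y \<in> FH" "y \<in> U0"
  shows "Hm y * ht y = kap y" "ht y = kap y / Hm y" "ht y < \<infinity>"
proof -
  have y: "y \<in> F" "I y \<in> F" using assms(1) FH_F I_F by auto
  have k: "kelvin_transform I h (\<lambda>y. ennreal (H y)) y = kap y"
    using y assms(2) by (simp add: kelvin_transform_def kap_def h0_def HI_def Hm_def)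
  then show e: "ht y = kap y / Hm y" using y by (simp add: ht_def Hm_def)
  have p: "0 < Hm y" "Hm y < \<infinity>" using FH_pos[OF assms(1)] y by (simp_all add: Hm_def)
  then show "Hm y * ht y = kap y" unfolding e by (rule ennreal_mult_div_cancel)
  have "kap y < \<infinity>"
    using h_pos[OF assms(2)] assms(2) y by (simp add: kap_def h0_def HI_def Hm_def ennreal_mult_less_top)
  then show "ht y < \<infinity>" unfolding e using p by (intro ennreal_divide_finite)
qed

lemma ht_pos: assumes "y \<in> D" shows "0 < ht y" "0 < kap y" "kap y < \<infinity>" "ht y < \<infinity>"
proof -
  have y: "y \<in> FH" "y \<in> U0" "y \<in> F" using assms D_sub by auto
  have "I y \<in> FH" "I y \<in> F" using I_D[OF assms] D_sub by auto
  then have "0 < HI y" "HI y < \<infinity>" using FH_pos[of "I y"] y by (simp_all add: HI_def Hm_def)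
  then show k: "0 < kap y" "kap y < \<infinity>"
    using h_pos[OF y(2)] y by (simp_all add: kap_def h0_def ennreal_mult_less_top ennreal_zero_less_mult_iff)
  show "ht y < \<infinity>" by (rule kap_ht(3)[OF y(1,2)])
  show "0 < ht y"
  proof (rule ccontr)
    assume "\<not> 0 < ht y"
    then have "ht y = 0" by simp
    then have "kap y = 0" using kap_ht(1)[OF y(1,2)] by simp
    then show False using k by simp
  qed
qed

lemma killed_cong:
  assumes "0 \<le> t" "\<And>z. z \<in> D \<Longrightarrow> f z = g z"
  shows "killed_semigroup N Y D t f y = killed_semigroup N Y D t g y"
  unfolding killed_semigroup_def
proof (rule nn_integral_cong)
  fix om
  show "(if ennreal t < exit_time Y D om then case Y t om of None \<Rightarrow> 0 | Some y \<Rightarrow> f y else 0) =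
    (if ennreal t < exit_time Y D om then case Y t om of None \<Rightarrow> 0 | Some y \<Rightarrow> g y else 0)"
    using exit_time_less_in[of t Y D om t] assms by (auto split: option.splits)
qed

lemma Rx_cong:
  assumes "0 \<le> t" "\<And>z. z \<in> D \<Longrightarrow> f z = g z"
  shows "Rx t f y = Rx t g y"
  unfolding Rx_def
proof (rule nn_integral_cong)
  fix om
  show "indicator (SD t) (path om) * f (X t om) = indicator (SD t) (path om) * g (X t om)"
    using SD_in[of "path om" t t] assms by (cases "path om \<in> SD t") auto
qed

text \<open>Transforming first by \<open>H\<close> and then by \<open>ht\<close> amounts to one
  transform by \<open>kap\<close>, because \<open>H\<close> times \<open>ht\<close> is
  \<open>kap\<close>.\<close>

lemma fdd_Y_doob:
  assumes "valid_list T l" "y \<in> D"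
  shows "fdd (doob_semigroup N Y D ht) l y = nest Rx l kap y / kap y"
  using assms
proof (induct l arbitrary: y)
  case Nil
  then show ?case using ht_pos[of y] by (simp add: ennreal_div_self)
next
  case (Cons a l)
  obtain s B where a: "a = (s, B)" by (cases a)
  have v: "0 \<le> s" "B \<in> sets BE" "valid_list T l" using Cons.prems a by auto
  have y: "y \<in> D" "y \<in> FH" "y \<in> U0" "y \<in> F" using Cons.prems D_sub by auto
  have B': "D \<inter> {y. 0 < ht y \<and> ht y < \<infinity>} = D" using ht_pos by auto
  \<comment> \<open>On \<open>D\<close> this is the integrand, and it is visibly Borel, while the
    measurability of the inner \<open>fdd\<close> is not known. Dividing by \<open>Hm\<close> undoes
    the weight that \<open>killed_semigroup_Y\<close> brings in.\<close>
  define g where "g z = indicator B z * nest Rx l kap z / Hm z" for z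
  have gm: "g \<in> borel_measurable BE"
    unfolding g_def[abs_def] using v nest_Rx_measurable[OF v(3) kap_measurable] Hm_measurable
    by (intro borel_measurable_divide_ennreal borel_measurable_times_ennreal borel_measurable_indicator)
  have "killed_semigroup N Y D s (\<lambda>z. ht z * (indicator B z * fdd (doob_semigroup N Y D ht) l z)) y = killed_semigroup N Y D s g y"
  proof (rule killed_cong[OF v(1)])
    fix z assume z: "z \<in> D"
    have zz: "z \<in> FH" "z \<in> U0" using z D_sub by auto
    have kz: "kap z / kap z = 1" using ht_pos[OF z] by (intro ennreal_div_self)
    have "ht z * (indicator B z * fdd (doob_semigroup N Y D ht) l z) = (kap z / Hm z) * (indicator B z * (nest Rx l kap z / kap z))"
      using Cons.hyps[OF v(3) z] kap_ht(2)[OF zz] by simp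
    also have "\<dots> = (kap z / kap z) * (indicator B z * nest Rx l kap z / Hm z)"
      by (simp add: divide_ennreal_def mult_ac)
    finally show "ht z * (indicator B z * fdd (doob_semigroup N Y D ht) l z) = g z" by (simp add: kz g_def)
  qed
  also have "\<dots> = Rx s (\<lambda>z. Hm z * g z) y / ennreal (H y)" by (rule killed_semigroup_Y[OF y(1) v(1) gm])
  also have "Rx s (\<lambda>z. Hm z * g z) y = Rx s (\<lambda>z. indicator B z * nest Rx l kap z) y"
  proof (rule Rx_cong[OF v(1)])
    fix z assume "z \<in> D"
    then have "z \<in> FH" using D_sub by auto
    then have "0 < Hm z" "Hm z < \<infinity>" using FH_pos[of z] FH_F by (auto simp: Hm_def)
    then show "Hm z * g z = indicator B z * nest Rx l kap z" unfolding g_def by (rule ennreal_mult_div_cancel)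
  qed
  finally have K: "killed_semigroup N Y D s (\<lambda>z. ht z * (indicator B z * fdd (doob_semigroup N Y D ht) l z)) y = Rx s (\<lambda>z. indicator B z * nest Rx l kap z) y / Hm y"
    using y by (simp add: Hm_def)
  have "fdd (doob_semigroup N Y D ht) (a # l) y = killed_semigroup N Y D s (\<lambda>z. ht z * (indicator B z * fdd (doob_semigroup N Y D ht) l z)) y / ht y"
    unfolding a fdd.simps doob_semigroup_def Let_def B' using y by simp
  also have "\<dots> = Rx s (\<lambda>z. indicator B z * nest Rx l kap z) y / (Hm y * ht y)"
  proof -
    have "inverse (Hm y * ht y) = inverse (Hm y) * inverse (ht y)"
      using FH_pos[OF y(2)] ht_pos[OF y(1)] y by (intro ennreal_inverse_mult) (auto simp: Hm_def)
    then show ?thesis unfolding K by (simp add: divide_ennreal_def mult_ac)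
  qed
  also have "\<dots> = nest Rx (a # l) kap y / kap y" using kap_ht(1)[OF y(2,3)] by (simp add: a)
  finally show ?case .
qed

lemma fdd_Y_doob_out: "y \<notin> D \<Longrightarrow> fdd (doob_semigroup N Y D ht) ((s, B) # l) y = 0"
  by (simp add: doob_semigroup_def Let_def)

definition aliveD :: "real \<Rightarrow> (real \<Rightarrow> 'a option) set" where
  "aliveD t = {w. \<exists>m u. w \<in> stays (KD m) u \<and> gam t w < ennreal u}"

lemma KD_compact: "compactin T (KD m)"
  by (intro closedin_compact_space compact_space_compactified exhausts_closed[OF KD])

lemma KD_U0: "KD m \<subseteq> U0"
  using exhausts_subset[OF KD, of m] D_sub by auto

lemma KD_K0: "\<exists>p. KD m \<subseteq> K0 p"
  by (rule exhausts_compact[OF K0 KD_compact KD_U0])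

text \<open>By continuity of \<open>I\<close> the image is a compact subset of \<open>D\<close>, and
  the exhaustion absorbs it. Inversion thus preserves confinement.\<close>

lemma KD_I: "\<exists>p. I ` KD m \<subseteq> KD p"
proof (rule exhausts_compact[OF KD])
  have "compactin (subtopology T U0) (KD m)" using KD_compact KD_U0 by (simp add: compactin_subtopology)
  then show "compactin T (I ` KD m)" using I_cont by (rule image_compactin)
  show "I ` KD m \<subseteq> D" using exhausts_subset[OF KD, of m] I_D by auto
qed

lemma stays_le: "w \<in> stays C u \<Longrightarrow> C \<subseteq> C' \<Longrightarrow> u' \<le> u \<Longrightarrow> w \<in> stays C' u'"
  by (auto simp: stays_def)

lemma aliveD_alive: "w \<in> aliveD t \<Longrightarrow> w \<in> alive t"
proof -
  assume "w \<in> aliveD t"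
  then obtain m u where w: "w \<in> stays (KD m) u" "gam t w < ennreal u" by (auto simp: aliveD_def)
  obtain p where "KD m \<subseteq> K0 p" using KD_K0 by auto
  from stays_le[OF w(1) this order_refl] have "w \<in> stays (K0 p) u" .
  then show ?thesis using w by (auto simp: alive_def stays_def)
qed

text \<open>\<open>I\<close> maps compact pieces into compact pieces and is its own inverse, and by
  \<open>gam_surj\<close> the time change reaches every time up to the inverse clock; so confinement
  passes in both directions.\<close>

lemma tc_SD_iff:
  assumes w: "w \<in> alive t" and t: "0 \<le> t"
  shows "tc t w \<in> SD t \<longleftrightarrow> w \<in> aliveD t"
proof
  assume "w \<in> aliveD t"
  then obtain m u where m: "w \<in> stays (KD m) u" "gam t w < ennreal u" by (auto simp: aliveD_def)
  obtain p where p: "I ` KD m \<subseteq> KD p" using KD_I by auto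
  have gu: "gamr t w \<le> u" using m(2) by (cases "gam t w") (auto simp: ennreal_less_iff)
  have "tc t w s \<in> KD p" if "0 \<le> s" "s \<le> t" for s
  proof -
    have "gamr (min s t) w \<le> u" using gamr_mono[of "min s t" t w] alive_gam[OF w] gu by auto
    then have "w (gamr (min s t) w) \<in> KD m" using m(1) by (auto simp: stays_def)
    then show ?thesis using p by (auto simp: tc_def)
  qed
  then have "tc t w \<in> stays (KD p) t" using tc_rc[OF w t] by (simp add: stays_def)
  then show "tc t w \<in> SD t" unfolding SD_def by (rule UN_I[OF UNIV_I])
next
  assume "tc t w \<in> SD t"
  then obtain m where m: "tc t w \<in> stays (KD m) t" by (auto simp: SD_def)
  obtain p where p: "I ` KD m \<subseteq> KD p" using KD_I by auto
  obtain q u where w0: "w \<in> stays (K0 q) u" "gam t w < ennreal u" using w by (auto simp: alive_def)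
  have "w r \<in> KD p" if r: "0 \<le> r" "r \<le> gamr t w" for r
  proof -
    obtain s where s: "0 \<le> s" "s \<le> t" "gam s w = ennreal r"
      using gam_surj[OF w0(1) exhausts_closed[OF K0] exhausts_subset[OF K0] t w0(2) r] by blast
    then have "tc t w s = I (w r)" using r by (simp add: tc_def min_absorb1)
    moreover have "tc t w s \<in> KD m" using m s by (simp add: stays_def)
    ultimately have "I (I (w r)) \<in> KD p" using p by auto
    moreover have "w r \<in> points S" using alive_U0[OF w r] U0_sub by auto
    ultimately show ?thesis by (simp add: I_I)
  qed
  then have "w \<in> stays (KD p) (gamr t w)" using w0(1) by (simp add: stays_def)
  \<comment> \<open>\<open>aliveD\<close> demands confinement strictly beyond the inverse clock; the
    next member of the exhaustion provides it.\<close>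
  from stays_extend[OF KD this] obtain u' where u': "u' > gamr t w" "w \<in> stays (KD (Suc p)) u'" by auto
  have "gam t w < ennreal u'" using u'(1) alive_gam[OF w] by (cases "gam t w") (auto simp: ennreal_lessI ennreal_less_iff)
  then show "w \<in> aliveD t" using u'(2) by (auto simp: aliveD_def)
qed

lemma gam_cong:
  assumes "\<And>s. 0 \<le> s \<Longrightarrow> s \<le> u \<Longrightarrow> w s = w' s" "gam t w < ennreal u"
  shows "gam t w' = gam t w"
  unfolding gam_def by (rule inverse_clock_cong[of u]) (use assms in \<open>auto simp: gam_def\<close>)

lemma tc_cong:
  assumes ag: "\<And>s. 0 \<le> s \<Longrightarrow> s \<le> u \<Longrightarrow> w s = w' s" and g: "gam t w < ennreal u"
  shows "tc t w' = tc t w"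
proof
  fix s
  have "gam (min s t) w \<le> gam t w" by (intro gam_mono) auto
  then have lt: "gam (min s t) w < ennreal u" using g by (rule le_less_trans)
  have eq: "gam (min s t) w' = gam (min s t) w" by (rule gam_cong[OF ag lt])
  have "gamr (min s t) w \<le> u" using lt by (cases "gam (min s t) w") (auto simp: ennreal_less_iff)
  then have "w (gamr (min s t) w) = w' (gamr (min s t) w)" by (intro ag) auto
  then show "tc t w' s = tc t w s" by (simp add: tc_def eq)
qed

text \<open>The random time \<open>gam\<close> is replaced by the right end point of its dyadic interval, since the laws of
  \<open>X\<close> and \<open>Y\<close> can be compared at deterministic times only.\<close>

definition slot :: "(real \<times> 'a option set) list \<Rightarrow> nat \<Rightarrow> nat \<Rightarrow> nat \<Rightarrow> (real \<Rightarrow> 'a option) set" where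
  "slot l m n j = {w \<in> stays (KD m) ((real j + 1) / 2 ^ n).
     ennreal (real j / 2 ^ n) \<le> gam (total l) w \<and> gam (total l) w < ennreal ((real j + 1) / 2 ^ n) \<and>
     visits (\<lambda>s. Some (tc (total l) w s)) 0 l}"

lemma slot_aliveD: "w \<in> slot l m n j \<Longrightarrow> w \<in> aliveD (total l)"
  by (auto simp: slot_def aliveD_def)

lemma slot_sets:
  assumes l: "valid_list T l"
  shows "slot l m n j \<in> sets PA"
proof -
  let ?t = "total l"
  have t: "0 \<le> ?t" by (rule total_nonneg[OF l])
  have 1: "stays (KD m) ((real j + 1) / 2 ^ n) \<in> sets PA" by (rule stays_closed[OF exhausts_closed[OF KD]])
  have 2: "{w\<in>space PA. ennreal (real j / 2 ^ n) \<le> gam ?t w \<and> gam ?t w < ennreal ((real j + 1) / 2 ^ n)} \<in> sets PA"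
    using gam_measurable by measurable
  have "{w\<in>alive ?t. tc ?t w \<in> {w\<in>rc_paths T. visits (\<lambda>s. Some (w s)) 0 l}} \<in> sets PA"
    by (rule tc_preimage_sets[OF t visits_path_sets[OF l order_refl]])
  also have "{w\<in>alive ?t. tc ?t w \<in> {w\<in>rc_paths T. visits (\<lambda>s. Some (w s)) 0 l}} = {w\<in>alive ?t. visits (\<lambda>s. Some (tc ?t w s)) 0 l}"
    using tc_rc t by auto
  finally have 3: "{w\<in>alive ?t. visits (\<lambda>s. Some (tc ?t w s)) 0 l} \<in> sets PA" .
  have "slot l m n j = stays (KD m) ((real j + 1) / 2 ^ n) \<inter>
     {w\<in>space PA. ennreal (real j / 2 ^ n) \<le> gam ?t w \<and> gam ?t w < ennreal ((real j + 1) / 2 ^ n)} \<inter>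
     {w\<in>alive ?t. visits (\<lambda>s. Some (tc ?t w s)) 0 l}"
    using aliveD_alive[OF slot_aliveD, of _ l m n j] by (auto simp: slot_def stays_def)
  then show ?thesis using 1 2 3 by auto
qed

text \<open>Membership is decided by the path up to the right end of the slot, so it can be tested
  on the path frozen there, at a deterministic time where the laws of \<open>X\<close> and
  \<open>Y\<close> are comparable.\<close>

lemma slot_cong:
  assumes ag: "\<And>s. 0 \<le> s \<Longrightarrow> s \<le> (real j + 1) / 2 ^ n \<Longrightarrow> w s = w' s" and rc: "w' \<in> rc_paths T"
    and w: "w \<in> slot l m n j"
  shows "w' \<in> slot l m n j"
proof -
  have g: "gam (total l) w < ennreal ((real j + 1) / 2 ^ n)" using w by (simp add: slot_def)
  have "w' \<in> stays (KD m) ((real j + 1) / 2 ^ n)"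
    using w rc by (auto simp: slot_def stays_def ag[symmetric])
  moreover have "gam (total l) w' = gam (total l) w" by (rule gam_cong[OF ag g])
  moreover have "tc (total l) w' = tc (total l) w" by (rule tc_cong[OF ag g])
  ultimately show ?thesis using w by (simp add: slot_def)
qed

end

section \<open>Dyadic slots for the inverse clock\<close>

context prop4
begin

lemma slot_disjoint:
  assumes "w \<in> slot l m n j" "w \<in> slot l m n j'"
  shows "j = j'"
proof -
  have "ennreal (real i / 2 ^ n) < ennreal ((real k + 1) / 2 ^ n)"
    if "w \<in> slot l m n i" "w \<in> slot l m n k" for i k
    using that by (auto simp: slot_def intro: le_less_trans)
  then have "real i < real k + 1" if "w \<in> slot l m n i" "w \<in> slot l m n k" for i k
    using that by (fastforce simp: ennreal_less_iff divide_less_cancel)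
  from this[OF assms] this[OF assms(2,1)] show ?thesis by linarith
qed

lemma slot_gam:
  assumes "w \<in> slot l m n j"
  shows "0 \<le> gamr (total l) w" "gam (total l) w = ennreal (gamr (total l) w)"
    "(real j + 1) / 2 ^ n = dyadic_above n (gamr (total l) w)"
proof -
  have g: "ennreal (real j / 2 ^ n) \<le> gam (total l) w" "gam (total l) w < ennreal ((real j + 1) / 2 ^ n)"
    using assms by (auto simp: slot_def)
  then have fin: "gam (total l) w < \<infinity>" by (auto intro: less_trans)
  then show e: "gam (total l) w = ennreal (gamr (total l) w)" by (cases "gam (total l) w") auto
  show "0 \<le> gamr (total l) w" by simp
  have "real j / 2 ^ n \<le> gamr (total l) w" "gamr (total l) w < (real j + 1) / 2 ^ n"
    using ord_le_eq_trans[OF g(1) e] ord_eq_less_trans[OF e[symmetric] g(2)] by (simp_all add: ennreal_less_iff)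
  then show "(real j + 1) / 2 ^ n = dyadic_above n (gamr (total l) w)" by (rule dyadic_above_interval[symmetric])
qed

lemma slot_exists:
  assumes w: "w \<in> stays (KD m) u" and g: "gam (total l) w < \<infinity>" "dyadic_above n (gamr (total l) w) \<le> u"
    and v: "visits (\<lambda>s. Some (tc (total l) w s)) 0 l"
  shows "\<exists>j. w \<in> slot l m n j \<and> (real j + 1) / 2 ^ n = dyadic_above n (gamr (total l) w)"
proof -
  obtain j :: nat where j: "real j / 2 ^ n \<le> gamr (total l) w" "gamr (total l) w < (real j + 1) / 2 ^ n"
    using dyadic_above_index[of "gamr (total l) w" n] by auto
  have d: "dyadic_above n (gamr (total l) w) = (real j + 1) / 2 ^ n" by (rule dyadic_above_interval[OF j])
  have e: "gam (total l) w = ennreal (gamr (total l) w)" using g(1) by (cases "gam (total l) w") auto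
  have "ennreal (real j / 2 ^ n) \<le> gam (total l) w" "gam (total l) w < ennreal ((real j + 1) / 2 ^ n)"
    using j by (subst e, simp add: ennreal_leI ennreal_less_iff)+
  moreover have "w \<in> stays (KD m) ((real j + 1) / 2 ^ n)" using stays_le[OF w order_refl] g(2) d by simp
  ultimately show ?thesis using v d by (auto simp: slot_def)
qed

text \<open>A finer grid ends no later, and a larger compact set confines less. This makes the
  unions over \<open>j\<close> increase in \<open>n\<close> and in \<open>m\<close>.\<close>

lemma slot_refine:
  assumes "w \<in> slot l m n j" "m \<le> m'"
  shows "\<exists>j'. w \<in> slot l m' (Suc n) j' \<and> (real j' + 1) / 2 ^ Suc n \<le> (real j + 1) / 2 ^ n"
    "w \<in> slot l m' n j"
proof -
  have w: "w \<in> stays (KD m) ((real j + 1) / 2 ^ n)" "visits (\<lambda>s. Some (tc (total l) w s)) 0 l"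
    using assms(1) by (auto simp: slot_def)
  have w': "w \<in> stays (KD m') ((real j + 1) / 2 ^ n)"
    by (rule stays_le[OF w(1) exhausts_mono[OF KD assms(2)] order_refl])
  then show "w \<in> slot l m' n j" using assms(1) by (simp add: slot_def)
  have d: "dyadic_above (Suc n) (gamr (total l) w) \<le> (real j + 1) / 2 ^ n"
    using slot_gam(3)[OF assms(1)] dyadic_above_Suc_le[of n "gamr (total l) w"] by simp
  have "gam (total l) w < \<infinity>" using slot_gam(2)[OF assms(1)] by (metis ennreal_less_top infinity_ennreal_def)
  from slot_exists[OF w' this d w(2)] d
  show "\<exists>j'. w \<in> slot l m' (Suc n) j' \<and> (real j' + 1) / 2 ^ Suc n \<le> (real j + 1) / 2 ^ n" by auto
qed

definition slots :: "(real \<times> 'a option set) list \<Rightarrow> nat \<Rightarrow> nat \<Rightarrow> (real \<Rightarrow> 'a option) set" where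
  "slots l m n = (\<Union>j. slot l m n j)"

lemma slots_mono: "slots l m n \<subseteq> slots l m (Suc n)" "slots l m n \<subseteq> slots l (Suc m) n"
  unfolding slots_def using slot_refine(1)[OF _ order_refl] slot_refine(2)[of _ l m n _ "Suc m"] by fastforce+

lemma slots_incseq: "n \<le> n' \<Longrightarrow> slots l m n \<subseteq> slots l m n'"
  by (rule lift_Suc_mono_le[of "slots l m"]) (rule slots_mono)

lemma slots_sets: "valid_list T l \<Longrightarrow> slots l m n \<in> sets PA"
  unfolding slots_def using slot_sets by (intro sets.countable_UN) auto

text \<open>Confinement reaches strictly beyond the inverse clock, so for a fine enough grid the end
  of the slot still falls into the confined stretch.\<close>

lemma slots_union:
  "(\<Union>m n. slots l m n) = {w\<in>aliveD (total l). visits (\<lambda>s. Some (tc (total l) w s)) 0 l}"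
proof (intro set_eqI iffI)
  fix w assume "w \<in> (\<Union>m n. slots l m n)"
  then show "w \<in> {w\<in>aliveD (total l). visits (\<lambda>s. Some (tc (total l) w s)) 0 l}"
    using slot_aliveD[of w l] by (auto simp: slots_def slot_def)
next
  fix w assume "w \<in> {w\<in>aliveD (total l). visits (\<lambda>s. Some (tc (total l) w s)) 0 l}"
  then obtain m u where w: "w \<in> stays (KD m) u" "gam (total l) w < ennreal u" "visits (\<lambda>s. Some (tc (total l) w s)) 0 l"
    by (auto simp: aliveD_def)
  have "gamr (total l) w < u" using w(2) by (cases "gam (total l) w") (auto simp: ennreal_less_iff)
  then have "eventually (\<lambda>n. dyadic_above n (gamr (total l) w) \<in> {..<u}) sequentially"
    using filterlim_dyadic_above[of "gamr (total l) w"]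
    by (intro topological_tendstoD[of _ "gamr (total l) w"]) (auto simp: filterlim_at)
  then obtain n where n: "dyadic_above n (gamr (total l) w) < u" by (auto simp: eventually_sequentially)
  have "gam (total l) w < \<infinity>" using w(2) by (auto intro: less_trans)
  from slot_exists[OF w(1) this less_imp_le[OF n] w(3)] show "w \<in> (\<Union>m n. slots l m n)"
    by (auto simp: slots_def)
qed

text \<open>The slot is tested on \<open>Y\<close> frozen at the end of that slot, so
  \<open>Y\<close> has to survive only until then; each \<open>j\<close> comes with its own law
  \<open>YL\<close>.\<close>

definition YS :: "'a option \<Rightarrow> (real \<times> 'a option set) list \<Rightarrow> nat \<Rightarrow> nat \<Rightarrow> nat \<Rightarrow> 'u set" where
  "YS x l m n j = {om\<in>Al ((real j + 1) / 2 ^ n) x. Yst ((real j + 1) / 2 ^ n) om \<in> slot l m n j}"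

text \<open>By \<open>slot_cong\<close> the membership test looks no further than the end of the
  slot, so a later freezing can be moved forward to it.\<close>

lemma YS_shrink:
  assumes x: "x \<in> F" and om: "om \<in> Al u x" and u: "(real j + 1) / 2 ^ n \<le> u" and s: "Yst u om \<in> slot l m n j"
  shows "om \<in> YS x l m n j"
proof -
  let ?q = "(real j + 1) / 2 ^ n"
  have om': "om \<in> space (N x)" "Y u om \<noteq> None" using om by (auto simp: Al_def)
  have q: "0 \<le> ?q" by simp
  obtain y where y: "y \<in> F" "Y ?q om = Some y" using Y_alive[OF x om'(1) q u om'(2)] by auto
  have "Yst ?q om \<in> rc_paths T" by (rule Yst_rc[OF x om'(1) q]) (simp add: y)
  then have "Yst ?q om \<in> slot l m n j"
    by (rule slot_cong[rotated, OF _ s]) (use u in simp)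
  then show ?thesis using y om' by (simp add: YS_def Al_def)
qed

text \<open>The members are tested on paths frozen at different times. The earlier test is first
  carried over to the later freezing, where disjointness of the slots of one path applies.\<close>

lemma YS_disjoint:
  assumes x: "x \<in> F" shows "disjoint_family (YS x l m n)"
proof -
  have less: "j = j'" if j: "om \<in> YS x l m n j" "om \<in> YS x l m n j'" "j \<le> j'" for j j' om
  proof -
    let ?u = "(real j' + 1) / 2 ^ n" and ?q = "(real j + 1) / 2 ^ n"
    have u: "?q \<le> ?u" using that by (intro divide_right_mono) auto
    have A: "om \<in> space (N x)" "Y ?u om \<noteq> None" "Yst ?u om \<in> slot l m n j'" "Yst ?q om \<in> slot l m n j"
      using j by (auto simp: YS_def Al_def)
    have "Yst ?u om \<in> rc_paths T" by (rule Yst_rc[OF x A(1) _ A(2)]) simp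
    then have "Yst ?u om \<in> slot l m n j" by (rule slot_cong[rotated, OF _ A(4)]) (use u in simp)
    then show "j = j'" using A(3) by (rule slot_disjoint)
  qed
  show ?thesis
  proof (unfold disjoint_family_on_def, intro ballI impI)
    fix j j' :: nat assume "j \<noteq> j'"
    then show "YS x l m n j \<inter> YS x l m n j' = {}" using less[of _ j j'] less[of _ j' j] by (cases "j \<le> j'") auto
  qed
qed

lemma YS_mono:
  assumes x: "x \<in> F"
  shows "(\<Union>j. YS x l m n j) \<subseteq> (\<Union>j. YS x l m (Suc n) j)" "(\<Union>j. YS x l m n j) \<subseteq> (\<Union>j. YS x l (Suc m) n j)"
proof -
  show "(\<Union>j. YS x l m n j) \<subseteq> (\<Union>j. YS x l m (Suc n) j)"
  proof
    fix om assume "om \<in> (\<Union>j. YS x l m n j)"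
    then obtain j where j: "om \<in> Al ((real j + 1) / 2 ^ n) x" "Yst ((real j + 1) / 2 ^ n) om \<in> slot l m n j"
      by (auto simp: YS_def)
    from slot_refine(1)[OF j(2) order_refl] obtain j' where j':
      "Yst ((real j + 1) / 2 ^ n) om \<in> slot l m (Suc n) j'" "(real j' + 1) / 2 ^ Suc n \<le> (real j + 1) / 2 ^ n" by auto
    have "om \<in> YS x l m (Suc n) j'" by (rule YS_shrink[OF x j(1) j'(2,1)])
    then show "om \<in> (\<Union>j. YS x l m (Suc n) j)" by auto
  qed
  show "(\<Union>j. YS x l m n j) \<subseteq> (\<Union>j. YS x l (Suc m) n j)"
    using slot_refine(2)[of _ l m n _ "Suc m"] by (auto simp: YS_def)
qed

lemma YS_sets:
  assumes "x \<in> F" "valid_list T l"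
  shows "YS x l m n j \<in> sets (N x)" "emeasure (N x) (YS x l m n j) = emeasure (YL ((real j + 1) / 2 ^ n) x) (slot l m n j)"
  unfolding YS_def using emeasure_YL[OF assms(1) _ slot_sets[OF assms(2)], of "(real j + 1) / 2 ^ n" m n j] by auto

text \<open>At most one term is nonzero, so on \<open>slots\<close> the series is \<open>Hm\<close>
  at the dyadic approximation of the inverse clock. Its terms come from comparisons at deterministic
  times.\<close>

definition slot_sum :: "(real \<times> 'a option set) list \<Rightarrow> nat \<Rightarrow> nat \<Rightarrow> (real \<Rightarrow> 'a option) \<Rightarrow> ennreal" where
  "slot_sum l m n w = (\<Sum>j. Hm (w ((real j + 1) / 2 ^ n)) * indicator (slot l m n j) w)"

lemma slot_sum_eq:
  "slot_sum l m n w = Hm (w (dyadic_above n (gamr (total l) w))) * indicator (slots l m n) w"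
proof (cases "w \<in> slots l m n")
  case True
  then obtain j where j: "w \<in> slot l m n j" by (auto simp: slots_def)
  have "slot_sum l m n w = (\<Sum>j\<in>{j}. Hm (w ((real j + 1) / 2 ^ n)) * indicator (slot l m n j) w)"
    unfolding slot_sum_def
    by (rule suminf_finite) (use slot_disjoint[OF j] in \<open>auto simp: indicator_def\<close>)
  then show ?thesis using j True slot_gam(3)[OF j] by simp
next
  case False
  then show ?thesis by (auto simp: slot_sum_def slots_def indicator_def)
qed

lemma slot_term_measurable:
  assumes "valid_list T l"
  shows "(\<lambda>w. Hm (w ((real j + 1) / 2 ^ n)) * indicator (slot l m n j) w :: ennreal) \<in> borel_measurable PA"
  using slot_sets[OF assms] measurable_compose[OF path_eval Hm_measurable]
  by (intro borel_measurable_times_ennreal borel_measurable_indicator) auto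

lemma slot_sum_measurable: "valid_list T l \<Longrightarrow> slot_sum l m n \<in> borel_measurable PA"
  unfolding slot_sum_def[abs_def] by (intro borel_measurable_suminf_order slot_term_measurable)

text \<open>Each slot is compared at its own end point, where the two laws agree because the slot
  includes confinement to \<open>KD m\<close>. The slot does not notice the freezing, so one law of
  \<open>X\<close> serves all terms.\<close>

lemma YS_emeasure:
  assumes x: "x \<in> D" and l: "valid_list T l"
  shows "emeasure (N x) (\<Union>j. YS x l m n j) = inverse (Hm x) * (\<integral>\<^sup>+w. slot_sum l m n w \<partial>Lx x)"
proof -
  have xF: "x \<in> F" "x \<in> points S" using x D_sub F_E by auto
  have "emeasure (N x) (\<Union>j. YS x l m n j) = (\<Sum>j. emeasure (N x) (YS x l m n j))"
    using YS_sets(1)[OF xF(1) l] YS_disjoint[OF xF(1)] by (intro suminf_emeasure[symmetric]) auto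
  also have "\<dots> = (\<Sum>j. inverse (Hm x) * (\<integral>\<^sup>+w. Hm (w ((real j + 1) / 2 ^ n)) * indicator (slot l m n j) w \<partial>Lx x))"
  proof (rule suminf_cong)
    fix j
    let ?u = "(real j + 1) / 2 ^ n"
    have u: "0 \<le> ?u" by simp
    have sub: "slot l m n j \<inter> stays (KD m) ?u = slot l m n j" by (auto simp: slot_def)
    have "emeasure (N x) (YS x l m n j) = emeasure (XL ?u x) (slot l m n j)"
      using YL_eq_stays[OF x u slot_sets[OF l], of m n j m] unfolding sub YS_sets(2)[OF xF(1) l] .
    also have "\<dots> = (\<integral>\<^sup>+w. indicator (slot l m n j) w \<partial>XL ?u x)" using slot_sets[OF l] by simp
    also have "\<dots> = (\<integral>\<^sup>+om. Hm (X ?u om) * indicator (slot l m n j) (\<lambda>s. X (min s ?u) om) \<partial>P x) / ennreal (H x)"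
      using slot_sets[OF l] by (intro nn_integral_XL[OF xF(2) u]) auto
    also have "(\<integral>\<^sup>+om. Hm (X ?u om) * indicator (slot l m n j) (\<lambda>s. X (min s ?u) om) \<partial>P x) =
      (\<integral>\<^sup>+om. Hm (path om ?u) * indicator (slot l m n j) (path om) \<partial>P x)"
    proof (rule nn_integral_cong)
      fix om assume "om \<in> space (P x)"
      then have rc: "path om \<in> rc_paths T" using path_rc xF by auto
      have "(\<lambda>s. X (min s ?u) om) \<in> slot l m n j \<longleftrightarrow> path om \<in> slot l m n j"
        using slot_cong[of j n "\<lambda>s. X (min s ?u) om" "path om" l m, OF _ rc]
          slot_cong[of j n "path om" "\<lambda>s. X (min s ?u) om" l m, OF _ stop_rc_paths[OF rc u]] by auto
      then show "Hm (X ?u om) * indicator (slot l m n j) (\<lambda>s. X (min s ?u) om) = Hm (path om ?u) * indicator (slot l m n j) (path om)"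
        by (simp add: indicator_def)
    qed
    also have "\<dots> = (\<integral>\<^sup>+w. Hm (w ?u) * indicator (slot l m n j) w \<partial>Lx x)"
      by (rule nn_integral_Lx[OF xF(2) slot_term_measurable[OF l], symmetric])
    finally show "emeasure (N x) (YS x l m n j) = inverse (Hm x) * (\<integral>\<^sup>+w. Hm (w ?u) * indicator (slot l m n j) w \<partial>Lx x)"
      using xF by (simp add: divide_ennreal_def mult.commute Hm_eq)
  qed
  also have "\<dots> = inverse (Hm x) * (\<Sum>j. \<integral>\<^sup>+w. Hm (w ((real j + 1) / 2 ^ n)) * indicator (slot l m n j) w \<partial>Lx x)"
    by (rule ennreal_suminf_cmult)
  also have "(\<Sum>j. \<integral>\<^sup>+w. Hm (w ((real j + 1) / 2 ^ n)) * indicator (slot l m n j) w \<partial>Lx x) = (\<integral>\<^sup>+w. slot_sum l m n w \<partial>Lx x)"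
    unfolding slot_sum_def using slot_term_measurable[OF l]
    by (intro nn_integral_suminf[symmetric]) (simp cong: measurable_cong_sets)
  finally show ?thesis .
qed

lemma Hm_KD_bound: "\<exists>b<\<infinity>. \<forall>y\<in>KD m. Hm y \<le> b"
proof -
  have sub: "KD m \<subseteq> D" by (rule exhausts_subset[OF KD])
  have "\<exists>a b. 0 < a \<and> 0 < b \<and> (\<forall>y\<in>KD m. a \<le> H y \<and> H y \<le> b)"
  proof (rule continuous_map_bounds[OF compact_space_compactified H_cont exhausts_closed[OF KD]])
    show "KD m \<subseteq> F" "\<And>y. y \<in> KD m \<Longrightarrow> 0 < H y" using sub D_sub H_int by auto
  qed
  then obtain b where "\<forall>y\<in>KD m. H y \<le> b" by auto
  then show ?thesis using sub D_sub by (intro exI[of _ "ennreal b"]) (auto simp: Hm_def ennreal_leI)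
qed

text \<open>The approximations approach the inverse clock from the right. There the path is
  right-continuous and stays in the open set \<open>D\<close> for a while, so continuity of
  \<open>H\<close> on \<open>F\<close> applies.\<close>

lemma slot_sum_tendsto:
  assumes w: "w \<in> rc_paths T"
  shows "(\<lambda>n. slot_sum l m n w) \<longlonglongrightarrow> Hm (w (gamr (total l) w)) * indicator (\<Union>n. slots l m n) w"
proof (cases "w \<in> (\<Union>n. slots l m n)")
  case False
  then show ?thesis by (auto simp: slot_sum_eq indicator_def)
next
  case True
  then obtain n0 where n0: "w \<in> slots l m n0" by auto
  let ?g = "gamr (total l) w"
  have sd: "w \<in> stays (KD m) ?g"
  proof -
    from n0 obtain j where j: "w \<in> slot l m n0 j" by (auto simp: slots_def)
    have "?g \<le> (real j + 1) / 2 ^ n0" using slot_gam(3)[OF j] dyadic_above_gt[of ?g n0] by simp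
    then show ?thesis using stays_le[of w "KD m" "(real j + 1) / 2 ^ n0"] j by (auto simp: slot_def)
  qed
  then have "w ?g \<in> KD m" by (simp add: stays_def)
  then have D: "w ?g \<in> D" using exhausts_subset[OF KD] by auto
  have nD: "eventually (\<lambda>s. w s \<in> D) (at_right ?g)" by (rule rc_pathsD[OF w _ openin_D D]) simp
  have "limitin euclideanreal (\<lambda>s. H (w s)) (H (w ?g)) (at_right ?g)"
  proof (rule limitin_compose_on[OF H_cont])
    show "limitin T w (w ?g) (at_right ?g)" using w by (auto simp: rc_paths_def)
    show "w ?g \<in> F" using D D_sub by auto
    show "\<forall>\<^sub>F s in at_right ?g. w s \<in> F" using nD by eventually_elim (use D_sub in auto)
  qed
  then have "((\<lambda>s. ennreal (H (w s))) \<longlongrightarrow> ennreal (H (w ?g))) (at_right ?g)" by simp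
  then have 1: "(\<lambda>n. ennreal (H (w (dyadic_above n ?g)))) \<longlonglongrightarrow> ennreal (H (w ?g))"
    by (rule filterlim_compose[OF _ filterlim_dyadic_above])
  have ev: "eventually (\<lambda>n. slot_sum l m n w = ennreal (H (w (dyadic_above n ?g)))) sequentially"
  proof -
    have "eventually (\<lambda>n. w (dyadic_above n ?g) \<in> D) sequentially"
      using nD filterlim_dyadic_above[of ?g] by (rule eventually_compose_filterlim)
    moreover have "eventually (\<lambda>n. n0 \<le> n) sequentially" by (rule eventually_ge_at_top)
    ultimately show ?thesis
    proof eventually_elim
      case (elim n)
      then have "w \<in> slots l m n" using slots_incseq n0 by blast
      then show ?case using elim D_sub by (auto simp: slot_sum_eq Hm_def)
    qed
  qed
  from 1 have "(\<lambda>n. slot_sum l m n w) \<longlonglongrightarrow> ennreal (H (w ?g))"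
    by (rule Lim_transform_eventually) (use ev in eventually_elim, simp)
  then show ?thesis using True D D_sub by (auto simp: Hm_def)
qed

text \<open>On a slot the path is still in \<open>KD m\<close> at the time of evaluation, and
  \<open>H\<close> is bounded there; the bound depends on \<open>m\<close> but not on
  \<open>n\<close>.\<close>

lemma slot_sum_bound: "\<exists>b<\<infinity>. \<forall>n w. slot_sum l m n w \<le> b"
proof -
  obtain b where b: "b < \<infinity>" "\<forall>y\<in>KD m. Hm y \<le> b" using Hm_KD_bound[of m] by auto
  have "slot_sum l m n w \<le> b" for n w
  proof (cases "w \<in> slots l m n")
    case True
    then obtain j where j: "w \<in> slot l m n j" by (auto simp: slots_def)
    then have "w (dyadic_above n (gamr (total l) w)) \<in> KD m"
      using slot_gam(3)[OF j] less_imp_le[OF le_less_trans[OF slot_gam(1)[OF j] dyadic_above_gt], of n] by (auto simp: slot_def stays_def)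
    then show ?thesis using b True by (simp add: slot_sum_eq)
  qed (simp add: slot_sum_eq)
  then show ?thesis using b(1) by auto
qed

text \<open>The order of the limits matters: \<open>n\<close> first, by dominated convergence with a
  bound that depends on \<open>m\<close>, then \<open>m\<close> by monotonicity.\<close>

lemma YS_union_emeasure:
  assumes x: "x \<in> D" and l: "valid_list T l"
  shows "emeasure (N x) (\<Union>m n j. YS x l m n j) =
    inverse (Hm x) * (\<integral>\<^sup>+w. Hm (w (gamr (total l) w)) * indicator (\<Union>m n. slots l m n) w \<partial>Lx x)"
proof -
  have xF: "x \<in> F" "x \<in> points S" "x \<in> FH" using x D_sub F_E by auto
  interpret Lx: prob_space "Lx x" by (rule Lx_prob[OF xF(2)])
  have c: "inverse (Hm x) < top" using FH_pos[OF xF(3)] xF by (simp add: Hm_eq less_top[symmetric] ennreal_inverse_eq_top_iff)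
  define \<phi> where "\<phi> w = Hm (w (gamr (total l) w))" for w
  have \<phi>: "\<phi> \<in> borel_measurable (Lx x)"
    unfolding \<phi>_def[abs_def] using measurable_compose[OF eval_gam_measurable Hm_measurable] by (simp cong: measurable_cong_sets)
  have ys: "(\<Union>j. YS x l m n j) \<in> sets (N x)" for m n using YS_sets(1)[OF xF(1) l] by auto
  have S1: "(\<Union>n. slots l m n) \<in> sets (Lx x)" for m using slots_sets[OF l] by auto
  have m: "emeasure (N x) (\<Union>n j. YS x l m n j) = inverse (Hm x) * (\<integral>\<^sup>+w. \<phi> w * indicator (\<Union>n. slots l m n) w \<partial>Lx x)" for m
  proof (rule LIMSEQ_unique)
    show "(\<lambda>n. emeasure (N x) (\<Union>j. YS x l m n j)) \<longlonglongrightarrow> emeasure (N x) (\<Union>n j. YS x l m n j)"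
      using ys YS_mono(1)[OF xF(1), of l m] by (intro Lim_emeasure_incseq incseq_SucI) auto
    obtain b where b: "b < \<infinity>" "\<forall>n w. slot_sum l m n w \<le> b" using slot_sum_bound[of l m] by auto
    have "(\<lambda>n. \<integral>\<^sup>+w. slot_sum l m n w \<partial>Lx x) \<longlonglongrightarrow> (\<integral>\<^sup>+w. \<phi> w * indicator (\<Union>n. slots l m n) w \<partial>Lx x)"
    proof (rule nn_integral_dominated_convergence[where w="\<lambda>_. b"])
      show "slot_sum l m n \<in> borel_measurable (Lx x)" for n using slot_sum_measurable[OF l] by (simp cong: measurable_cong_sets)
      show "(\<lambda>w. \<phi> w * indicator (\<Union>n. slots l m n) w) \<in> borel_measurable (Lx x)"
        using \<phi> S1 by (intro borel_measurable_times_ennreal borel_measurable_indicator) auto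
      show "(\<integral>\<^sup>+ w. b \<partial>Lx x) < \<infinity>" using b Lx.emeasure_space_1 by (simp del: space_Lx)
      show "AE w in Lx x. (\<lambda>n. slot_sum l m n w) \<longlonglongrightarrow> \<phi> w * indicator (\<Union>n. slots l m n) w"
        unfolding \<phi>_def by (rule AE_I2) (rule slot_sum_tendsto, simp)
    qed (use b in auto)
    then have "(\<lambda>n. inverse (Hm x) * (\<integral>\<^sup>+w. slot_sum l m n w \<partial>Lx x)) \<longlonglongrightarrow> inverse (Hm x) * (\<integral>\<^sup>+w. \<phi> w * indicator (\<Union>n. slots l m n) w \<partial>Lx x)"
      by (rule ennreal_tendsto_cmult[OF c])
    then show "(\<lambda>n. emeasure (N x) (\<Union>j. YS x l m n j)) \<longlonglongrightarrow> inverse (Hm x) * (\<integral>\<^sup>+w. \<phi> w * indicator (\<Union>n. slots l m n) w \<partial>Lx x)"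
      by (simp only: YS_emeasure[OF x l])
  qed
  \<comment> \<open>Puts monotone convergence in \<open>m\<close> into the form of continuity of a
    weighted measure along increasing sets.\<close>
  have dens: "(\<integral>\<^sup>+w. \<phi> w * indicator A w \<partial>Lx x) = emeasure (density (Lx x) \<phi>) A" if "A \<in> sets (Lx x)" for A
    using \<phi> that by (rule emeasure_density[symmetric])
  show ?thesis unfolding \<phi>_def[symmetric]
  proof (rule LIMSEQ_unique)
    show "(\<lambda>m. emeasure (N x) (\<Union>n j. YS x l m n j)) \<longlonglongrightarrow> emeasure (N x) (\<Union>m n j. YS x l m n j)"
    proof (intro Lim_emeasure_incseq incseq_SucI)
      show "range (\<lambda>m. \<Union>n j. YS x l m n j) \<subseteq> sets (N x)" using ys by auto
      show "(\<Union>n j. YS x l m n j) \<subseteq> (\<Union>n j. YS x l (Suc m) n j)" for m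
        by (rule UN_mono[OF subset_refl YS_mono(2)[OF xF(1)]])
    qed
    have "(\<lambda>m. emeasure (density (Lx x) \<phi>) (\<Union>n. slots l m n)) \<longlonglongrightarrow> emeasure (density (Lx x) \<phi>) (\<Union>m n. slots l m n)"
    proof (intro Lim_emeasure_incseq incseq_SucI)
      show "range (\<lambda>m. \<Union>n. slots l m n) \<subseteq> sets (density (Lx x) \<phi>)" using S1 by auto
      show "(\<Union>n. slots l m n) \<subseteq> (\<Union>n. slots l (Suc m) n)" for m
        using slots_mono(2)[of l m] by (intro UN_mono) auto
    qed
    moreover have "(\<Union>m n. slots l m n) \<in> sets (Lx x)" using S1 by auto
    ultimately have "(\<lambda>m. \<integral>\<^sup>+w. \<phi> w * indicator (\<Union>n. slots l m n) w \<partial>Lx x) \<longlonglongrightarrow> (\<integral>\<^sup>+w. \<phi> w * indicator (\<Union>m n. slots l m n) w \<partial>Lx x)"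
      using S1 by (simp only: dens)
    then have "(\<lambda>m. inverse (Hm x) * (\<integral>\<^sup>+w. \<phi> w * indicator (\<Union>n. slots l m n) w \<partial>Lx x)) \<longlonglongrightarrow> inverse (Hm x) * (\<integral>\<^sup>+w. \<phi> w * indicator (\<Union>m n. slots l m n) w \<partial>Lx x)"
      by (rule ennreal_tendsto_cmult[OF c])
    then show "(\<lambda>m. emeasure (N x) (\<Union>n j. YS x l m n j)) \<longlonglongrightarrow> inverse (Hm x) * (\<integral>\<^sup>+w. \<phi> w * indicator (\<Union>m n. slots l m n) w \<partial>Lx x)"
      by (simp only: m)
  qed
qed

text \<open>A number \<open>u\<close> strictly between the inverse clock and the exit time gives a
  stretch of confinement, and a dyadic point inside it produces the slot. Conversely, on a slot the
  inverted process is the inverted frozen path.\<close>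

lemma YS_iff:
  assumes x: "x \<in> F" and l: "valid_list T l" "l \<noteq> []" and om: "om \<in> space (N x)"
    and good: "\<forall>u\<ge>0. (\<forall>s\<in>{0..u}. Y s om \<in> Some ` D) \<longrightarrow> (\<exists>m. \<forall>s\<in>{0..u}. Y s om \<in> Some ` KD m)"
  shows "visits (\<lambda>t. inverted_process I v D Y t om) 0 l \<longleftrightarrow> om \<in> (\<Union>m n j. YS x l m n j)"
proof -
  let ?t = "total l"
  have t: "0 \<le> ?t" by (rule total_nonneg[OF l(1)])
  \<comment> \<open>Up to the last visit the inverted process may be read off the path frozen at any
    \<open>u\<close> beyond the inverse clock up to which the path is confined.\<close>
  have visits_eq: "visits (\<lambda>t. inverted_process I v D Y t om) 0 l \<longleftrightarrow> visits (\<lambda>s. Some (tc ?t (Yst u om) s)) 0 l"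
    if a: "om \<in> Al u x" "0 \<le> u" and k: "Yst u om \<in> stays (KD m) u" "gam ?t (Yst u om) < ennreal u" for u m
  proof (rule visits_cong[OF l(1)])
    fix s assume s: "0 \<le> s" "s \<le> 0 + ?t"
    have "inverted_process I v D Y s om = Some (I (Yst u om (gamr s (Yst u om))))"
    proof (rule inverted_process_eq[OF D_sub(2)])
      fix r assume r: "0 \<le> r" "r \<le> u"
      have "Y u om \<noteq> None" using a by (auto simp: Al_def)
      from Y_alive[OF x om r this] show "Y r om = Some (Yst u om r)" using r by auto
      show "Yst u om r \<in> D" using k(1) r exhausts_subset[OF KD, of m] by (auto simp: stays_def)
    next
      show "gam s (Yst u om) < ennreal u" using gam_mono[of s ?t "Yst u om"] s k(2) by (auto intro: le_less_trans)
    qed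
    then show "inverted_process I v D Y s om = Some (tc ?t (Yst u om) s)" using s by (simp add: tc_def)
  qed
  show ?thesis
  proof
    assume "om \<in> (\<Union>m n j. YS x l m n j)"
    then obtain m n j where j: "om \<in> YS x l m n j" by auto
    show "visits (\<lambda>t. inverted_process I v D Y t om) 0 l"
      by (rule visits_eq[THEN iffD2, of "(real j + 1) / 2 ^ n" m]) (use j in \<open>auto simp: YS_def slot_def\<close>)
  next
    assume v: "visits (\<lambda>t. inverted_process I v D Y t om) 0 l"
    have "inverted_process I v D Y ?t om \<noteq> None" using visits_last[OF v l(2)] by simp
    from inverted_process_alive[OF this] obtain u where u: "0 \<le> u" "inverse_clock v Y ?t om < ennreal u"
      "\<forall>s\<in>{0..u}. Y s om \<in> Some ` D" by auto
    from good u obtain m where m: "\<forall>s\<in>{0..u}. Y s om \<in> Some ` KD m" by auto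
    have "Y u om \<in> Some ` D" using u by auto
    then have a: "om \<in> Al u x" "Y u om \<noteq> None" using D_sub om by (auto simp: Al_def)
    have rc: "Yst u om \<in> rc_paths T" by (rule Yst_rc[OF x om u(1) a(2)])
    have k: "Yst u om \<in> stays (KD m) u" using rc m by (force simp: stays_def)
    have "gam ?t (Yst u om) = inverse_clock v Y ?t om" unfolding gam_def
    proof (rule inverse_clock_cong[OF _ u(2)])
      fix s assume s: "0 \<le> s" "s \<le> u"
      then have "Y s om \<in> Some ` D" using u(3) by simp
      then obtain y where y: "y \<in> D" "Y s om = Some y" by (elim imageE) simp
      then show "(case Y s om of None \<Rightarrow> 0 | Some y \<Rightarrow> ennreal (1 / v y)) =
         (case Some (Yst u om s) of None \<Rightarrow> 0 | Some y \<Rightarrow> ennreal (1 / v0 y))"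
        using s D_sub by (auto simp: v0_def)
    qed
    with u(2) have g: "gam ?t (Yst u om) < ennreal u" by simp
    have tcv: "visits (\<lambda>s. Some (tc ?t (Yst u om) s)) 0 l" using v[unfolded visits_eq[OF a(1) u(1) k g]] .
    have "gamr ?t (Yst u om) < u" using g by (cases "gam ?t (Yst u om)") (auto simp: ennreal_less_iff)
    then have "eventually (\<lambda>n. dyadic_above n (gamr ?t (Yst u om)) \<in> {..<u}) sequentially"
      using filterlim_dyadic_above[of "gamr ?t (Yst u om)"]
      by (intro topological_tendstoD[of _ "gamr ?t (Yst u om)"]) (auto simp: filterlim_at)
    then obtain n where n: "dyadic_above n (gamr ?t (Yst u om)) < u" by (auto simp: eventually_sequentially)
    have "gam ?t (Yst u om) < \<infinity>" using g by (auto intro: less_trans)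
    from slot_exists[OF k this less_imp_le[OF n] tcv] obtain j where j:
      "Yst u om \<in> slot l m n j" "(real j + 1) / 2 ^ n \<le> u" using n by auto
    then have "om \<in> YS x l m n j" by (intro YS_shrink[OF x a(1)])
    then show "om \<in> (\<Union>m n j. YS x l m n j)" by auto
  qed
qed

lemma inverted_Y_law:
  assumes x: "x \<in> D" and l: "valid_list T l" "l \<noteq> []"
  shows "emeasure (completion (N x)) {om\<in>space (N x). visits (\<lambda>t. inverted_process I v D Y t om) 0 l} =
    inverse (Hm x) * (\<integral>\<^sup>+w. Hm (w (gamr (total l) w)) * indicator (\<Union>m n. slots l m n) w \<partial>Lx x)"
proof -
  have xF: "x \<in> F" using x D_sub by auto
  have "AE om in N x. om \<in> (\<Union>m n j. YS x l m n j) \<longleftrightarrow> om \<in> {om\<in>space (N x). visits (\<lambda>t. inverted_process I v D Y t om) 0 l}"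
    using Y_good_AE[OF x] AE_space
  proof eventually_elim
    case (elim om)
    show ?case using YS_iff[OF xF l elim(2,1)] elim(2) by simp
  qed
  moreover have "(\<Union>m n j. YS x l m n j) \<in> sets (N x)" using YS_sets(1)[OF xF l(1)] by auto
  ultimately show ?thesis
    using emeasure_completion_AE(1)[of "\<Union>m n j. YS x l m n j" "N x"] YS_union_emeasure[OF x l(1)] by auto
qed

text \<open>\<open>inversion_integral\<close> is applied to the functional that checks visits and
  confinement and weights with \<open>HI\<close>. As \<open>I\<close> is an involution, this weight
  becomes \<open>H\<close> at the position before inversion.\<close>

lemma fdd_Y_doob_inverted:
  assumes x: "x \<in> D" and l: "valid_list T l"
  shows "fdd (doob_semigroup N Y D ht) l (I x) =
    inverse (Hm x) * (\<integral>\<^sup>+w. Hm (w (gamr (total l) w)) * indicator (\<Union>m n. slots l m n) w \<partial>Lx x)"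
proof -
  let ?t = "total l"
  have t: "0 \<le> ?t" by (rule total_nonneg[OF l])
  have y: "I x \<in> D" by (rule I_D[OF x])
  have xF: "x \<in> F" "x \<in> points S" "x \<in> FH" "x \<in> U0" "I x \<in> U0" using x y D_sub F_E by auto
  define V where "V = {w\<in>rc_paths T. visits (\<lambda>s. Some (w s)) 0 l}"
  have VP: "V \<in> sets PA" unfolding V_def by (rule visits_path_sets[OF l order_refl])
  \<comment> \<open>The factor \<open>h0\<close> of \<open>kap\<close> is left out here: the density
    in \<open>inversion_integral\<close> supplies it.\<close>
  define \<Phi> where "\<Phi> w = indicator V w * (indicator (SD ?t) w * HI (w ?t))" for w :: "real \<Rightarrow> 'a option"
  have \<Phi>m: "\<Phi> \<in> borel_measurable PA"
    unfolding \<Phi>_def[abs_def] using VP SD_sets measurable_compose[OF path_eval[OF t] HI_measurable]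
    by (intro borel_measurable_times_ennreal borel_measurable_indicator) auto
  have "nest Rx l kap (I x) = (\<integral>\<^sup>+om. indicator {om. visits (\<lambda>s. Some (X s om)) 0 l} om * (indicator (SD ?t) (path om) * kap (X ?t om)) \<partial>P (I x))"
    by (rule nest_Rx_eq[OF y kap_measurable l])
  also have "\<dots> = (\<integral>\<^sup>+om. h0 (X ?t om) * \<Phi> (\<lambda>s. X (min s ?t) om) \<partial>P (I x))"
  proof (rule nn_integral_cong)
    fix om assume "om \<in> space (P (I x))"
    then have rc: "path om \<in> rc_paths T" using path_rc xF I_E[of x] by auto
    have "visits (\<lambda>s. Some (X s om)) 0 l = visits (\<lambda>s. Some (X (min s ?t) om)) 0 l"
      by (rule visits_cong[OF l]) simp
    then have "(\<lambda>s. X (min s ?t) om) \<in> V \<longleftrightarrow> visits (\<lambda>s. Some (X s om)) 0 l"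
      using stop_rc_paths[OF rc t] by (simp add: V_def)
    moreover have "(\<lambda>s. X (min s ?t) om) \<in> SD ?t \<longleftrightarrow> path om \<in> SD ?t" by (rule SD_stop[OF rc t])
    ultimately show "indicator {om. visits (\<lambda>s. Some (X s om)) 0 l} om * (indicator (SD ?t) (path om) * kap (X ?t om)) =
      h0 (X ?t om) * \<Phi> (\<lambda>s. X (min s ?t) om)"
      by (simp add: \<Phi>_def kap_def indicator_def)
  qed
  finally have 1: "nest Rx l kap (I x) = (\<integral>\<^sup>+om. h0 (X ?t om) * \<Phi> (\<lambda>s. X (min s ?t) om) \<partial>P (I x))" .
  have hp: "0 < h (I x)" "h (I x) < \<infinity>" using h_pos[OF xF(5)] by auto
  \<comment> \<open>The normalisation splits into \<open>h (I x)\<close>, which belongs to the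
    exchange, and \<open>H x\<close>, which belongs to the law of \<open>Y\<close>.\<close>
  have kx: "kap (I x) = h (I x) * Hm x" using xF I_I by (simp add: kap_def h0_def HI_def)
  have Hx: "0 < Hm x" "Hm x < \<infinity>" using FH_pos[OF xF(3)] xF by (auto simp: Hm_eq)
  have "fdd (doob_semigroup N Y D ht) l (I x) = nest Rx l kap (I x) / kap (I x)" by (rule fdd_Y_doob[OF l y])
  also have "\<dots> = inverse (Hm x) * ((\<integral>\<^sup>+om. h0 (X ?t om) * \<Phi> (\<lambda>s. X (min s ?t) om) \<partial>P (I x)) / h (I x))"
  proof -
    have "inverse (kap (I x)) = inverse (h (I x)) * inverse (Hm x)"
      unfolding kx using hp Hx by (intro ennreal_inverse_mult) auto
    then show ?thesis unfolding 1 by (simp add: divide_ennreal_def mult_ac)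
  qed
  also have "(\<integral>\<^sup>+om. h0 (X ?t om) * \<Phi> (\<lambda>s. X (min s ?t) om) \<partial>P (I x)) / h (I x) =
     (\<integral>\<^sup>+om. indicator (alive ?t) (path om) * \<Phi> (tc ?t (path om)) \<partial>P x)"
    by (rule inversion_integral[OF xF(4) t \<Phi>m, symmetric])
  also have "\<dots> = (\<integral>\<^sup>+om. Hm (path om (gamr ?t (path om))) * indicator (\<Union>m n. slots l m n) (path om) \<partial>P x)"
  proof (rule nn_integral_cong)
    fix om assume "om \<in> space (P x)"
    show "indicator (alive ?t) (path om) * \<Phi> (tc ?t (path om)) = Hm (path om (gamr ?t (path om))) * indicator (\<Union>m n. slots l m n) (path om)"
    proof (cases "path om \<in> alive ?t")
      case False
      then show ?thesis using aliveD_alive[of "path om" ?t] unfolding slots_union by (auto simp: indicator_def)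
    next
      case True
      have u: "path om (gamr ?t (path om)) \<in> U0" by (rule alive_U0[OF True]) auto
      have "tc ?t (path om) ?t = I (path om (gamr ?t (path om)))" by (simp add: tc_def)
      then have "HI (tc ?t (path om) ?t) = Hm (path om (gamr ?t (path om)))"
        using u I_U0[OF u] I_I U0_sub by (auto simp: HI_def)
      moreover have "tc ?t (path om) \<in> V \<longleftrightarrow> visits (\<lambda>s. Some (tc ?t (path om) s)) 0 l"
        using tc_rc[OF True t] by (simp add: V_def)
      ultimately show ?thesis
        using True tc_SD_iff[OF True t] unfolding slots_union \<Phi>_def by (auto simp: indicator_def)
    qed
  qed
  also have "\<dots> = (\<integral>\<^sup>+w. Hm (w (gamr ?t w)) * indicator (\<Union>m n. slots l m n) w \<partial>Lx x)"
    using measurable_compose[OF eval_gam_measurable Hm_measurable] slots_sets[OF l]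
    by (intro nn_integral_Lx[symmetric, OF xF(2)] borel_measurable_times_ennreal borel_measurable_indicator) auto
  finally show ?thesis .
qed

lemma law_Nil: assumes "prob_space M'" shows "emeasure (completion M') {om\<in>space M'. visits z 0 []} = 1"
  using prob_space.emeasure_space_1[OF assms] by simp

text \<open>At time \<open>0\<close> the semigroup of \<open>Y\<close> need not be the identity,
  since an immediate exit kills; but it charges no point other than \<open>x\<close>.\<close>

lemma Y_start:
  assumes x: "x \<in> F"
  shows "AE om in N x. Y 0 om = None \<or> Y 0 om = Some x"
proof -
  have xE: "x \<in> points S" using x F_E by auto
  interpret prob_space "N x" by (rule N_prob[OF x])
  have cl: "closedin T {x}"
    using compactified_Hausdorff[OF lc] xE by (simp add: closedin_Hausdorff_singleton)
  have B: "points S - {x} \<in> sets BE" using closedin_borel_of[OF cl] sets.compl_sets[of "{x}" BE] by simp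
  have v: "valid_list T [(0, points S - {x})]" using B by simp
  have "emeasure (N x) {om\<in>space (N x). visits (\<lambda>s. Y s om) 0 [(0, points S - {x})]} = 0"
  proof (cases "x \<in> FH")
    case True
    have "fdd QY [(0, points S - {x})] x \<le> nest Kx [(0, points S - {x})] Hm x / ennreal (H x)"
      by (rule fdd_upper[OF v True])
    also have "nest Kx [(0, points S - {x})] Hm x = (\<integral>\<^sup>+om. indicator {om. visits (\<lambda>s. Some (X s om)) 0 [(0, points S - {x})]} om * Hm (X (total [(0, points S - {x})]) om) \<partial>P x)"
      by (rule nest_Kx_eq[OF xE Hm_measurable v])
    also have "\<dots> = (\<integral>\<^sup>+om. 0 \<partial>P x)"
      by (rule nn_integral_cong_AE) (use P_start[OF xE] in \<open>eventually_elim, auto simp: indicator_def\<close>)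
    finally show ?thesis using Y_fdd[OF x v] by simp
  next
    case False
    then show ?thesis using Y_fdd[OF x v] QY_out by simp
  qed
  then have "AE om in N x. om \<notin> {om\<in>space (N x). visits (\<lambda>s. Y s om) 0 [(0, points S - {x})]}"
    using visits_Y_sets[OF x v order_refl] by (intro AE_not_in null_setsI) auto
  then show ?thesis using AE_space
  proof eventually_elim
    case (elim om)
    then show ?case using Y_value(1)[OF x elim(2) order_refl] F_E by (cases "Y 0 om") auto
  qed
qed

theorem Y_inversion_law:
  assumes x: "x \<in> F"
  shows "has_markov_law T (N x) (inverted_process I v D Y) (doob_semigroup N Y D ht) (I x)"
  unfolding has_markov_law_def
proof (intro allI impI)
  fix l :: "(real \<times> 'a option set) list" assume "\<forall>(s, B)\<in>set l. 0 \<le> s \<and> B \<in> sets BE"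
  then have l: "valid_list T l" by (auto simp: valid_list_def)
  show "emeasure (completion (N x)) {om\<in>space (N x). visits (\<lambda>t. inverted_process I v D Y t om) 0 l} = fdd (doob_semigroup N Y D ht) l (I x)"
  \<comment> \<open>The empty list has value \<open>1\<close> on both sides, also at points where
    the transform carries no mass, so it is treated apart.\<close>
  proof (cases "l = []")
    case True
    then show ?thesis using law_Nil[OF N_prob[OF x]] by simp
  next
    case nonempty: False
    show ?thesis
    proof (cases "x \<in> D")
      case True
      show ?thesis using inverted_Y_law[OF True l nonempty] fdd_Y_doob_inverted[OF True l] by simp
    next
      case False
      \<comment> \<open>For a nonempty list both sides vanish here: \<open>Y\<close> starts dead or
        outside \<open>D\<close>, and \<open>I x\<close> is outside \<open>D\<close> because
        \<open>I\<close> preserves \<open>D\<close>.\<close>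
      have "x \<in> points S" using x F_E by auto
      then have ID: "I x \<notin> D" using I_D[of "I x"] False I_I by auto
      obtain s B l' where sl: "l = (s, B) # l'" using nonempty by (cases l) auto
      have "AE om in N x. om \<in> {} \<longleftrightarrow> om \<in> {om\<in>space (N x). visits (\<lambda>t. inverted_process I v D Y t om) 0 l}"
        using Y_start[OF x]
      proof eventually_elim
        case (elim om)
        have "inverted_process I v D Y s om = None"
        proof (rule ccontr)
          assume "inverted_process I v D Y s om \<noteq> None"
          from inverted_process_alive[OF this] have "Y 0 om \<in> Some ` D" by auto
          then show False using elim False by auto
        qed
        then show ?case by (simp add: sl)
      qed
      then show ?thesis
        using emeasure_completion_AE(1)[of "{}" "N x" "{om\<in>space (N x). visits (\<lambda>t. inverted_process I v D Y t om) 0 l}"]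
          fdd_Y_doob_out[OF ID] by (auto simp: sl)
    qed
  qed
qed

end

section \<open>Live states\<close>

text \<open>An event of the completion is squeezed between two Borel events that agree almost
  surely. The pair depends on the law \<open>\<nu>\<close>, so each application has to name the law
  in question.\<close>

lemma (in exhaustible) stays_hull:
  assumes "finite_measure \<nu>" "sets \<nu> = sets (path_algebra T)" "B \<in> sets (borel_of T)"
  shows "\<exists>V1\<in>sets (path_algebra T). \<exists>V2\<in>sets (path_algebra T). V1 \<subseteq> stays B q \<and> stays B q \<subseteq> V2 \<and> (AE w in \<nu>. w \<in> V2 \<longrightarrow> w \<in> V1)"
  using stays_completion[OF assms]
proof (rule sets_completionE)
  fix S N N' assume h: "stays B q = S \<union> N" "N \<subseteq> N'" "N' \<in> null_sets \<nu>" "S \<in> sets \<nu>"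
  then have "AE w in \<nu>. w \<notin> N'" by (intro AE_not_in)
  then have "AE w in \<nu>. w \<in> S \<union> N' \<longrightarrow> w \<in> S" by eventually_elim auto
  then show ?thesis using h assms(2)
    by (intro bexI[of _ S] bexI[of _ "S \<union> N'"]) (auto simp: null_sets_def)
qed

context std_process
begin

text \<open>The strict inequality leaves a margin: it means staying in \<open>B\<close> up to
  \<open>t + 1 / (n + 1)\<close> for some \<open>n\<close>, a countable union of events measurable
  for the completed law.\<close>

lemma exit_time_hull:
  assumes x: "x \<in> points S" and B: "B \<in> sets BE" and t: "0 \<le> t"
  shows "\<exists>V\<in>sets PA. AE om in P x. ennreal t < exit_time (\<lambda>t om. Some (X t om)) B om \<longleftrightarrow> path om \<in> V"
proof -
  have fin: "finite_measure (Lx x)" using Lx_prob[OF x] by (simp add: prob_space_def)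
  have "\<forall>n::nat. \<exists>V. V \<in> sets PA \<and> (AE w in Lx x. w \<in> stays B (t + 1 / (real n + 1)) \<longleftrightarrow> w \<in> V)"
  proof
    fix n :: nat
    from stays_hull[OF fin sets_Lx B, of "t + 1 / (real n + 1)"] obtain V1 V2 where V: "V1 \<in> sets PA" "V2 \<in> sets PA"
      "V1 \<subseteq> stays B (t + 1 / (real n + 1))" "stays B (t + 1 / (real n + 1)) \<subseteq> V2" "AE w in Lx x. w \<in> V2 \<longrightarrow> w \<in> V1"
      by (elim bexE conjE)
    from V(5) have "AE w in Lx x. w \<in> stays B (t + 1 / (real n + 1)) \<longleftrightarrow> w \<in> V1"
      by eventually_elim (use V(3,4) in auto)
    then show "\<exists>V. V \<in> sets PA \<and> (AE w in Lx x. w \<in> stays B (t + 1 / (real n + 1)) \<longleftrightarrow> w \<in> V)" using V(1) by (intro exI conjI)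
  qed
  then obtain V where V: "\<And>n. V n \<in> sets PA" "\<And>n. AE w in Lx x. w \<in> stays B (t + 1 / (real n + 1)) \<longleftrightarrow> w \<in> V n"
    by (elim choice[THEN exE]) auto
  have "AE w in Lx x. \<forall>n. w \<in> stays B (t + 1 / (real n + 1)) \<longleftrightarrow> w \<in> V n"
    using V(2) by (simp add: AE_all_countable)
  then have "AE om in P x. \<forall>n. path om \<in> stays B (t + 1 / (real n + 1)) \<longleftrightarrow> path om \<in> V n"
    unfolding Lx_def by (rule AE_distrD[OF path_P[OF x]])
  then have "AE om in P x. ennreal t < exit_time (\<lambda>t om. Some (X t om)) B om \<longleftrightarrow> path om \<in> (\<Union>n. V n)"
    using AE_space
  proof eventually_elim
    case (elim om)
    have rc: "path om \<in> rc_paths T" using elim(2) path_rc x by simp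
    have "ennreal t < exit_time (\<lambda>t om. Some (X t om)) B om \<longleftrightarrow> (\<exists>n::nat. path om \<in> stays B (t + 1 / (real n + 1)))"
    proof
      assume "ennreal t < exit_time (\<lambda>t om. Some (X t om)) B om"
      then obtain e where e: "ennreal t < e" "e < exit_time (\<lambda>t om. Some (X t om)) B om" using dense by blast
      then obtain r where r: "e = ennreal r" "0 \<le> r" by (cases e) auto
      have "t < r" using e(1) t r by (simp add: ennreal_less_iff)
      then obtain n where "inverse (real (Suc n)) < r - t" using reals_Archimedean[of "r - t"] by auto
      then have n: "t + 1 / (real n + 1) \<le> r" by (simp add: inverse_eq_divide add.commute)
      have "X s om \<in> B" if "0 \<le> s" "s \<le> t + 1 / (real n + 1)" for s
        using exit_time_less_in[OF e(2)[unfolded r(1)], of s] that n by auto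
      then show "\<exists>n::nat. path om \<in> stays B (t + 1 / (real n + 1))" using rc by (intro exI[of _ n]) (simp add: stays_def)
    next
      assume "\<exists>n::nat. path om \<in> stays B (t + 1 / (real n + 1))"
      then obtain n :: nat where n: "path om \<in> stays B (t + 1 / (real n + 1))" ..
      have "ennreal (t + 1 / (real n + 1)) \<le> exit_time (\<lambda>t om. Some (X t om)) B om"
        by (rule exit_time_ge) (use n in \<open>auto simp: stays_def\<close>)
      moreover have "ennreal t < ennreal (t + 1 / (real n + 1))" using t by (simp add: ennreal_less_iff)
      ultimately show "ennreal t < exit_time (\<lambda>t om. Some (X t om)) B om" by (rule less_le_trans[rotated])
    qed
    then show ?case using elim(1) by simp
  qed
  moreover have "(\<Union>n. V n) \<in> sets PA" using V(1) by auto
  ultimately show ?thesis by blast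
qed

end

section \<open>Initial states at which \<open>Y\<close> is alive\<close>

context prop4
begin

text \<open>At time \<open>0\<close> the path sits at \<open>z\<close>, so the operator multiplies
  by the probability \<open>p\<close> that the exit time from \<open>FH\<close> is positive.\<close>

lemma QY_0:
  assumes z: "z \<in> FH"
  shows "\<exists>p\<le>1. (\<forall>f. QY 0 f z = p * f z) \<and> (p = 0 \<longrightarrow> (AE om in P z. exit_time Xo FH om = 0))"
proof -
  have zE: "z \<in> points S" "z \<in> F" using z FH_F F_E by auto
  interpret prob_space "P z" using zE(1) by (rule P_prob)
  obtain V where V: "V \<in> sets PA" "AE om in P z. ennreal 0 < exit_time Xo FH om \<longleftrightarrow> path om \<in> V"
    using exit_time_hull[OF zE(1) FH_BE order_refl] by (elim bexE)
  define W where "W = {om\<in>space M. path om \<in> V}"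
  have WM: "W \<in> sets (P z)"
  proof -
    have "W = path -` V \<inter> space (P z)" using zE by (auto simp: W_def)
    then show ?thesis using measurable_sets[OF path_P[OF zE(1)] V(1)] by simp
  qed
  have "QY 0 f z = emeasure (P z) W * f z" for f
  proof -
    have "killed_semigroup P Xo FH 0 (\<lambda>z. ennreal (H z) * f z) z = (\<integral>\<^sup>+om. (ennreal (H z) * f z) * indicator W om \<partial>P z)"
      unfolding killed_semigroup_def nn_integral_completion
    proof (rule nn_integral_cong_AE)
      show "AE om in P z. (if ennreal 0 < exit_time Xo FH om then case Xo 0 om of None \<Rightarrow> 0 | Some y \<Rightarrow> ennreal (H y) * f y else 0) =
        (ennreal (H z) * f z) * indicator W om"
        using V(2) P_start[OF zE(1)] AE_space by eventually_elim (use zE in \<open>auto simp: W_def indicator_def\<close>)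
    qed
    also have "\<dots> = ennreal (H z) * f z * emeasure (P z) W" using WM by (rule nn_integral_cmult_indicator)
    finally have "QY 0 f z = ennreal (H z) * (f z * emeasure (P z) W) / ennreal (H z)" by (simp add: QY_FH[OF z] mult.assoc)
    also have "\<dots> = ennreal (H z) / ennreal (H z) * (f z * emeasure (P z) W)" by (simp add: divide_ennreal_def mult_ac)
    finally show ?thesis using FH_pos[OF z] ennreal_div_self[of "ennreal (H z)"] by (simp add: mult.commute)
  qed
  moreover have "AE om in P z. exit_time Xo FH om = 0" if "emeasure (P z) W = 0"
  proof -
    have "AE om in P z. om \<notin> W" using that WM by (intro AE_not_in null_setsI)
    then show ?thesis using V(2) AE_space
      by eventually_elim (use zE in \<open>auto simp: W_def zero_less_iff_neq_zero\<close>)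
  qed
  moreover have "emeasure (P z) W \<le> 1" by (rule emeasure_le_1)
  ultimately show ?thesis by blast
qed

text \<open>By continuity of \<open>H\<close> on \<open>F\<close>, an immediate exit from
  \<open>FH\<close> would be an immediate exit from \<open>F\<close>. The killed semigroup would
  then send \<open>H\<close> to \<open>0\<close> at \<open>z\<close> for every \<open>t\<close>,
  contrary to its convergence to \<open>H z\<close>, which is positive.\<close>

lemma exit_FH_pos:
  assumes z: "z \<in> FH"
  shows "\<not> (AE om in P z. exit_time Xo FH om = 0)"
proof
  assume ae: "AE om in P z. exit_time Xo FH om = 0"
  have zE: "z \<in> points S" "z \<in> F" using z FH_F F_E by auto
  have 0: "killed_semigroup P Xo F t (\<lambda>x. ennreal (H x)) z = 0" if t: "0 \<le> t" for t
  proof -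
    have "killed_semigroup P Xo F t (\<lambda>x. ennreal (H x)) z = (\<integral>\<^sup>+om. 0 \<partial>P z)"
      unfolding killed_semigroup_def nn_integral_completion
    proof (rule nn_integral_cong_AE)
      show "AE om in P z. (if ennreal t < exit_time Xo F om then case Xo t om of None \<Rightarrow> 0 | Some y \<Rightarrow> ennreal (H y) else 0) = 0"
        using ae P_start[OF zE(1)] AE_space
      proof eventually_elim
        case (elim om)
        have rc: "path om \<in> rc_paths T" using elim(3) path_rc zE by simp
        have "\<not> ennreal t < exit_time Xo F om"
        proof
          assume e: "ennreal t < exit_time Xo F om"
          then obtain e' where e': "ennreal t < e'" "e' < exit_time Xo F om" using dense by blast
          then obtain r where r: "e' = ennreal r" "0 \<le> r" by (cases e') auto
          have tr: "0 < r" using e'(1) t r by (simp add: ennreal_less_iff)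
          have inF: "X s om \<in> F" if "0 \<le> s" "s \<le> r" for s
            using exit_time_less_in[OF e'(2)[unfolded r(1)] that] by auto
          have evF: "eventually (\<lambda>s. X s om \<in> F) (at_right 0)"
            by (rule eventually_at_rightI[OF _ tr]) (use inF in auto)
          have "limitin euclideanreal (\<lambda>s. H (X s om)) (H (X 0 om)) (at_right 0)"
          proof (rule limitin_compose_on[OF H_cont _ _ evF])
            show "limitin T (\<lambda>s. X s om) (X 0 om) (at_right 0)" using rc by (auto simp: rc_paths_def)
            show "X 0 om \<in> F" using zE elim by simp
          qed
          then have "((\<lambda>s. H (X s om)) \<longlongrightarrow> H z) (at_right 0)" using elim by simp
          then have "eventually (\<lambda>s. 0 < H (X s om)) (at_right 0)"
            using z by (intro order_tendstoD) (auto simp: FH_def)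
          then have "eventually (\<lambda>s. Xo s om \<in> Some ` FH) (at_right 0)"
            using evF by eventually_elim (auto simp: FH_def)
          then have "ennreal 0 < exit_time Xo FH om"
            using z elim by (intro exit_time_gt) auto
          then show False using elim by simp
        qed
        then show ?case by simp
      qed
    qed
    then show ?thesis by simp
  qed
  have "((\<lambda>t. killed_semigroup P Xo F t (\<lambda>x. ennreal (H x)) z) \<longlongrightarrow> ennreal (H z)) (at_right 0)"
    using H_exc zE unfolding excessive_def by auto
  moreover have "((\<lambda>t. killed_semigroup P Xo F t (\<lambda>x. ennreal (H x)) z) \<longlongrightarrow> 0) (at_right 0)"
  proof (rule tendsto_eventually)
    show "\<forall>\<^sub>F t in at_right 0. killed_semigroup P Xo F t (\<lambda>x. ennreal (H x)) z = 0"
      using eventually_at_right_less[of 0] by eventually_elim (simp add: 0)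
  qed
  ultimately have "ennreal (H z) = 0" by (intro tendsto_unique[of "at_right (0::real)"]) auto
  then show False using FH_pos[OF z] by simp
qed

text \<open>A zero-one law drawn from the mere existence of \<open>Y\<close>: asking twice for
  survival at time \<open>0\<close> is one and the same event, but the semigroup assigns it
  \<open>p * p\<close>. Hence \<open>p = p * p\<close>, and \<open>p\<close> is not
  \<open>0\<close>.\<close>

lemma Y_start_FH:
  assumes z: "z \<in> FH"
  shows "AE om in N z. Y 0 om = Some z"
proof -
  have zE: "z \<in> points S" "z \<in> F" using z FH_F F_E by auto
  interpret prob_space "N z" by (rule N_prob[OF zE(2)])
  let ?E = "points S"
  have EB: "?E \<in> sets BE" using sets.top[of BE] by simp
  obtain p where p: "p \<le> 1" "\<And>f. QY 0 f z = p * f z" "p = 0 \<longrightarrow> (AE om in P z. exit_time Xo FH om = 0)"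
    using QY_0[OF z] by (elim exE conjE) auto
  have v: "valid_list T [(0, ?E)]" "valid_list T [(0, ?E), (0, ?E)]" using EB by auto
  have "p = fdd QY [(0, ?E)] z" using zE by (simp add: p)
  also have "\<dots> = fdd QY [(0, ?E), (0, ?E)] z" using Y_fdd[OF zE(2) v(1)] Y_fdd[OF zE(2) v(2)] by simp
  also have "\<dots> = p * p" using zE by (simp add: p)
  finally have "p = p * p" .
  moreover have "p \<noteq> 0" using p(3) exit_FH_pos[OF z] by auto
  moreover have "p < \<infinity>" using p(1) by (auto intro: le_less_trans)
  ultimately have "p = 1" by (metis mult.right_neutral ennreal_mult_cancel_left infinity_ennreal_def less_irrefl)
  then have "emeasure (N z) {om\<in>space (N z). visits (\<lambda>s. Y s om) 0 [(0, ?E)]} = 1"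
    using Y_fdd[OF zE(2) v(1)] zE by (simp add: p)
  then have "AE om in N z. om \<in> {om\<in>space (N z). visits (\<lambda>s. Y s om) 0 [(0, ?E)]}"
    using visits_Y_sets[OF zE(2) v(1) order_refl] by (intro AE_prob_1) (simp add: measure_def)
  then show ?thesis using Y_start[OF zE(2)] by eventually_elim auto
qed

lemma live_states_eq: "live_states S F N Y = FH \<inter> U0"
proof (intro set_eqI iffI)
  fix z assume "z \<in> FH \<inter> U0"
  then show "z \<in> live_states S F N Y" using Y_start_FH FH_F by (auto simp: live_states_def)
next
  fix z assume "z \<in> live_states S F N Y"
  then have z: "z \<in> F" "z \<in> U0" "AE om in N z. Y 0 om = Some z" by (auto simp: live_states_def)
  have zE: "z \<in> points S" using z F_E by auto
  have "z \<in> FH"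
  proof (rule ccontr)
    assume no: "z \<notin> FH"
    interpret prob_space "N z" by (rule N_prob[OF z(1)])
    have v: "valid_list T [(0, points S)]" using sets.top[of BE] by simp
    have "emeasure (N z) {om\<in>space (N z). visits (\<lambda>s. Y s om) 0 [(0, points S)]} = 0"
      using Y_fdd[OF z(1) v] QY_out[OF no] by simp
    then have "AE om in N z. om \<notin> {om\<in>space (N z). visits (\<lambda>s. Y s om) 0 [(0, points S)]}"
      using visits_Y_sets[OF z(1) v order_refl] by (intro AE_not_in null_setsI)
    then have "AE om in N z. False" using z(3) AE_space by eventually_elim (use zE in auto)
    then show False by (simp add: AE_False)
  qed
  then show "z \<in> FH \<inter> U0" using z by simp
qed

end

section \<open>Optional stopping\<close>

lemma increasing_to:
  assumes "0 < (t::real)"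
  obtains r where "\<And>n. 0 \<le> r n" "\<And>n. r n < t" "\<And>n. r n \<le> r (Suc n)" "r \<longlonglongrightarrow> t"
proof
  let ?r = "\<lambda>n. t - t * inverse (real (Suc n))"
  show "0 \<le> ?r n" "?r n < t" "?r n \<le> ?r (Suc n)" for n
    using assms by (auto simp: field_simps)
  have "?r \<longlonglongrightarrow> t - t * 0" by (intro tendsto_intros LIMSEQ_inverse_real_of_nat)
  then show "?r \<longlonglongrightarrow> t" by simp
qed

context prop4
begin

abbreviation "F0 \<equiv> F \<inter> U0"

lemma F0_BE: "F0 \<in> sets BE"
  using F_BE U0_BE by auto

lemma H_limit:
  assumes "limitin T g y Fl" "y \<in> F" "eventually (\<lambda>s. g s \<in> F) Fl"
  shows "((\<lambda>s. Hm (g s)) \<longlongrightarrow> Hm y) Fl"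
proof -
  have "limitin euclideanreal (\<lambda>s. H (g s)) (H y) Fl" by (rule limitin_compose_on[OF H_cont assms])
  then have "((\<lambda>s. ennreal (H (g s))) \<longlongrightarrow> ennreal (H y)) Fl" by simp
  then have "((\<lambda>s. ennreal (H (g s))) \<longlongrightarrow> Hm y) Fl" using assms(2) by (simp add: Hm_eq)
  then show ?thesis
    by (rule Lim_transform_eventually) (use assms(3) in \<open>eventually_elim, simp add: Hm_eq\<close>)
qed

lemma stopping_const: "0 \<le> r \<Longrightarrow> stopping_time \<F> (\<lambda>om. ennreal r)"
proof (rule stopping_time_less)
  fix b :: real assume "0 < b"
  show "{om\<in>space M. ennreal r < ennreal b} \<in> sets (\<F> (ennreal b))"
    using sets.top[of "\<F> (ennreal b)"] by (cases "ennreal r < ennreal b") auto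
qed

text \<open>Excessiveness controls paths whose exit time is strictly larger than the time
  considered, while staying in \<open>F0\<close> on \<open>[0, s]\<close> only gives an exit time of
  at least \<open>s\<close>. Times below \<open>s\<close>, quasi-left-continuity at \<open>s\<close>
  and Fatou's lemma close the gap.\<close>

lemma supermartingale_one:
  assumes z: "z \<in> points S" and s: "0 \<le> s" and V: "V \<in> sets PA" "V \<subseteq> stays F0 s"
  shows "(\<integral>\<^sup>+w. indicator V w * Hm (w s) \<partial>Lx z) \<le> Hm z"
proof -
  have fm: "(\<lambda>w. indicator V w * Hm (w s) :: ennreal) \<in> borel_measurable PA"
    using V measurable_compose[OF path_eval[OF s] Hm_measurable]
    by (intro borel_measurable_times_ennreal borel_measurable_indicator) auto
  have VM: "(\<lambda>om. indicator V (path om) :: ennreal) \<in> borel_measurable (P z)"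
    using measurable_compose[OF path_P[OF z] borel_measurable_indicator[OF V(1)]] .
  have L: "(\<integral>\<^sup>+w. indicator V w * Hm (w s) \<partial>Lx z) = (\<integral>\<^sup>+om. indicator V (path om) * Hm (X s om) \<partial>P z)"
    by (rule nn_integral_Lx[OF z fm])
  show ?thesis
  \<comment> \<open>For \<open>s = 0\<close> there are no times below \<open>s\<close>, and from a
    point outside \<open>F\<close> the event \<open>V\<close> has probability
    \<open>0\<close>.\<close>
  proof (cases "s = 0 \<or> z \<notin> F")
    case True
    interpret prob_space "P z" using z by (rule P_prob)
    have "(\<integral>\<^sup>+om. indicator V (path om) * Hm (X s om) \<partial>P z) \<le> (\<integral>\<^sup>+om. Hm z \<partial>P z)"
    proof (rule nn_integral_mono_AE)
      show "AE om in P z. indicator V (path om) * Hm (X s om) \<le> Hm z"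
        using P_start[OF z]
      proof eventually_elim
        case (elim om)
        have "path om \<in> V \<Longrightarrow> X 0 om \<in> F" using V(2) s by (auto simp: stays_def)
        then show ?case using True elim by (auto simp: indicator_def)
      qed
    qed
    then show ?thesis using L emeasure_space_1 by simp
  next
    case False
    then have sp: "0 < s" and zF: "z \<in> F" using s by auto
    from increasing_to[OF sp] obtain r where r: "\<And>n. 0 \<le> r n" "\<And>n. r n < s" "\<And>n. r n \<le> r (Suc n)" and rlim: "r \<longlonglongrightarrow> s" by blast
    have sup: "(SUP n. ennreal (r n)) = ennreal s"
    proof (rule LIMSEQ_unique)
      show "(\<lambda>n. ennreal (r n)) \<longlonglongrightarrow> (SUP n. ennreal (r n))"
        by (rule LIMSEQ_SUP) (intro incseq_SucI ennreal_leI r(3))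
      show "(\<lambda>n. ennreal (r n)) \<longlonglongrightarrow> ennreal s" using rlim by simp
    qed
    have lim: "AE om in P z. ennreal s < lifetime S X om \<longrightarrow> limitin T (\<lambda>n. X (r n) om) (X s om) sequentially"
      using qlc_AE[OF z, where \<sigma>="\<lambda>n om. ennreal (r n)", OF stopping_const[OF r(1)] ennreal_leI[OF r(3)]]
      unfolding sup using r(1) s by simp
    have "(\<integral>\<^sup>+om. indicator V (path om) * Hm (X s om) \<partial>P z) \<le> (\<integral>\<^sup>+om. liminf (\<lambda>n. indicator V (path om) * Hm (X (r n) om)) \<partial>P z)"
    proof (rule nn_integral_mono_AE)
      show "AE om in P z. indicator V (path om) * Hm (X s om) \<le> liminf (\<lambda>n. indicator V (path om) * Hm (X (r n) om))"
        using lim absorb_AE[OF z]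
      proof eventually_elim
        case (elim om)
        show ?case
        proof (cases "path om \<in> V")
          case True
          then have st: "\<And>q. 0 \<le> q \<Longrightarrow> q \<le> s \<Longrightarrow> X q om \<in> F0" using V(2) by (auto simp: stays_def)
          have "X s om \<in> U0" using st s by auto
          then have "ennreal s < lifetime S X om" using elim(2) s by auto
          then have "limitin T (\<lambda>n. X (r n) om) (X s om) sequentially" using elim(1) by simp
          then have "(\<lambda>n. Hm (X (r n) om)) \<longlonglongrightarrow> Hm (X s om)"
            using st s r(1) r(2)[THEN less_imp_le] by (intro H_limit always_eventually) auto
          then have "liminf (\<lambda>n. Hm (X (r n) om)) = Hm (X s om)" by (intro lim_imp_Liminf) auto
          then show ?thesis using True by simp
        qed simp
      qed
    qed
    also have "\<dots> \<le> liminf (\<lambda>n. \<integral>\<^sup>+om. indicator V (path om) * Hm (X (r n) om) \<partial>P z)"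
      using VM measurable_compose[OF X_P[OF z r(1)] Hm_measurable]
      by (intro nn_integral_liminf borel_measurable_times_ennreal)
    also have "\<dots> \<le> liminf (\<lambda>n. Hm z)"
    proof (intro Liminf_mono always_eventually allI)
      fix n
      have "(\<integral>\<^sup>+om. indicator V (path om) * Hm (X (r n) om) \<partial>P z) \<le> killed_semigroup P Xo F (r n) (\<lambda>x. ennreal (H x)) z"
        unfolding killed_semigroup_def nn_integral_completion
      proof (rule nn_integral_mono)
        fix om
        show "indicator V (path om) * Hm (X (r n) om) \<le>
          (if ennreal (r n) < exit_time Xo F om then case Xo (r n) om of None \<Rightarrow> 0 | Some y \<Rightarrow> ennreal (H y) else 0)"
        proof (cases "path om \<in> V")
          case True
          then have st: "\<And>q. 0 \<le> q \<Longrightarrow> q \<le> s \<Longrightarrow> X q om \<in> F" using V(2) by (auto simp: stays_def)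
          have "ennreal s \<le> exit_time Xo F om" by (rule exit_time_ge) (use st in auto)
          moreover have "ennreal (r n) < ennreal s" using r[of n] by (simp add: ennreal_less_iff)
          ultimately have "ennreal (r n) < exit_time Xo F om" by (rule less_le_trans[rotated])
          then show ?thesis using True st[of "r n"] r[of n] by (simp add: Hm_eq)
        qed simp
      qed
      also have "\<dots> \<le> ennreal (H z)" using H_exc zF r(1) unfolding excessive_def by auto
      finally show "(\<integral>\<^sup>+om. indicator V (path om) * Hm (X (r n) om) \<partial>P z) \<le> Hm z" using zF by (simp add: Hm_eq)
    qed
    also have "\<dots> = Hm z" by (simp add: Liminf_const)
    finally show ?thesis using L by simp
  qed
qed

text \<open>The hull is taken for the law of the path frozen at \<open>u\<close>; this makes its
  preimage an event of the filtration at time \<open>u\<close>.\<close>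

lemma stays_filtration:
  assumes y: "y \<in> points S" and u: "0 \<le> u"
  shows "\<exists>G\<in>sets (\<F> (ennreal u)). AE om in P y. om \<in> G \<longleftrightarrow> path om \<in> stays F0 u"
proof -
  let ?\<nu> = "distr (P y) PA (\<lambda>om s. X (min s u) om)"
  have fin: "finite_measure ?\<nu>"
    using prob_space.prob_space_distr[OF P_prob[OF y] spath_P[OF y u]] by (simp add: prob_space_def)
  from stays_hull[OF fin sets_distr F0_BE, of u] obtain V1 V2 where V: "V1 \<in> sets PA" "V2 \<in> sets PA"
    "V1 \<subseteq> stays F0 u" "stays F0 u \<subseteq> V2" "AE w in ?\<nu>. w \<in> V2 \<longrightarrow> w \<in> V1"
    by (elim bexE conjE)
  have ae: "AE om in P y. (\<lambda>s. X (min s u) om) \<in> V2 \<longrightarrow> (\<lambda>s. X (min s u) om) \<in> V1"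
    by (rule AE_distrD[OF spath_P[OF y u] V(5)])
  let ?G = "(\<lambda>om s. X (min s u) om) -` V1 \<inter> space (\<F> (ennreal u))"
  have "AE om in P y. om \<in> ?G \<longleftrightarrow> path om \<in> stays F0 u"
    using ae AE_space
  proof eventually_elim
    case (elim om)
    have rc: "path om \<in> rc_paths T" using elim(2) path_rc y by simp
    have "(\<lambda>s. X (min s u) om) \<in> stays F0 u \<longleftrightarrow> path om \<in> stays F0 u"
      using rc stop_rc_paths[OF rc u] by (simp add: stays_def)
    then have "(\<lambda>s. X (min s u) om) \<in> V1 \<longleftrightarrow> path om \<in> stays F0 u" using elim(1) V(3,4) by auto
    then show ?case using elim(2) y by simp
  qed
  moreover have "?G \<in> sets (\<F> (ennreal u))" by (rule measurable_sets[OF spath_F[OF u] V(1)])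
  ultimately show ?thesis by (intro bexI)
qed

text \<open>The choice depends on \<open>y\<close>, since a hull is valid for one law only; optional
  stopping takes place under a single \<open>P y\<close>.\<close>

definition GF :: "'a option \<Rightarrow> real \<Rightarrow> 'w set" where
  "GF y u = (SOME G. G \<in> sets (\<F> (ennreal u)) \<and> (AE om in P y. om \<in> G \<longleftrightarrow> path om \<in> stays F0 u))"

lemma GF:
  assumes "y \<in> points S" "0 \<le> u"
  shows "GF y u \<in> sets (\<F> (ennreal u))" "AE om in P y. om \<in> GF y u \<longleftrightarrow> path om \<in> stays F0 u" "GF y u \<in> sets (P y)"
proof -
  have "\<exists>G. G \<in> sets (\<F> (ennreal u)) \<and> (AE om in P y. om \<in> G \<longleftrightarrow> path om \<in> stays F0 u)"
    using stays_filtration[OF assms] by (elim bexE) (intro exI conjI)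
  from someI_ex[OF this] show g: "GF y u \<in> sets (\<F> (ennreal u))" "AE om in P y. om \<in> GF y u \<longleftrightarrow> path om \<in> stays F0 u"
    unfolding GF_def by auto
  show "GF y u \<in> sets (P y)" using F_sets[OF g(1)] assms(1) by simp
qed

text \<open>The Markov property at \<open>u\<close> reduces this to
  \<open>supermartingale_one\<close> from the random point \<open>X u\<close>. One Borel hull, taken
  for the law of the shifted path, serves all these starting points.\<close>

lemma supermartingale:
  assumes y: "y \<in> points S" and u: "0 \<le> u" and s: "0 \<le> s" and A: "A \<in> sets (\<F> (ennreal u))"
  shows "(\<integral>\<^sup>+om. indicator A om * (indicator (GF y (u + s)) om * Hm (X (u + s) om)) \<partial>P y) \<le>
    (\<integral>\<^sup>+om. indicator A om * (indicator (GF y u) om * Hm (X u om)) \<partial>P y)"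
proof -
  have sh: "(\<lambda>om r. X (u + r) om) \<in> measurable (P y) PA"
    using shift_rc_paths[OF path_rc u] X_P[OF y] u y by (intro path_measurableI) auto
  let ?\<nu> = "distr (P y) PA (\<lambda>om r. X (u + r) om)"
  have fin: "finite_measure ?\<nu>"
    using prob_space.prob_space_distr[OF P_prob[OF y] sh] by (simp add: prob_space_def)
  from stays_hull[OF fin sets_distr F0_BE, of s] obtain V1 V2 where V: "V1 \<in> sets PA" "V2 \<in> sets PA"
    "V1 \<subseteq> stays F0 s" "stays F0 s \<subseteq> V2" "AE w in ?\<nu>. w \<in> V2 \<longrightarrow> w \<in> V1"
    by (elim bexE conjE)
  have ae: "AE om in P y. (\<lambda>r. X (u + r) om) \<in> V2 \<longrightarrow> (\<lambda>r. X (u + r) om) \<in> V1"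
    by (rule AE_distrD[OF sh V(5)])
  define g where "g w = indicator V1 w * Hm (w s)" for w :: "real \<Rightarrow> 'a option"
  have gm: "g \<in> borel_measurable PA"
    unfolding g_def[abs_def] using V(1) measurable_compose[OF path_eval[OF s] Hm_measurable]
    by (intro borel_measurable_times_ennreal borel_measurable_indicator) auto
  have AG: "A \<inter> GF y u \<in> sets (\<F> (ennreal u))" using A GF(1)[OF y u] by auto
  have us: "0 \<le> u + s" using u s by simp
  have "(\<integral>\<^sup>+om. indicator A om * (indicator (GF y (u + s)) om * Hm (X (u + s) om)) \<partial>P y) =
    (\<integral>\<^sup>+om. indicator (A \<inter> GF y u) om * g (\<lambda>r. X (u + r) om) \<partial>P y)"
  proof (rule nn_integral_cong_AE)
    show "AE om in P y. indicator A om * (indicator (GF y (u + s)) om * Hm (X (u + s) om)) =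
      indicator (A \<inter> GF y u) om * g (\<lambda>r. X (u + r) om)"
      using ae GF(2)[OF y u] GF(2)[OF y us] AE_space
    proof eventually_elim
      case (elim om)
      have rc: "path om \<in> rc_paths T" using elim(4) path_rc y by simp
      have split: "path om \<in> stays F0 (u + s) \<longleftrightarrow> path om \<in> stays F0 u \<and> (\<lambda>r. X (u + r) om) \<in> stays F0 s"
      proof (intro iffI conjI)
        assume l: "path om \<in> stays F0 (u + s)"
        show "path om \<in> stays F0 u" by (rule stays_le[OF l order_refl]) (use s in simp)
        show "(\<lambda>r. X (u + r) om) \<in> stays F0 s" using l shift_rc_paths[OF rc u] u by (simp add: stays_def)
      next
        assume r: "path om \<in> stays F0 u \<and> (\<lambda>r. X (u + r) om) \<in> stays F0 s"
        have "X q om \<in> F0" if q: "0 \<le> q" "q \<le> u + s" for q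
        proof (cases "q \<le> u")
          case True then show ?thesis using r q by (simp add: stays_def)
        next
          case False
          moreover have "\<forall>p\<in>{0..s}. X (u + p) om \<in> F0" using r by (simp add: stays_def)
          ultimately show ?thesis using q by (auto dest: bspec[of _ _ "q - u"])
        qed
        then show "path om \<in> stays F0 (u + s)" using rc by (simp add: stays_def)
      qed
      have "(\<lambda>r. X (u + r) om) \<in> V1 \<longleftrightarrow> (\<lambda>r. X (u + r) om) \<in> stays F0 s" using elim(1) V(3,4) by auto
      then show ?case using elim(2,3) split by (auto simp: g_def indicator_def)
    qed
  qed
  also have "\<dots> = (\<integral>\<^sup>+om. indicator (A \<inter> GF y u) om * (\<integral>\<^sup>+w. g w \<partial>Lx (X u om)) \<partial>P y)"
    by (rule markov_path[OF y u AG gm])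
  also have "\<dots> \<le> (\<integral>\<^sup>+om. indicator (A \<inter> GF y u) om * Hm (X u om) \<partial>P y)"
  proof (rule nn_integral_mono)
    fix om assume "om \<in> space (P y)"
    then have "X u om \<in> points S" using X_space u y by simp
    then show "indicator (A \<inter> GF y u) om * (\<integral>\<^sup>+w. g w \<partial>Lx (X u om)) \<le> indicator (A \<inter> GF y u) om * Hm (X u om)"
      unfolding g_def by (intro mult_left_mono supermartingale_one s V) auto
  qed
  also have "\<dots> = (\<integral>\<^sup>+om. indicator A om * (indicator (GF y u) om * Hm (X u om)) \<partial>P y)"
    by (intro nn_integral_cong) (simp add: indicator_def)
  finally show ?thesis .
qed

text \<open>The right end of the dyadic interval around \<open>\<tau>\<close> takes countably many
  values, and reaching the left end of an interval without stopping is an event of the filtration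
  there.\<close>

lemma optional_stopping_discrete:
  assumes y: "y \<in> points S" and \<tau>: "\<And>b. 0 < b \<Longrightarrow> {om\<in>space M. \<tau> om < ennreal b} \<in> sets (\<F> (ennreal b))"
  shows "(\<integral>\<^sup>+om. (\<Sum>j. indicator {om\<in>space M. ennreal (real j / 2 ^ n) \<le> \<tau> om \<and> \<tau> om < ennreal ((real j + 1) / 2 ^ n)} om *
     (indicator (GF y ((real j + 1) / 2 ^ n)) om * Hm (X ((real j + 1) / 2 ^ n) om))) \<partial>P y) \<le> Hm y"
proof -
  define r where "r j = real j / 2 ^ n" for j :: nat
  have r: "0 \<le> r j" "r j < r (Suc j)" "r (Suc j) = (real j + 1) / 2 ^ n" for j
    by (auto simp: r_def divide_strict_right_mono add.commute)
  define A where "A j = {om\<in>space M. ennreal (r j) \<le> \<tau> om}" for j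
  have AF: "A j \<in> sets (\<F> (ennreal (r j)))" for j
  proof (cases "r j = 0")
    case True
    then show ?thesis using sets.top[of "\<F> (ennreal (r j))"] by (simp add: A_def)
  next
    case False
    then have "{om\<in>space M. \<tau> om < ennreal (r j)} \<in> sets (\<F> (ennreal (r j)))" using r(1)[of j] by (intro \<tau>) auto
    from sets.compl_sets[OF this] show ?thesis
      by (rule back_subst[of "\<lambda>x. x \<in> sets _"]) (auto simp: A_def)
  qed
  have AM: "A j \<in> sets (P y)" for j using F_sets[OF AF] y by simp
  define \<psi> where "\<psi> j om = indicator (GF y (r j)) om * Hm (X (r j) om)" for j om
  have \<psi>m: "\<psi> j \<in> borel_measurable (P y)" for j
    unfolding \<psi>_def[abs_def] using GF(3)[OF y r(1)] measurable_compose[OF X_P[OF y r(1)] Hm_measurable]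
    by (intro borel_measurable_times_ennreal borel_measurable_indicator) auto
  define B where "B j = A j - A (Suc j)" for j
  have BM: "B j \<in> sets (P y)" for j using AM by (auto simp: B_def)
  have BA: "B j = {om\<in>space M. ennreal (real j / 2 ^ n) \<le> \<tau> om \<and> \<tau> om < ennreal ((real j + 1) / 2 ^ n)}" for j
    unfolding B_def A_def r(3) by (auto simp: r_def)
  define e where "e j = (\<integral>\<^sup>+om. indicator (B j) om * \<psi> (Suc j) om \<partial>P y)" for j
  \<comment> \<open>The induction bounds together what has been stopped and what is still running.
    One step moves the block \<open>B J\<close> from the second part to the first, and the
    supermartingale inequality pays for advancing the time.\<close>
  have bound: "(\<Sum>j<J. e j) + (\<integral>\<^sup>+om. indicator (A J) om * \<psi> J om \<partial>P y) \<le> Hm y" for J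
  proof (induct J)
    case 0
    interpret prob_space "P y" using y by (rule P_prob)
    have "(\<integral>\<^sup>+om. indicator (A 0) om * \<psi> 0 om \<partial>P y) \<le> (\<integral>\<^sup>+om. Hm y \<partial>P y)"
    proof (rule nn_integral_mono_AE)
      show "AE om in P y. indicator (A 0) om * \<psi> 0 om \<le> Hm y"
        using P_start[OF y] by eventually_elim (simp add: \<psi>_def r_def indicator_def)
    qed
    then show ?case using emeasure_space_1 by simp
  next
    case (Suc J)
    have "e J + (\<integral>\<^sup>+om. indicator (A (Suc J)) om * \<psi> (Suc J) om \<partial>P y) =
      (\<integral>\<^sup>+om. indicator (B J) om * \<psi> (Suc J) om + indicator (A (Suc J)) om * \<psi> (Suc J) om \<partial>P y)"
      unfolding e_def using BM AM \<psi>m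
      by (intro nn_integral_add[symmetric] borel_measurable_times_ennreal borel_measurable_indicator) auto
    also have "\<dots> = (\<integral>\<^sup>+om. indicator (A J) om * \<psi> (Suc J) om \<partial>P y)"
    proof (rule nn_integral_cong)
      fix om
      have "A (Suc J) \<subseteq> A J" using r(2)[of J] by (auto simp: A_def intro: order_trans[OF ennreal_leI[OF less_imp_le]])
      then show "indicator (B J) om * \<psi> (Suc J) om + indicator (A (Suc J)) om * \<psi> (Suc J) om = indicator (A J) om * \<psi> (Suc J) om"
        by (auto simp: B_def indicator_def)
    qed
    also have "\<dots> \<le> (\<integral>\<^sup>+om. indicator (A J) om * \<psi> J om \<partial>P y)"
      using supermartingale[OF y r(1)[of J] _ AF[of J], of "r (Suc J) - r J"] r(2)[of J] by (simp add: \<psi>_def)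
    finally have "e J + (\<integral>\<^sup>+om. indicator (A (Suc J)) om * \<psi> (Suc J) om \<partial>P y) \<le> (\<integral>\<^sup>+om. indicator (A J) om * \<psi> J om \<partial>P y)" .
    then have "(\<Sum>j<J. e j) + (e J + (\<integral>\<^sup>+om. indicator (A (Suc J)) om * \<psi> (Suc J) om \<partial>P y)) \<le> Hm y"
      using Suc by (meson add_left_mono order_trans)
    then show ?case by (simp add: add.assoc)
  qed
  have "(\<Sum>j<J. e j) \<le> Hm y" for J using bound[of J] by (meson le_iff_add order_trans)
  then have "(\<Sum>j. e j) \<le> Hm y" by (intro suminf_le_const) auto
  moreover have "(\<integral>\<^sup>+om. (\<Sum>j. indicator (B j) om * \<psi> (Suc j) om) \<partial>P y) = (\<Sum>j. e j)"
    unfolding e_def using BM \<psi>m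
    by (intro nn_integral_suminf borel_measurable_times_ennreal borel_measurable_indicator) auto
  ultimately show ?thesis by (simp add: BA \<psi>_def r(3))
qed

text \<open>By \<open>gam_cong\<close> the event depends only on the path frozen at
  \<open>b\<close>, which is measurable for the filtration at time \<open>b\<close>.\<close>

lemma gam_less_F:
  assumes b: "0 < b"
  shows "{om\<in>space M. gam t (path om) < ennreal b} \<in> sets (\<F> (ennreal b))"
proof -
  have "(\<lambda>om s. X (min s b) om) -` {w\<in>space PA. gam t w < ennreal b} \<inter> space (\<F> (ennreal b)) \<in> sets (\<F> (ennreal b))"
    using gam_measurable[of t] b by (intro measurable_sets[OF spath_F]) (measurable, simp)
  also have "(\<lambda>om s. X (min s b) om) -` {w\<in>space PA. gam t w < ennreal b} \<inter> space (\<F> (ennreal b)) =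
    {om\<in>space M. gam t (path om) < ennreal b}"
  proof (intro set_eqI iffI)
    fix om assume a: "om \<in> (\<lambda>om s. X (min s b) om) -` {w\<in>space PA. gam t w < ennreal b} \<inter> space (\<F> (ennreal b))"
    have "gam t (path om) = gam t (\<lambda>s. X (min s b) om)" by (rule gam_cong[of b]) (use a in auto)
    then show "om \<in> {om\<in>space M. gam t (path om) < ennreal b}" using a by simp
  next
    fix om assume a: "om \<in> {om\<in>space M. gam t (path om) < ennreal b}"
    have "gam t (\<lambda>s. X (min s b) om) = gam t (path om)" by (rule gam_cong[of b]) (use a in auto)
    then show "om \<in> (\<lambda>om s. X (min s b) om) -` {w\<in>space PA. gam t w < ennreal b} \<inter> space (\<F> (ennreal b))"
      using a stop_rc_paths[OF path_rc, of om b] b by simp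
  qed
  finally show ?thesis .
qed

text \<open>Dyadic times overshoot the inverse clock at \<open>t'\<close>, while the path is known
  to stay in \<open>F\<close> only up to the inverse clock at \<open>t\<close>. The strict gap
  between the two leaves room for a fine grid, and Fatou's lemma removes the discretisation.\<close>

lemma optional_stopping_before:
  assumes y: "y \<in> points S" and t': "0 \<le> t'" "t' < t" and V: "V \<in> sets PA"
    and Va: "\<And>w. w \<in> V \<Longrightarrow> w \<in> alive t \<and> (\<forall>r\<in>{0..gamr t w}. w r \<in> F)"
  shows "(\<integral>\<^sup>+om. indicator V (path om) * Hm (X (gamr t' (path om)) om) \<partial>P y) \<le> Hm y"
proof -
  define \<tau> where "\<tau> om = gam t' (path om)" for om
  have \<tau>F: "{om\<in>space M. \<tau> om < ennreal b} \<in> sets (\<F> (ennreal b))" if b: "0 < b" for b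
    unfolding \<tau>_def by (rule gam_less_F[OF b])
  define B where "B n j = {om\<in>space M. ennreal (real j / 2 ^ n) \<le> \<tau> om \<and> \<tau> om < ennreal ((real j + 1) / 2 ^ n)}" for n j :: nat
  define \<Theta> where "\<Theta> n om = (\<Sum>j. indicator (B n j) om * (indicator (GF y ((real j + 1) / 2 ^ n)) om * Hm (X ((real j + 1) / 2 ^ n) om)))" for n om
  have \<tau>M: "\<tau> \<in> borel_measurable (P y)"
    unfolding \<tau>_def by (rule measurable_compose[OF path_P[OF y] gam_measurable])
  have BM: "B n j \<in> sets (P y)" for n j
  proof -
    have "{om\<in>space (P y). ennreal (real j / 2 ^ n) \<le> \<tau> om \<and> \<tau> om < ennreal ((real j + 1) / 2 ^ n)} \<in> sets (P y)"
      using \<tau>M by measurable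
    then show ?thesis using y by (simp add: B_def)
  qed
  have \<Theta>m: "\<Theta> n \<in> borel_measurable (P y)" for n
    unfolding \<Theta>_def[abs_def]
    by (intro borel_measurable_suminf_order borel_measurable_times_ennreal borel_measurable_indicator BM GF(3)[OF y]
        measurable_compose[OF X_P[OF y] Hm_measurable]) auto
  have \<Theta>le: "(\<integral>\<^sup>+om. \<Theta> n om \<partial>P y) \<le> Hm y" for n
    unfolding \<Theta>_def B_def by (rule optional_stopping_discrete[OF y \<tau>F])
  have gf: "AE om in P y. \<forall>n j. om \<in> GF y ((real j + 1) / 2 ^ n) \<longleftrightarrow> path om \<in> stays F0 ((real j + 1) / 2 ^ n)"
    unfolding AE_all_countable by (intro allI GF(2)[OF y]) simp
  have "(\<integral>\<^sup>+om. indicator V (path om) * Hm (X (gamr t' (path om)) om) \<partial>P y) \<le> (\<integral>\<^sup>+om. liminf (\<lambda>n. \<Theta> n om) \<partial>P y)"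
  proof (rule nn_integral_mono_AE)
    show "AE om in P y. indicator V (path om) * Hm (X (gamr t' (path om)) om) \<le> liminf (\<lambda>n. \<Theta> n om)"
      using gf AE_space
    proof eventually_elim
      case (elim om)
      show ?case
      proof (cases "path om \<in> V")
        case True
        let ?w = "path om"
        let ?g = "gamr t' ?w"
        have rc: "?w \<in> rc_paths T" using elim(2) path_rc y by simp
        have wM: "om \<in> space M" using elim(2) y by simp
        have al: "?w \<in> alive t" and inF: "\<And>r. 0 \<le> r \<Longrightarrow> r \<le> gamr t ?w \<Longrightarrow> X r om \<in> F" using Va[OF True] by auto
        have inU: "\<And>r. 0 \<le> r \<Longrightarrow> r \<le> gamr t ?w \<Longrightarrow> X r om \<in> U0" using alive_U0[OF al] by auto
        obtain m u where mu: "?w \<in> stays (K0 m) u" "gam t ?w < ennreal u" using al by (auto simp: alive_def)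
        have lt: "?g < gamr t ?w"
          by (rule gam_strict[OF mu(1) exhausts_closed[OF K0] exhausts_subset[OF K0] t' mu(2)])
        have fin: "gam t' ?w = ennreal ?g"
          using gam_mono[of t' t ?w] t' alive_gam[OF al] by (cases "gam t' ?w") (auto simp: top_unique)
        have lim: "limitin T ?w (?w ?g) (at_right ?g)" using rc by (auto simp: rc_paths_def)
        have evF: "eventually (\<lambda>s. ?w s \<in> F) (at_right ?g)"
        proof (rule eventually_at_rightI[OF _ lt])
          fix s assume "s \<in> {?g<..<gamr t ?w}"
          then show "?w s \<in> F" using inF[of s] order_trans[of 0 ?g s] by auto
        qed
        have "((\<lambda>s. Hm (?w s)) \<longlongrightarrow> Hm (?w ?g)) (at_right ?g)"
          using inF[of ?g] lt by (intro H_limit[OF lim _ evF]) auto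
        then have 1: "(\<lambda>n. Hm (?w (dyadic_above n ?g))) \<longlonglongrightarrow> Hm (?w ?g)"
          by (rule filterlim_compose[OF _ filterlim_dyadic_above])
        have ev: "eventually (\<lambda>n. dyadic_above n ?g < gamr t ?w) sequentially"
        proof (rule eventually_compose_filterlim[OF _ filterlim_dyadic_above])
          show "\<forall>\<^sub>F s in at_right ?g. s < gamr t ?w" by (rule eventually_at_rightI[OF _ lt]) auto
        qed
        have "eventually (\<lambda>n. \<Theta> n om = Hm (?w (dyadic_above n ?g))) sequentially"
          using ev
        proof eventually_elim
          case (elim n)
          obtain j :: nat where j: "real j / 2 ^ n \<le> ?g" "?g < (real j + 1) / 2 ^ n"
            using dyadic_above_index[of ?g n] by auto
          have d: "dyadic_above n ?g = (real j + 1) / 2 ^ n" by (rule dyadic_above_interval[OF j])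
          have B: "om \<in> B n i \<longleftrightarrow> i = j" for i
          proof
            assume "om \<in> B n i"
            then have "ennreal (real i / 2 ^ n) \<le> ennreal ?g" "ennreal ?g < ennreal ((real i + 1) / 2 ^ n)"
              using fin by (auto simp: B_def \<tau>_def)
            then have "real i / 2 ^ n \<le> ?g" "?g < (real i + 1) / 2 ^ n" by (simp_all add: ennreal_less_iff)
            then have "dyadic_above n ?g = (real i + 1) / 2 ^ n" by (rule dyadic_above_interval)
            then show "i = j" using d by simp
          next
            assume "i = j"
            then show "om \<in> B n i" using j wM ord_le_eq_trans[OF ennreal_leI fin[symmetric]] ord_eq_less_trans[OF fin ennreal_lessI]
              le_less_trans[OF enn2real_nonneg j(2)] by (simp add: B_def \<tau>_def)
          qed
          have "path om \<in> stays F0 ((real j + 1) / 2 ^ n)"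
            using rc inF inU elim d by (auto simp: stays_def)
          then have G: "om \<in> GF y ((real j + 1) / 2 ^ n)" using \<open>\<forall>n j. om \<in> GF y ((real j + 1) / 2 ^ n) \<longleftrightarrow> path om \<in> stays F0 ((real j + 1) / 2 ^ n)\<close> by simp
          have "\<Theta> n om = (\<Sum>i\<in>{j}. indicator (B n i) om * (indicator (GF y ((real i + 1) / 2 ^ n)) om * Hm (X ((real i + 1) / 2 ^ n) om)))"
            unfolding \<Theta>_def by (rule suminf_finite) (auto simp: B indicator_def)
          then show ?case using G B d by (simp add: indicator_def)
        qed
        then have "(\<lambda>n. \<Theta> n om) \<longlonglongrightarrow> Hm (?w ?g)"
          using 1 by (intro Lim_transform_eventually[OF 1]) (auto elim: eventually_mono)
        then have "liminf (\<lambda>n. \<Theta> n om) = Hm (?w ?g)" by (intro lim_imp_Liminf) auto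
        then show ?thesis using True by simp
      qed simp
    qed
  qed
  also have "\<dots> \<le> liminf (\<lambda>n. \<integral>\<^sup>+om. \<Theta> n om \<partial>P y)" by (rule nn_integral_liminf[OF \<Theta>m])
  also have "\<dots> \<le> liminf (\<lambda>n. Hm y)" by (intro Liminf_mono always_eventually allI \<Theta>le)
  also have "\<dots> = Hm y" by (simp add: Liminf_const)
  finally show ?thesis .
qed

text \<open>At \<open>t\<close> itself there is no room to the right. Instead, the inverse clocks at
  earlier levels are stopping times that increase to the one at \<open>t\<close>, and by
  quasi-left-continuity the positions of \<open>X\<close> converge along them.\<close>

theorem optional_stopping:
  assumes y: "y \<in> points S" and t: "0 < t" and V: "V \<in> sets PA"
    and Va: "\<And>w. w \<in> V \<Longrightarrow> w \<in> alive t \<and> (\<forall>r\<in>{0..gamr t w}. w r \<in> F)"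
  shows "(\<integral>\<^sup>+om. indicator V (path om) * Hm (X (gamr t (path om)) om) \<partial>P y) \<le> Hm y"
proof -
  from increasing_to[OF t] obtain r where r: "\<And>n. 0 \<le> r n" "\<And>n. r n < t" "\<And>n. r n \<le> r (Suc n)" and rlim: "r \<longlonglongrightarrow> t" by blast
  define \<sigma> where "\<sigma> n om = gam (r n) (path om)" for n om
  have st: "stopping_time \<F> (\<sigma> n)" for n
    unfolding \<sigma>_def by (rule stopping_time_less[OF gam_less_F])
  have mono: "\<sigma> n om \<le> \<sigma> (Suc n) om" for n om unfolding \<sigma>_def by (rule gam_mono[OF r(3)])
  have VM: "(\<lambda>om. indicator V (path om) :: ennreal) \<in> borel_measurable (P y)"
    using measurable_compose[OF path_P[OF y] borel_measurable_indicator[OF V]] .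
  have XM: "(\<lambda>om. Hm (X (gamr s (path om)) om)) \<in> borel_measurable (P y)" for s
    using measurable_compose[OF measurable_compose[OF path_P[OF y] eval_gam_measurable] Hm_measurable] .
  have "(\<integral>\<^sup>+om. indicator V (path om) * Hm (X (gamr t (path om)) om) \<partial>P y) \<le>
    (\<integral>\<^sup>+om. liminf (\<lambda>n. indicator V (path om) * Hm (X (gamr (r n) (path om)) om)) \<partial>P y)"
  proof (rule nn_integral_mono_AE)
    show "AE om in P y. indicator V (path om) * Hm (X (gamr t (path om)) om) \<le>
      liminf (\<lambda>n. indicator V (path om) * Hm (X (gamr (r n) (path om)) om))"
      using qlc_AE[OF y, where \<sigma>=\<sigma>, OF st mono] absorb_AE[OF y]
    proof eventually_elim
      case (elim om)
      show ?case
      proof (cases "path om \<in> V")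
        case True
        let ?w = "path om"
        have al: "?w \<in> alive t" and inF: "\<And>q. 0 \<le> q \<Longrightarrow> q \<le> gamr t ?w \<Longrightarrow> X q om \<in> F" using Va[OF True] by auto
        have inU: "X (gamr t ?w) om \<in> U0" using alive_U0[OF al, of "gamr t ?w"] by auto
        obtain m u where mu: "?w \<in> stays (K0 m) u" "gam t ?w < ennreal u" using al by (auto simp: alive_def)
        have fin: "gam t ?w = ennreal (gamr t ?w)" using alive_gam[OF al] by (cases "gam t ?w") auto
        \<comment> \<open>The earlier inverse clocks leave no gap below the one at \<open>t\<close>,
          because the time change is onto: every \<open>q\<close> below is the inverse clock at some
          \<open>s < t\<close>.\<close>
        have sup: "(SUP n. \<sigma> n om) = ennreal (gamr t ?w)"
        proof (rule antisym)
          show "(SUP n. \<sigma> n om) \<le> ennreal (gamr t ?w)"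
            unfolding \<sigma>_def fin[symmetric] using r(2) by (intro SUP_least gam_mono) (simp add: less_imp_le)
          show "ennreal (gamr t ?w) \<le> (SUP n. \<sigma> n om)"
          proof (rule dense_le)
            fix z assume z: "z < ennreal (gamr t ?w)"
            then obtain q where q: "z = ennreal q" "0 \<le> q" by (cases z) auto
            have ql: "q < gamr t ?w" using z q by (simp add: ennreal_less_iff)
            obtain s where s: "0 \<le> s" "gam s ?w = ennreal q" "s < t"
              using gam_surj[OF mu(1) exhausts_closed[OF K0] exhausts_subset[OF K0] less_imp_le[OF t] mu(2) q(2) less_imp_le[OF ql]] ql by blast
            have "eventually (\<lambda>n. s < r n) sequentially" using rlim s(3) by (rule order_tendstoD)
            then obtain n where "s < r n" by (auto simp: eventually_sequentially)
            then have "z \<le> \<sigma> n om" unfolding q s(2)[symmetric] \<sigma>_def by (intro gam_mono) simp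
            also have "\<dots> \<le> (SUP n. \<sigma> n om)" by (rule SUP_upper) simp
            finally show "z \<le> (SUP n. \<sigma> n om)" .
          qed
        qed
        have "ennreal (gamr t ?w) < lifetime S X om" using elim(2)[rule_format, OF _ inU] by simp
        then have "limitin T (\<lambda>n. X (enn2real (\<sigma> n om)) om) (X (gamr t ?w) om) sequentially"
          using elim(1) unfolding sup by simp
        then have "(\<lambda>n. Hm (X (enn2real (\<sigma> n om)) om)) \<longlonglongrightarrow> Hm (X (gamr t ?w) om)"
          using inF gamr_mono[OF less_imp_le[OF r(2)] alive_gam[OF al]]
          by (intro H_limit always_eventually allI) (auto simp: \<sigma>_def)
        then have "liminf (\<lambda>n. Hm (X (gamr (r n) ?w) om)) = Hm (X (gamr t ?w) om)"
          unfolding \<sigma>_def by (intro lim_imp_Liminf) auto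
        then show ?thesis using True by simp
      qed simp
    qed
  qed
  also have "\<dots> \<le> liminf (\<lambda>n. \<integral>\<^sup>+om. indicator V (path om) * Hm (X (gamr (r n) (path om)) om) \<partial>P y)"
    by (intro nn_integral_liminf borel_measurable_times_ennreal VM XM)
  also have "\<dots> \<le> liminf (\<lambda>n. Hm y)"
    by (intro Liminf_mono always_eventually allI optional_stopping_before[OF y r(1,2) V Va])
  also have "\<dots> = Hm y" by (simp add: Liminf_const)
  finally show ?thesis .
qed

end

section \<open>Excessiveness\<close>

lemma continuous_map_enn2real:
  assumes "continuous_map T euclidean f" "\<And>x. x \<in> topspace T \<Longrightarrow> f x < (\<infinity>::ennreal)"
  shows "continuous_map T euclideanreal (\<lambda>x. enn2real (f x))"
  unfolding continuous_map_atin
proof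
  fix x assume x: "x \<in> topspace T"
  then have "(f \<longlongrightarrow> f x) (atin T x)" using assms(1) by (simp add: continuous_map_atin)
  moreover have "f x = ennreal (enn2real (f x))" using assms(2)[OF x] by simp
  ultimately have "((\<lambda>x. enn2real (f x)) \<longlongrightarrow> enn2real (f x)) (atin T x)" by (intro tendsto_enn2real) auto
  then show "limitin euclideanreal (\<lambda>x. enn2real (f x)) (enn2real (f x)) (atin T x)" by simp
qed

section \<open>Upper and lower bound for the semigroup of \<open>Y\<close> acting on
  \<open>ht\<close>\<close>

context prop4
begin

abbreviation "L \<equiv> FH \<inter> U0"

lemma L_BE: "L \<in> sets BE"
  using FH_BE U0_BE by auto

lemma kap_eq: assumes "x \<in> U0" shows "kap x = h x * Hm (I x)"
  using assms by (simp add: kap_def h0_def HI_def)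

text \<open>The time change is onto, so each position up to the inverse clock is the image under
  \<open>I\<close> of a state visited by the inverted path, and \<open>I\<close> preserves
  \<open>F\<close>.\<close>

lemma inverted_stays:
  assumes w: "w \<in> alive t" and t: "0 \<le> t" and st: "tc t w \<in> stays L t" and r: "r \<in> {0..gamr t w}"
  shows "w r \<in> F"
proof -
  obtain m u where mu: "w \<in> stays (K0 m) u" "gam t w < ennreal u" using w by (auto simp: alive_def)
  have r': "0 \<le> r" "r \<le> gamr t w" using r by auto
  obtain s where s: "0 \<le> s" "s \<le> t" "gam s w = ennreal r"
    using gam_surj[OF mu(1) exhausts_closed[OF K0] exhausts_subset[OF K0] t mu(2) r'] by blast
  have "tc t w s = I (w r)" using s r' by (simp add: tc_def min_absorb1)
  moreover have "tc t w s \<in> L" using st s by (simp add: stays_def)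
  ultimately have "I (I (w r)) \<in> F" using I_F FH_F by auto
  moreover have "w r \<in> points S" using alive_U0[OF w r'] U0_sub by auto
  ultimately show ?thesis by (simp add: I_I)
qed

text \<open>\<open>L\<close> is only known to be Borel, so staying in it is measurable only after
  completion. The hull is taken for the law of the inverted path on \<open>alive t\<close>.\<close>

lemma tc_hull:
  assumes y: "y \<in> points S" and t: "0 \<le> t"
  shows "\<exists>V1\<in>sets PA. \<exists>V2\<in>sets PA. V1 \<subseteq> stays L t \<and> stays L t \<subseteq> V2 \<and>
    (AE om in P y. path om \<in> alive t \<longrightarrow> tc t (path om) \<in> V2 \<longrightarrow> tc t (path om) \<in> V1)"
proof -
  let ?A = "{om\<in>space M. path om \<in> alive t}"
  have AP: "?A \<in> sets (P y)" using alive_M[of t] y by simp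
  note f = tc_path_measurable[OF y t]
  have "finite_measure (P y)" using P_prob[OF y] by (simp add: prob_space_def)
  then have fin: "finite_measure (distr (restrict_space (P y) ?A) PA (\<lambda>om. tc t (path om)))"
    using AP by (intro finite_measure.finite_measure_distr[OF _ f] finite_measure_restrict_space)
  from stays_hull[OF fin sets_distr L_BE, of t] obtain V1 V2 where V: "V1 \<in> sets PA" "V2 \<in> sets PA"
    "V1 \<subseteq> stays L t" "stays L t \<subseteq> V2" "AE w in distr (restrict_space (P y) ?A) PA (\<lambda>om. tc t (path om)). w \<in> V2 \<longrightarrow> w \<in> V1"
    by (elim bexE conjE)
  have "AE om in restrict_space (P y) ?A. tc t (path om) \<in> V2 \<longrightarrow> tc t (path om) \<in> V1"
    by (rule AE_distrD[OF f V(5)])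
  moreover have "?A \<inter> space (P y) \<in> sets (P y)" using AP by auto
  ultimately have "AE om in P y. om \<in> ?A \<longrightarrow> tc t (path om) \<in> V2 \<longrightarrow> tc t (path om) \<in> V1"
    by (subst (asm) AE_restrict_space_iff)
  then have "AE om in P y. path om \<in> alive t \<longrightarrow> tc t (path om) \<in> V2 \<longrightarrow> tc t (path om) \<in> V1"
    using AE_space by eventually_elim (use y in auto)
  then show ?thesis using V by (intro bexI[of _ V1] bexI[of _ V2]) auto
qed

text \<open>The estimates lead from \<open>Y\<close> to the weighted law of \<open>X\<close>, then
  by the exchange to the inverted path from \<open>I x\<close>, where optional stopping applies.
  Since an upper bound is wanted, the one-sided comparison of laws on \<open>L\<close> is
  enough.\<close>

lemma ht_supermedian:
  assumes x: "x \<in> L" and t: "0 \<le> t"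
  shows "killed_semigroup N Y L t ht x \<le> ht x"
\<comment> \<open>Optional stopping approaches \<open>t\<close> from below and so needs
  \<open>t > 0\<close>; at time \<open>0\<close> the process \<open>Y\<close> is dead or at
  \<open>x\<close>.\<close>
proof (cases "t = 0")
  case True
  have xF: "x \<in> F" using x FH_F by auto
  interpret prob_space "N x" by (rule N_prob[OF xF])
  have "killed_semigroup N Y L t ht x \<le> (\<integral>\<^sup>+om. ht x \<partial>N x)"
    unfolding killed_semigroup_def nn_integral_completion
    by (rule nn_integral_mono_AE) (use Y_start[OF xF] in \<open>eventually_elim, auto simp: True\<close>)
  then show ?thesis using emeasure_space_1 by simp
next
  case False
  then have tp: "0 < t" using t by simp
  have xF: "x \<in> F" "x \<in> U0" "x \<in> FH" "x \<in> points S" using x FH_F F_E by auto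
  define y where "y = I x"
  have y: "y \<in> points S" "y \<in> U0" "I y = x" using I_E[OF xF(4)] I_U0[OF xF(2)] I_I[OF xF(4)] by (auto simp: y_def)
  obtain V1 V2 where V: "V1 \<in> sets PA" "V2 \<in> sets PA" "V1 \<subseteq> stays L t" "stays L t \<subseteq> V2"
    "AE om in P y. path om \<in> alive t \<longrightarrow> tc t (path om) \<in> V2 \<longrightarrow> tc t (path om) \<in> V1"
    using tc_hull[OF y(1) t] by (elim bexE conjE)
  \<comment> \<open>Equal to \<open>ht\<close> on \<open>L\<close>, and Borel on the whole
    space.\<close>
  define k where "k z = kap z / Hm z * indicator L z" for z
  have km: "k \<in> borel_measurable BE"
    unfolding k_def[abs_def] using kap_measurable Hm_measurable L_BE
    by (intro borel_measurable_times_ennreal borel_measurable_divide_ennreal borel_measurable_indicator)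
  define g where "g w = indicator V2 w * k (w t)" for w :: "real \<Rightarrow> 'a option"
  have gm: "g \<in> borel_measurable PA"
    unfolding g_def[abs_def] using V(2) measurable_compose[OF path_eval[OF t] km]
    by (intro borel_measurable_times_ennreal borel_measurable_indicator) auto
  define \<Phi> where "\<Phi> w = indicator V2 w * HI (w t)" for w :: "real \<Rightarrow> 'a option"
  have \<Phi>m: "\<Phi> \<in> borel_measurable PA"
    unfolding \<Phi>_def[abs_def] using V(2) measurable_compose[OF path_eval[OF t] HI_measurable]
    by (intro borel_measurable_times_ennreal borel_measurable_indicator) auto
  \<comment> \<open>The outer hull \<open>V2\<close> serves the upper bound. After the exchange it
    is replaced by the inner hull \<open>V1\<close>, whose paths satisfy the condition of optional
    stopping.\<close>
  have "killed_semigroup N Y L t ht x \<le> (\<integral>\<^sup>+om. indicator (Al t x) om * g (Yst t om) \<partial>N x)"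
    unfolding killed_semigroup_def nn_integral_completion
  proof (rule nn_integral_mono)
    fix om assume om: "om \<in> space (N x)"
    show "(if ennreal t < exit_time Y L om then case Y t om of None \<Rightarrow> 0 | Some y \<Rightarrow> ht y else 0) \<le> indicator (Al t x) om * g (Yst t om)"
    proof (cases "ennreal t < exit_time Y L om")
      case True
      have inL: "Y s om \<in> Some ` L" if "0 \<le> s" "s \<le> t" for s by (rule exit_time_less_in[OF True that])
      obtain z where z: "z \<in> L" "Y t om = Some z" using inL[OF t order_refl] by (elim imageE)
      have "om \<in> Al t x" using z FH_F om by (auto simp: Al_def)
      moreover have "Yst t om \<in> stays L t"
        using Yst_rc[OF xF(1) om t] z inL by (force simp: stays_def)
      moreover have "ht z = k z" using z kap_ht(2)[of z] by (simp add: k_def)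
      ultimately show ?thesis using V(4) z True by (auto simp: g_def)
    qed simp
  qed
  also have "\<dots> = (\<integral>\<^sup>+w. g w \<partial>YL t x)" by (rule nn_integral_YL[OF xF(1) t gm, symmetric])
  also have "\<dots> \<le> (\<integral>\<^sup>+w. g w \<partial>XL t x)" using YL_le[OF xF(3) t] by (intro nn_integral_mono_measure) auto
  also have "\<dots> = (\<integral>\<^sup>+om. Hm (X t om) * g (\<lambda>s. X (min s t) om) \<partial>P x) / ennreal (H x)"
    by (rule nn_integral_XL[OF xF(4) t gm])
  also have "\<dots> \<le> (\<integral>\<^sup>+om. h0 (X t om) * \<Phi> (\<lambda>s. X (min s t) om) \<partial>P x) / ennreal (H x)"
  proof (intro divide_right_mono_ennreal nn_integral_mono)
    fix om
    have "Hm z * k z \<le> h0 z * HI z" for z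
    proof (cases "z \<in> L")
      case True
      then have "Hm z * k z = kap z" using kap_ht(1,2)[of z] by (simp add: k_def)
      then show ?thesis by (simp add: kap_def)
    qed (simp add: k_def)
    then show "Hm (X t om) * g (\<lambda>s. X (min s t) om) \<le> h0 (X t om) * \<Phi> (\<lambda>s. X (min s t) om)"
      by (auto simp: g_def \<Phi>_def indicator_def)
  qed
  also have "(\<integral>\<^sup>+om. h0 (X t om) * \<Phi> (\<lambda>s. X (min s t) om) \<partial>P x) =
      h x * (\<integral>\<^sup>+om. indicator (alive t) (path om) * \<Phi> (tc t (path om)) \<partial>P y)"
    unfolding inversion_integral[OF y(2) t \<Phi>m] y(3)
    using h_pos[OF xF(2)] by (intro ennreal_mult_div_cancel[symmetric])
  also have "(\<integral>\<^sup>+om. indicator (alive t) (path om) * \<Phi> (tc t (path om)) \<partial>P y) \<le>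
      (\<integral>\<^sup>+om. indicator {w\<in>alive t. tc t w \<in> V1} (path om) * Hm (X (gamr t (path om)) om) \<partial>P y)"
  proof (rule nn_integral_mono_AE)
    show "AE om in P y. indicator (alive t) (path om) * \<Phi> (tc t (path om)) \<le>
      indicator {w\<in>alive t. tc t w \<in> V1} (path om) * Hm (X (gamr t (path om)) om)"
      using V(5)
    proof eventually_elim
      case (elim om)
      show ?case
      proof (cases "path om \<in> alive t \<and> tc t (path om) \<in> V2")
        case True
        have u: "path om (gamr t (path om)) \<in> U0" using True by (intro alive_U0[of _ t]) auto
        have "tc t (path om) t = I (path om (gamr t (path om)))" by (simp add: tc_def)
        then have "HI (tc t (path om) t) = Hm (path om (gamr t (path om)))"
          using u I_U0[OF u] I_I U0_sub by (auto simp: HI_def)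
        then show ?thesis using True elim by (simp add: \<Phi>_def)
      qed (auto simp: \<Phi>_def indicator_def)
    qed
  qed
  also have "\<dots> \<le> Hm y"
  proof (rule optional_stopping[OF y(1) tp tc_preimage_sets[OF t V(1)]])
    fix w assume "w \<in> {w\<in>alive t. tc t w \<in> V1}"
    then show "w \<in> alive t \<and> (\<forall>r\<in>{0..gamr t w}. w r \<in> F)"
      using inverted_stays[OF _ t, of w] V(3) by auto
  qed
  also have "h x * Hm y / ennreal (H x) = ht x"
    using kap_ht(2)[OF xF(3,2)] kap_eq[OF xF(2)] xF by (simp add: y_def Hm_eq)
  finally show ?thesis by (simp add: divide_right_mono_ennreal mult_left_mono)
qed

text \<open>On \<open>L\<close> the function \<open>ht\<close> is continuous, and \<open>FH\<close>
  is relatively open in \<open>F\<close> because \<open>H\<close> is continuous. Openness relative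
  to \<open>F\<close> is the form in which right-continuity of \<open>Y\<close> can be used.\<close>

lemma ht_superlevel:
  assumes c: "c < \<infinity>"
  shows "\<exists>W. openin T W \<and> {z\<in>L. c < ht z} = F \<inter> W"
proof -
  define f where "f z = enn2real (h z) * H (I z) / H z" for z
  have LF: "L \<subseteq> F" "L \<subseteq> U0" "L \<subseteq> points S" using FH_F F_E by auto
  have top: "topspace (subtopology T L) = L" using LF by auto
  have Ic: "continuous_map (subtopology T L) (subtopology T F) I"
    using LF I_F by (intro continuous_map_into_subtopology continuous_map_from_subtopology_mono[OF I_cont]) auto
  have "continuous_map (subtopology T L) euclideanreal (\<lambda>z. H (I z))"
    using continuous_map_compose[OF Ic H_cont] by (simp add: comp_def)
  moreover have "continuous_map (subtopology T L) euclideanreal (\<lambda>z. enn2real (h z))"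
    using LF h_pos by (intro continuous_map_enn2real continuous_map_from_subtopology_mono[OF h_cont]) auto
  moreover have "continuous_map (subtopology T L) euclideanreal H"
    by (rule continuous_map_from_subtopology_mono[OF H_cont LF(1)])
  ultimately have f: "continuous_map (subtopology T L) euclideanreal f"
    unfolding f_def[abs_def] by (intro continuous_map_real_divide continuous_map_real_mult) (auto simp: FH_def)
  have hf: "ht z = ennreal (f z)" if z: "z \<in> L" for z
  proof -
    have zz: "z \<in> F" "z \<in> U0" "I z \<in> F" "0 < H z" using z LF I_F by (auto simp: FH_def)
    have "h z = ennreal (enn2real (h z))" using h_pos(2)[OF zz(2)] by simp
    then have "ht z = ennreal (enn2real (h z)) * ennreal (H (I z)) / ennreal (H z)"
      unfolding ht_def kelvin_transform_def by simp
    then show ?thesis using zz H_nonneg[of "I z"]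
      by (simp add: f_def ennreal_mult[symmetric] divide_ennreal)
  qed
  have "openin (subtopology T L) {z \<in> topspace (subtopology T L). f z \<in> {enn2real c<..}}"
    by (rule openin_continuous_map_preimage[OF f]) simp
  moreover have "{z \<in> topspace (subtopology T L). f z \<in> {enn2real c<..}} = {z\<in>L. c < ht z}"
  proof -
    have "enn2real c < f z \<longleftrightarrow> c < ht z" if "z \<in> L" for z
    proof -
      have "c < ht z \<longleftrightarrow> ennreal (enn2real c) < ennreal (f z)" using c hf[OF that] by simp
      then show ?thesis by (simp add: ennreal_less_iff)
    qed
    then show ?thesis unfolding top by auto
  qed
  ultimately obtain W1 where W1: "openin T W1" "{z\<in>L. c < ht z} = W1 \<inter> L"
    by (auto simp: openin_subtopology)
  have "openin (subtopology T F) {z \<in> topspace (subtopology T F). H z \<in> {0<..}}"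
    by (rule openin_continuous_map_preimage[OF H_cont]) simp
  moreover have "{z \<in> topspace (subtopology T F). H z \<in> {0<..}} = FH" using F_E by (auto simp: FH_def)
  ultimately obtain W2 where W2: "openin T W2" "FH = W2 \<inter> F" by (auto simp: openin_subtopology)
  show ?thesis
    using W1 W2 openin_U0 by (intro exI[of _ "W1 \<inter> (W2 \<inter> U0)"]) (auto intro!: openin_Int)
qed

text \<open>From a point of \<open>L\<close> the process \<open>Y\<close> starts alive and by
  right-continuity remains for a short time where \<open>ht\<close> exceeds a level slightly below
  \<open>ht x\<close>. Together with \<open>ht_supermedian\<close> this gives the limit at time
  \<open>0\<close>.\<close>

lemma ht_lower:
  assumes x: "x \<in> L" and a: "a < ht x"
  shows "eventually (\<lambda>t. a < killed_semigroup N Y L t ht x) (at_right 0)"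
proof -
  have xF: "x \<in> F" "x \<in> U0" "x \<in> FH" "x \<in> points S" using x FH_F F_E by auto
  interpret prob_space "N x" by (rule N_prob[OF xF(1)])
  obtain c where c: "a < c" "c < ht x" using dense[OF a] by auto
  have cfin: "c < \<infinity>" using c(2) by (auto intro: less_le_trans)
  obtain W where W: "openin T W" "{z\<in>L. c < ht z} = F \<inter> W" using ht_superlevel[OF cfin] by auto
  have xW: "x \<in> W" using W(2) x c(2) by auto
  obtain K where K: "exhausts T K W" using exh[OF W(1)] by auto
  have "x \<in> (\<Union>m. K m)" using K xW by (simp add: exhausts_def)
  then obtain m where "x \<in> K m" by auto
  \<comment> \<open>A closed neighbourhood of \<open>x\<close> inside \<open>W\<close>: staying in a
    closed set is a Borel event, so the events \<open>E k\<close> below are measurable.\<close>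
  define C where "C = K (Suc m)"
  have C: "closedin T C" "C \<subseteq> W" "x \<in> T interior_of C"
    using exhausts_closed[OF K] exhausts_subset[OF K] exhausts_interior[OF K, of m] \<open>x \<in> K m\<close> by (auto simp: C_def)
  define q where "q k = inverse (real (Suc k))" for k
  have q: "0 < q k" "q (Suc k) \<le> q k" for k by (auto simp: q_def field_simps)
  define E where "E k = {om\<in>Al (q k) x. Yst (q k) om \<in> stays C (q k)}" for k
  have EN: "E k \<in> sets (N x)" for k
    unfolding E_def by (rule emeasure_YL(2)[OF xF(1) less_imp_le[OF q(1)] stays_closed[OF C(1)]])
  have EY: "om \<in> E k \<longleftrightarrow> om \<in> space (N x) \<and> (\<forall>s\<in>{0..q k}. Y s om \<in> Some ` (F \<inter> C))" for om k
  proof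
    assume e: "om \<in> E k"
    then have om: "om \<in> space (N x)" "Y (q k) om \<noteq> None" by (auto simp: E_def Al_def)
    show "om \<in> space (N x) \<and> (\<forall>s\<in>{0..q k}. Y s om \<in> Some ` (F \<inter> C))"
    proof (intro conjI ballI om(1))
      fix s assume s: "s \<in> {0..q k}"
      obtain z where z: "z \<in> F" "Y s om = Some z" using Y_alive[OF xF(1) om(1) _ _ om(2), of s] s by auto
      have "Yst (q k) om s \<in> C" using e s by (auto simp: E_def stays_def)
      then show "Y s om \<in> Some ` (F \<inter> C)" using z s by auto
    qed
  next
    assume e: "om \<in> space (N x) \<and> (\<forall>s\<in>{0..q k}. Y s om \<in> Some ` (F \<inter> C))"
    then have s: "\<And>s. 0 \<le> s \<Longrightarrow> s \<le> q k \<Longrightarrow> Y s om \<in> Some ` (F \<inter> C)" by auto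
    have qk: "0 \<le> q k" using q(1)[of k] by simp
    have A: "om \<in> Al (q k) x" using e s[OF qk order_refl] by (auto simp: Al_def)
    then have "Y (q k) om \<noteq> None" by (auto simp: Al_def)
    then have "Yst (q k) om \<in> rc_paths T" using Yst_rc[OF xF(1) _ qk] e by simp
    then show "om \<in> E k" using A s by (force simp: E_def stays_def)
  qed
  have inc: "E k \<subseteq> E (Suc k)" for k using EY q(2)[of k] by auto
  have full: "emeasure (N x) (\<Union>k. E k) = 1"
  proof (rule emeasure_eq_1_AE)
    show "(\<Union>k. E k) \<in> sets (N x)" using EN by auto
    show "AE om in N x. om \<in> (\<Union>k. E k)"
      using Y_start_FH[OF xF(3)] AE_space
    proof eventually_elim
      case (elim om)
      have "eventually (\<lambda>s. Y s om \<in> Some ` (F \<inter> (T interior_of C))) (at_right 0)"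
        by (rule Y_value(2)[OF xF(1) elim(2) order_refl elim(1) _ C(3)]) simp
      then obtain b where b: "0 < b" "\<And>s. 0 < s \<Longrightarrow> s < b \<Longrightarrow> Y s om \<in> Some ` (F \<inter> (T interior_of C))"
        by (auto simp: eventually_at_right_field)
      obtain k where k: "q k < b" using reals_Archimedean[OF b(1)] by (auto simp: q_def)
      have ic: "T interior_of C \<subseteq> C" by (rule interior_of_subset)
      have "Y s om \<in> Some ` (F \<inter> C)" if "s \<in> {0..q k}" for s
      proof (cases "s = 0")
        case True
        then show ?thesis using elim(1) xF(1) C(3) ic by auto
      next
        case False
        then have "Y s om \<in> Some ` (F \<inter> (T interior_of C))" using b(2)[of s] that k by auto
        then show ?thesis using ic by auto
      qed
      then have "om \<in> E k" using EY elim(2) by simp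
      then show ?case by auto
    qed
  qed
  have "(\<lambda>k. emeasure (N x) (E k)) \<longlonglongrightarrow> emeasure (N x) (\<Union>k. E k)"
    using EN inc by (intro Lim_emeasure_incseq incseq_SucI) auto
  then have "(\<lambda>k. c * emeasure (N x) (E k)) \<longlonglongrightarrow> c * 1"
    unfolding full using cfin by (intro ennreal_tendsto_cmult) auto
  then have "eventually (\<lambda>k. a < c * emeasure (N x) (E k)) sequentially"
    using c(1) by (intro order_tendstoD) auto
  then obtain k where k: "a < c * emeasure (N x) (E k)" by (auto simp: eventually_sequentially)
  show ?thesis
  proof (rule eventually_at_rightI[of 0 "q k"])
    fix t assume t: "t \<in> {0<..<q k}"
    have "c * emeasure (N x) (E k) = (\<integral>\<^sup>+om. c * indicator (E k) om \<partial>N x)"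
      using EN by (intro nn_integral_cmult_indicator[symmetric])
    also have "\<dots> \<le> killed_semigroup N Y L t ht x"
      unfolding killed_semigroup_def nn_integral_completion
    proof (rule nn_integral_mono)
      fix om assume om: "om \<in> space (N x)"
      show "c * indicator (E k) om \<le> (if ennreal t < exit_time Y L om then case Y t om of None \<Rightarrow> 0 | Some y \<Rightarrow> ht y else 0)"
      proof (cases "om \<in> E k")
        case True
        have G: "\<exists>z. Y s om = Some z \<and> z \<in> L \<and> c < ht z" if "0 \<le> s" "s \<le> q k" for s
        proof -
          have "Y s om \<in> Some ` (F \<inter> C)" using True EY that by auto
          then obtain z where z: "Y s om = Some z" "z \<in> F \<inter> C" by (elim imageE)
          then have "z \<in> {z\<in>L. c < ht z}" using W(2) C(2) by auto
          then show ?thesis using z by auto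
        qed
        have "ennreal (q k) \<le> exit_time Y L om" by (rule exit_time_ge) (use G in force)
        moreover have "ennreal t < ennreal (q k)" using t by (simp add: ennreal_less_iff)
        ultimately have "ennreal t < exit_time Y L om" by (rule less_le_trans[rotated])
        moreover obtain z where "Y t om = Some z" "c < ht z" using G[of t] t by auto
        ultimately show ?thesis using True by simp
      qed simp
    qed
    finally show "a < killed_semigroup N Y L t ht x" using k by (rule less_le_trans[rotated])
  qed (rule q(1))
qed

theorem ht_excessive: "excessive T N Y L ht"
  unfolding excessive_def
proof (intro conjI ballI allI impI)
  show "ht \<in> borel_measurable (restrict_space BE L)"
  proof -
    have "(\<lambda>z. kap z / Hm z) \<in> borel_measurable (restrict_space BE L)"
      by (intro measurable_restrict_space1 borel_measurable_divide_ennreal kap_measurable Hm_measurable)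
    then show ?thesis
      by (rule measurable_cong[THEN iffD1, rotated]) (use kap_ht(2) in \<open>auto simp: space_restrict_space\<close>)
  qed
  show "killed_semigroup N Y L t ht x \<le> ht x" if "x \<in> L" "0 \<le> t" for x t
    using that by (rule ht_supermedian)
  show "((\<lambda>t. killed_semigroup N Y L t ht x) \<longlongrightarrow> ht x) (at_right 0)" if x: "x \<in> L" for x
  proof (rule order_tendstoI)
    show "\<forall>\<^sub>F t in at_right 0. a < killed_semigroup N Y L t ht x" if "a < ht x" for a
      using x that by (rule ht_lower)
    show "\<forall>\<^sub>F t in at_right 0. killed_semigroup N Y L t ht x < a" if a: "ht x < a" for a
      using eventually_at_right_less[of 0]
      by eventually_elim (rule le_less_trans[OF ht_supermedian[OF x less_imp_le] a])
  qed
qed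

theorem Y_inversion_property:
  assumes nontrivial: "\<exists>x\<in>F. I x \<noteq> x"
  shows "inversion_property S F N Y I ht v"
  unfolding inversion_property_def live_states_eq
proof (intro conjI)
  show "I \<in> F \<rightarrow> F" using I_F by auto
  show "\<forall>x\<in>F. I (I x) = x" using I_I F_E by auto
  show "\<exists>x\<in>F. I x \<noteq> x" by (rule nontrivial)
  show "excessive T N Y L ht" by (rule ht_excessive)
  show "\<forall>x\<in>D. 0 < ht x \<and> ht x < \<infinity>" using ht_pos by auto
  show "\<forall>x\<in>D. 0 < v x" using vpos D_sub by auto
  show "continuous_map (subtopology T D) euclideanreal v"
    by (rule continuous_map_from_subtopology_mono[OF vcont D_sub(2)])
  show "\<forall>x\<in>F. has_markov_law T (N x) (inverted_process I v D Y) (doob_semigroup N Y D ht) (I x)"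
    using Y_inversion_law by auto
qed

end

text \<open>That \<open>I\<close> moves a point of \<open>F\<close> does not follow from its moving
  a point of the whole space, and positivity of \<open>H\<close> in the interior of \<open>F\<close>
  is what makes the quotient positive and finite there.\<close>

theorem proposition4:
  fixes S :: "'a::euclidean_space set"
    and M :: "'w measure" and \<F> :: "ennreal \<Rightarrow> 'w measure"
    and P :: "'a option \<Rightarrow> 'w measure" and X :: "real \<Rightarrow> 'w \<Rightarrow> 'a option"
    and I :: "'a option \<Rightarrow> 'a option" and h :: "'a option \<Rightarrow> ennreal" and v :: "'a option \<Rightarrow> real"
    and F :: "'a option set" and H :: "'a option \<Rightarrow> real"
    and N :: "'a option \<Rightarrow> 'u measure" and Y :: "real \<Rightarrow> 'u \<Rightarrow> 'a option option"
  assumes "locally compact S" and "\<not> bounded S" and "0 \<in> S"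
    and "standard_process S M \<F> P X"
    and "irreducible_process S P X"
    and "inversion_property S (points S) P (\<lambda>t \<omega>. Some (X t \<omega>)) I h v"
    and "continuous_characteristics S (points S) I h"
    and "F \<in> sets (borel_of (compactified S))"
    and "I ` F = F"
    and "\<exists>x\<in>F. I x \<noteq> x"
    and "continuous_map (subtopology (compactified S) F) euclideanreal H"
    and "\<forall>x\<in>F. 0 \<le> H x" and "\<forall>x\<in>interior_pts F. 0 < H x"
    and "excessive (compactified S) P (\<lambda>t \<omega>. Some (X t \<omega>)) F (\<lambda>x. ennreal (H x))"
    and "is_doob_transform (compactified S) P (\<lambda>t \<omega>. Some (X t \<omega>)) F (\<lambda>x. ennreal (H x)) N Y"
  shows "inversion_property S F N Y I
           (\<lambda>x. kelvin_transform I h (\<lambda>y. ennreal (H y)) x / ennreal (H x)) v"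
proof -
  interpret prop4 S M \<F> P X I h v F H N Y
    by unfold_locales (use assms in auto)
  from Y_inversion_property[OF assms(10)] show ?thesis by (simp add: ht_def[abs_def])
qed

end
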